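(* Let $N=3$, $2<p<4$, and suppose $V,f,Q$ satisfy (V1)–(V3) and (D1)–(D3). Then: (i) there exists $a_0>0$ such that for every $0<a<a_0$ and $0<\lambda<\lambda_1(f_\Omega)$ there is $\mu^*>0$ such that for all $\mu>\mu^*$, $(E_{\mu,\lambda})$ has a positive solution $u_\mu^+$ with $J_{\mu,\lambda}(u_\mu^+)<0$; (ii) for each $\lambda\ge\lambda_1(f_\Omega)$ and $a>0$ there is $\mu^*>0$ such that for all $\mu>\mu^*$, $(E_{\mu,\lambda})$ has a positive solution $u_\mu^+$ with $J_{\mu,\lambda}(u_\mu^+)<0$.
   Context: Conditions on $V,f,Q:\mathbb{R}^3\to\mathbb{R}$: (V1) $V$ nonnegative and continuous; (V2) there is $c>0$ with $\{V<c\}$ nonempty of finite Lebesgue measure; (V3) $\Omega=\mathrm{int}\{V=0\}$ is a nonempty bounded domain with smooth boundary and $\overline\Omega=\{V=0\}$; (D1) $f\in L^{3/2}(\mathbb{R}^3)$, $f^+\not\equiv0$ in $\Omega$; (D2) $Q\in L^\infty(\mathbb{R}^3)$, $Q^+\not\equiv0$ in $\Omega$; (D3) there exist $c_*,R_*>0$ with $|x|^{p-2}Q(x)\le c_*[V(x)]^{4-p}$ for all $|x|>R_*$. $\|u\|_{D^{1,2}}^2=\int|\nabla u|^2$, $\|u\|_\mu^2=\int(|\nabla u|^2+\mu Vu^2)$, $X=\{u\in H^1(\mathbb{R}^3):\int Vu^2<\infty\}$. For $a,\lambda,\mu>0$, $(E_{\mu,\lambda})$ is $-\left(a\int|\nabla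 u|^2dx+1\right)\Delta u+\mu Vu=Q|u|^{p-2}u+\lambda fu$ in $\mathbb{R}^3$, $u\in H^1(\mathbb{R}^3)$, in the weak sense; a positive solution is a solution with $u>0$. $J_{\mu,\lambda}(u)=\frac a4\|u\|_{D^{1,2}}^4+\frac12\|u\|_\mu^2-\frac1p\int Q|u|^p-\frac\lambda2\int fu^2$. $\lambda_1(f_\Omega)$ is the positive principal eigenvalue of $-\Delta u=\lambda f_\Omega u$ in $\Omega$, $u=0$ on $\partial\Omega$, $f_\Omega=f|_{\overline\Omega}$. *)

theory Defs
  imports "HOL-Analysis.Analysis"
begin

type_synonym R3 = "real^3"

definition pdir :: "3 \<Rightarrow> (R3 \<Rightarrow> real) \<Rightarrow> R3 \<Rightarrow> real" where
  "pdir i h x = frechet_derivative h (at x) (axis i 1)"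

definition cgrad :: "(R3 \<Rightarrow> real) \<Rightarrow> R3 \<Rightarrow> R3" where
  "cgrad h x = (\<chi> i. pdir i h x)"

fun Ck_on :: "nat \<Rightarrow> R3 set \<Rightarrow> (R3 \<Rightarrow> real) \<Rightarrow> bool" where
  "Ck_on 0 S h = continuous_on S h"
| "Ck_on (Suc k) S h = (h differentiable_on S \<and> (\<forall>i. Ck_on k S (pdir i h)))"

definition smooth_on :: "R3 set \<Rightarrow> (R3 \<Rightarrow> real) \<Rightarrow> bool" where
  "smooth_on S h \<longleftrightarrow> (\<forall>k. Ck_on k S h)"

definition test_fun :: "R3 set \<Rightarrow> (R3 \<Rightarrow> real) \<Rightarrow> bool" where
  "test_fun U \<phi> \<longleftrightarrow> smooth_on UNIV \<phi> \<and> compact (closure {x. \<phi> x \<noteq> 0})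
      \<and> closure {x. \<phi> x \<noteq> 0} \<subseteq> U"

definition weak_grad :: "(R3 \<Rightarrow> real) \<Rightarrow> (R3 \<Rightarrow> R3) \<Rightarrow> bool" where
  "weak_grad u g \<longleftrightarrow> (\<forall>\<phi>. test_fun UNIV \<phi> \<longrightarrow> (\<forall>i.
      (\<integral>x. u x * pdir i \<phi> x \<partial>lebesgue) = - (\<integral>x. g x $ i * \<phi> x \<partial>lebesgue)))"

definition H1_grad :: "(R3 \<Rightarrow> real) \<Rightarrow> (R3 \<Rightarrow> R3) \<Rightarrow> bool" where
  "H1_grad u g \<longleftrightarrow> u \<in> borel_measurable lebesgue \<and> integrable lebesgue (\<lambda>x. (u x)\<^sup>2)
     \<and> g \<in> borel_measurable lebesgue \<and> integrable lebesgue (\<lambda>x. (norm (g x))\<^sup>2)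
     \<and> weak_grad u g"

definition H10_grad :: "R3 set \<Rightarrow> (R3 \<Rightarrow> real) \<Rightarrow> (R3 \<Rightarrow> R3) \<Rightarrow> bool" where
  "H10_grad \<Omega> u g \<longleftrightarrow> H1_grad u g \<and> (\<exists>\<phi>s. (\<forall>n. test_fun \<Omega> (\<phi>s n)) \<and>
      (\<lambda>n. \<integral>x. (\<phi>s n x - u x)\<^sup>2 + (norm (cgrad (\<phi>s n) x - g x))\<^sup>2 \<partial>lebesgue)
        \<longlonglongrightarrow> 0)"

definition smooth_boundary :: "R3 set \<Rightarrow> bool" where
  "smooth_boundary \<Omega> \<longleftrightarrow> (\<forall>x\<in>frontier \<Omega>. \<exists>r>0. \<exists>\<psi>. smooth_on UNIV \<psi> \<and>
      (\<forall>y\<in>ball x r. cgrad \<psi> y \<noteq> 0) \<and> \<Omega> \<inter> ball x r = {y\<in>ball x r. \<psi> y < 0})"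

definition principal_eigenfun ::
  "R3 set \<Rightarrow> (R3 \<Rightarrow> real) \<Rightarrow> real \<Rightarrow> (R3 \<Rightarrow> real) \<Rightarrow> bool" where
  "principal_eigenfun \<Omega> f l u \<longleftrightarrow> (\<exists>g. H10_grad \<Omega> u g \<and>
      (AE x in lebesgue. x \<in> \<Omega> \<longrightarrow> u x > 0) \<and>
      (\<forall>\<phi>. test_fun \<Omega> \<phi> \<longrightarrow>
         (\<integral>x. g x \<bullet> cgrad \<phi> x \<partial>lebesgue) = l * (\<integral>x. f x * u x * \<phi> x \<partial>lebesgue)))"

definition lambda1 :: "R3 set \<Rightarrow> (R3 \<Rightarrow> real) \<Rightarrow> real" where
  "lambda1 \<Omega> f = (THE l. l > 0 \<and> (\<exists>u. principal_eigenfun \<Omega> f l u))"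

definition kirchhoff_sol ::
  "real \<Rightarrow> real \<Rightarrow> real \<Rightarrow> real \<Rightarrow> (R3 \<Rightarrow> real) \<Rightarrow> (R3 \<Rightarrow> real) \<Rightarrow> (R3 \<Rightarrow> real)
   \<Rightarrow> (R3 \<Rightarrow> real) \<Rightarrow> (R3 \<Rightarrow> R3) \<Rightarrow> bool" where
  "kirchhoff_sol a \<mu> lam p V f Q u g \<longleftrightarrow> H1_grad u g \<and>
     (\<forall>\<phi>. test_fun UNIV \<phi> \<longrightarrow>
        (a * (\<integral>x. (norm (g x))\<^sup>2 \<partial>lebesgue) + 1) * (\<integral>x. g x \<bullet> cgrad \<phi> x \<partial>lebesgue)
        + \<mu> * (\<integral>x. V x * u x * \<phi> x \<partial>lebesgue)
        = (\<integral>x. Q x * \<bar>u x\<bar> powr (p - 2) * u x * \<phi> x \<partial>lebesgue)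
        + lam * (\<integral>x. f x * u x * \<phi> x \<partial>lebesgue))"

definition energy ::
  "real \<Rightarrow> real \<Rightarrow> real \<Rightarrow> real \<Rightarrow> (R3 \<Rightarrow> real) \<Rightarrow> (R3 \<Rightarrow> real) \<Rightarrow> (R3 \<Rightarrow> real)
   \<Rightarrow> (R3 \<Rightarrow> real) \<Rightarrow> (R3 \<Rightarrow> R3) \<Rightarrow> real" where
  "energy a \<mu> lam p V f Q u g =
     a / 4 * (\<integral>x. (norm (g x))\<^sup>2 \<partial>lebesgue)\<^sup>2
     + 1 / 2 * ((\<integral>x. (norm (g x))\<^sup>2 \<partial>lebesgue) + \<mu> * (\<integral>x. V x * (u x)\<^sup>2 \<partial>lebesgue))
     - 1 / p * (\<integral>x. Q x * \<bar>u x\<bar> powr p \<partial>lebesgue)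
     - lam / 2 * (\<integral>x. f x * (u x)\<^sup>2 \<partial>lebesgue)"

definition pos_sol_neg_energy ::
  "real \<Rightarrow> real \<Rightarrow> real \<Rightarrow> real \<Rightarrow> (R3 \<Rightarrow> real) \<Rightarrow> (R3 \<Rightarrow> real) \<Rightarrow> (R3 \<Rightarrow> real)
   \<Rightarrow> (R3 \<Rightarrow> real) \<Rightarrow> bool" where
  "pos_sol_neg_energy a \<mu> lam p V f Q u \<longleftrightarrow> (\<exists>g. kirchhoff_sol a \<mu> lam p V f Q u g \<and>
      (AE x in lebesgue. u x > 0) \<and> integrable lebesgue (\<lambda>x. V x * (u x)\<^sup>2) \<and>
      energy a \<mu> lam p V f Q u g < 0)"

end

theory Submission
  imports Defs "HOL-Complex_Analysis.Great_Picard"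
begin

text \<open>The positive solution is a global minimiser of the energy \<open>J\<close>. The growth condition on \<open>Q\<close>, combined with its
  boundedness and Hardy's inequality, makes the quartic Kirchhoff term dominate \<open>\<integral> Q |u|\<^sup>p\<close>, so \<open>J\<close> is coercive for large \<open>\<mu>\<close>;
  Rellich's theorem and the decay of \<open>Q\<^sup>+\<close> relative to \<open>V\<close> give a minimiser as soon as \<open>inf J < 0\<close>.
  It is positive by a strong maximum principle, proved by testing the equation with \<open>\<eta>\<^sup>2 / (u + \<delta>)\<close> and bounding
  \<open>ln (1 + u / \<delta>)\<close> through a Poincare inequality as \<open>\<delta> \<rightarrow> 0\<close>. In (i), a test function in \<open>\<Omega>\<close> with \<open>\<integral> Q |\<phi>|\<^sup>p > 0\<close>
  has negative energy once scaled suitably and \<open>a\<close> is small. In (ii), \<open>J \<ge> 0\<close> would force the principal Dirichlet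
  eigenfunction of \<open>\<Omega>\<close> to solve a linear equation on the whole space, against the maximum principle.

  All functions in \<open>H\<^sup>1\<close> are handled as \<open>L\<^sup>2\<close> limits of test functions together with their gradients, so every inequality
  is needed for test functions only; by minimality the approximants may be taken non-negative.\<close>

text \<open>Smooth functions can be composed with \<open>sabs\<close>, divided by u + \<delta> and
  put under a logarithm by elementary calculus, whereas for a pair (u, g) given through weak
  derivatives each of these steps would call for a chain rule in H1. Hence u never travels without
  an approximating sequence, and a nonlinear expression in u is reached as the limit of the same
  expression in smooth functions. Two obstacles shape the variational part. The growth condition
  bounds Q from above only, so along a minimising sequence the Q-term is merely upper
  semicontinuous; that is the half which minimisation needs. And \<open>lambda1\<close> is a
  definite description: before it can be identified with the infimum of the Rayleigh quotient,
  Picone's inequality must show that only one positive number has a positive eigenfunction. The size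
  of \<mu> matters for coercivity: half of \<mu> times the V-integral has to absorb the multiple of
  that integral which the estimate of the Q-term costs. As for constants, 4 is Hardy's, 4096 = 16^3
  Sobolev's, and their product is the square of 128.\<close>

abbreviation "sqint g \<equiv> \<integral>x. (norm (g x))\<^sup>2 \<partial>(lebesgue :: R3 measure)"

abbreviation "wint w g \<equiv> \<integral>x. w x * (g x)\<^sup>2 \<partial>(lebesgue :: R3 measure)"

subsection \<open>Smooth functions and test functions\<close>

lemma pdir_eqI: "(h has_derivative D) (at x) \<Longrightarrow> pdir i h x = D (axis i 1)"
  unfolding pdir_def using frechet_derivative_at by metis

lemma cgrad_eqI:
  assumes "(h has_derivative (\<lambda>v. w \<bullet> v)) (at x)"
  shows "cgrad h x = w"
  unfolding cgrad_def using pdir_eqI[OF assms]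
  by (simp add: vec_eq_iff inner_axis)

lemma has_derivative_cgrad:
  assumes "h differentiable at x"
  shows "(h has_derivative (\<lambda>v. cgrad h x \<bullet> v)) (at x)"
proof -
  obtain D where D: "(h has_derivative D) (at x)"
    using assms unfolding differentiable_def by blast
  then interpret bounded_linear D by (rule has_derivative_bounded_linear)
  have "D v = cgrad h x \<bullet> v" for v
  proof -
    have "v = (\<Sum>i\<in>UNIV. v $ i *\<^sub>R axis i 1)"
      by (simp add: basis_expansion scalar_mult_eq_scaleR[symmetric])
    then have "D v = D (\<Sum>i\<in>UNIV. v $ i *\<^sub>R axis i 1)" by simp
    also have "\<dots> = (\<Sum>i\<in>UNIV. v $ i * pdir i h x)"
      by (simp add: sum scaleR pdir_eqI[OF D])
    also have "\<dots> = cgrad h x \<bullet> v"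
      by (simp add: inner_vec_def cgrad_def mult.commute)
    finally show ?thesis .
  qed
  then have "D = (\<lambda>v. cgrad h x \<bullet> v)" by blast
  with D show ?thesis by simp
qed

lemma pdir_eq_cgrad: "pdir i h x = cgrad h x $ i"
  by (simp add: cgrad_def)

lemma Ck_on_SucD: "Ck_on (Suc k) S h \<Longrightarrow> Ck_on k S h"
  by (induction k arbitrary: h) (auto intro: differentiable_imp_continuous_on)

lemma Ck_on_differentiable: "Ck_on (Suc k) UNIV h \<Longrightarrow> h differentiable at x"
  by (simp add: differentiable_on_def)

section \<open>Closure properties of smooth functions\<close>

lemma pdir_const [simp]: "pdir i (\<lambda>x. c) = (\<lambda>x. 0)"
  by (rule ext, rule pdir_eqI, simp)

lemma Ck_on_const: "Ck_on k UNIV (\<lambda>x. c)"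
  by (induction k arbitrary: c) auto

lemma pdir_add:
  assumes "\<And>x. g differentiable at x" "\<And>x. h differentiable at x"
  shows "pdir i (\<lambda>x. g x + h x) = (\<lambda>x. pdir i g x + pdir i h x)"
proof
  fix x
  show "pdir i (\<lambda>x. g x + h x) x = pdir i g x + pdir i h x"
    by (subst pdir_eqI[OF has_derivative_add[OF has_derivative_cgrad[OF assms(1)] has_derivative_cgrad[OF assms(2)]]])
       (simp add: inner_axis pdir_eq_cgrad)
qed

lemma pdir_mult:
  assumes "\<And>x. g differentiable at x" "\<And>x. h differentiable at x"
  shows "pdir i (\<lambda>x. g x * h x) = (\<lambda>x. g x * pdir i h x + pdir i g x * h x)"
proof
  fix x
  show "pdir i (\<lambda>x. g x * h x) x = g x * pdir i h x + pdir i g x * h x"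
    by (subst pdir_eqI[OF has_derivative_mult[OF has_derivative_cgrad[OF assms(1)] has_derivative_cgrad[OF assms(2)]]])
       (simp add: inner_axis pdir_eq_cgrad)
qed

lemma Ck_on_add:
  assumes "Ck_on k UNIV g" "Ck_on k UNIV h"
  shows "Ck_on k UNIV (\<lambda>x. g x + h x)"
  using assms
proof (induction k arbitrary: g h)
  case 0 then show ?case by (auto intro: continuous_intros)
next
  case (Suc k)
  then show ?case
    using pdir_add[of g h] by (auto simp: differentiable_on_def)
qed

lemma Ck_on_mult:
  assumes "Ck_on k UNIV g" "Ck_on k UNIV h"
  shows "Ck_on k UNIV (\<lambda>x. g x * h x)"
  using assms
proof (induction k arbitrary: g h)
  case 0 then show ?case by (auto intro: continuous_intros)
next
  case (Suc k)
  have "Ck_on k UNIV g" "Ck_on k UNIV h" using Suc.prems Ck_on_SucD by blast+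
  then show ?case
    using pdir_mult[of g h] Suc by (auto simp: differentiable_on_def intro!: Ck_on_add)
qed

text \<open>The outer function comes with the whole sequence of its derivatives: the chain rule
  turns \<open>D j\<close> after \<open>h\<close> into \<open>D (Suc j)\<close> after
  \<open>h\<close> times a partial derivative of \<open>h\<close>, so the induction on
  \<open>k\<close> closes only if \<open>j\<close> stays free. The set \<open>T\<close> leaves room
  for powers and \<open>ln\<close>, which are differentiated on the positive half-line only.\<close>

lemma Ck_on_compose:
  fixes D :: "nat \<Rightarrow> real \<Rightarrow> real"
  assumes D: "\<And>j t. t \<in> T \<Longrightarrow> (D j has_field_derivative D (Suc j) t) (at t)"
    and h: "\<And>k. Ck_on k UNIV h" and T: "\<And>x. h x \<in> T"
  shows "Ck_on k UNIV (\<lambda>x. D j (h x))"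
proof (induction k arbitrary: j)
  have dh: "h differentiable at x" for x using h Ck_on_differentiable by blast
  have d: "((\<lambda>x. D j (h x)) has_derivative (\<lambda>v. D (Suc j) (h x) * (cgrad h x \<bullet> v))) (at x)" for j x
    using has_derivative_compose[OF has_derivative_cgrad[OF dh] D[OF T, unfolded has_field_derivative_def]] .
  {
    case 0
    have "isCont (\<lambda>x. D j (h x)) x" for x using d has_derivative_continuous by blast
    then show ?case by (simp add: continuous_at_imp_continuous_on)
  next
    case (Suc k)
    have p: "pdir i (\<lambda>x. D j (h x)) = (\<lambda>x. D (Suc j) (h x) * pdir i h x)" for i
      by (rule ext) (simp add: pdir_eqI[OF d] inner_axis pdir_eq_cgrad)
    have "Ck_on k UNIV (pdir i h)" for i using h[of "Suc k"] by simp
    then show ?case using d p Suc by (auto simp: differentiable_on_def differentiable_def intro!: Ck_on_mult)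
  }
qed

lemma smooth_on_const: "smooth_on UNIV (\<lambda>x. c)"
  and smooth_on_add: "smooth_on UNIV g \<Longrightarrow> smooth_on UNIV h \<Longrightarrow> smooth_on UNIV (\<lambda>x. g x + h x)"
  and smooth_on_mult: "smooth_on UNIV g \<Longrightarrow> smooth_on UNIV h \<Longrightarrow> smooth_on UNIV (\<lambda>x. g x * h x)"
  by (auto simp: smooth_on_def Ck_on_const Ck_on_add Ck_on_mult)

lemma smooth_on_cmult: "smooth_on UNIV h \<Longrightarrow> smooth_on UNIV (\<lambda>x. c * h x)"
  by (intro smooth_on_mult smooth_on_const)

lemma smooth_on_diff: "smooth_on UNIV g \<Longrightarrow> smooth_on UNIV h \<Longrightarrow> smooth_on UNIV (\<lambda>x. g x - h x)"
  using smooth_on_add[of g "\<lambda>x. -1 * h x"] smooth_on_cmult[of h "-1"] by simp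

lemma smooth_on_sum:
  "finite I \<Longrightarrow> (\<And>i. i \<in> I \<Longrightarrow> smooth_on UNIV (h i)) \<Longrightarrow> smooth_on UNIV (\<lambda>x. \<Sum>i\<in>I. h i x)"
  by (induction I rule: finite_induct) (auto intro: smooth_on_const smooth_on_add)

lemma smooth_on_power: "smooth_on UNIV h \<Longrightarrow> smooth_on UNIV (\<lambda>x. h x ^ n)"
  by (induction n) (auto intro: smooth_on_const smooth_on_mult)

lemma smooth_on_compose:
  assumes "\<And>j t. t \<in> T \<Longrightarrow> (D j has_field_derivative D (Suc j) t) (at t)"
    and "smooth_on UNIV h" "\<And>x. h x \<in> T"
  shows "smooth_on UNIV (\<lambda>x. D 0 (h x))"
  using assms Ck_on_compose[of T D h] unfolding smooth_on_def by blast

lemma smooth_on_pdir: "smooth_on UNIV h \<Longrightarrow> smooth_on UNIV (pdir i h)"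
  unfolding smooth_on_def by (metis Ck_on.simps(2))

lemma smooth_on_differentiable: "smooth_on UNIV h \<Longrightarrow> h differentiable at x"
  unfolding smooth_on_def using Ck_on_differentiable by blast

lemma smooth_on_continuous: "smooth_on UNIV h \<Longrightarrow> continuous_on UNIV h"
  unfolding smooth_on_def by (metis Ck_on.simps(1))

lemma smooth_on_has_derivative:
  "smooth_on UNIV h \<Longrightarrow> (h has_derivative (\<lambda>v. cgrad h x \<bullet> v)) (at x)"
  by (intro has_derivative_cgrad smooth_on_differentiable)

lemma smooth_on_continuous_cgrad: "smooth_on UNIV h \<Longrightarrow> continuous_on UNIV (cgrad h)"
  unfolding cgrad_def
  by (intro continuous_on_vec_lambda) (use smooth_on_pdir smooth_on_continuous in blast)

lemma smooth_on_coord: "smooth_on UNIV (\<lambda>x. x $ i)"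
proof -
  have d: "((\<lambda>x::R3. x $ i) has_derivative (\<lambda>v. v $ i)) (at x)" for x
    by (intro bounded_linear_imp_has_derivative bounded_linear_vec_nth)
  have p: "pdir j (\<lambda>x. x $ i) = (\<lambda>x. axis j 1 $ i)" for j
    by (rule ext) (simp add: pdir_eqI[OF d])
  have "Ck_on k UNIV (\<lambda>x. x $ i)" for k
  proof (cases k)
    case 0
    then show ?thesis by (auto intro: continuous_intros)
  next
    case (Suc m)
    then show ?thesis using d p by (auto simp: differentiable_on_def differentiable_def Ck_on_const)
  qed
  then show ?thesis by (simp add: smooth_on_def)
qed

lemma smooth_on_norm2: "smooth_on UNIV (\<lambda>x::R3. (norm (x - z))\<^sup>2)"
proof -
  have "(\<lambda>x::R3. (norm (x - z))\<^sup>2) = (\<lambda>x. \<Sum>i\<in>UNIV. (x $ i - z $ i)^2)"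
    unfolding norm_vec_def L2_set_def by (auto simp: sum_nonneg)
  then show ?thesis
    by (auto intro!: smooth_on_sum smooth_on_power smooth_on_diff smooth_on_const smooth_on_coord)
qed

lemma smooth_on_powr:
  assumes "smooth_on UNIV h" "\<And>x. h x > 0"
  shows "smooth_on UNIV (\<lambda>x. h x powr a)"
proof -
  define D where "D k t = (\<Prod>j<k. a - real j) * t powr (a - real k)" for k and t :: real
  have "(D j has_field_derivative D (Suc j) t) (at t)" if "t \<in> {0<..}" for j t
    using that unfolding D_def
    by (auto intro!: derivative_eq_intros simp: algebra_simps)
  from smooth_on_compose[of "{0<..}" D h, OF this assms(1)] assms(2) show ?thesis
    by (simp add: D_def)
qed

lemma smooth_on_inverse:
  assumes "smooth_on UNIV h" "\<And>x. h x > 0"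
  shows "smooth_on UNIV (\<lambda>x. inverse (h x))"
  using smooth_on_powr[OF assms, of "-1"] assms(2)
  by (simp add: powr_minus abs_of_pos)

lemma smooth_on_sqrt:
  assumes "smooth_on UNIV h" "\<And>x. h x > 0"
  shows "smooth_on UNIV (\<lambda>x. sqrt (h x))"
  using smooth_on_powr[OF assms, of "1/2"] assms(2)
  by (simp add: powr_half_sqrt less_imp_le)

lemma smooth_on_ln:
  assumes "smooth_on UNIV h" "\<And>x. h x > 0"
  shows "smooth_on UNIV (\<lambda>x. ln (h x))"
proof -
  define D where "D k t = (case k of 0 \<Rightarrow> ln t | Suc k \<Rightarrow> (\<Prod>j<k. -1 - real j) * t powr (-1 - real k))" 
    for k and t :: real
  have "(D j has_field_derivative D (Suc j) t) (at t)" if "t \<in> {0<..}" for j t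
    using that unfolding D_def
    by (cases j) (auto intro!: derivative_eq_intros simp: algebra_simps powr_minus divide_simps)
  from smooth_on_compose[of "{0<..}" D h, OF this assms(1)] assms(2) show ?thesis
    by (simp add: D_def)
qed

lemma smooth_on_exp_inverse:
  assumes "smooth_on UNIV h"
  shows "smooth_on UNIV (\<lambda>x. if h x > 0 then exp (- inverse (h x)) else 0)"
proof -
  define E where "E q t = (if t > 0 then poly q (inverse t) * exp (- inverse t) else 0)"
    for q and t :: real
  \<comment> \<open>In the variable y = 1/t the derivative of q(y) exp(-y) is y^2 (q(y) - q'(y))
    exp(-y). So \<open>N\<close> acts on polynomials as differentiation acts on the functions
    \<open>E q\<close>, and every derivative is again some \<open>E q\<close>.\<close>
  define N where "N q = [:0,0,1:] * (q - pderiv q)" for q :: "real poly"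
  define D where "D k = E ((N ^^ k) 1)" for k
  have lim: "((\<lambda>t. poly q (inverse t) * exp (- inverse t)) \<longlongrightarrow> 0) (at_right 0)" for q :: "real poly"
  proof -
    have "((\<lambda>t. poly q t * exp (- t)) \<longlongrightarrow> 0) at_top"
    proof -
      have pe: "((\<lambda>t::real. t ^ k * exp (-t)) \<longlongrightarrow> 0) at_top" for k
        using tendsto_power_div_exp_0[of k] by (simp add: exp_minus divide_inverse)
      have "((\<lambda>t. poly r t * exp (- t)) \<longlongrightarrow> 0) at_top" for r :: "real poly"
      proof -
        have "((\<lambda>t. \<Sum>i\<le>degree r. coeff r i * (t ^ i * exp (-t))) \<longlongrightarrow> (\<Sum>i\<le>degree r. coeff r i * 0)) at_top"
          by (rule tendsto_sum, rule tendsto_mult[OF tendsto_const pe])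
        then show ?thesis by (simp add: poly_altdef sum_distrib_right mult.assoc)
      qed
      then show ?thesis .
    qed
    then show ?thesis
      by (rule filterlim_compose[OF _ filterlim_inverse_at_top_right])
  qed
  have der: "(E q has_field_derivative E (N q) t) (at t)" for q t
  proof -
    consider "t > 0" | "t < 0" | "t = 0" by linarith
    then show ?thesis
    proof cases
      case 1
      have "((\<lambda>t. poly q (inverse t) * exp (- inverse t)) has_field_derivative E (N q) t) (at t)"
        using 1 unfolding E_def N_def
        by (auto intro!: derivative_eq_intros simp: power2_eq_square algebra_simps)
      moreover have "\<forall>\<^sub>F s in nhds t. E q s = poly q (inverse s) * exp (- inverse s)"
        using eventually_nhds_in_open[of "{0<..}" t] 1
        by (auto simp: E_def elim!: eventually_mono)
      ultimately show ?thesis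
        by (rule iffD2[OF DERIV_cong_ev[OF refl _ refl], rotated])
    next
      case 2
      have "((\<lambda>t. 0) has_field_derivative E (N q) t) (at t)"
        using 2 unfolding E_def by auto
      moreover have "\<forall>\<^sub>F s in nhds t. E q s = 0"
        using eventually_nhds_in_open[of "{..<0}" t] 2
        by (auto simp: E_def elim!: eventually_mono)
      ultimately show ?thesis
        by (rule iffD2[OF DERIV_cong_ev[OF refl _ refl], rotated])
    next
      case 3
      \<comment> \<open>For h > 0 the difference quotient at the origin again has the form
        \<open>E\<close>, now with the polynomial y q(y), so the limit established above settles
        it.\<close>
      have a: "((\<lambda>h. E q h / h) \<longlongrightarrow> 0) (at_right 0)"
      proof -
        have "((\<lambda>t. poly ([:0,1:] * q) (inverse t) * exp (- inverse t)) \<longlongrightarrow> 0) (at_right 0)" by (rule lim)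
        moreover have "\<forall>\<^sub>F h in at_right 0. poly ([:0,1:] * q) (inverse h) * exp (- inverse h) = E q h / h"
          using eventually_at_right_less[of "0::real"] by eventually_elim (auto simp: E_def divide_inverse)
        ultimately show ?thesis by (rule Lim_transform_eventually)
      qed
      have b: "((\<lambda>h. E q h / h) \<longlongrightarrow> 0) (at_left 0)"
      proof -
        have "\<forall>\<^sub>F h in at_left (0::real). h < 0" 
          by (auto simp: eventually_at_left_field intro: exI[of _ "-1"])
        then have "\<forall>\<^sub>F h in at_left 0. 0 = E q h / h"
          by eventually_elim (auto simp: E_def)
        then show ?thesis by (rule Lim_transform_eventually[OF tendsto_const])
      qed
      have "((\<lambda>h. E q h / h) \<longlongrightarrow> 0) (at 0)" using a b filterlim_split_at by blast
      then show ?thesis using 3 by (simp add: DERIV_def E_def)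
    qed
  qed
  have "(D j has_field_derivative D (Suc j) t) (at t)" for j t
    unfolding D_def using der by simp
  from smooth_on_compose[of UNIV D h, OF this assms] show ?thesis
    by (simp add: D_def E_def cong: if_cong)
qed

section \<open>Test functions and cutoffs\<close>

lemma test_fun_smooth: "test_fun U \<phi> \<Longrightarrow> smooth_on UNIV \<phi>"
  by (simp add: test_fun_def)

lemma test_funI:
  assumes "smooth_on UNIV \<psi>" "compact K" "K \<subseteq> U" "\<And>x. x \<notin> K \<Longrightarrow> \<psi> x = 0"
  shows "test_fun U \<psi>"
proof -
  have "closure {x. \<psi> x \<noteq> 0} \<subseteq> K"
    using assms by (intro closure_minimal compact_imp_closed) auto
  moreover have "compact (K \<inter> closure {x. \<psi> x \<noteq> 0})"
    using assms by (intro compact_Int_closed) auto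
  ultimately show ?thesis
    unfolding test_fun_def using assms by (auto simp: Int_absorb1)
qed

lemma test_funE:
  assumes "test_fun U \<phi>"
  obtains K where "compact K" "K \<subseteq> U" "\<And>x. x \<notin> K \<Longrightarrow> \<phi> x = 0" "\<And>x. x \<notin> K \<Longrightarrow> cgrad \<phi> x = 0"
proof -
  define K where "K = closure {x. \<phi> x \<noteq> 0}"
  have K: "compact K" "K \<subseteq> U" using assms by (auto simp: test_fun_def K_def)
  have 0: "\<phi> x = 0" if "x \<notin> K" for x
    using that subsetD[OF closure_subset, of x "{x. \<phi> x \<noteq> 0}"] unfolding K_def by blast
  have "cgrad \<phi> x = 0" if "x \<notin> K" for x
  proof -
    have "((\<lambda>x. 0) has_derivative (\<lambda>v. 0 \<bullet> v)) (at x)" by simp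
    moreover have "open (- K)" "x \<in> - K" using that by (auto simp: K_def)
    ultimately have "(\<phi> has_derivative (\<lambda>v. 0 \<bullet> v)) (at x)"
      by (rule has_derivative_transform_within_open) (use 0 in auto)
    then show ?thesis by (rule cgrad_eqI)
  qed
  with K 0 show ?thesis by (rule that)
qed

lemma test_fun_eq0_outside: "test_fun U \<phi> \<Longrightarrow> x \<notin> U \<Longrightarrow> \<phi> x = 0"
  and test_fun_cgrad_eq0_outside: "test_fun U \<phi> \<Longrightarrow> x \<notin> U \<Longrightarrow> cgrad \<phi> x = 0"
  by (metis test_funE subsetD)+

lemma test_fun_mono: "test_fun U \<phi> \<Longrightarrow> U \<subseteq> U' \<Longrightarrow> test_fun U' \<phi>"
  by (auto simp: test_fun_def)

text \<open>Supports are compared through zeros alone. This covers every smooth function of \<phi>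
  that vanishes where \<phi> does: powers, \<open>sabs\<close>, and ln (1 + \<phi> /
  \<delta>).\<close>

lemma test_fun_vanish:
  assumes "smooth_on UNIV \<psi>" "test_fun U \<phi>" "\<And>x. \<phi> x = 0 \<Longrightarrow> \<psi> x = 0"
  shows "test_fun U \<psi>"
  by (metis test_funE assms test_funI)

lemma test_fun_mult: "smooth_on UNIV h \<Longrightarrow> test_fun U \<phi> \<Longrightarrow> test_fun U (\<lambda>x. h x * \<phi> x)"
  by (rule test_fun_vanish[of _ U \<phi>]) (auto intro: smooth_on_mult test_fun_smooth)

lemma test_fun_cmult: "test_fun U \<phi> \<Longrightarrow> test_fun U (\<lambda>x. c * \<phi> x)"
  by (rule test_fun_mult[OF smooth_on_const])

lemma test_fun_power: "test_fun U \<phi> \<Longrightarrow> n > 0 \<Longrightarrow> test_fun U (\<lambda>x. \<phi> x ^ n)"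
  by (rule test_fun_vanish[of _ U \<phi>]) (auto intro: smooth_on_power test_fun_smooth)

lemma test_fun_add:
  assumes "test_fun U \<phi>" "test_fun U \<psi>"
  shows "test_fun U (\<lambda>x. \<phi> x + \<psi> x)"
proof -
  obtain K L where "compact K" "K \<subseteq> U" "\<And>x. x \<notin> K \<Longrightarrow> \<phi> x = 0" "compact L" "L \<subseteq> U" "\<And>x. x \<notin> L \<Longrightarrow> \<psi> x = 0"
    using assms by (metis test_funE)
  then show ?thesis
    by (intro test_funI[of _ "K \<union> L"] smooth_on_add test_fun_smooth[OF assms(1)] test_fun_smooth[OF assms(2)]) auto
qed

lemma test_fun_zero: "test_fun U (\<lambda>x. 0)"
  by (rule test_funI[of _ "{}"]) (auto intro: smooth_on_const)

text \<open>Finitely many balls with closures inside U cover K, and the sum S of one smooth bump per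
  ball is positive on K, hence at least some m > 0 there. The quotient E(S) / (E(S) + E(m - S))
  turns S into a plateau: it is 1 as soon as S >= m, and 0 where S = 0.\<close>

lemma cutoff_exists:
  assumes K: "compact K" and U: "open U" "K \<subseteq> U"
  obtains \<eta> where "test_fun U \<eta>" "\<And>x. 0 \<le> \<eta> x" "\<And>x. \<eta> x \<le> 1" "\<And>x. x \<in> K \<Longrightarrow> \<eta> x = 1"
proof (cases "K = {}")
  case True
  then show ?thesis using that[OF test_fun_zero] by auto
next
  case False
  define E where "E t = (if t > 0 then exp (- inverse t) else 0)" for t :: real
  have E0: "E t \<ge> 0" "t > 0 \<Longrightarrow> E t > 0" "t \<le> 0 \<Longrightarrow> E t = 0" for t by (auto simp: E_def)
  have Es: "smooth_on UNIV (\<lambda>x. E (h x))" if "smooth_on UNIV h" for h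
    unfolding E_def by (rule smooth_on_exp_inverse[OF that])
  have "\<forall>z\<in>K. \<exists>r>0. cball z r \<subseteq> U" using U open_contains_cball by blast
  then obtain r where r: "\<And>z. z \<in> K \<Longrightarrow> r z > 0" "\<And>z. z \<in> K \<Longrightarrow> cball z (r z) \<subseteq> U" by metis
  obtain Z where Z: "Z \<subseteq> K" "finite Z" "K \<subseteq> (\<Union>z\<in>Z. ball z (r z))"
    by (rule compactE_image[OF K, of K "\<lambda>z. ball z (r z)"]) (use r in \<open>auto intro: centre_in_ball[THEN iffD2]\<close>)
  define S where "S x = (\<Sum>z\<in>Z. E ((r z)\<^sup>2 - (norm (x - z))\<^sup>2))" for x
  have Ss: "smooth_on UNIV S" unfolding S_def
    using Z by (intro smooth_on_sum Es smooth_on_diff smooth_on_const smooth_on_norm2)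
  have S0: "S x \<ge> 0" for x unfolding S_def by (intro sum_nonneg E0)
  have SK: "S x > 0" if xK: "x \<in> K" for x
  proof -
    obtain z where z: "z \<in> Z" "x \<in> ball z (r z)" using subsetD[OF Z(3) xK] by auto
    then have "norm (x - z) < r z" by (simp add: dist_norm norm_minus_commute)
    then have "(r z)\<^sup>2 - (norm (x - z))\<^sup>2 > 0" by (simp add: power_strict_mono)
    then show ?thesis unfolding S_def using z Z E0 by (intro sum_pos2[of Z z]) auto
  qed
  obtain x0 where x0: "x0 \<in> K" "\<And>x. x \<in> K \<Longrightarrow> S x0 \<le> S x"
    using continuous_attains_inf[OF K False, of S] smooth_on_continuous[OF Ss] continuous_on_subset by blast
  define m where "m = S x0"
  have m: "m > 0" "\<And>x. x \<in> K \<Longrightarrow> m \<le> S x" using x0 SK by (auto simp: m_def)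
  have den: "E (S x) + E (m - S x) > 0" for x
    using E0 m S0 by (cases "S x > 0") (auto intro: add_pos_nonneg add_nonneg_pos)
  define \<eta> where "\<eta> x = E (S x) * inverse (E (S x) + E (m - S x))" for x
  have "smooth_on UNIV \<eta>" unfolding \<eta>_def
    by (intro smooth_on_mult smooth_on_inverse smooth_on_add Es smooth_on_diff smooth_on_const Ss den)
  moreover have "\<eta> x = 0" if "x \<notin> (\<Union>z\<in>Z. cball z (r z))" for x
  proof -
    have "E ((r z)\<^sup>2 - (norm (x - z))\<^sup>2) = 0" if z: "z \<in> Z" for z
    proof -
      have "x \<notin> cball z (r z)" using \<open>x \<notin> _\<close> z by blast
      then have "norm (x - z) \<ge> r z" by (simp add: dist_norm norm_minus_commute)
      moreover have "r z > 0" using r z Z by auto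
      ultimately show ?thesis by (intro E0) (simp add: power_mono)
    qed
    then show ?thesis by (simp add: \<eta>_def S_def E0)
  qed
  moreover have "compact (\<Union>z\<in>Z. cball z (r z))" using Z by (auto intro!: compact_UN)
  moreover have "(\<Union>z\<in>Z. cball z (r z)) \<subseteq> U" using Z(1) r(2) by blast
  ultimately have "test_fun U \<eta>" by (intro test_funI)
  moreover have "\<eta> x \<ge> 0" for x unfolding \<eta>_def using E0(1) by (intro mult_nonneg_nonneg) (auto intro: add_nonneg_nonneg)
  moreover have "\<eta> x \<le> 1" for x unfolding \<eta>_def using E0(1)[of "m - S x"] den[of x] by (simp add: divide_simps flip: divide_inverse)
  moreover have "\<eta> x = 1" if "x \<in> K" for x
    using m(2)[OF that] den[of x] E0(3)[of "m - S x"] unfolding \<eta>_def by simp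
  ultimately show ?thesis using that by blast
qed

text \<open>These are cutoffs for the neighbourhoods of radius 1/(n+1) of K. A point off the closed
  set K leaves them eventually, so the limit is the indicator at every point and integrals over
  compact sets become limits of integrals of test functions.\<close>

lemma cutoff_seq_exists:
  assumes K: "compact K" and U: "open U" "K \<subseteq> U"
  obtains \<eta> :: "nat \<Rightarrow> R3 \<Rightarrow> real" where "\<And>n. test_fun U (\<eta> n)" "\<And>n x. 0 \<le> \<eta> n x" "\<And>n x. \<eta> n x \<le> 1"
    "\<And>x. (\<lambda>n. \<eta> n x) \<longlonglongrightarrow> indicator K x"
proof (cases "K = {}")
  case True
  then show ?thesis using that[of "\<lambda>n x. 0"] test_fun_zero by auto
next
  case False
  define W where "W n = U \<inter> {x. infdist x K < 1 / real (Suc n)}" for n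
  have W: "open (W n)" "K \<subseteq> W n" "W n \<subseteq> U" for n
    using U False unfolding W_def
    by (auto intro!: open_Int open_Collect_less continuous_intros)
  have "\<forall>n. \<exists>\<eta>. test_fun (W n) \<eta> \<and> (\<forall>x. 0 \<le> \<eta> x) \<and> (\<forall>x. \<eta> x \<le> 1) \<and> (\<forall>x\<in>K. \<eta> x = 1)"
    using cutoff_exists[OF K W(1,2)] by metis
  then obtain \<eta> where \<eta>: "\<And>n. test_fun (W n) (\<eta> n)" "\<And>n x. 0 \<le> \<eta> n x" "\<And>n x. \<eta> n x \<le> 1" "\<And>n x. x \<in> K \<Longrightarrow> \<eta> n x = 1"
    by metis
  have "(\<lambda>n. \<eta> n x) \<longlonglongrightarrow> indicator K x" for x
  proof (cases "x \<in> K")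
    case True then show ?thesis using \<eta>(4) by simp
  next
    case f: False
    then have "infdist x K > 0" 
      using False K compact_imp_closed in_closed_iff_infdist_zero infdist_nonneg
      by (metis order_le_less)
    then obtain N where N: "1 / real (Suc N) < infdist x K" using nat_approx_posE by blast
    have "\<eta> n x = 0" if "n \<ge> N" for n
    proof (rule test_fun_eq0_outside[OF \<eta>(1)])
      have "1 / real (Suc n) \<le> 1 / real (Suc N)" using that by (simp add: frac_le)
      then show "x \<notin> W n" using N by (auto simp: W_def)
    qed
    then have "\<forall>\<^sub>F n in sequentially. \<eta> n x = 0" using eventually_sequentially by blast
    then show ?thesis using f by (simp add: tendsto_eventually)
  qed
  then show ?thesis using that[of \<eta>] \<eta> test_fun_mono[OF \<eta>(1) W(3)] by auto
qed

subsection \<open>Integration by parts and the Hardy inequality\<close>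

lemma borel_imp_lebesgue: "f \<in> borel_measurable borel \<Longrightarrow> f \<in> borel_measurable lebesgue"
  by (intro measurable_completion) simp

lemma continuous_imp_lebesgue:
  fixes h :: "R3 \<Rightarrow> 'b::topological_space"
  shows "continuous_on UNIV h \<Longrightarrow> h \<in> borel_measurable lebesgue"
  by (intro borel_imp_lebesgue borel_measurable_continuous_onI)

lemma integrable_lebesgue_continuous_compact:
  fixes h :: "R3 \<Rightarrow> 'b::{banach,second_countable_topology}"
  assumes "continuous_on UNIV h" "compact K" "\<And>x. x \<notin> K \<Longrightarrow> h x = 0"
  shows "integrable lebesgue h"
proof -
  have "integrable lborel (\<lambda>x. indicator K x *\<^sub>R h x)"
    using assms by (intro borel_integrable_compact) (auto intro: continuous_on_subset)
  moreover have "(\<lambda>x. indicator K x *\<^sub>R h x) = h" using assms(3) by (auto simp: indicator_def)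
  ultimately show ?thesis
    using assms(1) by (subst integrable_completion) (auto intro: borel_measurable_continuous_onI)
qed

lemma test_fun_continuous: "test_fun U \<phi> \<Longrightarrow> continuous_on UNIV \<phi>"
  and test_fun_continuous_cgrad: "test_fun U \<phi> \<Longrightarrow> continuous_on UNIV (cgrad \<phi>)"
  and test_fun_measurable: "test_fun U \<phi> \<Longrightarrow> \<phi> \<in> borel_measurable lebesgue"
  using test_fun_smooth smooth_on_continuous smooth_on_continuous_cgrad continuous_imp_lebesgue
  by blast+

lemma continuous_compact_bounded:
  fixes h :: "R3 \<Rightarrow> 'b::real_normed_vector"
  assumes "continuous_on UNIV h" "compact K" "\<And>x. x \<notin> K \<Longrightarrow> h x = 0"
  obtains B where "B > 0" "\<And>x. norm (h x) \<le> B"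
proof -
  have "bounded (h ` K)"
    using assms by (intro compact_imp_bounded compact_continuous_image) (auto intro: continuous_on_subset)
  then obtain B where "B > 0" "\<And>x. x \<in> K \<Longrightarrow> norm (h x) \<le> B" by (auto simp: bounded_pos)
  then show ?thesis using that[of B] assms(3) by (metis less_imp_le norm_zero)
qed

text \<open>The partial derivative is a limit of difference quotients. Each of them has integral
  zero by translation invariance of Lebesgue measure, and the Lipschitz bound dominates them on a
  compact set.\<close>

lemma integral_pdir_test_fun:
  assumes "test_fun U \<phi>"
  shows "(\<integral>x. pdir i \<phi> x \<partial>lebesgue) = 0"
proof -
  obtain K where K: "compact K" "\<And>x. x \<notin> K \<Longrightarrow> \<phi> x = 0" "\<And>x. x \<notin> K \<Longrightarrow> cgrad \<phi> x = 0"
    using test_funE[OF assms] by metis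
  note cont = test_fun_continuous[OF assms] test_fun_continuous_cgrad[OF assms]
  obtain B where B: "B > 0" "\<And>x. norm (cgrad \<phi> x) \<le> B"
    using continuous_compact_bounded[OF cont(2) K(1,3)] by metis
  define e where "e = (axis i 1 :: R3)"
  have ne: "norm e = 1" by (simp add: e_def)
  have der: "(\<phi> has_derivative (\<lambda>v. cgrad \<phi> x \<bullet> v)) (at x)" for x
    using assms smooth_on_has_derivative test_fun_smooth by blast
  \<comment> \<open>K is enlarged by the closed unit ball: the increments have length 1/(n+1) <= 1,
    so all quotients vanish outside this set.\<close>
  define K' where "K' = (\<lambda>(x,y). x + y) ` (K \<times> cball 0 (1::real) :: (R3\<times>R3) set)"
  have K': "compact K'" unfolding K'_def
    by (intro compact_continuous_image compact_Times K(1) compact_cball) (auto intro!: continuous_intros simp: split_beta)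
  have KK': "K \<subseteq> K'" unfolding K'_def by (force intro!: image_eqI[of _ _ "(x,0)" for x])
  define s where "s n x = real (Suc n) * (\<phi> (x + (1 / real (Suc n)) *\<^sub>R e) - \<phi> x)" for n x
  have lip: "norm (\<phi> y - \<phi> x) \<le> B * norm (y - x)" for x y
  proof (rule differentiable_bound[of UNIV])
    show "onorm (\<lambda>v. cgrad \<phi> x \<bullet> v) \<le> B" for x
    proof (rule onorm_le)
      fix v show "norm (cgrad \<phi> x \<bullet> v) \<le> B * norm v"
        using Cauchy_Schwarz_ineq2[of "cgrad \<phi> x" v] mult_right_mono[OF B(2)[of x], of "norm v"] by simp
    qed
  qed (use der in auto)
  have sb: "norm (s n x) \<le> B * indicator K' x" for n x
  proof (cases "x \<in> K'")
    case True
    have "\<bar>s n x\<bar> = real (Suc n) * norm (\<phi> (x + (1 / real (Suc n)) *\<^sub>R e) - \<phi> x)"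
      by (simp add: s_def abs_mult del: of_nat_Suc)
    also have "\<dots> \<le> real (Suc n) * (B * norm ((x + (1 / real (Suc n)) *\<^sub>R e) - x))"
      by (intro mult_left_mono lip) auto
    also have "\<dots> = B" using ne by simp
    finally show ?thesis using True by simp
  next
    case False
    have "x + (1 / real (Suc n)) *\<^sub>R e \<notin> K"
    proof
      assume "x + (1 / real (Suc n)) *\<^sub>R e \<in> K"
      then have "(x + (1 / real (Suc n)) *\<^sub>R e) + (- (1 / real (Suc n)) *\<^sub>R e) \<in> K'"
        unfolding K'_def using ne by (intro image_eqI[of _ _ "(x + (1 / real (Suc n)) *\<^sub>R e, - (1 / real (Suc n)) *\<^sub>R e)"]) auto
      then show False using False by simp
    qed
    then show ?thesis using False KK' K(2) by (auto simp: s_def)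
  qed
  have lim: "(\<lambda>n. s n x) \<longlonglongrightarrow> pdir i \<phi> x" for x
  proof -
    have "((\<lambda>h. (\<phi> (x + h *\<^sub>R e) - \<phi> x) / h) \<longlongrightarrow> pdir i \<phi> x) (at 0)"
    proof -
      have "((\<lambda>t. \<phi> (x + t *\<^sub>R e)) has_derivative (\<lambda>t. cgrad \<phi> (x + 0 *\<^sub>R e) \<bullet> (t *\<^sub>R e))) (at 0)"
        by (rule has_derivative_compose[OF _ der]) (auto intro!: derivative_eq_intros)
      then have "((\<lambda>t. \<phi> (x + t *\<^sub>R e)) has_field_derivative (pdir i \<phi> x)) (at 0)"
        unfolding has_field_derivative_def by (simp add: e_def inner_axis pdir_eq_cgrad mult.commute[of _ "cgrad \<phi> x $ i"])
      then show ?thesis by (simp add: DERIV_def)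
    qed
    moreover have "filterlim (\<lambda>n. 1 / real (Suc n)) (at 0) sequentially"
      using LIMSEQ_Suc[OF lim_1_over_n] by (auto simp: filterlim_at)
    ultimately have "(\<lambda>n. (\<phi> (x + (1 / real (Suc n)) *\<^sub>R e) - \<phi> x) / (1 / real (Suc n))) \<longlonglongrightarrow> pdir i \<phi> x"
      by (rule filterlim_compose)
    then show ?thesis by (simp add: s_def mult.commute del: of_nat_Suc)
  qed
  have "(\<lambda>n. \<integral>x. s n x \<partial>lebesgue) \<longlonglongrightarrow> (\<integral>x. pdir i \<phi> x \<partial>lebesgue)"
  proof (rule integral_dominated_convergence[where w="\<lambda>x. B * indicator K' x"])
    show "pdir i \<phi> \<in> borel_measurable lebesgue"
      by (intro continuous_imp_lebesgue smooth_on_continuous smooth_on_pdir test_fun_smooth[OF assms])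
    show "s n \<in> borel_measurable lebesgue" for n
      unfolding s_def by (intro continuous_imp_lebesgue continuous_intros continuous_on_compose2[OF cont(1)]) auto
    show "integrable lebesgue (\<lambda>x. B * indicator K' x)"
      using lmeasurable_compact[OF K'] by (intro integrable_mult_right integrable_real_indicator) (auto simp: fmeasurable_def)
  qed (use lim sb in auto)
  moreover have "(\<integral>x. s n x \<partial>lebesgue) = 0" for n
  proof -
    have m: "\<phi> \<in> borel_measurable borel" by (intro borel_measurable_continuous_onI cont)
    have "integrable lebesgue \<phi>" by (rule integrable_lebesgue_continuous_compact[OF cont(1) K(1,2)])
    then have i: "integrable lborel \<phi>" using m by (simp add: integrable_completion)
    have tr: "integrable lborel (\<lambda>x. \<phi> (a + x))" "(\<integral>x. \<phi> (a + x) \<partial>lborel) = (\<integral>x. \<phi> x \<partial>lborel)" for a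
      using i m integrable_distr_eq[of "(+) a" lborel borel \<phi>] integral_distr[of "(+) a" lborel borel \<phi>] lborel_distr_plus[of a]
      by auto
    have "(\<integral>x. s n x \<partial>lebesgue) = (\<integral>x. s n x \<partial>lborel)"
      by (intro integral_completion) (auto simp: s_def intro!: borel_measurable_continuous_onI continuous_intros continuous_on_compose2[OF cont(1)])
    also have "\<dots> = 0" unfolding s_def using tr[of "(1 / real (Suc n)) *\<^sub>R e"] i
      by (simp add: add.commute del: of_nat_Suc)
    finally show ?thesis .
  qed
  ultimately have "(\<lambda>n. 0) \<longlonglongrightarrow> (\<integral>x. pdir i \<phi> x \<partial>lebesgue)" by simp
  from LIMSEQ_unique[OF this tendsto_const] show ?thesis .
qed

section \<open>Gradient rules, integration by parts and Hardy's inequality\<close>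

lemma cgrad_mult:
  assumes "smooth_on UNIV g" "smooth_on UNIV h"
  shows "cgrad (\<lambda>x. g x * h x) x = g x *\<^sub>R cgrad h x + h x *\<^sub>R cgrad g x"
  by (rule cgrad_eqI, rule has_derivative_eq_rhs[OF has_derivative_mult[OF smooth_on_has_derivative[OF assms(1)] smooth_on_has_derivative[OF assms(2)]]])
     (auto simp: inner_add_left algebra_simps)

lemma cgrad_add:
  assumes "smooth_on UNIV g" "smooth_on UNIV h"
  shows "cgrad (\<lambda>x. g x + h x) x = cgrad g x + cgrad h x"
  by (rule cgrad_eqI, rule has_derivative_eq_rhs[OF has_derivative_add[OF smooth_on_has_derivative[OF assms(1)] smooth_on_has_derivative[OF assms(2)]]])
     (auto simp: inner_add_left)

lemma cgrad_compose:
  assumes "smooth_on UNIV h" "(F has_field_derivative F') (at (h x))"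
  shows "cgrad (\<lambda>x. F (h x)) x = F' *\<^sub>R cgrad h x"
  by (rule cgrad_eqI, rule has_derivative_eq_rhs[OF has_derivative_compose[OF smooth_on_has_derivative[OF assms(1)] assms(2)[unfolded has_field_derivative_def]]])
     auto

lemma cgrad_cmult: "smooth_on UNIV h \<Longrightarrow> cgrad (\<lambda>x. c * h x) x = c *\<^sub>R cgrad h x"
  by (rule cgrad_compose) (auto intro!: derivative_eq_intros)

lemma integration_by_parts:
  assumes "smooth_on UNIV h" "test_fun U \<phi>"
  shows "(\<integral>x. h x * pdir i \<phi> x \<partial>lebesgue) = - (\<integral>x. cgrad h x $ i * \<phi> x \<partial>lebesgue)"
proof -
  obtain K where K: "compact K" "\<And>x. x \<notin> K \<Longrightarrow> \<phi> x = 0" "\<And>x. x \<notin> K \<Longrightarrow> cgrad \<phi> x = 0"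
    using test_funE[OF assms(2)] by metis
  note sm = assms(1) test_fun_smooth[OF assms(2)]
  note cs = sm[THEN smooth_on_continuous] sm[THEN smooth_on_continuous_cgrad]
  have i1: "integrable lebesgue (\<lambda>x. h x * pdir i \<phi> x)"
    by (rule integrable_lebesgue_continuous_compact[OF _ K(1)])
      (use K in \<open>auto simp: pdir_eq_cgrad intro!: continuous_intros cs\<close>)
  have i2: "integrable lebesgue (\<lambda>x. cgrad h x $ i * \<phi> x)"
    by (rule integrable_lebesgue_continuous_compact[OF _ K(1)])
      (use K in \<open>auto intro!: continuous_intros cs\<close>)
  have "0 = (\<integral>x. pdir i (\<lambda>x. h x * \<phi> x) x \<partial>lebesgue)"
    using integral_pdir_test_fun[OF test_fun_mult[OF assms]] by simp
  also have "\<dots> = (\<integral>x. h x * pdir i \<phi> x + cgrad h x $ i * \<phi> x \<partial>lebesgue)"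
    by (intro Bochner_Integration.integral_cong) (auto simp: pdir_eq_cgrad cgrad_mult[OF sm])
  also have "\<dots> = (\<integral>x. h x * pdir i \<phi> x \<partial>lebesgue) + (\<integral>x. cgrad h x $ i * \<phi> x \<partial>lebesgue)"
    using i1 i2 by simp
  finally show ?thesis by simp
qed

text \<open>The vector field x w(x) with w(x) = 1/(1 + |x|^2) has divergence 3 w - 2 w^2 |x|^2,
  which is at least w because w |x|^2 <= 1. Integration by parts against \<phi>^2 leaves a cross
  term that Young's inequality absorbs. The regularised weight is smooth at the origin and still
  gives the constant 4 of the classical inequality in dimension three.\<close>

lemma Hardy_test_fun:
  assumes "test_fun U \<phi>"
  shows "(\<integral>x. (\<phi> x)\<^sup>2 / (1 + (norm x)\<^sup>2) \<partial>lebesgue) \<le> 4 * sqint (cgrad \<phi>)"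
proof -
  obtain K where K: "compact K" "\<And>x. x \<notin> K \<Longrightarrow> \<phi> x = 0" "\<And>x. x \<notin> K \<Longrightarrow> cgrad \<phi> x = 0"
    using test_funE[OF assms] by metis
  note sm = test_fun_smooth[OF assms]
  note cont = test_fun_continuous[OF assms] test_fun_continuous_cgrad[OF assms]
  define w where "w x = inverse (1 + (norm x)\<^sup>2)" for x :: R3
  have w0: "w x > 0" "w x * (1 + (norm x)^2) = 1" for x
    unfolding w_def by (auto intro!: add_pos_nonneg left_inverse simp: add_nonneg_eq_0_iff)
  have ws: "smooth_on UNIV w" unfolding w_def
    using smooth_on_norm2[of 0] by (intro smooth_on_inverse smooth_on_add smooth_on_const) (auto intro: add_pos_nonneg)
  have gw: "cgrad w x = (- 2 * (w x)\<^sup>2) *\<^sub>R x" for x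
    unfolding w_def power2_norm_eq_inner
    by (rule cgrad_eqI) (auto intro!: derivative_eq_intros ext
         simp: inner_commute divide_inverse power2_eq_square algebra_simps add_nonneg_eq_0_iff)
  have gx: "cgrad (\<lambda>x. x $ i) x = axis i 1" for i x
    by (rule cgrad_eqI) (auto simp: inner_axis' intro!: bounded_linear_imp_has_derivative bounded_linear_vec_nth)
  define h where "h i x = w x * x $ i" for i x
  have hs: "smooth_on UNIV (h i)" for i
    unfolding h_def by (intro smooth_on_mult ws smooth_on_coord)
  have gh: "cgrad (h i) x $ i = w x - 2 * (w x)\<^sup>2 * (x $ i)\<^sup>2" for i x
    unfolding h_def by (simp add: cgrad_mult[OF ws smooth_on_coord] gx gw power2_eq_square)
  have p2: "test_fun U (\<lambda>x. (\<phi> x)\<^sup>2)" using test_fun_power[OF assms, of 2] by simp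
  have gp: "cgrad (\<lambda>x. (\<phi> x)\<^sup>2) x = (2 * \<phi> x) *\<^sub>R cgrad \<phi> x" for x
    by (rule cgrad_compose[OF sm]) (auto intro!: derivative_eq_intros)
  have ci: "integrable lebesgue F" if "continuous_on UNIV F" "\<And>x. \<phi> x = 0 \<Longrightarrow> cgrad \<phi> x = 0 \<Longrightarrow> F x = 0" for F :: "R3 \<Rightarrow> real"
    by (rule integrable_lebesgue_continuous_compact[OF that(1) K(1)]) (use K that(2) in auto)
  note ci = ci[OF _ ] and cs = continuous_intros cont smooth_on_continuous[OF ws] smooth_on_continuous[OF hs]
    smooth_on_continuous_cgrad[OF hs]
  have nx: "(norm x)\<^sup>2 = (\<Sum>i\<in>UNIV. (x $ i)\<^sup>2)" for x :: R3
    unfolding power2_norm_eq_inner inner_vec_def by (simp add: power2_eq_square)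
  have eq: "(\<integral>x. 2 * \<phi> x * w x * (x \<bullet> cgrad \<phi> x) \<partial>lebesgue) = - (\<integral>x. (\<phi> x)\<^sup>2 * (3 * w x - 2 * (w x)\<^sup>2 * (norm x)\<^sup>2) \<partial>lebesgue)"
  proof -
    have "(\<integral>x. 2 * \<phi> x * w x * (x \<bullet> cgrad \<phi> x) \<partial>lebesgue) = (\<integral>x. (\<Sum>i\<in>UNIV. h i x * pdir i (\<lambda>x. (\<phi> x)\<^sup>2) x) \<partial>lebesgue)"
      by (intro Bochner_Integration.integral_cong)
         (auto simp: pdir_eq_cgrad gp h_def inner_vec_def sum_distrib_left algebra_simps)
    also have "\<dots> = (\<Sum>i\<in>UNIV. \<integral>x. h i x * pdir i (\<lambda>x. (\<phi> x)\<^sup>2) x \<partial>lebesgue)"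
      by (intro Bochner_Integration.integral_sum ci) (auto simp: pdir_eq_cgrad gp intro!: cs)
    also have "\<dots> = - (\<Sum>i\<in>UNIV. \<integral>x. cgrad (h i) x $ i * (\<phi> x)\<^sup>2 \<partial>lebesgue)"
      by (simp add: integration_by_parts[OF hs p2] sum_negf)
    also have "(\<Sum>i\<in>UNIV. \<integral>x. cgrad (h i) x $ i * (\<phi> x)\<^sup>2 \<partial>lebesgue) = (\<integral>x. (\<Sum>i\<in>UNIV. cgrad (h i) x $ i * (\<phi> x)\<^sup>2) \<partial>lebesgue)"
      by (intro Bochner_Integration.integral_sum[symmetric] ci) (auto intro!: cs)
    also have "\<dots> = (\<integral>x. (\<phi> x)\<^sup>2 * (3 * w x - 2 * (w x)\<^sup>2 * (norm x)\<^sup>2) \<partial>lebesgue)"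
      by (intro Bochner_Integration.integral_cong)
         (auto simp: gh nx sum_3 algebra_simps)
    finally show ?thesis .
  qed
  have i1: "integrable lebesgue (\<lambda>x. (\<phi> x)\<^sup>2 * w x)" by (rule ci) (auto intro!: cs)
  have i2: "integrable lebesgue (\<lambda>x. (\<phi> x)\<^sup>2 * (3 * w x - 2 * (w x)\<^sup>2 * (norm x)\<^sup>2))" by (rule ci) (auto intro!: cs)
  have i3: "integrable lebesgue (\<lambda>x. 2 * \<phi> x * w x * (x \<bullet> cgrad \<phi> x))" by (rule ci) (auto intro!: cs)
  have i4: "integrable lebesgue (\<lambda>x. (norm (cgrad \<phi> x))\<^sup>2)" by (rule ci) (auto intro!: cs)
  have "(\<integral>x. (\<phi> x)\<^sup>2 * w x \<partial>lebesgue) \<le> (\<integral>x. (\<phi> x)\<^sup>2 * (3 * w x - 2 * (w x)\<^sup>2 * (norm x)\<^sup>2) \<partial>lebesgue)"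
  proof (rule integral_mono[OF i1 i2])
    fix x
    have "w x * (norm x)^2 \<le> 1" using w0[of x] by (simp add: algebra_simps)
    then have "w x * (w x * (norm x)^2) \<le> w x * 1" using w0[of x] by (intro mult_left_mono) auto
    then show "(\<phi> x)\<^sup>2 * w x \<le> (\<phi> x)\<^sup>2 * (3 * w x - 2 * (w x)\<^sup>2 * (norm x)\<^sup>2)"
      by (intro mult_left_mono) (auto simp: power2_eq_square algebra_simps)
  qed
  also have "\<dots> = (\<integral>x. - (2 * \<phi> x * w x * (x \<bullet> cgrad \<phi> x)) \<partial>lebesgue)" using eq by simp
  \<comment> \<open>Young's inequality is used as 2ab <= a^2/2 + 2b^2 with a = |\<phi>| w |x| and b
    the norm of the gradient. Since (w |x|)^2 <= w, exactly half of the left-hand side comes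
    back.\<close>
  also have "\<dots> \<le> (\<integral>x. 1/2 * ((\<phi> x)\<^sup>2 * w x) + 2 * (norm (cgrad \<phi> x))\<^sup>2 \<partial>lebesgue)"
  proof (rule integral_mono)
    fix x
    have "(w x * norm x)\<^sup>2 \<le> w x"
    proof -
      have "w x * (norm x)^2 \<le> 1" using w0[of x] by (simp add: algebra_simps)
      then have "w x * (w x * (norm x)^2) \<le> w x * 1" using w0[of x] by (intro mult_left_mono) auto
      then show ?thesis by (simp add: power2_eq_square algebra_simps)
    qed
    then have a: "(\<phi> x)\<^sup>2 * (w x * norm x)\<^sup>2 \<le> (\<phi> x)\<^sup>2 * w x" by (intro mult_left_mono) auto
    have "- (2 * \<phi> x * w x * (x \<bullet> cgrad \<phi> x)) \<le> 2 * \<bar>\<phi> x\<bar> * w x * (norm x * norm (cgrad \<phi> x))"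
    proof -
      have "- (2 * \<phi> x * w x * (x \<bullet> cgrad \<phi> x)) \<le> \<bar>2 * \<phi> x * w x * (x \<bullet> cgrad \<phi> x)\<bar>" by simp
      also have "\<dots> = 2 * \<bar>\<phi> x\<bar> * w x * \<bar>x \<bullet> cgrad \<phi> x\<bar>" using w0[of x] by (simp add: abs_mult)
      also have "\<dots> \<le> 2 * \<bar>\<phi> x\<bar> * w x * (norm x * norm (cgrad \<phi> x))"
        using w0[of x] by (intro mult_left_mono Cauchy_Schwarz_ineq2) auto
      finally show ?thesis .
    qed
    also have "\<dots> \<le> 1/2 * (\<bar>\<phi> x\<bar> * (w x * norm x))\<^sup>2 + 2 * (norm (cgrad \<phi> x))\<^sup>2"
      using sum_squares_bound[of "\<bar>\<phi> x\<bar> * (w x * norm x)" "2 * norm (cgrad \<phi> x)"] by (simp add: power2_eq_square algebra_simps)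
    also have "\<dots> \<le> 1/2 * ((\<phi> x)\<^sup>2 * w x) + 2 * (norm (cgrad \<phi> x))\<^sup>2"
      using a by (simp add: power_mult_distrib)
    finally show "- (2 * \<phi> x * w x * (x \<bullet> cgrad \<phi> x)) \<le> 1/2 * ((\<phi> x)\<^sup>2 * w x) + 2 * (norm (cgrad \<phi> x))\<^sup>2" .
  qed (use i1 i3 i4 in auto)
  also have "\<dots> = 1/2 * (\<integral>x. (\<phi> x)\<^sup>2 * w x \<partial>lebesgue) + 2 * sqint (cgrad \<phi>)"
    using i1 i4 by simp
  finally have "(\<integral>x. (\<phi> x)\<^sup>2 * w x \<partial>lebesgue) \<le> 4 * sqint (cgrad \<phi>)" by linarith
  then show ?thesis unfolding w_def divide_inverse .
qed

subsection \<open>The Sobolev inequality\<close>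

text \<open>The first coordinate is stored last, so that the iterated integral has it innermost,
  over a fixed pair of the other two; \<open>distr_vec3\<close> transfers Fubini's theorem from the
  product to \<open>R3\<close>.\<close>

definition vec3 :: "(real \<times> real) \<times> real \<Rightarrow> R3" where
  "vec3 p = vector [snd p, fst (fst p), snd (fst p)]"

lemma vec3_nth [simp]: "vec3 ((y, z), x) $ 1 = x" "vec3 ((y, z), x) $ 2 = y" "vec3 ((y, z), x) $ 3 = z"
  by (simp_all add: vec3_def)

lemma vec3_eq: "vec3 p = snd p *\<^sub>R axis 1 1 + fst (fst p) *\<^sub>R axis 2 1 + snd (fst p) *\<^sub>R axis 3 1"
  by (cases p, cases "fst p") (simp add: vec_eq_iff forall_3 axis_def)

lemma continuous_on_vec3 [continuous_intros]: "continuous_on S g \<Longrightarrow> continuous_on S (\<lambda>x. vec3 (g x))"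
  unfolding vec3_eq by (intro continuous_intros)

lemma vec3_measurable [measurable]: "vec3 \<in> borel_measurable borel"
  by (intro borel_measurable_continuous_onI continuous_intros)

lemma distr_vec3: "distr lborel borel vec3 = lborel"
proof (rule lborel_eqI[symmetric])
  fix l u :: R3 assume lub: "\<And>b. b \<in> Basis \<Longrightarrow> l \<bullet> b \<le> u \<bullet> b"
  then have lu: "l $ i \<le> u $ i" for i using lub[of "axis i 1"] by (simp add: inner_axis axis_in_Basis_iff)
  have e: "vec3 -` box l u = ({l $ 2 <..< u $ 2} \<times> {l $ 3 <..< u $ 3}) \<times> {l $ 1 <..< u $ 1}"
    by (auto simp: mem_box_cart forall_3)
  have "emeasure (distr lborel borel vec3) (box l u) = emeasure lborel (vec3 -` box l u)"
    by (subst emeasure_distr) auto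
  also have "\<dots> = emeasure (lborel \<Otimes>\<^sub>M lborel) (({l $ 2 <..< u $ 2} \<times> {l $ 3 <..< u $ 3}) \<times> {l $ 1 <..< u $ 1})"
    by (simp add: e lborel_prod)
  also have "\<dots> = emeasure (lborel \<Otimes>\<^sub>M lborel) ({l $ 2 <..< u $ 2} \<times> {l $ 3 <..< u $ 3}) * emeasure lborel {l $ 1 <..< u $ 1}"
    by (subst lborel.emeasure_pair_measure_Times) (auto simp: lborel_prod intro!: borel_open open_Times)
  also have "\<dots> = ennreal (u $ 2 - l $ 2) * ennreal (u $ 3 - l $ 3) * ennreal (u $ 1 - l $ 1)"
    using lu by (subst lborel.emeasure_pair_measure_Times) auto
  also have "\<dots> = ennreal ((u $ 2 - l $ 2) * (u $ 3 - l $ 3) * (u $ 1 - l $ 1))"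
    using lu by (simp add: ennreal_mult)
  also have "(u $ 2 - l $ 2) * (u $ 3 - l $ 3) * (u $ 1 - l $ 1) = (\<Prod>i\<in>UNIV. u $ i - l $ i)"
    unfolding UNIV_3 by (simp add: ac_simps)
  also have "(\<Prod>i\<in>UNIV. u $ i - l $ i) = (\<Prod>b\<in>Basis. (u - l) \<bullet> b)"
  proof -
    have B: "(Basis :: R3 set) = (\<lambda>i. axis i 1) ` UNIV" by (auto simp: Basis_vec_def)
    show ?thesis unfolding B
      by (subst prod.reindex) (auto simp: inj_on_def axis_eq_axis inner_axis)
  qed
  finally show "emeasure (distr lborel borel vec3) (box l u) = ennreal (\<Prod>b\<in>Basis. (u - l) \<bullet> b)" .
qed simp

lemma nn_integral_vec3:
  assumes [measurable]: "F \<in> borel_measurable (borel :: R3 measure)"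
  shows "(\<integral>\<^sup>+x. F x \<partial>lborel) = (\<integral>\<^sup>+yz. \<integral>\<^sup>+x. F (vec3 (yz, x)) \<partial>lborel \<partial>lborel)"
    and "(\<integral>\<^sup>+x. F x \<partial>lborel) = (\<integral>\<^sup>+y. \<integral>\<^sup>+z. \<integral>\<^sup>+x. F (vec3 ((y, z), x)) \<partial>lborel \<partial>lborel \<partial>lborel)"
proof -
  have "(\<integral>\<^sup>+x. F x \<partial>lborel) = (\<integral>\<^sup>+x. F x \<partial>distr lborel borel vec3)" by (simp add: distr_vec3)
  also have "\<dots> = (\<integral>\<^sup>+p. F (vec3 p) \<partial>(lborel \<Otimes>\<^sub>M lborel))"
    by (subst nn_integral_distr) (auto simp: lborel_prod)
  also have "\<dots> = (\<integral>\<^sup>+yz. \<integral>\<^sup>+x. F (vec3 (yz, x)) \<partial>lborel \<partial>lborel)"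
    by (subst lborel.nn_integral_fst[symmetric]) (auto simp: lborel_prod)
  finally show 1: "(\<integral>\<^sup>+x. F x \<partial>lborel) = (\<integral>\<^sup>+yz. \<integral>\<^sup>+x. F (vec3 (yz, x)) \<partial>lborel \<partial>lborel)" .
  have "(\<lambda>yz. \<integral>\<^sup>+x. F (vec3 (yz, x)) \<partial>lborel) \<in> borel_measurable (lborel \<Otimes>\<^sub>M lborel)"
    by (rule lborel.borel_measurable_nn_integral_fst[of "\<lambda>p. F (vec3 p)"]) (simp add: lborel_prod)
  from lborel.nn_integral_fst[OF this] show "(\<integral>\<^sup>+x. F x \<partial>lborel) = (\<integral>\<^sup>+y. \<integral>\<^sup>+z. \<integral>\<^sup>+x. F (vec3 ((y, z), x)) \<partial>lborel \<partial>lborel \<partial>lborel)"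
    unfolding 1 by (simp add: lborel_prod)
qed

text \<open>In the Loomis-Whitney argument h^2 is bounded by a product of three line integrals that
  may be infinite. Cauchy-Schwarz works with the roots of the factors, hence a square root that
  admits infinity.\<close>

definition esqrt :: "ennreal \<Rightarrow> ennreal" where
  "esqrt r = (if r = top then top else ennreal (sqrt (enn2real r)))"

lemma esqrt_square [simp]: "esqrt r ^ 2 = r"
  by (cases r) (auto simp: esqrt_def ennreal_power)

lemma esqrt_measurable [measurable]: "esqrt \<in> borel_measurable borel"
  unfolding esqrt_def by measurable

lemma ennreal_power2_le_imp_le: "x ^ 2 \<le> y ^ 2 \<Longrightarrow> x \<le> (y :: ennreal)"
proof -
  assume le: "x ^ 2 \<le> y ^ 2"
  show ?thesis
  proof (cases y)
    case y: (real r)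
    then have "x ^ 2 < top" using le by (simp add: ennreal_power le_less_trans)
    then obtain q where "0 \<le> q" "x = ennreal q" by (cases x) auto
    then show ?thesis using le y by (auto simp: ennreal_power intro: power2_le_imp_le)
  qed simp
qed

lemma lborel_pair_measurable: "f \<in> borel_measurable borel \<Longrightarrow> f \<in> borel_measurable (lborel \<Otimes>\<^sub>M lborel)"
  by (simp add: lborel_prod)

lemma nn_integral_swap:
  assumes "(\<lambda>(x, y). f x y) \<in> borel_measurable (borel :: ('a::euclidean_space \<times> 'b::euclidean_space) measure)"
  shows "(\<integral>\<^sup>+x. \<integral>\<^sup>+y. f x y \<partial>lborel \<partial>lborel) = (\<integral>\<^sup>+y. \<integral>\<^sup>+x. f x y \<partial>lborel \<partial>lborel)"
  using lborel_pair.Fubini'[OF lborel_pair_measurable[OF assms]] by simp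

lemma borel_measurable_nn_integral_lborel:
  assumes "(\<lambda>(x, y). f x y) \<in> borel_measurable (borel :: ('a::euclidean_space \<times> 'b::euclidean_space) measure)"
  shows "(\<lambda>x. \<integral>\<^sup>+y. f x y \<partial>lborel) \<in> borel_measurable borel"
  using lborel.borel_measurable_nn_integral_fst[OF lborel_pair_measurable[OF assms]] by simp

lemma borel_measurable_compose_continuous:
  assumes "F \<in> borel_measurable borel" "continuous_on UNIV g"
  shows "(\<lambda>x. F (g x)) \<in> borel_measurable borel"
  using measurable_compose[OF borel_measurable_continuous_onI[OF assms(2)] assms(1)] .

text \<open>The Loomis--Whitney inequality in squared form, so that only the Cauchy--Schwarz inequality is used.\<close>
lemma Loomis_Whitney:
  fixes F1 F2 F3 h :: "R3 \<Rightarrow> ennreal"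
  assumes m: "F1 \<in> borel_measurable borel" "F2 \<in> borel_measurable borel" "F3 \<in> borel_measurable borel"
      "h \<in> borel_measurable borel"
    and h: "\<And>x y z. (h (vec3 ((y, z), x)))\<^sup>2 \<le> (\<integral>\<^sup>+s. F1 (vec3 ((y, z), s)) \<partial>lborel)
          * (\<integral>\<^sup>+s. F2 (vec3 ((s, z), x)) \<partial>lborel) * (\<integral>\<^sup>+s. F3 (vec3 ((y, s), x)) \<partial>lborel)"
  shows "(\<integral>\<^sup>+x. h x \<partial>lborel)\<^sup>2 \<le> (\<integral>\<^sup>+x. F1 x \<partial>lborel) * (\<integral>\<^sup>+x. F2 x \<partial>lborel) * (\<integral>\<^sup>+x. F3 x \<partial>lborel)"
proof -
  \<comment> \<open>Each root misses one coordinate: a depends on (y, z), b on (x, z), c on (x, y).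
    Cauchy-Schwarz in (y, z) splits off a; Cauchy-Schwarz in x separates b from c, after which the
    integrals over z and y factor.\<close>
  define a where "a yz = esqrt (\<integral>\<^sup>+s. F1 (vec3 (yz, s)) \<partial>lborel)" for yz
  define b where "b x z = esqrt (\<integral>\<^sup>+s. F2 (vec3 ((s, z), x)) \<partial>lborel)" for x z
  define c where "c x y = esqrt (\<integral>\<^sup>+s. F3 (vec3 ((y, s), x)) \<partial>lborel)" for x y
  have am: "a \<in> borel_measurable borel"
    unfolding a_def
    by (intro measurable_compose[OF borel_measurable_nn_integral_lborel esqrt_measurable])
       (auto simp: case_prod_beta' intro!: borel_measurable_compose_continuous[OF m(1)] continuous_intros)
  have bm: "(\<lambda>(x,z). b x z) \<in> borel_measurable borel"
    unfolding b_def case_prod_beta'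
    by (intro measurable_compose[OF borel_measurable_nn_integral_lborel esqrt_measurable])
       (auto simp: case_prod_beta' intro!: borel_measurable_compose_continuous[OF m(2)] continuous_intros)
  have cm: "(\<lambda>(x,y). c x y) \<in> borel_measurable borel"
    unfolding c_def case_prod_beta'
    by (intro measurable_compose[OF borel_measurable_nn_integral_lborel esqrt_measurable])
       (auto simp: case_prod_beta' intro!: borel_measurable_compose_continuous[OF m(3)] continuous_intros)
  have bm1: "(\<lambda>x. b x z) \<in> borel_measurable borel" for z
    using measurable_compose[OF _ bm, of "\<lambda>x. (x, z)" borel] by (simp add: borel_prod[symmetric])
  have cm1: "(\<lambda>x. c x y) \<in> borel_measurable borel" for y
    using measurable_compose[OF _ cm, of "\<lambda>x. (x, y)" borel] by (simp add: borel_prod[symmetric])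
  have hle: "h (vec3 ((y, z), x)) \<le> a (y, z) * (b x z * c x y)" for x y z
    by (rule ennreal_power2_le_imp_le) (use h[of y z x] in \<open>simp add: power_mult_distrib a_def b_def c_def mult_ac\<close>)
  define \<beta> where "\<beta> z = (\<integral>\<^sup>+x. (b x z)\<^sup>2 \<partial>lborel)" for z
  define \<gamma> where "\<gamma> y = (\<integral>\<^sup>+x. (c x y)\<^sup>2 \<partial>lborel)" for y
  define L where "L yz = (\<integral>\<^sup>+x. b x (snd yz) * c x (fst yz) \<partial>lborel)" for yz
  have "(\<lambda>(yz, x). b x (snd yz) * c x (fst yz)) \<in> borel_measurable borel"
  proof -
    have "(\<lambda>p::(real\<times>real)\<times>real. (\<lambda>(x,z). b x z) (snd p, snd (fst p)) * (\<lambda>(x,y). c x y) (snd p, fst (fst p))) \<in> borel_measurable borel"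
      by (intro borel_measurable_times_ennreal borel_measurable_compose_continuous[OF bm] borel_measurable_compose_continuous[OF cm] continuous_intros)
    then show ?thesis by (simp add: case_prod_beta')
  qed
  then have Lm: "L \<in> borel_measurable borel" unfolding L_def by (rule borel_measurable_nn_integral_lborel)
  have "(\<lambda>(z,x). (b x z)\<^sup>2) \<in> borel_measurable borel"
    using borel_measurable_power_ennreal[OF borel_measurable_compose_continuous[OF bm, of "\<lambda>p. (snd p, fst p)"], of 2]
    by (simp add: case_prod_beta' continuous_intros)
  then have \<beta>m: "\<beta> \<in> borel_measurable borel" unfolding \<beta>_def by (rule borel_measurable_nn_integral_lborel)
  have "(\<lambda>(z,x). (c x z)\<^sup>2) \<in> borel_measurable borel"
    using borel_measurable_power_ennreal[OF borel_measurable_compose_continuous[OF cm, of "\<lambda>p. (snd p, fst p)"], of 2]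
    by (simp add: case_prod_beta' continuous_intros)
  then have \<gamma>m: "\<gamma> \<in> borel_measurable borel" unfolding \<gamma>_def by (rule borel_measurable_nn_integral_lborel)
  have L2: "(L yz)\<^sup>2 \<le> \<beta> (snd yz) * \<gamma> (fst yz)" for yz
    unfolding L_def \<beta>_def \<gamma>_def by (rule Cauchy_Schwarz_nn_integral) (auto simp: bm1 cm1)
  have "(\<integral>\<^sup>+x. h x \<partial>lborel) \<le> (\<integral>\<^sup>+yz. a yz * L yz \<partial>lborel)"
    unfolding nn_integral_vec3(1)[OF m(4)] L_def
  proof (rule nn_integral_mono)
    fix yz :: "real \<times> real"
    have "(\<lambda>x. b x (snd yz) * c x (fst yz)) \<in> borel_measurable lborel" using bm1 cm1 by simp
    from nn_integral_cmult[OF this, of "a yz"]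
    show "(\<integral>\<^sup>+x. h (vec3 (yz, x)) \<partial>lborel) \<le> a yz * (\<integral>\<^sup>+x. b x (snd yz) * c x (fst yz) \<partial>lborel)"
      using hle[of "fst yz" "snd yz"] by (metis (no_types, lifting) nn_integral_mono prod.collapse)
  qed
  then have "(\<integral>\<^sup>+x. h x \<partial>lborel)\<^sup>2 \<le> (\<integral>\<^sup>+yz. a yz * L yz \<partial>lborel)\<^sup>2" by (rule power_mono) simp
  also have "\<dots> \<le> (\<integral>\<^sup>+yz. (a yz)\<^sup>2 \<partial>lborel) * (\<integral>\<^sup>+yz. (L yz)\<^sup>2 \<partial>lborel)"
    by (rule Cauchy_Schwarz_nn_integral) (auto simp: am Lm)
  also have "(\<integral>\<^sup>+yz. (a yz)\<^sup>2 \<partial>lborel) = (\<integral>\<^sup>+x. F1 x \<partial>lborel)"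
    unfolding nn_integral_vec3(1)[OF m(1)] a_def by simp
  also have "(\<integral>\<^sup>+yz. (L yz)\<^sup>2 \<partial>lborel) \<le> (\<integral>\<^sup>+yz. \<beta> (snd yz) * \<gamma> (fst yz) \<partial>lborel)"
    by (intro nn_integral_mono L2)
  also have "(\<integral>\<^sup>+yz. \<beta> (snd yz) * \<gamma> (fst yz) \<partial>lborel) = (\<integral>\<^sup>+y. \<integral>\<^sup>+z. \<beta> z * \<gamma> y \<partial>lborel \<partial>lborel)"
  proof -
    have "(\<lambda>yz. \<beta> (snd yz) * \<gamma> (fst yz)) \<in> borel_measurable (borel :: (real\<times>real) measure)"
      by (intro borel_measurable_times_ennreal borel_measurable_compose_continuous[OF \<beta>m] borel_measurable_compose_continuous[OF \<gamma>m] continuous_intros)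
    from lborel.nn_integral_fst[OF lborel_pair_measurable[OF this]] show ?thesis by (simp add: lborel_prod)
  qed
  also have "\<dots> = (\<integral>\<^sup>+z. \<beta> z \<partial>lborel) * (\<integral>\<^sup>+y. \<gamma> y \<partial>lborel)"
    using \<beta>m \<gamma>m by (simp add: nn_integral_multc nn_integral_cmult)
  also have "(\<integral>\<^sup>+z. \<beta> z \<partial>lborel) = (\<integral>\<^sup>+x. F2 x \<partial>lborel)"
  proof -
    have "(\<integral>\<^sup>+z. \<beta> z \<partial>lborel) = (\<integral>\<^sup>+z. \<integral>\<^sup>+x. \<integral>\<^sup>+s. F2 (vec3 ((s, z), x)) \<partial>lborel \<partial>lborel \<partial>lborel)"
      by (simp add: \<beta>_def b_def)
    also have "\<dots> = (\<integral>\<^sup>+z. \<integral>\<^sup>+s. \<integral>\<^sup>+x. F2 (vec3 ((s, z), x)) \<partial>lborel \<partial>lborel \<partial>lborel)"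
      by (intro nn_integral_cong nn_integral_swap)
         (auto simp: case_prod_beta' intro!: borel_measurable_compose_continuous[OF m(2)] continuous_intros)
    also have "\<dots> = (\<integral>\<^sup>+s. \<integral>\<^sup>+z. \<integral>\<^sup>+x. F2 (vec3 ((s, z), x)) \<partial>lborel \<partial>lborel \<partial>lborel)"
    proof (rule nn_integral_swap)
      have "(\<lambda>p. \<integral>\<^sup>+x. F2 (vec3 ((snd p, fst p), x)) \<partial>lborel) \<in> borel_measurable borel"
        by (rule borel_measurable_nn_integral_lborel)
           (auto simp: case_prod_beta' intro!: borel_measurable_compose_continuous[OF m(2)] continuous_intros)
      then show "(\<lambda>(z, s). \<integral>\<^sup>+x. F2 (vec3 ((s, z), x)) \<partial>lborel) \<in> borel_measurable borel"
        by (simp add: case_prod_beta')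
    qed
    finally show ?thesis by (simp add: nn_integral_vec3(2)[OF m(2)])
  qed
  also have "(\<integral>\<^sup>+y. \<gamma> y \<partial>lborel) = (\<integral>\<^sup>+x. F3 x \<partial>lborel)"
  proof -
    have "(\<integral>\<^sup>+z. \<gamma> z \<partial>lborel) = (\<integral>\<^sup>+y. \<integral>\<^sup>+x. \<integral>\<^sup>+s. F3 (vec3 ((y, s), x)) \<partial>lborel \<partial>lborel \<partial>lborel)"
      by (simp add: \<gamma>_def c_def)
    also have "\<dots> = (\<integral>\<^sup>+y. \<integral>\<^sup>+s. \<integral>\<^sup>+x. F3 (vec3 ((y, s), x)) \<partial>lborel \<partial>lborel \<partial>lborel)"
      by (intro nn_integral_cong nn_integral_swap)
         (auto simp: case_prod_beta' intro!: borel_measurable_compose_continuous[OF m(3)] continuous_intros)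
    finally show ?thesis by (simp add: nn_integral_vec3(2)[OF m(3)])
  qed
  finally show ?thesis by (simp add: mult.assoc mult_left_mono)
qed

text \<open>The fundamental theorem of calculus along the line, started at -R outside the support.
  The right-hand side is an extended integral because Loomis-Whitney takes it in this form.\<close>

lemma test_fun_line_bound:
  assumes "test_fun U \<psi>" "norm e = 1"
  shows "ennreal \<bar>\<psi> (y + t *\<^sub>R e)\<bar> \<le> (\<integral>\<^sup>+s. ennreal (norm (cgrad \<psi> (y + s *\<^sub>R e))) \<partial>lborel)"
proof -
  obtain K where K: "compact K" "\<And>x. x \<notin> K \<Longrightarrow> \<psi> x = 0" using test_funE[OF assms(1)] by metis
  obtain M where M: "\<And>x. x \<in> K \<Longrightarrow> norm x \<le> M" using compact_imp_bounded[OF K(1)] by (auto simp: bounded_iff)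
  define R where "R = \<bar>M\<bar> + norm y + 1"
  have out: "\<psi> (y + s *\<^sub>R e) = 0" if "\<bar>s\<bar> \<ge> R" for s
  proof -
    have "norm (y + s *\<^sub>R e) \<ge> \<bar>s\<bar> - norm y"
      using norm_triangle_ineq2[of "s *\<^sub>R e" "- y"] assms(2) by (simp add: add.commute)
    then show ?thesis using M[of "y + s *\<^sub>R e"] K(2) that unfolding R_def by force
  qed
  show ?thesis
  proof (cases "\<bar>t\<bar> \<ge> R")
    case True then show ?thesis using out by simp
  next
    case False
    define g where "g s = cgrad \<psi> (y + s *\<^sub>R e) \<bullet> e" for s
    have gc: "continuous_on S g" for S unfolding g_def
      by (intro continuous_intros continuous_on_compose2[OF test_fun_continuous_cgrad[OF assms(1)]]) auto
    have d: "((\<lambda>s. \<psi> (y + s *\<^sub>R e)) has_vector_derivative g s) (at s within S)" for s S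
    proof -
      have "((\<lambda>t. \<psi> (y + t *\<^sub>R e)) has_derivative (\<lambda>t. cgrad \<psi> (y + s *\<^sub>R e) \<bullet> (t *\<^sub>R e))) (at s within S)"
        by (rule has_derivative_compose[OF _ smooth_on_has_derivative[OF test_fun_smooth[OF assms(1)]]])
           (auto intro!: derivative_eq_intros)
      then show ?thesis by (simp add: has_vector_derivative_def g_def)
    qed
    have "-R \<le> t" using False by auto
    from has_bochner_integral_FTC_Icc[OF this d gc]
    have hb: "has_bochner_integral lborel (\<lambda>s. indicator {-R..t} s *\<^sub>R g s) (\<psi> (y + t *\<^sub>R e))"
      using out[of "-R"] M by (simp add: R_def)
    then have "ennreal \<bar>\<psi> (y + t *\<^sub>R e)\<bar> \<le> (\<integral>\<^sup>+s. norm (indicator {-R..t} s *\<^sub>R g s) \<partial>lborel)"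
      using integral_norm_bound_ennreal[of lborel "\<lambda>s. indicator {-R..t} s *\<^sub>R g s"] 
      by (simp add: has_bochner_integral_iff)
    also have "\<dots> \<le> (\<integral>\<^sup>+s. ennreal (norm (cgrad \<psi> (y + s *\<^sub>R e))) \<partial>lborel)"
    proof (intro nn_integral_mono ennreal_leI)
      fix s
      have "\<bar>g s\<bar> \<le> norm (cgrad \<psi> (y + s *\<^sub>R e))" unfolding g_def
        using Cauchy_Schwarz_ineq2[of "cgrad \<psi> (y + s *\<^sub>R e)" e] assms(2) by simp
      then show "norm (indicator {- R..t} s *\<^sub>R g s) \<le> norm (cgrad \<psi> (y + s *\<^sub>R e))"
        by (auto simp: indicator_def)
    qed
    finally show ?thesis .
  qed
qed

lemma nn_integral_lborel_eq_lebesgue_integral: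
  fixes h :: "R3 \<Rightarrow> real"
  assumes "integrable lebesgue h" "h \<in> borel_measurable borel" "\<And>x. h x \<ge> 0"
  shows "(\<integral>\<^sup>+x. ennreal (h x) \<partial>lborel) = ennreal (\<integral>x. h x \<partial>lebesgue)"
  using assms by (simp add: integral_completion integrable_completion nn_integral_eq_integral)

text \<open>The Gagliardo-Nirenberg argument for \<psi> = \<phi>^4. Let P be the integral of
  \<phi>^6 and G that of the squared gradient. The line bounds in the three directions multiply to
  (\<phi>^6)^2, so Loomis-Whitney gives P^2 <= D^3, where D is the integral of |grad \<psi>| = 4
  |\<phi>|^3 |grad \<phi>|. By Cauchy-Schwarz D^2 <= 16 P G, hence P^4 <= (16 P G)^3; cancelling P^3
  leaves the constant 16^3.\<close>

lemma Sobolev_test_fun: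
  assumes "test_fun U \<phi>"
  shows "(\<integral>x. (\<phi> x) ^ 6 \<partial>lebesgue) \<le> 4096 * (sqint (cgrad \<phi>)) ^ 3"
proof -
  obtain K where K: "compact K" "\<And>x. x \<notin> K \<Longrightarrow> \<phi> x = 0" "\<And>x. x \<notin> K \<Longrightarrow> cgrad \<phi> x = 0"
    using test_funE[OF assms] by metis
  note cont = test_fun_continuous[OF assms] test_fun_continuous_cgrad[OF assms]
  define \<psi> where "\<psi> x = (\<phi> x) ^ 4" for x
  have \<psi>: "test_fun U \<psi>" unfolding \<psi>_def by (intro test_fun_power assms) simp
  have g\<psi>: "cgrad \<psi> x = (4 * (\<phi> x) ^ 3) *\<^sub>R cgrad \<phi> x" for x
    unfolding \<psi>_def by (rule cgrad_compose[OF test_fun_smooth[OF assms]]) (auto intro!: derivative_eq_intros)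
  define F where "F x = ennreal (norm (cgrad \<psi> x))" for x
  define h where "h x = ennreal ((\<phi> x) ^ 6)" for x
  define P where "P = (\<integral>x. (\<phi> x) ^ 6 \<partial>lebesgue)"
  define G where "G = sqint (cgrad \<phi>)"
  have Fm: "F \<in> borel_measurable borel" unfolding F_def
    using borel_measurable_continuous_onI[OF test_fun_continuous_cgrad[OF \<psi>]] by measurable
  have hm: "h \<in> borel_measurable borel" unfolding h_def
    using borel_measurable_continuous_onI[OF cont(1)] by measurable
  have line: "ennreal \<bar>\<psi> (y + t *\<^sub>R axis i 1)\<bar> \<le> (\<integral>\<^sup>+s. F (y + s *\<^sub>R axis i 1) \<partial>lborel)" for y t i
    unfolding F_def by (rule test_fun_line_bound[OF \<psi>]) simp
  have "(\<integral>\<^sup>+x. h x \<partial>lborel)\<^sup>2 \<le> (\<integral>\<^sup>+x. F x \<partial>lborel) * (\<integral>\<^sup>+x. F x \<partial>lborel) * (\<integral>\<^sup>+x. F x \<partial>lborel)"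
  proof (rule Loomis_Whitney[OF Fm Fm Fm hm])
    fix x y z
    have "(h (vec3 ((y, z), x)))\<^sup>2 = ennreal \<bar>\<psi> (vec3 ((y, z), x))\<bar> * ennreal \<bar>\<psi> (vec3 ((y, z), x))\<bar> * ennreal \<bar>\<psi> (vec3 ((y, z), x))\<bar>"
      unfolding h_def \<psi>_def by (simp add: ennreal_power ennreal_mult[symmetric] power_mult[symmetric] flip: power_add)
    also have "\<dots> \<le> (\<integral>\<^sup>+s. F (vec3 ((y, z), s)) \<partial>lborel)
          * (\<integral>\<^sup>+s. F (vec3 ((s, z), x)) \<partial>lborel) * (\<integral>\<^sup>+s. F (vec3 ((y, s), x)) \<partial>lborel)"
      using line[of "vec3 ((y, z), 0)" x 1] line[of "vec3 ((0, z), x)" y 2] line[of "vec3 ((y, 0), x)" z 3]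
      by (intro mult_mono) (simp_all add: vec3_eq add_ac)
    finally show "(h (vec3 ((y, z), x)))\<^sup>2 \<le> (\<integral>\<^sup>+s. F (vec3 ((y, z), s)) \<partial>lborel)
          * (\<integral>\<^sup>+s. F (vec3 ((s, z), x)) \<partial>lborel) * (\<integral>\<^sup>+s. F (vec3 ((y, s), x)) \<partial>lborel)" .
  qed
  then have LW: "(\<integral>\<^sup>+x. h x \<partial>lborel)\<^sup>2 \<le> (\<integral>\<^sup>+x. F x \<partial>lborel) ^ 3" by (simp add: power3_eq_cube)
  have hP: "(\<integral>\<^sup>+x. h x \<partial>lborel) = ennreal P" unfolding h_def P_def
    by (intro nn_integral_lborel_eq_lebesgue_integral borel_measurable_continuous_onI
         integrable_lebesgue_continuous_compact[OF _ K(1)] continuous_intros cont) (use K in auto)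
  have gG: "(\<integral>\<^sup>+x. ennreal ((norm (cgrad \<phi> x))\<^sup>2) \<partial>lborel) = ennreal G" unfolding G_def
    by (intro nn_integral_lborel_eq_lebesgue_integral borel_measurable_continuous_onI
         integrable_lebesgue_continuous_compact[OF _ K(1)] continuous_intros cont) (use K in auto)
  have P0: "P \<ge> 0" unfolding P_def by (intro Bochner_Integration.integral_nonneg) simp
  have G0: "G \<ge> 0" unfolding G_def by (intro Bochner_Integration.integral_nonneg) simp
  have m1: "(\<lambda>x. ennreal (4 * \<bar>\<phi> x\<bar> ^ 3)) \<in> borel_measurable lborel"
    using borel_measurable_continuous_onI[OF cont(1)] by simp
  have m2: "(\<lambda>x. ennreal (norm (cgrad \<phi> x))) \<in> borel_measurable lborel"
    using borel_measurable_continuous_onI[OF cont(2)] by simp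
  have "(\<integral>\<^sup>+x. F x \<partial>lborel)\<^sup>2 = (\<integral>\<^sup>+x. ennreal (4 * \<bar>\<phi> x\<bar> ^ 3) * ennreal (norm (cgrad \<phi> x)) \<partial>lborel)\<^sup>2"
    by (simp add: F_def g\<psi> ennreal_mult abs_mult power_abs)
  also have "\<dots> \<le> (\<integral>\<^sup>+x. (ennreal (4 * \<bar>\<phi> x\<bar> ^ 3))\<^sup>2 \<partial>lborel) * (\<integral>\<^sup>+x. (ennreal (norm (cgrad \<phi> x)))\<^sup>2 \<partial>lborel)"
    by (rule Cauchy_Schwarz_nn_integral[OF m1 m2])
  also have "(\<integral>\<^sup>+x. (ennreal (4 * \<bar>\<phi> x\<bar> ^ 3))\<^sup>2 \<partial>lborel) = (\<integral>\<^sup>+x. ennreal 16 * h x \<partial>lborel)"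
  proof (intro nn_integral_cong)
    fix x
    have "(4 * \<bar>\<phi> x\<bar> ^ 3)\<^sup>2 = 16 * (\<phi> x) ^ 6"
      by (simp add: power_mult_distrib power_even_abs flip: power_mult)
    then show "(ennreal (4 * \<bar>\<phi> x\<bar> ^ 3))\<^sup>2 = ennreal 16 * h x"
      unfolding h_def by (subst ennreal_mult[symmetric]) (auto simp: ennreal_power)
  qed
  also have "\<dots> = ennreal (16 * P)"
    using hm P0 by (subst nn_integral_cmult) (simp_all add: hP ennreal_mult)
  also have "(\<integral>\<^sup>+x. (ennreal (norm (cgrad \<phi> x)))\<^sup>2 \<partial>lborel) = ennreal G"
    unfolding gG[symmetric] by (simp add: ennreal_power)
  finally have F2: "(\<integral>\<^sup>+x. F x \<partial>lborel)\<^sup>2 \<le> ennreal (16 * P * G)"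
    using P0 G0 by (simp add: ennreal_mult)
  have "ennreal (P ^ 4) = ((\<integral>\<^sup>+x. h x \<partial>lborel)\<^sup>2)\<^sup>2" using P0 by (simp add: hP ennreal_power flip: power_mult)
  also have "\<dots> \<le> ((\<integral>\<^sup>+x. F x \<partial>lborel) ^ 3)\<^sup>2" by (intro power_mono LW) simp
  also have "\<dots> = ((\<integral>\<^sup>+x. F x \<partial>lborel)\<^sup>2) ^ 3" by (simp flip: power_mult)
  also have "\<dots> \<le> ennreal (16 * P * G) ^ 3" by (intro power_mono F2) simp
  also have "\<dots> = ennreal ((16 * P * G) ^ 3)" using P0 G0 by (simp add: ennreal_power)
  finally have "P ^ 4 \<le> (16 * P * G) ^ 3" using P0 G0 by (subst (asm) ennreal_le_iff) auto
  then have "P ^ 3 * P \<le> P ^ 3 * (4096 * G ^ 3)" by (simp add: power_mult_distrib eval_nat_numeral mult_ac)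
  then have "P \<le> 4096 * G ^ 3"
    using P0 G0 by (cases "P = 0") (auto simp: mult_le_cancel_left)
  then show ?thesis by (simp add: P_def G_def)
qed

subsection \<open>The Poincare inequality on convex sets\<close>

text \<open>The Jacobian c^3 is at least 1/8. In \<open>Poincare_double\<close> the factor c is t or
  1 - t, and one of the two is always at least 1/2.\<close>

lemma nn_integral_affine_half:
  fixes g :: "R3 \<Rightarrow> ennreal"
  assumes [measurable]: "g \<in> borel_measurable borel" and c: "c \<ge> 1/2"
  shows "(\<integral>\<^sup>+y. g (a + c *\<^sub>R y) \<partial>lborel) \<le> 8 * (\<integral>\<^sup>+y. g y \<partial>lborel)"
proof -
  have c0: "c \<noteq> 0" using c by auto
  have "(\<integral>\<^sup>+y. g y \<partial>lborel) = (\<integral>\<^sup>+y. g y \<partial>density (distr lborel borel (\<lambda>x. a + c *\<^sub>R x)) (\<lambda>_. \<bar>c\<bar>^DIM(R3)))"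
    using lborel_affine[OF c0, of a] by simp
  also have "\<dots> = ennreal (c ^ 3) * (\<integral>\<^sup>+y. g (a + c *\<^sub>R y) \<partial>lborel)"
    using c by (subst nn_integral_density) (auto simp: nn_integral_distr nn_integral_cmult)
  finally have e: "(\<integral>\<^sup>+y. g y \<partial>lborel) = ennreal (c ^ 3) * (\<integral>\<^sup>+y. g (a + c *\<^sub>R y) \<partial>lborel)" .
  have "(1/2) ^ 3 \<le> c ^ 3" using c by (intro power_mono) auto
  then have "ennreal 1 \<le> ennreal (8 * c ^ 3)" by (intro ennreal_leI) (simp add: power3_eq_cube)
  then have "1 \<le> 8 * ennreal (c ^ 3)" by (simp add: ennreal_mult')
  then have "1 * (\<integral>\<^sup>+y. g (a + c *\<^sub>R y) \<partial>lborel) \<le> (8 * ennreal (c ^ 3)) * (\<integral>\<^sup>+y. g (a + c *\<^sub>R y) \<partial>lborel)"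
    by (intro mult_right_mono) auto
  then show ?thesis by (simp add: e mult.assoc)
qed

lemma segment_bound:
  fixes w :: "R3 \<Rightarrow> real"
  assumes w: "smooth_on UNIV w" and d: "dist x y \<le> d"
  shows "ennreal ((w x - w y)\<^sup>2) \<le> ennreal (d\<^sup>2) * (\<integral>\<^sup>+t. indicator {0..1} t * ennreal ((norm (cgrad w (y + t *\<^sub>R (x - y))))\<^sup>2) \<partial>lborel)"
proof -
  note gc = smooth_on_continuous_cgrad[OF w]
  define n where "n t = norm (cgrad w (y + t *\<^sub>R (x - y)))" for t
  define g where "g t = cgrad w (y + t *\<^sub>R (x - y)) \<bullet> (x - y)" for t
  have cg: "continuous_on S g" for S unfolding g_def
    by (intro continuous_intros continuous_on_compose2[OF gc]) auto
  have cn: "continuous_on UNIV n" unfolding n_def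
    by (intro continuous_intros continuous_on_compose2[OF gc]) auto
  have nm [measurable]: "n \<in> borel_measurable borel" using cn by (rule borel_measurable_continuous_onI)
  have d0: "d \<ge> 0" using d zero_le_dist order_trans by blast
  have dv: "((\<lambda>s. w (y + s *\<^sub>R (x - y))) has_vector_derivative g s) (at s within S)" for s S
  proof -
    have "((\<lambda>t. w (y + t *\<^sub>R (x - y))) has_derivative (\<lambda>t. cgrad w (y + s *\<^sub>R (x - y)) \<bullet> (t *\<^sub>R (x - y)))) (at s within S)"
      by (rule has_derivative_compose[OF _ smooth_on_has_derivative[OF w]]) (auto intro!: derivative_eq_intros)
    then show ?thesis by (simp add: has_vector_derivative_def g_def)
  qed
  have "has_bochner_integral lborel (\<lambda>s. indicator {0..1} s *\<^sub>R g s) (w (y + 1 *\<^sub>R (x - y)) - w (y + 0 *\<^sub>R (x - y)))"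
    by (rule has_bochner_integral_FTC_Icc[OF _ dv cg]) simp
  then have "ennreal \<bar>w x - w y\<bar> \<le> (\<integral>\<^sup>+s. norm (indicator {0..1} s *\<^sub>R g s) \<partial>lborel)"
    using integral_norm_bound_ennreal[of lborel "\<lambda>s. indicator {0..1} s *\<^sub>R g s"]
    by (simp add: has_bochner_integral_iff)
  \<comment> \<open>The indicator is written twice: one copy plays the constant function on [0, 1]
    in the Cauchy-Schwarz inequality below, the other cuts off \<open>n\<close>.\<close>
  also have "\<dots> \<le> (\<integral>\<^sup>+s. ennreal d * (indicator {0..1} s * (indicator {0..1} s * ennreal (n s))) \<partial>lborel)"
  proof (intro nn_integral_mono)
    fix s
    have "\<bar>g s\<bar> \<le> n s * norm (x - y)" unfolding g_def n_def by (rule Cauchy_Schwarz_ineq2)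
    also have "\<dots> \<le> n s * d" using d by (intro mult_left_mono) (auto simp: dist_norm n_def)
    finally have "\<bar>g s\<bar> \<le> d * n s" by (simp add: mult.commute)
    then show "ennreal (norm (indicator {0..1} s *\<^sub>R g s)) \<le> ennreal d * (indicator {0..1} s * (indicator {0..1} s * ennreal (n s)))"
      using d0 by (auto simp: indicator_def ennreal_mult''[symmetric] n_def intro!: ennreal_leI)
  qed
  also have "\<dots> = ennreal d * (\<integral>\<^sup>+s. indicator {0..1} s * (indicator {0..1} s * ennreal (n s)) \<partial>lborel)"
    by (rule nn_integral_cmult) measurable
  finally have "(ennreal \<bar>w x - w y\<bar>)\<^sup>2 \<le> (ennreal d * (\<integral>\<^sup>+s. indicator {0..1} s * (indicator {0..1} s * ennreal (n s)) \<partial>lborel))\<^sup>2"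
    by (rule power_mono) simp
  also have "\<dots> = ennreal (d\<^sup>2) * (\<integral>\<^sup>+s. indicator {0..1} s * (indicator {0..1} s * ennreal (n s)) \<partial>lborel)\<^sup>2"
    using d0 by (simp add: power_mult_distrib ennreal_power)
  also have "\<dots> \<le> ennreal (d\<^sup>2) * ((\<integral>\<^sup>+s. (indicator {0..1::real} s)\<^sup>2 \<partial>lborel) * (\<integral>\<^sup>+s. (indicator {0..1} s * ennreal (n s))\<^sup>2 \<partial>lborel))"
    by (intro mult_left_mono Cauchy_Schwarz_nn_integral[where f="indicator {0..1}" and g="\<lambda>s. indicator {0..1} s * ennreal (n s)"]) auto
  also have "(\<integral>\<^sup>+s. (indicator {0..1::real} s :: ennreal)\<^sup>2 \<partial>lborel) = (\<integral>\<^sup>+s. indicator {0..1::real} s \<partial>lborel)"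
    by (intro nn_integral_cong) (auto simp: indicator_def)
  also have "(\<integral>\<^sup>+s. (indicator {0..1::real} s :: ennreal) \<partial>lborel) = 1" by simp
  also have "(\<integral>\<^sup>+s. (indicator {0..1} s * ennreal (n s))\<^sup>2 \<partial>lborel) = (\<integral>\<^sup>+s. indicator {0..1} s * ennreal ((n s)\<^sup>2) \<partial>lborel)"
    by (intro nn_integral_cong) (auto simp: indicator_def ennreal_power n_def)
  finally show ?thesis by (simp add: ennreal_power n_def)
qed

text \<open>The difference is bounded by the gradient along the segment from y to x, which convexity
  keeps inside B. After the parameter t has been moved outside, the point y + t (x - y) is
  substituted for the endpoint that it follows with factor at least 1/2: for y if t <= 1/2, for x
  otherwise. In this way both Jacobians are harmless and no singular kernel arises.\<close>

lemma Poincare_double: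
  fixes w :: "R3 \<Rightarrow> real" and B :: "R3 set"
  assumes w: "smooth_on UNIV w" and B: "convex B" "B \<in> sets borel" "\<And>x y. x \<in> B \<Longrightarrow> y \<in> B \<Longrightarrow> dist x y \<le> d"
  shows "(\<integral>\<^sup>+x. \<integral>\<^sup>+y. indicator B x * (indicator B y * ennreal ((w x - w y)\<^sup>2)) \<partial>lborel \<partial>lborel)
     \<le> ennreal (8 * d\<^sup>2) * emeasure lborel B * (\<integral>\<^sup>+x. indicator B x * ennreal ((norm (cgrad w x))\<^sup>2) \<partial>lborel)"
proof -
  define g where "g x = indicator B x * ennreal ((norm (cgrad w x))\<^sup>2)" for x
  have cw: "cgrad w \<in> borel_measurable borel"
    by (rule borel_measurable_continuous_onI[OF smooth_on_continuous_cgrad[OF w]])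
  have gm: "g \<in> borel_measurable borel" unfolding g_def using cw B(2) by measurable
  define I where "I = (\<integral>\<^sup>+x. g x \<partial>lborel)"
  define L where "L t = (\<integral>\<^sup>+x. \<integral>\<^sup>+y. indicator B x * (indicator B y * (indicator {0..1} t * g (y + t *\<^sub>R (x - y)))) \<partial>lborel \<partial>lborel)" for t :: real
  \<comment> \<open>Measurability in all three variables at once; the sections needed for moving t
    to the outermost integral follow by composition with continuous maps.\<close>
  have jm: "(\<lambda>p. indicator B (fst p) * (indicator B (fst (snd p)) * (indicator {0..1} (snd (snd p)) * g (fst (snd p) + snd (snd p) *\<^sub>R (fst p - fst (snd p))))))
        \<in> borel_measurable (borel :: (R3 \<times> R3 \<times> real) measure)"
  proof (intro borel_measurable_times_ennreal)
    show "(\<lambda>p. indicator B (fst p) :: ennreal) \<in> borel_measurable (borel :: (R3 \<times> R3 \<times> real) measure)"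
      by (rule borel_measurable_compose_continuous[of "indicator B" "\<lambda>p. fst p"]) (auto intro!: continuous_intros B(2) borel_measurable_indicator)
    show "(\<lambda>p. indicator B (fst (snd p)) :: ennreal) \<in> borel_measurable (borel :: (R3 \<times> R3 \<times> real) measure)"
      by (rule borel_measurable_compose_continuous[of "indicator B" "\<lambda>p. fst (snd p)"]) (auto intro!: continuous_intros B(2) borel_measurable_indicator)
    show "(\<lambda>p. indicator {0..1} (snd (snd p)) :: ennreal) \<in> borel_measurable (borel :: (R3 \<times> R3 \<times> real) measure)"
      by (rule borel_measurable_compose_continuous[of "indicator {0..1}" "\<lambda>p. snd (snd p)"]) (auto intro!: continuous_intros borel_measurable_indicator)
    show "(\<lambda>p. g (fst (snd p) + snd (snd p) *\<^sub>R (fst p - fst (snd p)))) \<in> borel_measurable (borel :: (R3 \<times> R3 \<times> real) measure)"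
      by (rule borel_measurable_compose_continuous[OF gm]) (auto intro!: continuous_intros)
  qed
  have Lb: "L t \<le> indicator {0..1} t * (8 * emeasure lborel B * I)" for t
  proof (cases "t \<in> {0..1}")
    case False then show ?thesis by (simp add: L_def)
  next
    case t: True
    have sm: "(\<lambda>p. indicator B (fst p) * (indicator B (snd p) * g (snd p + t *\<^sub>R (fst p - snd p)))) \<in> borel_measurable (borel :: (R3 \<times> R3) measure)"
    proof (intro borel_measurable_times_ennreal)
      show "(\<lambda>p. indicator B (fst p) :: ennreal) \<in> borel_measurable (borel :: (R3 \<times> R3) measure)"
        by (rule borel_measurable_compose_continuous[of "indicator B" "\<lambda>p. fst p"]) (auto intro!: continuous_intros B(2) borel_measurable_indicator)
      show "(\<lambda>p. indicator B (snd p) :: ennreal) \<in> borel_measurable (borel :: (R3 \<times> R3) measure)"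
        by (rule borel_measurable_compose_continuous[of "indicator B" "\<lambda>p. snd p"]) (auto intro!: continuous_intros B(2) borel_measurable_indicator)
      show "(\<lambda>p. g (snd p + t *\<^sub>R (fst p - snd p))) \<in> borel_measurable (borel :: (R3 \<times> R3) measure)"
        by (rule borel_measurable_compose_continuous[OF gm]) (auto intro!: continuous_intros)
    qed
    have "(\<integral>\<^sup>+x. \<integral>\<^sup>+y. indicator B x * (indicator B y * g (y + t *\<^sub>R (x - y))) \<partial>lborel \<partial>lborel) \<le> 8 * emeasure lborel B * I"
    proof (cases "t \<le> 1/2")
      case True
      have "(\<integral>\<^sup>+x. \<integral>\<^sup>+y. indicator B x * (indicator B y * g (y + t *\<^sub>R (x - y))) \<partial>lborel \<partial>lborel)
         \<le> (\<integral>\<^sup>+x. (8 * I) * indicator B x \<partial>lborel)"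
      proof (rule nn_integral_mono)
        fix x
        have "(\<integral>\<^sup>+y. indicator B x * (indicator B y * g (y + t *\<^sub>R (x - y))) \<partial>lborel)
           \<le> (\<integral>\<^sup>+y. indicator B x * g (t *\<^sub>R x + (1 - t) *\<^sub>R y) \<partial>lborel)"
          by (intro nn_integral_mono) (auto simp: indicator_def algebra_simps)
        also have "\<dots> = indicator B x * (\<integral>\<^sup>+y. g (t *\<^sub>R x + (1 - t) *\<^sub>R y) \<partial>lborel)"
          by (rule nn_integral_cmult) (auto intro!: borel_measurable_compose_continuous[OF gm] continuous_intros)
        also have "\<dots> \<le> indicator B x * (8 * I)" unfolding I_def
          using True by (intro mult_left_mono nn_integral_affine_half gm) auto
        finally show "(\<integral>\<^sup>+y. indicator B x * (indicator B y * g (y + t *\<^sub>R (x - y))) \<partial>lborel) \<le> 8 * I * indicator B x"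
          by (simp add: mult.commute)
      qed
      also have "\<dots> = 8 * emeasure lborel B * I" using B(2) by (subst nn_integral_cmult_indicator) (auto simp: mult_ac)
      finally show ?thesis .
    next
      case False
      have "(\<integral>\<^sup>+x. \<integral>\<^sup>+y. indicator B x * (indicator B y * g (y + t *\<^sub>R (x - y))) \<partial>lborel \<partial>lborel)
         = (\<integral>\<^sup>+y. \<integral>\<^sup>+x. indicator B x * (indicator B y * g (y + t *\<^sub>R (x - y))) \<partial>lborel \<partial>lborel)"
        by (rule nn_integral_swap) (use sm in \<open>simp add: case_prod_beta'\<close>)
      also have "\<dots> \<le> (\<integral>\<^sup>+y. (8 * I) * indicator B y \<partial>lborel)"
      proof (rule nn_integral_mono)
        fix y
        have "(\<integral>\<^sup>+x. indicator B x * (indicator B y * g (y + t *\<^sub>R (x - y))) \<partial>lborel)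
           \<le> (\<integral>\<^sup>+x. indicator B y * g ((1 - t) *\<^sub>R y + t *\<^sub>R x) \<partial>lborel)"
          by (intro nn_integral_mono) (auto simp: indicator_def algebra_simps)
        also have "\<dots> = indicator B y * (\<integral>\<^sup>+x. g ((1 - t) *\<^sub>R y + t *\<^sub>R x) \<partial>lborel)"
          by (rule nn_integral_cmult) (auto intro!: borel_measurable_compose_continuous[OF gm] continuous_intros)
        also have "\<dots> \<le> indicator B y * (8 * I)" unfolding I_def
          using False by (intro mult_left_mono nn_integral_affine_half gm) auto
        finally show "(\<integral>\<^sup>+x. indicator B x * (indicator B y * g (y + t *\<^sub>R (x - y))) \<partial>lborel) \<le> 8 * I * indicator B y"
          by (simp add: mult.commute)
      qed
      also have "\<dots> = 8 * emeasure lborel B * I" using B(2) by (subst nn_integral_cmult_indicator) (auto simp: mult_ac)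
      finally show ?thesis .
    qed
    then show ?thesis using t by (simp add: L_def)
  qed
  have "(\<integral>\<^sup>+x. \<integral>\<^sup>+y. indicator B x * (indicator B y * ennreal ((w x - w y)\<^sup>2)) \<partial>lborel \<partial>lborel)
    \<le> (\<integral>\<^sup>+x. \<integral>\<^sup>+y. ennreal (d\<^sup>2) * (\<integral>\<^sup>+t. indicator B x * (indicator B y * (indicator {0..1} t * g (y + t *\<^sub>R (x - y)))) \<partial>lborel) \<partial>lborel \<partial>lborel)"
  proof (intro nn_integral_mono)
    fix x y
    show "indicator B x * (indicator B y * ennreal ((w x - w y)\<^sup>2))
      \<le> ennreal (d\<^sup>2) * (\<integral>\<^sup>+t. indicator B x * (indicator B y * (indicator {0..1} t * g (y + t *\<^sub>R (x - y)))) \<partial>lborel)"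
    proof (cases "x \<in> B \<and> y \<in> B")
      case True
      have "y + t *\<^sub>R (x - y) \<in> B" if "t \<in> {0..1}" for t
        using convexD[OF B(1), of y x "1 - t" t] True that by (simp add: algebra_simps)
      then have "(\<integral>\<^sup>+t. indicator {0..1} t * ennreal ((norm (cgrad w (y + t *\<^sub>R (x - y))))\<^sup>2) \<partial>lborel)
         = (\<integral>\<^sup>+t. indicator B x * (indicator B y * (indicator {0..1} t * g (y + t *\<^sub>R (x - y)))) \<partial>lborel)"
        using True by (intro nn_integral_cong) (auto simp: g_def indicator_def)
      then show ?thesis using segment_bound[OF w B(3), of x y] True by simp
    qed auto
  qed
  also have "\<dots> = ennreal (d\<^sup>2) * (\<integral>\<^sup>+x. \<integral>\<^sup>+y. \<integral>\<^sup>+t. indicator B x * (indicator B y * (indicator {0..1} t * g (y + t *\<^sub>R (x - y)))) \<partial>lborel \<partial>lborel \<partial>lborel)"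
  proof -
    have 1: "(\<lambda>p. \<integral>\<^sup>+t. indicator B (fst p) * (indicator B (snd p) * (indicator {0..1} t * g (snd p + t *\<^sub>R (fst p - snd p)))) \<partial>lborel) \<in> borel_measurable (borel :: (R3 \<times> R3) measure)"
      by (rule borel_measurable_nn_integral_lborel)
         (use borel_measurable_compose_continuous[OF jm, of "\<lambda>p. (fst (fst p), snd (fst p), snd p)"] in \<open>simp add: case_prod_beta' continuous_intros\<close>)
    have 2: "(\<lambda>y. \<integral>\<^sup>+t. indicator B x * (indicator B y * (indicator {0..1} t * g (y + t *\<^sub>R (x - y)))) \<partial>lborel) \<in> borel_measurable borel" for x
      using borel_measurable_compose_continuous[OF 1, of "\<lambda>y. (x, y)"] by (simp add: continuous_intros)
    have 3: "(\<lambda>x. \<integral>\<^sup>+y. \<integral>\<^sup>+t. indicator B x * (indicator B y * (indicator {0..1} t * g (y + t *\<^sub>R (x - y)))) \<partial>lborel \<partial>lborel) \<in> borel_measurable borel"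
      by (rule borel_measurable_nn_integral_lborel) (use 1 in \<open>simp add: case_prod_beta'\<close>)
    show ?thesis using 2 3 by (simp add: nn_integral_cmult)
  qed
  also have "(\<integral>\<^sup>+x. \<integral>\<^sup>+y. \<integral>\<^sup>+t. indicator B x * (indicator B y * (indicator {0..1} t * g (y + t *\<^sub>R (x - y)))) \<partial>lborel \<partial>lborel \<partial>lborel)
      = (\<integral>\<^sup>+x. \<integral>\<^sup>+t. \<integral>\<^sup>+y. indicator B x * (indicator B y * (indicator {0..1} t * g (y + t *\<^sub>R (x - y)))) \<partial>lborel \<partial>lborel \<partial>lborel)"
  proof (intro nn_integral_cong nn_integral_swap)
    fix x
    show "(\<lambda>(y, t). indicator B x * (indicator B y * (indicator {0..1} t * g (y + t *\<^sub>R (x - y))))) \<in> borel_measurable borel"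
      using borel_measurable_compose_continuous[OF jm, of "\<lambda>p. (x, fst p, snd p)"] by (simp add: case_prod_beta' continuous_intros)
  qed
  also have "\<dots> = (\<integral>\<^sup>+t. L t \<partial>lborel)" unfolding L_def
  proof (rule nn_integral_swap)
    have "(\<lambda>p. \<integral>\<^sup>+y. indicator B (fst p) * (indicator B y * (indicator {0..1} (snd p) * g (y + snd p *\<^sub>R (fst p - y)))) \<partial>lborel) \<in> borel_measurable (borel :: (R3 \<times> real) measure)"
      by (rule borel_measurable_nn_integral_lborel)
         (use borel_measurable_compose_continuous[OF jm, of "\<lambda>p. (fst (fst p), snd p, snd (fst p))"] in \<open>simp add: case_prod_beta' continuous_intros\<close>)
    then show "(\<lambda>(x, t). \<integral>\<^sup>+y. indicator B x * (indicator B y * (indicator {0..1} t * g (y + t *\<^sub>R (x - y)))) \<partial>lborel) \<in> borel_measurable borel"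
      by (simp add: case_prod_beta')
  qed
  also have "ennreal (d\<^sup>2) * (\<integral>\<^sup>+t. L t \<partial>lborel) \<le> ennreal (d\<^sup>2) * (\<integral>\<^sup>+t. (8 * emeasure lborel B * I) * indicator {0..1::real} t \<partial>lborel)"
  proof -
    have "(\<integral>\<^sup>+t. L t \<partial>lborel) \<le> (\<integral>\<^sup>+t. (8 * emeasure lborel B * I) * indicator {0..1::real} t \<partial>lborel)"
      by (rule nn_integral_mono) (metis Lb mult.commute)
    then show ?thesis by (rule mult_left_mono) simp
  qed
  also have "\<dots> = ennreal (d\<^sup>2) * (8 * emeasure lborel B * I)"
    by (simp add: nn_integral_cmult_indicator)
  also have "\<dots> = ennreal (8 * d\<^sup>2) * emeasure lborel B * I"
    by (simp add: ennreal_mult mult_ac)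
  finally show ?thesis by (simp add: I_def g_def)
qed

text \<open>Expanding the square, the double integral of (w(x) - w(y))^2 over B times B is 2 (|B| I2
  - I1^2), with I1 and I2 the integrals of w and w^2 over B. Keeping |B| as a factor instead of
  dividing by it leaves the inequality valid for null sets as well.\<close>

lemma Poincare_variance:
  fixes w :: "R3 \<Rightarrow> real" and B :: "R3 set"
  assumes w: "test_fun U w" and B: "convex B" "B \<in> sets borel" "bounded B" "\<And>x y. x \<in> B \<Longrightarrow> y \<in> B \<Longrightarrow> dist x y \<le> d"
  shows "measure lebesgue B * (\<integral>x. indicator B x * (w x)\<^sup>2 \<partial>lebesgue)
     \<le> (\<integral>x. indicator B x * w x \<partial>lebesgue)\<^sup>2 + 4 * d\<^sup>2 * measure lebesgue B * (\<integral>x. indicator B x * (norm (cgrad w x))\<^sup>2 \<partial>lebesgue)"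
proof -
  obtain K where K: "compact K" "\<And>x. x \<notin> K \<Longrightarrow> w x = 0" "\<And>x. x \<notin> K \<Longrightarrow> cgrad w x = 0"
    using test_funE[OF w] by metis
  note cont = test_fun_continuous[OF w] test_fun_continuous_cgrad[OF w]
  have wm [measurable]: "w \<in> borel_measurable borel" by (rule borel_measurable_continuous_onI[OF cont(1)])
  have cm [measurable]: "cgrad w \<in> borel_measurable borel" by (rule borel_measurable_continuous_onI[OF cont(2)])
  note [measurable] = B(2)
  have lb: "(\<integral>x. F x \<partial>lebesgue) = (\<integral>x. F x \<partial>lborel)" if "F \<in> borel_measurable borel" for F :: "R3 \<Rightarrow> real"
    using that by (simp add: integral_completion)
  have fin: "emeasure lborel B < \<infinity>" using B(3) by (rule emeasure_bounded_finite)
  have ib: "integrable lborel (indicator B :: R3 \<Rightarrow> real)" using fin B(2) by (intro integrable_real_indicator) auto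
  have int: "integrable lborel (\<lambda>x. indicator B x * h x)" if h: "continuous_on UNIV h" "\<And>x. x \<notin> K \<Longrightarrow> h x = 0" for h :: "R3 \<Rightarrow> real"
  proof -
    have "integrable lborel h" using integrable_lebesgue_continuous_compact[OF h(1) K(1) h(2)] borel_measurable_continuous_onI[OF h(1)]
      by (simp add: integrable_completion)
    then show ?thesis using integrable_mult_indicator[of B lborel h] B(2) by simp
  qed
  define m where "m = measure lborel B"
  have em: "emeasure lborel B = ennreal m" unfolding m_def using fin by (simp add: emeasure_eq_ennreal_measure less_top)
  have m0: "m \<ge> 0" by (simp add: m_def)
  define I1 where "I1 = (\<integral>x. indicator B x * w x \<partial>lborel)"
  define I2 where "I2 = (\<integral>x. indicator B x * (w x)\<^sup>2 \<partial>lborel)"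
  define D where "D = (\<integral>x. indicator B x * (norm (cgrad w x))\<^sup>2 \<partial>lborel)"
  have i1: "integrable lborel (\<lambda>x. indicator B x * w x)" using int[OF cont(1)] K by auto
  have i2: "integrable lborel (\<lambda>x. indicator B x * (w x)\<^sup>2)" by (rule int) (use K in \<open>auto intro!: continuous_intros cont\<close>)
  have i3: "integrable lborel (\<lambda>x. indicator B x * (norm (cgrad w x))\<^sup>2)" by (rule int) (use K in \<open>auto intro!: continuous_intros cont\<close>)
  have D0: "D \<ge> 0" unfolding D_def by (intro Bochner_Integration.integral_nonneg) auto
  have inner: "(\<integral>\<^sup>+y. indicator B x * (indicator B y * ennreal ((w x - w y)\<^sup>2)) \<partial>lborel)
      = ennreal (indicator B x * (m * (w x)\<^sup>2 - 2 * w x * I1 + I2))" 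
    and pos: "indicator B x * (m * (w x)\<^sup>2 - 2 * w x * I1 + I2) \<ge> 0" for x
  proof -
    have hb: "has_bochner_integral lborel (\<lambda>y. indicator B y * (w x - w y)\<^sup>2) (m * (w x)\<^sup>2 - 2 * w x * I1 + I2)"
    proof -
      have "has_bochner_integral lborel (\<lambda>y. (w x)\<^sup>2 * indicator B y - 2 * w x * (indicator B y * w y) + indicator B y * (w y)\<^sup>2)
          ((w x)\<^sup>2 * m - 2 * w x * I1 + I2)"
        unfolding I1_def I2_def m_def using i1 i2 ib B(2)
        by (intro has_bochner_integral_add has_bochner_integral_diff has_bochner_integral_mult_right)
           (auto simp: has_bochner_integral_iff)
      then show ?thesis by (simp add: power2_eq_square algebra_simps)
    qed
    then have i: "integrable lborel (\<lambda>y. indicator B x * (indicator B y * (w x - w y)\<^sup>2))"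
      and e: "(\<integral>y. indicator B x * (indicator B y * (w x - w y)\<^sup>2) \<partial>lborel) = indicator B x * (m * (w x)\<^sup>2 - 2 * w x * I1 + I2)"
      by (auto simp: has_bochner_integral_iff)
    show "indicator B x * (m * (w x)\<^sup>2 - 2 * w x * I1 + I2) \<ge> 0"
      unfolding e[symmetric] by (intro Bochner_Integration.integral_nonneg) auto
    show "(\<integral>\<^sup>+y. indicator B x * (indicator B y * ennreal ((w x - w y)\<^sup>2)) \<partial>lborel)
      = ennreal (indicator B x * (m * (w x)\<^sup>2 - 2 * w x * I1 + I2))"
      unfolding e[symmetric] by (subst nn_integral_eq_integral[OF i, symmetric]) (auto intro!: nn_integral_cong simp: indicator_def)
  qed
  have "(\<integral>\<^sup>+x. \<integral>\<^sup>+y. indicator B x * (indicator B y * ennreal ((w x - w y)\<^sup>2)) \<partial>lborel \<partial>lborel) = ennreal (2 * (m * I2 - I1\<^sup>2))"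
  proof -
    have "has_bochner_integral lborel (\<lambda>x. m * (indicator B x * (w x)\<^sup>2) - 2 * I1 * (indicator B x * w x) + I2 * indicator B x)
        (m * I2 - 2 * I1 * I1 + I2 * m)"
      unfolding I2_def I1_def m_def using i1 i2 ib B(2)
      by (intro has_bochner_integral_add has_bochner_integral_diff has_bochner_integral_mult_right)
         (auto simp: has_bochner_integral_iff)
    then have "has_bochner_integral lborel (\<lambda>x. indicator B x * (m * (w x)\<^sup>2 - 2 * w x * I1 + I2)) (2 * (m * I2 - I1\<^sup>2))"
      by (simp add: power2_eq_square algebra_simps)
    then show ?thesis unfolding inner using pos
      by (subst nn_integral_eq_integral) (auto simp: has_bochner_integral_iff)
  qed
  moreover have "(\<integral>\<^sup>+x. indicator B x * ennreal ((norm (cgrad w x))\<^sup>2) \<partial>lborel) = ennreal D"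
    unfolding D_def by (subst nn_integral_eq_integral[OF i3, symmetric]) (auto intro!: nn_integral_cong simp: indicator_def)
  ultimately have "ennreal (2 * (m * I2 - I1\<^sup>2)) \<le> ennreal (8 * d\<^sup>2 * m * D)"
    using Poincare_double[OF test_fun_smooth[OF w] B(1,2,4)] m0 D0 by (simp add: em ennreal_mult)
  then have "2 * (m * I2 - I1\<^sup>2) \<le> 8 * d\<^sup>2 * m * D"
    using m0 D0 by (subst (asm) ennreal_le_iff) auto
  moreover have "measure lebesgue B = m" unfolding m_def by (simp add: measure_completion)
  ultimately show ?thesis
    unfolding I1_def I2_def D_def by (subst (1 2 3) lb) auto
qed

subsection \<open>Square-integrable functions\<close>

definition sqi :: "(R3 \<Rightarrow> 'b::euclidean_space) \<Rightarrow> bool" where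
  "sqi F \<longleftrightarrow> F \<in> borel_measurable lebesgue \<and> integrable lebesgue (\<lambda>x. (norm (F x))\<^sup>2)"

definition L2to :: "(nat \<Rightarrow> R3 \<Rightarrow> 'b::euclidean_space) \<Rightarrow> (R3 \<Rightarrow> 'b) \<Rightarrow> bool" where
  "L2to X F \<longleftrightarrow> (\<forall>n. sqi (X n)) \<and> sqi F \<and> (\<lambda>n. \<integral>x. (norm (X n x - F x))\<^sup>2 \<partial>lebesgue) \<longlonglongrightarrow> 0"

lemma integrable_real_bound:
  fixes f g :: "'a \<Rightarrow> real"
  assumes "integrable M g" "f \<in> borel_measurable M" "AE x in M. \<bar>f x\<bar> \<le> g x"
  shows "integrable M f"
  by (rule Bochner_Integration.integrable_bound[OF assms(1,2)]) (use assms(3) in \<open>auto elim!: eventually_mono\<close>)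

lemma sqi_measurable: "sqi F \<Longrightarrow> F \<in> borel_measurable lebesgue"
  and sqi_integrable: "sqi F \<Longrightarrow> integrable lebesgue (\<lambda>x. (norm (F x))\<^sup>2)"
  by (auto simp: sqi_def)

lemma norm_add_square_le: "(norm (a + b))\<^sup>2 \<le> 2 * (norm a)\<^sup>2 + 2 * (norm (b::'b::real_inner))\<^sup>2"
proof -
  have "(norm (a + b))\<^sup>2 \<le> (norm a + norm b)\<^sup>2" by (rule power_mono[OF norm_triangle_ineq norm_ge_zero])
  also have "\<dots> \<le> 2 * (norm a)\<^sup>2 + 2 * (norm b)\<^sup>2"
    using sum_squares_bound[of "norm a" "norm b"] by (simp add: power2_sum)
  finally show ?thesis .
qed

lemma sqi_add: "sqi F \<Longrightarrow> sqi H \<Longrightarrow> sqi (\<lambda>x. F x + H x)"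
  unfolding sqi_def
proof (intro conjI, goal_cases)
  case 2
  then show ?case
    by (intro integrable_real_bound[of lebesgue "\<lambda>x. 2 * (norm (F x))\<^sup>2 + 2 * (norm (H x))\<^sup>2" "\<lambda>x. (norm (F x + H x))\<^sup>2"])
       (auto simp: norm_add_square_le)
qed auto

lemma sqi_scaleR: "sqi F \<Longrightarrow> sqi (\<lambda>x. c *\<^sub>R F x)"
  unfolding sqi_def by (auto simp: power_mult_distrib)

lemma sqi_diff: "sqi F \<Longrightarrow> sqi H \<Longrightarrow> sqi (\<lambda>x. F x - H x)"
  using sqi_add[of F "\<lambda>x. (-1) *\<^sub>R H x"] sqi_scaleR[of H "-1"] by simp

lemma sqi_bounded_mult:
  assumes "sqi F" "m \<in> borel_measurable lebesgue" "AE x in lebesgue. \<bar>m x\<bar> \<le> C"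
  shows "sqi (\<lambda>x. m x *\<^sub>R F x)"
  unfolding sqi_def
proof
  show "(\<lambda>x. m x *\<^sub>R F x) \<in> borel_measurable lebesgue" using assms by (auto simp: sqi_def)
  show "integrable lebesgue (\<lambda>x. (norm (m x *\<^sub>R F x))\<^sup>2)"
  proof (rule integrable_real_bound[of lebesgue "\<lambda>x. C\<^sup>2 * (norm (F x))\<^sup>2"])
    show "AE x in lebesgue. \<bar>(norm (m x *\<^sub>R F x))\<^sup>2\<bar> \<le> C\<^sup>2 * (norm (F x))\<^sup>2"
      using assms(3) by eventually_elim (auto simp: power_mult_distrib intro!: mult_right_mono power2_le_iff_abs_le[THEN iffD2])
  qed (use assms in \<open>auto simp: sqi_def\<close>)
qed

lemma sqi_inner: "sqi F \<Longrightarrow> sqi H \<Longrightarrow> integrable lebesgue (\<lambda>x. F x \<bullet> H x)"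
proof (rule integrable_real_bound[of lebesgue "\<lambda>x. (norm (F x))\<^sup>2 + (norm (H x))\<^sup>2"])
  have "\<bar>a \<bullet> b\<bar> \<le> (norm a)\<^sup>2 + (norm b)\<^sup>2" for a b :: 'a
    using Cauchy_Schwarz_ineq2[of a b] sum_squares_bound[of "norm a" "norm b"] norm_ge_zero[of a] norm_ge_zero[of b]
      mult_nonneg_nonneg[OF norm_ge_zero[of a] norm_ge_zero[of b]] by linarith
  then show "AE x in lebesgue. \<bar>F x \<bullet> H x\<bar> \<le> (norm (F x))\<^sup>2 + (norm (H x))\<^sup>2" by simp
qed (auto simp: sqi_def)

lemma sqi_mult: "sqi F \<Longrightarrow> sqi H \<Longrightarrow> integrable lebesgue (\<lambda>x. F x * H x :: real)"
  using sqi_inner[of F H] by simp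

text \<open>Besides Cauchy-Schwarz it serves in \<open>quadratic_stationary\<close>, where
  \<open>A \<le> 0\<close> and therefore B must vanish.\<close>

lemma quadratic_nonneg_discriminant:
  fixes A B C :: real
  assumes "\<And>t. 0 \<le> A - 2 * t * B + t\<^sup>2 * C" "C \<ge> 0"
  shows "B\<^sup>2 \<le> A * C"
proof (cases "C = 0")
  case True
  have "B = 0"
  proof (rule ccontr)
    assume "B \<noteq> 0"
    then show False using assms(1)[of "(A + 1) / (2 * B)"] True by simp
  qed
  then show ?thesis using True by simp
next
  case False
  then have "C > 0" using assms(2) by simp
  moreover have "0 \<le> A - B\<^sup>2 / C" using assms(1)[of "B / C"] False by (simp add: power2_eq_square)
  ultimately show ?thesis by (simp add: divide_simps)
qed

lemma sqi_Cauchy_Schwarz: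
  assumes "sqi F" "sqi H"
  shows "(\<integral>x. F x \<bullet> H x \<partial>lebesgue)\<^sup>2 \<le> sqint F * sqint H"
proof (rule quadratic_nonneg_discriminant)
  fix t :: real
  have "0 \<le> (\<integral>x. (norm (F x - t *\<^sub>R H x))\<^sup>2 \<partial>lebesgue)" by simp
  also have "\<dots> = (\<integral>x. (norm (F x))\<^sup>2 - 2 * t * (F x \<bullet> H x) + t\<^sup>2 * (norm (H x))\<^sup>2 \<partial>lebesgue)"
    by (intro Bochner_Integration.integral_cong)
       (auto simp: power2_norm_eq_inner inner_diff_left inner_diff_right inner_commute power2_eq_square[of t] algebra_simps)
  also have "\<dots> = sqint F - 2 * t * (\<integral>x. F x \<bullet> H x \<partial>lebesgue) + t\<^sup>2 * sqint H"
    using sqi_inner[OF assms] assms[THEN sqi_integrable] by simp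
  finally show "0 \<le> \<dots>" .
qed simp

lemma tendsto_zero_square:
  fixes s r :: "nat \<Rightarrow> real"
  assumes "\<And>n. (s n)\<^sup>2 \<le> r n" "r \<longlonglongrightarrow> 0"
  shows "s \<longlonglongrightarrow> 0"
proof -
  have "(\<lambda>n. (s n)\<^sup>2) \<longlonglongrightarrow> 0"
    by (rule tendsto_sandwich[OF _ _ tendsto_const assms(2)]) (use assms(1) in auto)
  then have "(\<lambda>n. sqrt ((s n)\<^sup>2)) \<longlonglongrightarrow> sqrt 0" by (rule tendsto_real_sqrt)
  then show ?thesis by (simp add: tendsto_rabs_zero_iff)
qed

lemma tendsto_zero_le:
  fixes s r :: "nat \<Rightarrow> real"
  assumes "\<And>n. 0 \<le> s n" "\<And>n. s n \<le> r n" "r \<longlonglongrightarrow> 0"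
  shows "s \<longlonglongrightarrow> 0"
  by (rule tendsto_sandwich[OF _ _ tendsto_const assms(3)]) (use assms(1,2) in auto)

lemma L2to_const: "sqi F \<Longrightarrow> L2to (\<lambda>n. F) F"
  by (simp add: L2to_def)

lemma L2to_sqi: "L2to X F \<Longrightarrow> sqi (X n)" "L2to X F \<Longrightarrow> sqi F"
  by (auto simp: L2to_def)

lemma L2to_lim: "L2to X F \<Longrightarrow> (\<lambda>n. \<integral>x. (norm (X n x - F x))\<^sup>2 \<partial>lebesgue) \<longlonglongrightarrow> 0"
  by (auto simp: L2to_def)

lemma L2to_add:
  assumes "L2to X F" "L2to Y H"
  shows "L2to (\<lambda>n x. X n x + Y n x) (\<lambda>x. F x + H x)"
  unfolding L2to_def
proof (intro conjI allI)
  note s = L2to_sqi[OF assms(1)] L2to_sqi[OF assms(2)]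
  show "sqi (\<lambda>x. X n x + Y n x)" "sqi (\<lambda>x. F x + H x)" for n using s by (auto intro: sqi_add)
  have "(\<lambda>n. 2 * (\<integral>x. (norm (X n x - F x))\<^sup>2 \<partial>lebesgue) + 2 * (\<integral>x. (norm (Y n x - H x))\<^sup>2 \<partial>lebesgue)) \<longlonglongrightarrow> 2 * 0 + 2 * 0"
    by (intro tendsto_intros L2to_lim assms)
  moreover have "(\<integral>x. (norm (X n x + Y n x - (F x + H x)))\<^sup>2 \<partial>lebesgue)
     \<le> 2 * (\<integral>x. (norm (X n x - F x))\<^sup>2 \<partial>lebesgue) + 2 * (\<integral>x. (norm (Y n x - H x))\<^sup>2 \<partial>lebesgue)" for n
  proof -
    have i: "integrable lebesgue (\<lambda>x. (norm (X n x - F x))\<^sup>2)" "integrable lebesgue (\<lambda>x. (norm (Y n x - H x))\<^sup>2)"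
      using s by (auto intro!: sqi_integrable sqi_diff)
    have "(\<integral>x. (norm (X n x + Y n x - (F x + H x)))\<^sup>2 \<partial>lebesgue)
      \<le> (\<integral>x. 2 * (norm (X n x - F x))\<^sup>2 + 2 * (norm (Y n x - H x))\<^sup>2 \<partial>lebesgue)"
    proof (rule integral_mono)
      show "integrable lebesgue (\<lambda>x. (norm (X n x + Y n x - (F x + H x)))\<^sup>2)"
        using s by (auto intro!: sqi_integrable sqi_diff sqi_add)
      show "(norm (X n x + Y n x - (F x + H x)))\<^sup>2 \<le> 2 * (norm (X n x - F x))\<^sup>2 + 2 * (norm (Y n x - H x))\<^sup>2" for x
        using norm_add_square_le[of "X n x - F x" "Y n x - H x"] by (simp add: algebra_simps)
    qed (use i in auto)
    then show ?thesis using i by simp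
  qed
  ultimately show "(\<lambda>n. \<integral>x. (norm (X n x + Y n x - (F x + H x)))\<^sup>2 \<partial>lebesgue) \<longlonglongrightarrow> 0"
    by (intro tendsto_zero_le[of "\<lambda>n. \<integral>x. (norm (X n x + Y n x - (F x + H x)))\<^sup>2 \<partial>lebesgue"]) auto
qed

text \<open>Split m_n X_n - m' F into m_n (X_n - F) and (m_n - m') F: the first part is small by the
  uniform bound on the multipliers, the second by dominated convergence. This is the device by which
  factors such as 1 / (u + \<delta>) pass to the limit.\<close>

lemma L2to_mult:
  assumes X: "L2to X F" and m: "\<And>n. m n \<in> borel_measurable lebesgue" "\<And>n x. \<bar>m n x\<bar> \<le> C"
    and m': "m' \<in> borel_measurable lebesgue" "AE x in lebesgue. (\<lambda>n. m n x) \<longlonglongrightarrow> m' x"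
  shows "L2to (\<lambda>n x. m n x *\<^sub>R X n x) (\<lambda>x. m' x *\<^sub>R F x)"
  unfolding L2to_def
proof (intro conjI allI)
  note s = L2to_sqi[OF X] and meas = m(1) m'(1) sqi_measurable[OF L2to_sqi(1)[OF X]] sqi_measurable[OF L2to_sqi(2)[OF X]]
  have C0: "C \<ge> 0" using m(2)[of 0 0] by linarith
  have m'b: "AE x in lebesgue. \<bar>m' x\<bar> \<le> C"
    using m'(2)
  proof eventually_elim
    case (elim x)
    have "(\<lambda>n. \<bar>m n x\<bar>) \<longlonglongrightarrow> \<bar>m' x\<bar>" using elim by (rule tendsto_rabs)
    then show ?case using m(2) by (intro LIMSEQ_le_const2) auto
  qed
  show s1: "sqi (\<lambda>x. m n x *\<^sub>R X n x)" for n using s m by (intro sqi_bounded_mult[of _ _ C]) auto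
  show s2: "sqi (\<lambda>x. m' x *\<^sub>R F x)" using s m'(1) m'b by (intro sqi_bounded_mult) auto
  have i1: "integrable lebesgue (\<lambda>x. (norm (X n x - F x))\<^sup>2)" for n using s by (auto intro!: sqi_integrable sqi_diff)
  have b: "AE x in lebesgue. norm ((m n x - m' x)\<^sup>2 * (norm (F x))\<^sup>2) \<le> (2 * C)\<^sup>2 * (norm (F x))\<^sup>2" for n
    using m'b
  proof eventually_elim
    case (elim x)
    have "\<bar>m n x - m' x\<bar> \<le> 2 * C" using elim m(2)[of n x] by linarith
    then have "(m n x - m' x)\<^sup>2 \<le> (2 * C)\<^sup>2" using C0 by (intro power2_le_iff_abs_le[THEN iffD2]) auto
    from mult_right_mono[OF this, of "(norm (F x))\<^sup>2"] show ?case by (simp add: abs_mult)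
  qed
  have i2: "integrable lebesgue (\<lambda>x. (m n x - m' x)\<^sup>2 * (norm (F x))\<^sup>2)" for n
    by (rule integrable_real_bound[of _ "\<lambda>x. (2 * C)\<^sup>2 * (norm (F x))\<^sup>2"])
       (use b[of n] s meas in \<open>auto simp: sqi_integrable\<close>)
  have "(\<lambda>n. \<integral>x. (m n x - m' x)\<^sup>2 * (norm (F x))\<^sup>2 \<partial>lebesgue) \<longlonglongrightarrow> (\<integral>x. 0 \<partial>(lebesgue :: R3 measure))"
  proof (rule integral_dominated_convergence[where w="\<lambda>x. (2 * C)\<^sup>2 * (norm (F x))\<^sup>2"])
    show "AE x in lebesgue. (\<lambda>n. (m n x - m' x)\<^sup>2 * (norm (F x))\<^sup>2) \<longlonglongrightarrow> 0"
      using m'(2)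
    proof eventually_elim
      case (elim x)
      have "(\<lambda>n. (m n x - m' x)\<^sup>2 * (norm (F x))\<^sup>2) \<longlonglongrightarrow> (m' x - m' x)\<^sup>2 * (norm (F x))\<^sup>2"
        by (intro tendsto_intros elim)
      then show ?case by simp
    qed
  qed (use b s meas in \<open>auto simp: sqi_integrable\<close>)
  then have "(\<lambda>n. 2 * (C\<^sup>2 * (\<integral>x. (norm (X n x - F x))\<^sup>2 \<partial>lebesgue)) + 2 * (\<integral>x. (m n x - m' x)\<^sup>2 * (norm (F x))\<^sup>2 \<partial>lebesgue)) \<longlonglongrightarrow> 2 * (C\<^sup>2 * 0) + 2 * 0"
    by (intro tendsto_intros L2to_lim[OF X]) simp
  moreover have "(\<integral>x. (norm (m n x *\<^sub>R X n x - m' x *\<^sub>R F x))\<^sup>2 \<partial>lebesgue)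
     \<le> 2 * (C\<^sup>2 * (\<integral>x. (norm (X n x - F x))\<^sup>2 \<partial>lebesgue)) + 2 * (\<integral>x. (m n x - m' x)\<^sup>2 * (norm (F x))\<^sup>2 \<partial>lebesgue)" for n
  proof -
    have "(\<integral>x. (norm (m n x *\<^sub>R X n x - m' x *\<^sub>R F x))\<^sup>2 \<partial>lebesgue)
      \<le> (\<integral>x. 2 * (C\<^sup>2 * (norm (X n x - F x))\<^sup>2) + 2 * ((m n x - m' x)\<^sup>2 * (norm (F x))\<^sup>2) \<partial>lebesgue)"
    proof (rule integral_mono)
      show "integrable lebesgue (\<lambda>x. (norm (m n x *\<^sub>R X n x - m' x *\<^sub>R F x))\<^sup>2)"
        using s1[of n] s2 by (intro sqi_integrable sqi_diff)
      fix x
      have "(norm (m n x *\<^sub>R (X n x - F x) + (m n x - m' x) *\<^sub>R F x))\<^sup>2 \<le> 2 * (norm (m n x *\<^sub>R (X n x - F x)))\<^sup>2 + 2 * (norm ((m n x - m' x) *\<^sub>R F x))\<^sup>2"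
        by (rule norm_add_square_le)
      also have "\<dots> = 2 * ((m n x)\<^sup>2 * (norm (X n x - F x))\<^sup>2) + 2 * ((m n x - m' x)\<^sup>2 * (norm (F x))\<^sup>2)"
        by (simp add: power_mult_distrib)
      also have "\<dots> \<le> 2 * (C\<^sup>2 * (norm (X n x - F x))\<^sup>2) + 2 * ((m n x - m' x)\<^sup>2 * (norm (F x))\<^sup>2)"
        using m(2)[of n x] C0 by (auto intro!: mult_right_mono power2_le_iff_abs_le[THEN iffD2])
      finally show "(norm (m n x *\<^sub>R X n x - m' x *\<^sub>R F x))\<^sup>2 \<le> 2 * (C\<^sup>2 * (norm (X n x - F x))\<^sup>2) + 2 * ((m n x - m' x)\<^sup>2 * (norm (F x))\<^sup>2)"
        by (simp add: algebra_simps)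
    qed (use i1 i2 in auto)
    then show ?thesis using i1[of n] i2[of n] by simp
  qed
  ultimately show "(\<lambda>n. \<integral>x. (norm (m n x *\<^sub>R X n x - m' x *\<^sub>R F x))\<^sup>2 \<partial>lebesgue) \<longlonglongrightarrow> 0"
    by (intro tendsto_zero_le[of "\<lambda>n. \<integral>x. (norm (m n x *\<^sub>R X n x - m' x *\<^sub>R F x))\<^sup>2 \<partial>lebesgue"]) auto
qed

lemma L2to_scaleR: "L2to X F \<Longrightarrow> L2to (\<lambda>n x. c *\<^sub>R X n x) (\<lambda>x. c *\<^sub>R F x)"
  by (rule L2to_mult[where C="\<bar>c\<bar>" and m="\<lambda>n x. c" and m'="\<lambda>x. c"]) auto

lemma L2to_inner:
  assumes "L2to X F" "L2to Y H"
  shows "(\<lambda>n. \<integral>x. X n x \<bullet> Y n x \<partial>lebesgue) \<longlonglongrightarrow> (\<integral>x. F x \<bullet> H x \<partial>lebesgue)"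
proof -
  note s = L2to_sqi[OF assms(1)] L2to_sqi[OF assms(2)]
  have a: "(\<lambda>n. \<integral>x. (X n x - F x) \<bullet> (Y n x - H x) \<partial>lebesgue) \<longlonglongrightarrow> 0"
    by (rule tendsto_zero_square[OF sqi_Cauchy_Schwarz])
       (use s tendsto_mult[OF L2to_lim[OF assms(1)] L2to_lim[OF assms(2)]] in \<open>auto intro: sqi_diff\<close>)
  have b: "(\<lambda>n. \<integral>x. (X n x - F x) \<bullet> H x \<partial>lebesgue) \<longlonglongrightarrow> 0"
    by (rule tendsto_zero_square[OF sqi_Cauchy_Schwarz])
       (use s tendsto_mult[OF L2to_lim[OF assms(1)] tendsto_const[of "sqint H"]] in \<open>auto intro: sqi_diff\<close>)
  have c: "(\<lambda>n. \<integral>x. F x \<bullet> (Y n x - H x) \<partial>lebesgue) \<longlonglongrightarrow> 0"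
    by (rule tendsto_zero_square[OF sqi_Cauchy_Schwarz])
       (use s tendsto_mult[OF tendsto_const[of "sqint F"] L2to_lim[OF assms(2)]] in \<open>auto intro: sqi_diff\<close>)
  have "(\<integral>x. X n x \<bullet> Y n x \<partial>lebesgue) = (\<integral>x. (X n x - F x) \<bullet> (Y n x - H x) \<partial>lebesgue)
     + (\<integral>x. (X n x - F x) \<bullet> H x \<partial>lebesgue) + (\<integral>x. F x \<bullet> (Y n x - H x) \<partial>lebesgue) + (\<integral>x. F x \<bullet> H x \<partial>lebesgue)" for n
  proof -
    have i: "integrable lebesgue (\<lambda>x. (X n x - F x) \<bullet> (Y n x - H x))" "integrable lebesgue (\<lambda>x. (X n x - F x) \<bullet> H x)"
      "integrable lebesgue (\<lambda>x. F x \<bullet> (Y n x - H x))" "integrable lebesgue (\<lambda>x. F x \<bullet> H x)"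
      using s by (auto intro!: sqi_inner sqi_diff)
    have "(\<integral>x. X n x \<bullet> Y n x \<partial>lebesgue) = (\<integral>x. (X n x - F x) \<bullet> (Y n x - H x) + (X n x - F x) \<bullet> H x + F x \<bullet> (Y n x - H x) + F x \<bullet> H x \<partial>lebesgue)"
      by (intro Bochner_Integration.integral_cong) (auto simp: inner_diff_left inner_diff_right)
    then show ?thesis using i by simp
  qed
  then show ?thesis using tendsto_add[OF tendsto_add[OF tendsto_add[OF a b] c] tendsto_const[of "\<integral>x. F x \<bullet> H x \<partial>lebesgue"]] by simp
qed

lemma L2to_norm:
  assumes "L2to X F"
  shows "(\<lambda>n. sqint (X n)) \<longlonglongrightarrow> sqint F"
  using L2to_inner[OF assms assms] by (simp add: power2_norm_eq_inner)

lemma L2to_subseq: "L2to X F \<Longrightarrow> strict_mono r \<Longrightarrow> L2to (\<lambda>n. X (r n)) F"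
  unfolding L2to_def using LIMSEQ_subseq_LIMSEQ[of "\<lambda>n. \<integral>x. (norm (X n x - F x))\<^sup>2 \<partial>lebesgue" 0 r]
  by (auto simp: o_def)

lemma L2to_AE_subseq:
  assumes "L2to X F"
  obtains r where "strict_mono r" "AE x in lebesgue. (\<lambda>n. X (r n) x) \<longlonglongrightarrow> F x"
proof -
  have "integrable lebesgue (\<lambda>x. (norm (X n x - F x))\<^sup>2)" for n
    using L2to_sqi[OF assms] by (auto intro!: sqi_integrable sqi_diff)
  then obtain r where r: "strict_mono r" "AE x in lebesgue. (\<lambda>n. (norm (X (r n) x - F x))\<^sup>2) \<longlonglongrightarrow> 0"
    using tendsto_L1_AE_subseq[of lebesgue "\<lambda>n x. (norm (X n x - F x))\<^sup>2"] L2to_lim[OF assms] by auto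
  have "AE x in lebesgue. (\<lambda>n. X (r n) x) \<longlonglongrightarrow> F x"
    using r(2)
  proof eventually_elim
    case (elim x)
    have "(\<lambda>n. norm (X (r n) x - F x)) \<longlonglongrightarrow> 0" by (rule tendsto_zero_square[OF _ elim]) simp
    then show ?case by (simp add: tendsto_norm_zero_iff LIM_zero_iff)
  qed
  then show ?thesis using r that by blast
qed

section \<open>Limits of integrals and completeness of \<open>L2\<close>\<close>

lemma Fatou_bound:
  fixes h :: "'a \<Rightarrow> real"
  assumes i: "\<And>k. integrable M (g k)" and pos: "\<And>k x. g k x \<ge> 0" and h: "h \<in> borel_measurable M"
    and lim: "AE x in M. (\<lambda>k. g k x) \<longlonglongrightarrow> h x" and b: "\<And>k. integral\<^sup>L M (g k) \<le> B"
  shows "integrable M h" "integral\<^sup>L M h \<le> B"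
proof -
  have B0: "0 \<le> B" using b[of 0] Bochner_Integration.integral_nonneg[of M "g 0"] pos by (meson order_trans)
  have h0: "AE x in M. h x \<ge> 0"
    using lim by eventually_elim (use pos in \<open>auto intro: LIMSEQ_le_const\<close>)
  have "(\<integral>\<^sup>+x. ennreal (h x) \<partial>M) = (\<integral>\<^sup>+x. liminf (\<lambda>k. ennreal (g k x)) \<partial>M)"
    by (intro nn_integral_cong_AE) (use lim in \<open>auto elim!: eventually_mono intro!: lim_imp_Liminf[symmetric] tendsto_ennrealI\<close>)
  also have "\<dots> \<le> liminf (\<lambda>k. \<integral>\<^sup>+x. ennreal (g k x) \<partial>M)"
    using i by (intro nn_integral_liminf) auto
  also have "\<dots> \<le> liminf (\<lambda>k. ennreal B)"
    using i pos b by (intro Liminf_mono always_eventually allI) (simp add: nn_integral_eq_integral ennreal_leI)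
  also have "\<dots> = ennreal B" by (simp add: Liminf_const)
  finally have le: "(\<integral>\<^sup>+x. ennreal (h x) \<partial>M) \<le> ennreal B" .
  show "integrable M h"
    by (rule integrableI_nonneg[OF h h0]) (use le in \<open>auto intro: le_less_trans\<close>)
  then show "integral\<^sup>L M h \<le> B"
    using le h0 B0 by (simp add: nn_integral_eq_integral)
qed

lemma strict_mono_choice:
  assumes "\<And>k. \<exists>N. \<forall>n\<ge>N. P k n"
  obtains r :: "nat \<Rightarrow> nat" where "strict_mono r" "\<And>k. P k (r k)"
proof -
  obtain N where N: "\<And>k n. n \<ge> N k \<Longrightarrow> P k n" using assms by metis
  define r where "r = rec_nat (N 0) (\<lambda>k m. max (N (Suc k)) (Suc m))"
  have "strict_mono r" unfolding strict_mono_Suc_iff by (auto simp: r_def less_max_iff_disj)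
  moreover have "P k (r k)" for k by (rule N, cases k) (auto simp: r_def)
  ultimately show ?thesis using that by blast
qed

text \<open>Along a subsequence whose squared distances fall below 4^-k the increments are summable
  almost everywhere, which provides a pointwise limit; Fatou's lemma then bounds the distance of the
  original sequence from it.\<close>

lemma L2_complete:
  fixes X :: "nat \<Rightarrow> R3 \<Rightarrow> 'b::euclidean_space"
  assumes s: "\<And>n. sqi (X n)"
    and C: "\<And>e. e > 0 \<Longrightarrow> \<exists>N. \<forall>m\<ge>N. \<forall>n\<ge>N. (\<integral>x. (norm (X m x - X n x))\<^sup>2 \<partial>lebesgue) < e"
  obtains F where "L2to X F"
proof -
  have id: "integrable lebesgue (\<lambda>x. (norm (X m x - X n x))\<^sup>2)" for m n using s by (auto intro!: sqi_integrable sqi_diff)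
  have "\<exists>N. \<forall>n\<ge>N. \<forall>m\<ge>n. (\<integral>x. (norm (X m x - X n x))\<^sup>2 \<partial>lebesgue) < (1/4)^k" for k
  proof -
    obtain N where "\<forall>m\<ge>N. \<forall>n\<ge>N. (\<integral>x. (norm (X m x - X n x))\<^sup>2 \<partial>lebesgue) < (1/4)^k"
      using C[of "(1/4)^k"] by auto
    then show ?thesis by (intro exI[of _ N]) auto
  qed
  note ex = this
  obtain r where r: "strict_mono r" "\<And>k m. m \<ge> r k \<Longrightarrow> (\<integral>x. (norm (X m x - X (r k) x))\<^sup>2 \<partial>lebesgue) < (1/4)^k"
    by (rule strict_mono_choice[of "\<lambda>k n. \<forall>m\<ge>n. (\<integral>x. (norm (X m x - X n x))\<^sup>2 \<partial>lebesgue) < (1/4)^k", OF ex]) blast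
  \<comment> \<open>With the factor 2^k the integrals are still at most 2^-k, and d <= 2^-k + 2^k
    d^2 holds for every d >= 0. So summability of these weighted squares gives summability of the
    increments themselves.\<close>
  define D where "D k x = 2 ^ k * (norm (X (r (Suc k)) x - X (r k) x))\<^sup>2" for k x
  have Di: "integrable lebesgue (D k)" for k unfolding D_def using id by simp
  have D0: "D k x \<ge> 0" for k x by (simp add: D_def)
  have Db: "(\<integral>\<^sup>+x. ennreal (D k x) \<partial>lebesgue) \<le> ennreal ((1/2)^k)" for k
  proof -
    have "(\<integral>x. D k x \<partial>lebesgue) \<le> 2 ^ k * (1/4)^k" unfolding D_def
      using r(2)[of k "r (Suc k)"] strict_mono_less_eq[OF r(1), of k "Suc k"] id by simp
    also have "\<dots> = (2 * (1/4))^k" by (rule power_mult_distrib[symmetric])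
    also have "\<dots> = (1/2)^k" by simp
    finally show ?thesis using Di D0 by (simp add: nn_integral_eq_integral ennreal_leI)
  qed
  have "(\<integral>\<^sup>+x. (\<Sum>k. ennreal (D k x)) \<partial>lebesgue) = (\<Sum>k. \<integral>\<^sup>+x. ennreal (D k x) \<partial>lebesgue)"
    using Di by (intro nn_integral_suminf) auto
  also have "\<dots> \<le> (\<Sum>k. ennreal ((1/2)^k))" by (intro suminf_le Db) auto
  also have "\<dots> = ennreal (\<Sum>k. (1/2)^k)" by (intro suminf_ennreal2) (auto intro: summable_geometric)
  finally have fin: "(\<integral>\<^sup>+x. (\<Sum>k. ennreal (D k x)) \<partial>lebesgue) \<noteq> \<infinity>"
    using ennreal_less_top le_less_trans by (metis infinity_ennreal_def less_irrefl)
  have "AE x in lebesgue. (\<Sum>k. ennreal (D k x)) \<noteq> \<infinity>"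
    by (rule nn_integral_noteq_infinite[OF _ fin]) (use Di in auto)
  then have conv: "AE x in lebesgue. convergent (\<lambda>k. X (r k) x)"
  proof eventually_elim
    case (elim x)
    have sm: "summable (\<lambda>k. D k x)" using elim D0 by (intro summable_suminf_not_top) auto
    have "summable (\<lambda>k. norm (X (r (Suc k)) x - X (r k) x))"
    proof (rule summable_comparison_test'[of "\<lambda>k. (1/2)^k + D k x" 0])
      show "summable (\<lambda>k. (1/2)^k + D k x)" using sm by (intro summable_add) (auto intro: summable_geometric)
      fix k
      define d where "d = norm (X (r (Suc k)) x - X (r k) x)"
      have "d \<le> (1/2)^k + 2 ^ k * d\<^sup>2"
      proof (cases "d \<le> (1/2)^k")
        case True then show ?thesis by (auto intro: order_trans)
      next
        case False
        then have "1 \<le> 2 ^ k * d" by (simp add: power_divide field_simps)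
        then have "d * 1 \<le> d * (2 ^ k * d)" by (intro mult_left_mono) (auto simp: d_def)
        then show ?thesis by (simp add: power2_eq_square mult_ac add_increasing)
      qed
      then show "norm (norm (X (r (Suc k)) x - X (r k) x)) \<le> (1/2)^k + D k x" by (simp add: D_def d_def)
    qed
    then have "summable (\<lambda>k. X (r (Suc k)) x - X (r k) x)" by (rule summable_norm_cancel)
    then have "convergent (\<lambda>n. \<Sum>k<n. X (r (Suc k)) x - X (r k) x)" by (simp add: summable_iff_convergent)
    moreover have "(\<Sum>k<n. X (r (Suc k)) x - X (r k) x) = X (r n) x - X (r 0) x" for n
      using sum_lessThan_telescope[of "\<lambda>k. X (r k) x" n] by simp
    ultimately have "convergent (\<lambda>n. X (r n) x - X (r 0) x)" by simp
    from convergent_add[OF this convergent_const[of "X (r 0) x"]] show ?case by simp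
  qed
  define F where "F x = lim (\<lambda>k. X (r k) x)" for x
  have Fm: "F \<in> borel_measurable lebesgue" unfolding F_def
    using s by (intro borel_measurable_lim_metric) (auto simp: sqi_def)
  have Fl: "AE x in lebesgue. (\<lambda>k. X (r k) x) \<longlonglongrightarrow> F x"
    using conv by eventually_elim (simp add: F_def convergent_LIMSEQ_iff)
  have key: "integrable lebesgue (\<lambda>x. (norm (X n x - F x))\<^sup>2) \<and> (\<integral>x. (norm (X n x - F x))\<^sup>2 \<partial>lebesgue) \<le> e"
    if N: "\<forall>m\<ge>N. \<forall>n\<ge>N. (\<integral>x. (norm (X m x - X n x))\<^sup>2 \<partial>lebesgue) < e" "n \<ge> N" for n N e
  proof -
    have rk: "r (k + N) \<ge> N" for k using strict_mono_imp_increasing[OF r(1), of "k + N"] by linarith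
    have lim: "AE x in lebesgue. (\<lambda>k. (norm (X n x - X (r (k + N)) x))\<^sup>2) \<longlonglongrightarrow> (norm (X n x - F x))\<^sup>2"
      using Fl by eventually_elim (auto intro!: tendsto_intros LIMSEQ_ignore_initial_segment)
    have "(\<integral>x. (norm (X n x - X (r (k + N)) x))\<^sup>2 \<partial>lebesgue) \<le> e" for k using N rk[of k] by (auto intro: less_imp_le)
    note le = this
    have m: "(\<lambda>x. (norm (X n x - F x))\<^sup>2) \<in> borel_measurable lebesgue" 
      using Fm sqi_measurable[OF s[of n]] by measurable
    show ?thesis by (intro conjI Fatou_bound[OF id _ m lim le]) auto
  qed
  obtain N1 where N1: "\<forall>m\<ge>N1. \<forall>n\<ge>N1. (\<integral>x. (norm (X m x - X n x))\<^sup>2 \<partial>lebesgue) < 1" using C[of 1] by auto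
  have "sqi (\<lambda>x. X N1 x - F x)" using key[OF N1, of N1] sqi_measurable[OF s[of N1]] Fm by (simp add: sqi_def borel_measurable_diff)
  from sqi_diff[OF s this, of N1] have "sqi F" by simp
  moreover have "(\<lambda>n. \<integral>x. (norm (X n x - F x))\<^sup>2 \<partial>lebesgue) \<longlonglongrightarrow> 0"
  proof (rule LIMSEQ_I)
    fix e :: real assume "e > 0"
    then obtain N where "\<forall>m\<ge>N. \<forall>n\<ge>N. (\<integral>x. (norm (X m x - X n x))\<^sup>2 \<partial>lebesgue) < e / 2" using C[of "e/2"] by auto
    from key[OF this] show "\<exists>N. \<forall>n\<ge>N. norm ((\<integral>x. (norm (X n x - F x))\<^sup>2 \<partial>lebesgue) - 0) < e"
      using \<open>e > 0\<close> by (intro exI[of _ N]) force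
  qed
  ultimately show ?thesis using s that by (auto simp: L2to_def)
qed

text \<open>A substitute for weak compactness: near-minimisers of the norm in a decreasing sequence of
  midpoint-convex sets form a Cauchy sequence, by the parallelogram law.\<close>
lemma convex_minimisers_Cauchy:
  fixes C :: "nat \<Rightarrow> (R3 \<Rightarrow> 'b::euclidean_space) set"
  assumes ne: "\<And>n. C n \<noteq> {}" and dec: "\<And>n. C (Suc n) \<subseteq> C n"
    and mid: "\<And>n f g. f \<in> C n \<Longrightarrow> g \<in> C n \<Longrightarrow> (\<lambda>x. (1/2) *\<^sub>R (f x + g x)) \<in> C n"
    and s: "\<And>f. f \<in> C 0 \<Longrightarrow> sqi f" and b: "\<And>f. f \<in> C 0 \<Longrightarrow> sqint f \<le> M"
  obtains X F where "\<And>n. X n \<in> C n" "L2to X F"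
proof -
  define N where "N f = sqint f" for f :: "R3 \<Rightarrow> 'b"
  have N0: "N f \<ge> 0" for f by (simp add: N_def)
  have dec': "m \<le> n \<Longrightarrow> C n \<subseteq> C m" for m n using lift_Suc_antimono_le[of C] dec by blast
  define d where "d n = Inf (N ` C n)" for n
  have bb: "bdd_below (N ` C n)" for n using N0 by (intro bdd_belowI[of _ 0]) auto
  have dle: "d n \<le> N f" if "f \<in> C n" for n f unfolding d_def using that bb by (intro cInf_lower) auto
  have dmono: "d m \<le> d n" if "m \<le> n" for m n
    unfolding d_def using dec'[OF that] ne bb by (intro cInf_superset_mono) auto
  have dM: "d n \<le> M" for n
  proof -
    obtain f where "f \<in> C n" using ne by blast
    then show ?thesis using dle[of f n] b[of f] dec'[of 0 n] by (auto simp: N_def)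
  qed
  have "\<exists>X. \<forall>n. X n \<in> C n \<and> N (X n) < d n + 1 / real (Suc n)"
  proof (rule choice, rule allI)
    fix n
    have "\<exists>y\<in>N ` C n. y < d n + 1 / real (Suc n)"
      unfolding d_def using ne bb by (subst cInf_less_iff[symmetric]) auto
    then show "\<exists>f. f \<in> C n \<and> N f < d n + 1 / real (Suc n)" by auto
  qed
  then obtain X where X: "\<And>n. X n \<in> C n" "\<And>n. N (X n) < d n + 1 / real (Suc n)" by metis
  have sX: "sqi (X n)" for n using X(1)[of n] dec'[of 0 n] s by auto
  have d0: "d n \<ge> 0" for n unfolding d_def using ne N0 by (intro cInf_greatest) auto
  have "convergent d" 
    by (rule Bseq_mono_convergent) (use dM d0 dmono in \<open>auto intro!: BseqI'[of _ M]\<close>)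
  then have dC: "Cauchy d" by (simp add: convergent_Cauchy)
  have "\<exists>K. \<forall>m\<ge>K. \<forall>n\<ge>K. N (\<lambda>x. X m x - X n x) < e" if e: "e > 0" for e
  proof -
    obtain K1 where K1: "\<And>m n. m \<ge> K1 \<Longrightarrow> n \<ge> K1 \<Longrightarrow> \<bar>d m - d n\<bar> < e / 8" 
      using dC e unfolding Cauchy_def dist_real_def by (metis zero_less_divide_iff zero_less_numeral)
    obtain K2 where K2: "1 / real (Suc K2) < e / 8" using nat_approx_posE[of "e/8"] e by auto
    define K where "K = max K1 K2"
    have "N (\<lambda>x. X m x - X n x) < e" if mn: "m \<ge> K" "n \<ge> K" for m n
    proof -
      have i: "integrable lebesgue (\<lambda>x. (norm (X m x))\<^sup>2)" "integrable lebesgue (\<lambda>x. (norm (X n x))\<^sup>2)"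
         "integrable lebesgue (\<lambda>x. (norm ((1/2) *\<^sub>R (X m x + X n x)))\<^sup>2)"
        using sX by (auto intro!: sqi_integrable sqi_scaleR sqi_add simp del: norm_scaleR)
      have par: "(norm (a - c))\<^sup>2 = 2 * (norm a)\<^sup>2 + 2 * (norm c)\<^sup>2 - 4 * (norm ((1/2) *\<^sub>R (a + c)))\<^sup>2" for a c :: 'b
        by (simp add: power_mult_distrib power2_norm_eq_inner inner_add_left inner_add_right inner_diff_left inner_diff_right inner_commute algebra_simps power_divide)
      have "N (\<lambda>x. X m x - X n x) = 2 * N (X m) + 2 * N (X n) - 4 * N (\<lambda>x. (1/2) *\<^sub>R (X m x + X n x))"
        unfolding N_def par using i by simp
      \<comment> \<open>The sets decrease, so the midpoint lies in \<open>C K\<close> and its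
        squared norm is at least \<open>d K\<close>; those of X m and X n exceed \<open>d K\<close>
        by less than e/4 each. The parallelogram identity leaves less than e.\<close>
      moreover have "d K \<le> N (\<lambda>x. (1/2) *\<^sub>R (X m x + X n x))"
        by (intro dle mid) (use X(1) dec' mn in blast)+
      moreover have Xk: "N (X k) < d K + e / 4" if "k \<ge> K" for k
      proof -
        have "1 / real (Suc k) \<le> 1 / real (Suc K2)" using that by (intro divide_left_mono) (auto simp: K_def)
        moreover have "\<bar>d k - d K\<bar> < e / 8" using that by (intro K1) (auto simp: K_def)
        ultimately show ?thesis using X(2)[of k] K2 by linarith
      qed
      ultimately show ?thesis using Xk[OF mn(1)] Xk[OF mn(2)] by linarith
    qed
    then show ?thesis by blast
  qed
  note cauchy = this[unfolded N_def]
  obtain F where "L2to X F" by (rule L2_complete[OF sX cauchy])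
  then show ?thesis using X that by blast
qed

text \<open>Vitali's theorem with equi-integrability expressed by domination: up to a part
  \<open>d n\<close> that vanishes in L1 and \<tau> times a sequence bounded in L1,
  \<open>h n\<close> lies below a fixed integrable function. Subtracting both parts and cutting off
  at 0 leaves a sequence to which dominated convergence applies. In the applications
  \<open>e n\<close> consists of sixth powers, possibly with quadratic terms, and \<tau> comes from
  interpolation between powers.\<close>

lemma Vitali_tendsto_zero:
  fixes h :: "nat \<Rightarrow> 'a \<Rightarrow> real"
  assumes h: "\<And>n. integrable M (h n)" "\<And>n. AE x in M. h n x \<ge> 0" "AE x in M. (\<lambda>n. h n x) \<longlonglongrightarrow> 0"
    and e: "\<And>n. integrable M (e n)" "\<And>n. AE x in M. e n x \<ge> 0" "\<And>n. integral\<^sup>L M (e n) \<le> B"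
    and dom: "\<And>\<tau>. \<tau> > 0 \<Longrightarrow> \<exists>k d. integrable M k \<and> (\<forall>n. integrable M (d n)) \<and> (\<forall>n. AE x in M. d n x \<ge> 0) \<and>
        (\<lambda>n. integral\<^sup>L M (d n)) \<longlonglongrightarrow> 0 \<and> (\<forall>n. AE x in M. h n x \<le> k x + d n x + \<tau> * e n x)"
  shows "(\<lambda>n. integral\<^sup>L M (h n)) \<longlonglongrightarrow> 0"
proof (rule LIMSEQ_I)
  fix r :: real assume r: "r > 0"
  have B0: "B \<ge> 0" using e(3)[of 0] integral_nonneg_AE[OF e(2)[of 0]] by linarith
  define \<tau> where "\<tau> = r / (2 * (B + 1))"
  have \<tau>: "\<tau> > 0" "\<tau> * B \<le> r / 2" using r B0 by (auto simp: \<tau>_def divide_simps mult_left_mono)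
  obtain k d where kd: "integrable M k" "\<And>n. integrable M (d n)" "\<And>n. AE x in M. d n x \<ge> 0"
    "(\<lambda>n. integral\<^sup>L M (d n)) \<longlonglongrightarrow> 0" "\<And>n. AE x in M. h n x \<le> k x + d n x + \<tau> * e n x"
    using dom[OF \<tau>(1)] by blast
  define q where "q n x = max 0 (h n x - d n x - \<tau> * e n x)" for n x
  have qi: "integrable M (q n)" for n unfolding q_def using h(1) kd(2) e(1)
    by (intro integrable_max Bochner_Integration.integrable_diff) auto
  have "(\<lambda>n. integral\<^sup>L M (q n)) \<longlonglongrightarrow> integral\<^sup>L M (\<lambda>x. 0)"
  proof (rule integral_dominated_convergence[where w="\<lambda>x. \<bar>k x\<bar>"])
    have "AE x in M. \<forall>n. h n x \<ge> 0 \<and> d n x \<ge> 0 \<and> e n x \<ge> 0"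
      unfolding AE_all_countable using h(2) kd(3) e(2) by (auto intro: AE_conjI)
    then show "AE x in M. (\<lambda>n. q n x) \<longlonglongrightarrow> 0"
      using h(3)
    proof eventually_elim
      case (elim x)
      have "q n x \<le> h n x" for n using elim(1) mult_nonneg_nonneg[OF less_imp_le[OF \<tau>(1)], of "e n x"] unfolding q_def by (smt (verit))
      then show ?case by (intro tendsto_sandwich[OF _ _ tendsto_const elim(2)]) (auto simp: q_def)
    qed
    show "AE x in M. norm (q n x) \<le> \<bar>k x\<bar>" for n
      using kd(5)[of n] by eventually_elim (auto simp: q_def)
  qed (use kd(1) qi in auto)
  then have "(\<lambda>n. integral\<^sup>L M (q n) + integral\<^sup>L M (d n)) \<longlonglongrightarrow> 0 + 0" using kd(4) by (intro tendsto_add) auto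
  then have ev: "\<exists>N. \<forall>n\<ge>N. norm (integral\<^sup>L M (q n) + integral\<^sup>L M (d n) - 0) < r / 2"
    using r by (intro LIMSEQ_D) auto
  have "norm (integral\<^sup>L M (h n)) \<le> (integral\<^sup>L M (q n) + integral\<^sup>L M (d n)) + r / 2" for n
  proof -
    have "integral\<^sup>L M (h n) \<le> (\<integral>x. q n x + d n x + \<tau> * e n x \<partial>M)"
      using h(1) qi kd(2) e(1) by (intro integral_mono) (auto simp: q_def)
    also have "\<dots> = integral\<^sup>L M (q n) + integral\<^sup>L M (d n) + \<tau> * integral\<^sup>L M (e n)"
      using qi kd(2) e(1) by simp
    also have "\<tau> * integral\<^sup>L M (e n) \<le> \<tau> * B" using \<tau>(1) e(3) by (intro mult_left_mono) auto
    finally show ?thesis using \<tau>(2) integral_nonneg_AE[OF h(2)[of n]] by simp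
  qed
  then show "\<exists>N. \<forall>n\<ge>N. norm (integral\<^sup>L M (h n) - 0) < r"
    using ev by (smt (verit) diff_zero field_sum_of_halves real_norm_def)
qed

subsection \<open>Rellich compactness\<close>

text \<open>The Hardy weight. Its decay replaces the restriction to bounded sets in Rellich's
  theorem, and in the growth estimates its square root plays the part of 1/|x|.\<close>

definition wt :: "R3 \<Rightarrow> real" where "wt x = inverse (1 + (norm x)\<^sup>2)"

lemma wt_pos: "wt x > 0" and wt_le_1: "wt x \<le> 1"
  unfolding wt_def by (auto intro!: add_pos_nonneg inverse_le_1_iff[THEN iffD2])

lemma continuous_on_wt: "continuous_on S wt"
  unfolding wt_def by (intro continuous_intros) (auto simp: add_nonneg_eq_0_iff)

lemma wt_measurable [measurable]: "wt \<in> borel_measurable lebesgue"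
  by (rule continuous_imp_lebesgue[OF continuous_on_wt])

lemma sqi_continuous_compact:
  assumes "continuous_on UNIV h" "compact K" "\<And>x. x \<notin> K \<Longrightarrow> h x = 0"
  shows "sqi h"
  unfolding sqi_def
proof
  show "h \<in> borel_measurable lebesgue" by (rule continuous_imp_lebesgue[OF assms(1)])
  show "integrable lebesgue (\<lambda>x. (norm (h x))\<^sup>2)"
    by (rule integrable_lebesgue_continuous_compact[OF _ assms(2)]) (auto intro!: continuous_intros assms(1) simp: assms(3))
qed

lemma sqi_test_fun_mult:
  assumes "continuous_on UNIV h" "test_fun U \<phi>"
  shows "sqi (\<lambda>x. h x * \<phi> x)" "sqi (\<lambda>x. h x *\<^sub>R cgrad \<phi> x)"
proof -
  obtain K where K: "compact K" "\<And>x. x \<notin> K \<Longrightarrow> \<phi> x = 0" "\<And>x. x \<notin> K \<Longrightarrow> cgrad \<phi> x = 0"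
    using test_funE[OF assms(2)] by metis
  show "sqi (\<lambda>x. h x * \<phi> x)"
    by (rule sqi_continuous_compact[OF _ K(1)]) (auto simp: K intro!: continuous_intros assms(1) test_fun_continuous[OF assms(2)])
  show "sqi (\<lambda>x. h x *\<^sub>R cgrad \<phi> x)"
    by (rule sqi_continuous_compact[OF _ K(1)]) (auto simp: K intro!: continuous_intros assms(1) test_fun_continuous_cgrad[OF assms(2)])
qed

lemma sqi_test_fun: "test_fun U \<phi> \<Longrightarrow> sqi \<phi>" and sqi_cgrad: "test_fun U \<phi> \<Longrightarrow> sqi (cgrad \<phi>)"
  using sqi_test_fun_mult[of "\<lambda>x. 1" U \<phi>] by auto

text \<open>The index of the half-open dyadic cube of side 2^-k that contains x. Cubes are taken as
  the fibres of this map, so that they partition the space by construction.\<close>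

definition dyad :: "nat \<Rightarrow> R3 \<Rightarrow> int \<times> int \<times> int" where
  "dyad k x = (\<lfloor>2 ^ k * x $ 1\<rfloor>, \<lfloor>2 ^ k * x $ 2\<rfloor>, \<lfloor>2 ^ k * x $ 3\<rfloor>)"

definition cube :: "nat \<Rightarrow> int \<times> int \<times> int \<Rightarrow> R3 set" where
  "cube k z = {x. dyad k x = z}"

lemma cube_alt: "cube k (a, b, c) = (\<Inter>(i, z)\<in>{(1, a), (2, b), (3, c)}. {x. of_int z \<le> 2 ^ k * x $ i \<and> 2 ^ k * x $ i < of_int z + 1})"
  by (auto simp: cube_def dyad_def floor_eq_iff)

lemma cube_borel: "cube k z \<in> sets borel"
proof -
  have "{x::R3. of_int w \<le> 2 ^ k * x $ i \<and> 2 ^ k * x $ i < of_int w + 1} \<in> sets borel" for w :: int and i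
  proof -
    have "{x::R3. of_int w \<le> 2 ^ k * x $ i} \<inter> {x. 2 ^ k * x $ i < of_int w + 1} \<in> sets borel"
      by (intro sets.Int borel_closed borel_open closed_Collect_le open_Collect_less continuous_intros)
    then show ?thesis by (simp add: Collect_conj_eq)
  qed
  then show ?thesis by (cases z) (auto simp: cube_alt)
qed

lemma convex_cube: "convex (cube k z)"
proof -
  have "convex {x::R3. of_int w \<le> 2 ^ k * x $ i \<and> 2 ^ k * x $ i < of_int w + 1}" for w :: int and i
  proof (rule convexI, clarify)
    fix x y :: R3 and u v :: real
    assume h: "of_int w \<le> 2 ^ k * x $ i" "2 ^ k * x $ i < of_int w + 1" "of_int w \<le> 2 ^ k * y $ i" "2 ^ k * y $ i < of_int w + 1"
      and uv: "0 \<le> u" "0 \<le> v" "u + v = 1"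
    have e: "2 ^ k * (u *\<^sub>R x + v *\<^sub>R y) $ i = u * (2 ^ k * x $ i) + v * (2 ^ k * y $ i)" by (simp add: algebra_simps)
    have "u * (2 ^ k * x $ i) + v * (2 ^ k * y $ i) < of_int w + 1" using convex_bound_lt[OF h(2,4) uv] .
    moreover have "u * of_int w + v * of_int w \<le> u * (2 ^ k * x $ i) + v * (2 ^ k * y $ i)"
      using h uv by (intro add_mono mult_left_mono) auto
    moreover have "u * of_int w + v * of_int w = of_int w" using uv(3) by (metis distrib_right mult_1)
    ultimately show "of_int w \<le> 2 ^ k * (u *\<^sub>R x + v *\<^sub>R y) $ i \<and> 2 ^ k * (u *\<^sub>R x + v *\<^sub>R y) $ i < of_int w + 1"
      unfolding e by linarith
  qed
  then show ?thesis by (cases z) (auto simp: cube_alt intro!: convex_Int)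
qed

lemma cube_dist:
  assumes "x \<in> cube k z" "y \<in> cube k z"
  shows "dist x y \<le> 3 * (1/2) ^ k"
proof -
  have *: "\<bar>s - t\<bar> \<le> (1/2) ^ k" if "\<lfloor>2 ^ k * s\<rfloor> = \<lfloor>2 ^ k * t\<rfloor>" for s t :: real
  proof -
    have "\<bar>2 ^ k * s - 2 ^ k * t\<bar> \<le> 1" using that by linarith
    then have "2 ^ k * \<bar>s - t\<bar> \<le> 1" by (simp add: abs_mult flip: right_diff_distrib)
    then show ?thesis by (simp add: power_divide field_simps)
  qed
  have "dist x y \<le> (\<Sum>i\<in>UNIV. \<bar>(x - y) $ i\<bar>)" unfolding dist_norm by (rule norm_le_l1_cart)
  also have "\<dots> \<le> 3 * (1/2) ^ k"
    using assms *[of "x $ 1" "y $ 1"] *[of "x $ 2" "y $ 2"] *[of "x $ 3" "y $ 3"]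
    by (auto simp: cube_def dyad_def sum_3)
  finally show ?thesis .
qed

lemma bounded_cube: "bounded (cube k z)"
  using cube_dist unfolding bounded_def by (cases "cube k z = {}") (force, metis ex_in_conv)

lemma integrable_cube_mult: "integrable lebesgue f \<Longrightarrow> integrable lebesgue (\<lambda>x. indicator (cube k z) x * f x :: real)"
  using integrable_mult_indicator[of "cube k z" lebesgue f] cube_borel[of k z] by simp

text \<open>The diameter bound 3 times 2^-k turns the factor 4 d^2 into 36 times 4^-k. The value of
  the volume does not enter: in the degenerate case the left-hand side is an integral over a null
  set, and the quotient by 0 is 0.\<close>

lemma cube_Poincare:
  assumes w: "test_fun U w"
  shows "(\<integral>x. indicator (cube k z) x * (w x)\<^sup>2 \<partial>lebesgue)
     \<le> (\<integral>x. indicator (cube k z) x * w x \<partial>lebesgue)\<^sup>2 / measure lebesgue (cube k z)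
       + 36 * (1/4) ^ k * (\<integral>x. indicator (cube k z) x * (norm (cgrad w x))\<^sup>2 \<partial>lebesgue)"
proof (cases "measure lebesgue (cube k z) = 0")
  case True
  have "emeasure lebesgue (cube k z) = 0"
    using True emeasure_bounded_finite[OF bounded_cube, of k z] cube_borel[of k z]
    by (auto simp: measure_def enn2real_eq_0_iff emeasure_completion)
  then have "AE x in lebesgue. x \<notin> cube k z" using cube_borel[of k z] by (intro AE_not_in) (auto simp: null_sets_def)
  then have "(\<integral>x. indicator (cube k z) x * (w x)\<^sup>2 \<partial>lebesgue) = 0"
    by (intro integral_eq_zero_AE) (auto elim!: eventually_mono)
  then show ?thesis using True by simp
next
  case False
  define m where "m = measure lebesgue (cube k z)"
  have m: "m > 0" using False by (simp add: m_def zero_less_measure_iff)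
  have d: "(3 * (1/2)^k)\<^sup>2 = 9 * (1/4 :: real)^k"
    by (simp add: power_mult_distrib power_divide flip: power_mult)
       (simp add: power_mult mult.commute[of k 2])
  have gen: "a \<le> b / m + 36 * q * D" if "m * a \<le> b + 4 * (9 * q) * m * D" for a b q D
    using that m by (simp add: field_simps)
  have cd: "\<And>x y. x \<in> cube k z \<Longrightarrow> y \<in> cube k z \<Longrightarrow> dist x y \<le> 3 * (1/2)^k" by (rule cube_dist)
  note P = Poincare_variance[OF w convex_cube[of k z] cube_borel bounded_cube cd, folded m_def, unfolded d]
  show ?thesis unfolding m_def[symmetric] by (rule gen[OF P])
qed

text \<open>On the cubes that fill the box [-N, N)^3 Poincare's inequality reduces w to its means,
  up to 4^-k times the gradient; off the box wt^2 <= wt <= 1/(1 + N^2). So for bounded gradients and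
  norms, weighted smallness is a matter of finitely many means.\<close>

lemma dyadic_sum_bound:
  assumes w: "test_fun U w" and Z: "Z = {- (int N * 2 ^ k) ..< int N * 2 ^ k}"
  shows "(\<integral>x. (wt x * w x)\<^sup>2 \<partial>lebesgue)
    \<le> (\<Sum>z\<in>Z \<times> Z \<times> Z. (\<integral>x. indicator (cube k z) x * w x \<partial>lebesgue)\<^sup>2 / measure lebesgue (cube k z))
      + 36 * (1/4) ^ k * sqint (cgrad w) + 1 / (1 + (real N)\<^sup>2) * (\<integral>x. (w x)\<^sup>2 \<partial>lebesgue)"
proof -
  have fin: "finite (Z \<times> Z \<times> Z)" by (simp add: Z)
  have i1: "integrable lebesgue (\<lambda>x. (w x)\<^sup>2)" using sqi_integrable[OF sqi_test_fun[OF w]] by simp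
  have i2: "integrable lebesgue (\<lambda>x. (norm (cgrad w x))\<^sup>2)" using sqi_integrable[OF sqi_cgrad[OF w]] .
  have i3: "integrable lebesgue (\<lambda>x. (wt x * w x)\<^sup>2)"
    using sqi_integrable[OF sqi_test_fun_mult(1)[OF continuous_on_wt w]] by simp
  have ind: "(\<Sum>z\<in>Z \<times> Z \<times> Z. indicator (cube k z) x * t) = (if dyad k x \<in> Z \<times> Z \<times> Z then t else 0)" for x and t :: real
  proof -
    have "(\<Sum>z\<in>Z \<times> Z \<times> Z. indicator (cube k z) x * t) = (\<Sum>z\<in>Z \<times> Z \<times> Z. if dyad k x = z then t else 0)"
      by (intro sum.cong) (auto simp: cube_def indicator_def)
    then show ?thesis using fin by (simp add: sum.delta)
  qed
  have pw: "(wt x * w x)\<^sup>2 \<le> (\<Sum>z\<in>Z \<times> Z \<times> Z. indicator (cube k z) x * (w x)\<^sup>2) + 1 / (1 + (real N)\<^sup>2) * (w x)\<^sup>2" for x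
  proof (cases "dyad k x \<in> Z \<times> Z \<times> Z")
    case True
    have "(wt x)\<^sup>2 \<le> 1" using wt_pos[of x] wt_le_1[of x] by (simp add: power_le_one)
    then have "(wt x)\<^sup>2 * (w x)\<^sup>2 \<le> 1 * (w x)\<^sup>2" by (intro mult_right_mono) auto
    then show ?thesis using True by (simp add: ind power_mult_distrib add_increasing2)
  next
    case False
    have out: "\<bar>s\<bar> \<ge> real N" if "\<lfloor>2 ^ k * s\<rfloor> \<notin> Z" for s :: real
    proof (rule ccontr)
      assume "\<not> \<bar>s\<bar> \<ge> real N"
      then have a: "- real N < s" "s < real N" by auto
      have "2 ^ k * s < 2 ^ k * real N" "2 ^ k * (- real N) < 2 ^ k * s" using a by (intro mult_strict_left_mono; simp)+
      then have "2 ^ k * s < of_int (int N * 2 ^ k)" "of_int (- (int N * 2 ^ k)) \<le> 2 ^ k * s" by (auto simp: mult.commute)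
      then show False using that unfolding Z by (simp add: floor_less_iff le_floor_iff)
    qed
    have "real N \<le> norm x"
    proof -
      have "\<exists>i. \<lfloor>2 ^ k * x $ i\<rfloor> \<notin> Z" using False by (auto simp: dyad_def)
      then obtain i where "\<bar>x $ i\<bar> \<ge> real N" using out by blast
      then show ?thesis using component_le_norm_cart[of x i] by linarith
    qed
    then have "wt x \<le> 1 / (1 + (real N)\<^sup>2)"
      unfolding wt_def by (simp add: divide_inverse[symmetric] inverse_eq_divide frac_le power_mono add_pos_nonneg)
    moreover have "(wt x)\<^sup>2 \<le> wt x" using wt_pos[of x] wt_le_1[of x] by (simp add: power2_eq_square mult_left_le)
    ultimately have "(wt x)\<^sup>2 * (w x)\<^sup>2 \<le> 1 / (1 + (real N)\<^sup>2) * (w x)\<^sup>2" by (intro mult_right_mono) auto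
    then show ?thesis using False by (simp add: ind power_mult_distrib)
  qed
  have "(\<integral>x. (wt x * w x)\<^sup>2 \<partial>lebesgue) \<le> (\<integral>x. (\<Sum>z\<in>Z \<times> Z \<times> Z. indicator (cube k z) x * (w x)\<^sup>2) + 1 / (1 + (real N)\<^sup>2) * (w x)\<^sup>2 \<partial>lebesgue)"
    by (rule integral_mono[OF i3 _ pw]) (intro Bochner_Integration.integrable_add Bochner_Integration.integrable_sum integrable_cube_mult i1 integrable_mult_right)
  also have "\<dots> = (\<Sum>z\<in>Z \<times> Z \<times> Z. \<integral>x. indicator (cube k z) x * (w x)\<^sup>2 \<partial>lebesgue) + 1 / (1 + (real N)\<^sup>2) * (\<integral>x. (w x)\<^sup>2 \<partial>lebesgue)"
    by (subst Bochner_Integration.integral_add)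
       (auto intro!: Bochner_Integration.integrable_sum integrable_cube_mult i1 Bochner_Integration.integral_sum)
  also have "(\<Sum>z\<in>Z \<times> Z \<times> Z. \<integral>x. indicator (cube k z) x * (w x)\<^sup>2 \<partial>lebesgue)
    \<le> (\<Sum>z\<in>Z \<times> Z \<times> Z. (\<integral>x. indicator (cube k z) x * w x \<partial>lebesgue)\<^sup>2 / measure lebesgue (cube k z)
       + 36 * (1/4) ^ k * (\<integral>x. indicator (cube k z) x * (norm (cgrad w x))\<^sup>2 \<partial>lebesgue))"
    by (intro sum_mono cube_Poincare[OF w])
  also have "\<dots> = (\<Sum>z\<in>Z \<times> Z \<times> Z. (\<integral>x. indicator (cube k z) x * w x \<partial>lebesgue)\<^sup>2 / measure lebesgue (cube k z))
       + 36 * (1/4) ^ k * (\<Sum>z\<in>Z \<times> Z \<times> Z. \<integral>x. indicator (cube k z) x * (norm (cgrad w x))\<^sup>2 \<partial>lebesgue)"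
    by (simp add: sum.distrib sum_distrib_left)
  also have "(\<Sum>z\<in>Z \<times> Z \<times> Z. \<integral>x. indicator (cube k z) x * (norm (cgrad w x))\<^sup>2 \<partial>lebesgue)
    = (\<integral>x. (\<Sum>z\<in>Z \<times> Z \<times> Z. indicator (cube k z) x * (norm (cgrad w x))\<^sup>2) \<partial>lebesgue)"
    by (intro Bochner_Integration.integral_sum[symmetric] integrable_cube_mult i2)
  also have "36 * (1/4) ^ k * \<dots> \<le> 36 * (1/4) ^ k * sqint (cgrad w)"
  proof (intro mult_left_mono integral_mono)
    show "integrable lebesgue (\<lambda>x. \<Sum>z\<in>Z \<times> Z \<times> Z. indicator (cube k z) x * (norm (cgrad w x))\<^sup>2)"
      by (intro Bochner_Integration.integrable_sum integrable_cube_mult i2)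
  qed (auto simp: ind i2)
  finally show ?thesis by simp
qed

text \<open>There are countably many pairs of a level and a cube, so one diagonal subsequence makes
  the integrals over all cubes converge. Applied to differences of its members,
  \<open>dyadic_sum_bound\<close> shows the weighted sequence to be Cauchy.\<close>

lemma Rellich:
  assumes \<phi>: "\<And>n. test_fun U (\<phi> n)" and G: "\<And>n. sqint (cgrad (\<phi> n)) \<le> A"
    and M: "\<And>n. (\<integral>x. (\<phi> n x)\<^sup>2 \<partial>lebesgue) \<le> M"
  obtains s F where "strict_mono (s :: nat \<Rightarrow> nat)" "L2to (\<lambda>n x. wt x * \<phi> (s n) x) F"
proof -
  define I where "I n kz = (\<integral>x. indicator (cube (fst kz) (snd kz)) x * \<phi> n x \<partial>lebesgue)" for n kz
  define m where "m kz = measure lebesgue (cube (fst kz) (snd kz))" for kz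
  have M0: "M \<ge> 0" using M[of 0] by (rule order_trans[rotated]) simp
  have A0: "A \<ge> 0" using G[of 0] by (rule order_trans[rotated]) simp
  have m0: "m kz \<ge> 0" for kz by (simp add: m_def)
  have i: "integrable lebesgue (\<lambda>x. (\<phi> n x)\<^sup>2)" for n using sqi_integrable[OF sqi_test_fun[OF \<phi>]] by simp
  have ii: "integrable lebesgue (\<phi> n)" for n
    using test_funE[OF \<phi>[of n]] integrable_lebesgue_continuous_compact[OF test_fun_continuous[OF \<phi>]] by metis
  have ci: "integrable lebesgue (indicator (cube k z) :: R3 \<Rightarrow> real)" for k z
    using emeasure_bounded_finite[OF bounded_cube[of k z]] cube_borel[of k z]
    by (intro integrable_real_indicator) (auto simp: emeasure_completion)
  have Ib: "\<bar>I n kz\<bar> \<le> m kz + M" for n kz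
  proof -
    have "\<bar>I n kz\<bar> \<le> (\<integral>x. \<bar>indicator (cube (fst kz) (snd kz)) x * \<phi> n x\<bar> \<partial>lebesgue)"
      unfolding I_def by (rule integral_abs_bound)
    also have "\<dots> \<le> (\<integral>x. indicator (cube (fst kz) (snd kz)) x + (\<phi> n x)\<^sup>2 \<partial>lebesgue)"
    proof (rule integral_mono)
      fix x
      have "\<bar>t\<bar> \<le> 1 + t\<^sup>2" for t :: real
        using sum_squares_bound[of "\<bar>t\<bar>" 1] by simp
      then show "\<bar>indicator (cube (fst kz) (snd kz)) x * \<phi> n x\<bar> \<le> indicator (cube (fst kz) (snd kz)) x + (\<phi> n x)\<^sup>2"
        by (auto simp: indicator_def)
    qed (use i ii ci in \<open>auto intro!: integrable_cube_mult\<close>)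
    also have "\<dots> \<le> m kz + M" using i ci M[of n] cube_borel by (simp add: m_def)
    finally show ?thesis .
  qed
  \<comment> \<open>The selection theorem asks for a single bound valid at all indices, so each
    integral is first divided by a bound of its own.\<close>
  have nb: "norm (I n kz / (m kz + M + 1)) \<le> 1" for n kz using Ib[of n kz] m0[of kz] M0 by simp
  obtain s where s: "strict_mono (s :: nat \<Rightarrow> nat)" "\<And>kz. kz \<in> UNIV \<Longrightarrow> \<exists>l. (\<lambda>n. I (s n) kz / (m kz + M + 1)) \<longlonglongrightarrow> l"
    by (rule function_convergent_subsequence[of "UNIV :: (nat \<times> int \<times> int \<times> int) set" "\<lambda>n kz. I n kz / (m kz + M + 1)" 1])
       (simp, rule nb, rule that)
  have Ic: "Cauchy (\<lambda>n. I (s n) kz)" for kz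
  proof -
    obtain l where "(\<lambda>n. I (s n) kz / (m kz + M + 1)) \<longlonglongrightarrow> l" using s(2)[of kz] by blast
    from tendsto_mult[OF this tendsto_const[of "m kz + M + 1"]] have "(\<lambda>n. I (s n) kz) \<longlonglongrightarrow> l * (m kz + M + 1)"
      using m0[of kz] M0 by simp
    then show ?thesis by (rule LIMSEQ_imp_Cauchy)
  qed
  define X where "X n x = wt x * \<phi> (s n) x" for n x
  have sX: "sqi (X n)" for n unfolding X_def by (rule sqi_test_fun_mult(1)[OF continuous_on_wt \<phi>])
  have "\<exists>K. \<forall>a\<ge>K. \<forall>b\<ge>K. (\<integral>x. (norm (X a x - X b x))\<^sup>2 \<partial>lebesgue) < e" if e: "e > 0" for e
  proof -
    \<comment> \<open>A difference of two members has squared gradient norm at most 2A + 2A, and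
      likewise squared norm at most 4M. The level k and the box size N make the two corresponding
      errors less than e/3 each.\<close>
    obtain k where k: "36 * (1/4) ^ k * (4 * A) < e / 3"
    proof -
      have "(\<lambda>k. 36 * (1/4) ^ k * (4 * A)) \<longlonglongrightarrow> 36 * 0 * (4 * A)"
        by (intro tendsto_intros LIMSEQ_realpow_zero) auto
      then have "(\<lambda>k. 36 * (1/4) ^ k * (4 * A)) \<longlonglongrightarrow> 0" by (simp only: mult_zero_left mult_zero_right)
      from order_tendstoD(2)[OF this, of "e / 3"] have "\<forall>\<^sub>F k in sequentially. 36 * (1/4) ^ k * (4 * A) < e / 3" using e by simp
      from eventually_happens[OF this] obtain k where "36 * (1/4) ^ k * (4 * A) < e / 3" by auto
      then show ?thesis by (rule that)
    qed
    obtain N :: nat where N: "1 / (1 + (real N)\<^sup>2) * (4 * M) < e / 3"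
    proof -
      obtain N :: nat where N: "12 * M / e < real N" using reals_Archimedean2 by blast
      have "real N \<le> 1 + (real N)\<^sup>2" using sum_squares_bound[of "real N" 1] by simp
      then have "12 * M / e < 1 + (real N)\<^sup>2" using N by linarith
      then have "1 / (1 + (real N)\<^sup>2) * (4 * M) < e / 3" using e by (simp add: field_simps add_pos_nonneg)
      then show ?thesis using that by blast
    qed
    define Z where "Z = {- (int N * 2 ^ k) ..< int N * 2 ^ k}"
    define S where "S a b = (\<Sum>z\<in>Z \<times> Z \<times> Z. (I (s a) (k, z) - I (s b) (k, z))\<^sup>2 / m (k, z))" for a b
    have "\<exists>K. \<forall>a\<ge>K. \<forall>b\<ge>K. S a b < e / 3"
    proof -
      \<comment> \<open>The share of a single cube in e/3; the 1 added to the number of cubes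
        excludes a zero denominator and makes the total strictly smaller.\<close>
      define c where "c = e / 3 / (real (card (Z \<times> Z \<times> Z)) + 1)"
      have c: "c > 0" using e by (simp add: c_def)
      have "\<exists>K. \<forall>a\<ge>K. \<forall>b\<ge>K. (I (s a) (k, z) - I (s b) (k, z))\<^sup>2 / m (k, z) \<le> c" for z
      proof (cases "m (k, z) = 0")
        case False
        then have "m (k, z) > 0" using m0[of "(k, z)"] by simp
        then obtain K where K: "\<And>a b. a \<ge> K \<Longrightarrow> b \<ge> K \<Longrightarrow> \<bar>I (s a) (k, z) - I (s b) (k, z)\<bar> < sqrt (c * m (k, z))"
          using Ic[of "(k, z)"] c unfolding Cauchy_def dist_real_def by (metis mult_pos_pos real_sqrt_gt_zero)
        have "(I (s a) (k, z) - I (s b) (k, z))\<^sup>2 / m (k, z) \<le> c" if "a \<ge> K" "b \<ge> K" for a b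
        proof -
          have "(I (s a) (k, z) - I (s b) (k, z))\<^sup>2 \<le> (sqrt (c * m (k, z)))\<^sup>2"
            using K[OF that] c \<open>m (k, z) > 0\<close> by (intro power2_le_iff_abs_le[THEN iffD2]) auto
          then show ?thesis using c \<open>m (k, z) > 0\<close> by (simp add: field_simps)
        qed
        then show ?thesis by blast
      qed (use c in auto)
      then obtain K where K: "\<And>z a b. a \<ge> K z \<Longrightarrow> b \<ge> K z \<Longrightarrow> (I (s a) (k, z) - I (s b) (k, z))\<^sup>2 / m (k, z) \<le> c" by metis
      have fin: "finite (Z \<times> Z \<times> Z)" by (simp add: Z_def)
      have "S a b < e / 3" if ab: "a \<ge> Max (insert 0 (K ` (Z \<times> Z \<times> Z)))" "b \<ge> Max (insert 0 (K ` (Z \<times> Z \<times> Z)))" for a b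
      proof -
        have "a \<ge> K z" "b \<ge> K z" if "z \<in> Z \<times> Z \<times> Z" for z
          using ab fin that by (auto intro: order_trans[OF Max_ge])
        then have "S a b \<le> (\<Sum>z\<in>Z \<times> Z \<times> Z. c)" unfolding S_def by (intro sum_mono K) auto
        also have "\<dots> = real (card (Z \<times> Z \<times> Z)) * c" by simp
        also have "\<dots> < (real (card (Z \<times> Z \<times> Z)) + 1) * c" using c by simp
        also have "\<dots> = e / 3" proof -
          have "real (card (Z \<times> Z \<times> Z)) + 1 \<noteq> 0" by linarith
          then show ?thesis unfolding c_def by (rule nonzero_mult_div_cancel_left[of _ "e / 3", unfolded times_divide_eq_right[symmetric]])
        qed
        finally show ?thesis .
      qed
      then show ?thesis by blast
    qed
    then obtain K where K: "\<And>a b. a \<ge> K \<Longrightarrow> b \<ge> K \<Longrightarrow> S a b < e / 3" by blast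
    have "(\<integral>x. (norm (X a x - X b x))\<^sup>2 \<partial>lebesgue) < e" if ab: "a \<ge> K" "b \<ge> K" for a b
    proof -
      define w where "w x = \<phi> (s a) x + (-1) * \<phi> (s b) x" for x
      have w: "test_fun U w" unfolding w_def by (intro test_fun_add test_fun_cmult \<phi>)
      have gw: "cgrad w x = cgrad (\<phi> (s a)) x - cgrad (\<phi> (s b)) x" for x
      proof -
        have "cgrad w x = cgrad (\<phi> (s a)) x + cgrad (\<lambda>x. (-1) * \<phi> (s b) x) x"
          unfolding w_def by (intro cgrad_add smooth_on_cmult test_fun_smooth[OF \<phi>])
        also have "cgrad (\<lambda>x. (-1) * \<phi> (s b) x) x = (-1) *\<^sub>R cgrad (\<phi> (s b)) x"
          by (intro cgrad_cmult test_fun_smooth[OF \<phi>])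
        finally show ?thesis by simp
      qed
      have Iw: "(\<integral>x. indicator (cube k z) x * w x \<partial>lebesgue) = I (s a) (k, z) - I (s b) (k, z)" for z
      proof -
        have "(\<integral>x. indicator (cube k z) x * w x \<partial>lebesgue)
            = (\<integral>x. indicator (cube k z) x * \<phi> (s a) x - indicator (cube k z) x * \<phi> (s b) x \<partial>lebesgue)"
          by (intro Bochner_Integration.integral_cong) (auto simp: w_def algebra_simps)
        then show ?thesis unfolding I_def using integrable_cube_mult[OF ii] by simp
      qed
      have sq: "(\<integral>x. (norm (P x - Q x))\<^sup>2 \<partial>lebesgue) \<le> 4 * T"
        if P: "sqi P" "sqi Q" "sqint P \<le> T" "sqint Q \<le> T" for T and P Q :: "R3 \<Rightarrow> 'b::euclidean_space"
      proof -
        have "(\<integral>x. (norm (P x - Q x))\<^sup>2 \<partial>lebesgue) \<le> (\<integral>x. 2 * (norm (P x))\<^sup>2 + 2 * (norm (Q x))\<^sup>2 \<partial>lebesgue)"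
          using P norm_add_square_le[of "P x" "- Q x" for x]
          by (intro integral_mono) (auto intro!: sqi_integrable sqi_diff Bochner_Integration.integrable_add integrable_mult_right)
        also have "\<dots> \<le> 4 * T" using P by (simp add: sqi_integrable)
        finally show ?thesis .
      qed
      have Gw: "sqint (cgrad w) \<le> 4 * A" unfolding gw by (intro sq sqi_cgrad[OF \<phi>] G)
      have Mw: "(\<integral>x. (w x)\<^sup>2 \<partial>lebesgue) \<le> 4 * M"
        using sq[OF sqi_test_fun[OF \<phi>[of "s a"]] sqi_test_fun[OF \<phi>[of "s b"]]] M by (simp add: w_def)
      have "(\<integral>x. (norm (X a x - X b x))\<^sup>2 \<partial>lebesgue) = (\<integral>x. (wt x * w x)\<^sup>2 \<partial>lebesgue)"
        by (intro Bochner_Integration.integral_cong) (auto simp: X_def w_def algebra_simps)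
      also have "\<dots> \<le> S a b + 36 * (1/4) ^ k * sqint (cgrad w) + 1 / (1 + (real N)\<^sup>2) * (\<integral>x. (w x)\<^sup>2 \<partial>lebesgue)"
        using dyadic_sum_bound[OF w Z_def] unfolding S_def Iw m_def by simp
      also have "\<dots> \<le> S a b + 36 * (1/4) ^ k * (4 * A) + 1 / (1 + (real N)\<^sup>2) * (4 * M)"
        by (intro add_mono mult_left_mono Gw Mw order_refl) auto
      also have "\<dots> < e" using K[OF ab] k N by linarith
      finally show ?thesis .
    qed
    then show ?thesis by blast
  qed
  note cauchy = this
  obtain F where "L2to X F" by (rule L2_complete[OF sX cauchy])
  then show ?thesis using that[OF s(1)] unfolding X_def by blast
qed

subsection \<open>Compactness of bounded sequences of non-negative test functions\<close>

text \<open>Stands for a non-negative element u, with gradient g, of the H1-closure of the test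
  functions of U, together with its approximating sequence. Convergence almost everywhere is part of
  the notion because nonlinear terms reach their limit through it.\<close>

definition nnapp :: "R3 set \<Rightarrow> (R3 \<Rightarrow> real) \<Rightarrow> (R3 \<Rightarrow> R3) \<Rightarrow> (nat \<Rightarrow> R3 \<Rightarrow> real) \<Rightarrow> bool" where
  "nnapp U u g \<xi> \<longleftrightarrow> (\<forall>n. test_fun U (\<xi> n)) \<and> (\<forall>n x. \<xi> n x \<ge> 0) \<and> L2to \<xi> u \<and> L2to (\<lambda>n. cgrad (\<xi> n)) g
      \<and> (AE x in lebesgue. (\<lambda>n. \<xi> n x) \<longlonglongrightarrow> u x)"

text \<open>Simultaneous convergence of several quantities is expressed by one function with values
  in a product; this recovers the components.\<close>

lemma L2to_fst: "L2to X F \<Longrightarrow> L2to (\<lambda>n x. fst (X n x)) (\<lambda>x. fst (F x))"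
  and L2to_snd: "L2to X F \<Longrightarrow> L2to (\<lambda>n x. snd (X n x)) (\<lambda>x. snd (F x))"
proof -
  have n1: "(norm (fst a))\<^sup>2 \<le> (norm a)\<^sup>2" "(norm (snd a))\<^sup>2 \<le> (norm a)\<^sup>2" for a :: "'a \<times> 'b"
    using norm_fst_le[of "fst a" "snd a"] norm_snd_le[of "snd a" "fst a"] by (auto intro!: power_mono)
  have fm: "(\<lambda>x. fst (H x)) \<in> borel_measurable lebesgue" "(\<lambda>x. snd (H x)) \<in> borel_measurable lebesgue"
    if "H \<in> borel_measurable lebesgue" for H :: "R3 \<Rightarrow> 'a \<times> 'b"
    using measurable_compose[OF that borel_measurable_continuous_onI[OF continuous_on_fst[OF continuous_on_id]]]
      measurable_compose[OF that borel_measurable_continuous_onI[OF continuous_on_snd[OF continuous_on_id]]] by auto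
  have s: "sqi (\<lambda>x. fst (H x))" "sqi (\<lambda>x. snd (H x))" if "sqi H" for H :: "R3 \<Rightarrow> 'a \<times> 'b"
  proof -
    note fm' = fm[OF sqi_measurable[OF that]]
    note nm = measurable_compose[OF fm'(1) borel_measurable_norm] measurable_compose[OF fm'(2) borel_measurable_norm]
    show "sqi (\<lambda>x. fst (H x))" "sqi (\<lambda>x. snd (H x))"
      using fm' nm unfolding sqi_def
      by (auto intro!: integrable_real_bound[OF sqi_integrable[OF that]] simp: n1)
  qed
  assume X: "L2to X F"
  note sX = L2to_sqi[OF X]
  have d: "sqi (\<lambda>x. X n x - F x)" for n using sX by (intro sqi_diff)
  show "L2to (\<lambda>n x. fst (X n x)) (\<lambda>x. fst (F x))" unfolding L2to_def
  proof (intro conjI allI)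
    show "(\<lambda>n. \<integral>x. (norm (fst (X n x) - fst (F x)))\<^sup>2 \<partial>lebesgue) \<longlonglongrightarrow> 0"
    proof (rule tendsto_zero_le[OF _ _ L2to_lim[OF X]])
      fix n show "(\<integral>x. (norm (fst (X n x) - fst (F x)))\<^sup>2 \<partial>lebesgue) \<le> (\<integral>x. (norm (X n x - F x))\<^sup>2 \<partial>lebesgue)"
        using d[of n] s(1)[OF d[of n]] n1 by (intro integral_mono) (auto simp: sqi_integrable simp flip: fst_diff)
    qed simp
  qed (use sX s in auto)
  show "L2to (\<lambda>n x. snd (X n x)) (\<lambda>x. snd (F x))" unfolding L2to_def
  proof (intro conjI allI)
    show "(\<lambda>n. \<integral>x. (norm (snd (X n x) - snd (F x)))\<^sup>2 \<partial>lebesgue) \<longlonglongrightarrow> 0"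
    proof (rule tendsto_zero_le[OF _ _ L2to_lim[OF X]])
      fix n show "(\<integral>x. (norm (snd (X n x) - snd (F x)))\<^sup>2 \<partial>lebesgue) \<le> (\<integral>x. (norm (X n x - F x))\<^sup>2 \<partial>lebesgue)"
        using d[of n] s(2)[OF d[of n]] n1 by (intro integral_mono) (auto simp: sqi_integrable simp flip: snd_diff)
    qed simp
  qed (use sX s in auto)
qed

lemma L2to_cong_AE:
  assumes "L2to X F" "AE x in lebesgue. F x = H x" "H \<in> borel_measurable lebesgue"
  shows "L2to X H"
proof -
  have Fm: "F \<in> borel_measurable lebesgue" using L2to_sqi(2)[OF assms(1)] by (simp add: sqi_def)
  have "sqi H" unfolding sqi_def
  proof
    show "integrable lebesgue (\<lambda>x. (norm (H x))\<^sup>2)"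
      by (rule integrable_cong_AE_imp[OF sqi_integrable[OF L2to_sqi(2)[OF assms(1)]]])
         (use assms in \<open>auto elim!: eventually_mono\<close>)
  qed (rule assms(3))
  moreover have "(\<integral>x. (norm (X n x - H x))\<^sup>2 \<partial>lebesgue) = (\<integral>x. (norm (X n x - F x))\<^sup>2 \<partial>lebesgue)" for n
    using assms(2,3) Fm L2to_sqi(1)[OF assms(1), of n, THEN sqi_measurable]
    by (intro integral_cong_AE) (auto elim!: eventually_mono)
  ultimately show ?thesis using assms(1) by (auto simp: L2to_def)
qed

lemma sqi_midpoint_le:
  assumes "sqi a" "sqi b" "sqint a \<le> K" "sqint b \<le> K"
  shows "(\<integral>x. (norm ((1/2) *\<^sub>R (a x + b x)))\<^sup>2 \<partial>lebesgue) \<le> K"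
proof -
  have "(\<integral>x. (norm ((1/2) *\<^sub>R (a x + b x)))\<^sup>2 \<partial>lebesgue) \<le> (\<integral>x. 1/2 * (norm (a x))\<^sup>2 + 1/2 * (norm (b x))\<^sup>2 \<partial>lebesgue)"
  proof (rule integral_mono)
    show "integrable lebesgue (\<lambda>x. (norm ((1/2) *\<^sub>R (a x + b x)))\<^sup>2)" 
      by (intro sqi_integrable sqi_scaleR sqi_add assms)
    show "integrable lebesgue (\<lambda>x. 1/2 * (norm (a x))\<^sup>2 + 1/2 * (norm (b x))\<^sup>2)"
      using assms by (simp add: sqi_integrable)
    show "(norm ((1/2) *\<^sub>R (a x + b x)))\<^sup>2 \<le> 1/2 * (norm (a x))\<^sup>2 + 1/2 * (norm (b x))\<^sup>2" for x
      using norm_add_square_le[of "a x" "b x"] by (simp add: power_mult_distrib power_divide)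
  qed
  also have "\<dots> \<le> K" using assms by (simp add: sqi_integrable)
  finally show ?thesis .
qed

text \<open>The bounds on g and on the V-integral are those of a weak limit. Rellich's theorem gives
  a strong limit F of the weighted subsequence. The test functions whose two integrals exceed A and
  B by at most 1/(n+1), and whose weighted form is within 1/(n+1) of F, form decreasing
  midpoint-convex sets, and near-minimisers in them converge strongly together with their gradients.
  Being close to F, these have the same limit as the original subsequence, although they need not
  belong to it.\<close>

lemma test_fun_compactness:
  assumes V: "continuous_on UNIV V" "\<And>x. V x \<ge> 0" and \<psi>: "\<And>n. test_fun U (\<psi> n)" "\<And>n x. \<psi> n x \<ge> 0"
    and G: "(\<lambda>n. sqint (cgrad (\<psi> n))) \<longlonglongrightarrow> A"
    and W: "(\<lambda>n. wint V (\<psi> n)) \<longlonglongrightarrow> B"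
    and M: "\<And>n. (\<integral>x. (\<psi> n x)\<^sup>2 \<partial>lebesgue) \<le> M"
  obtains s u g \<xi> where "strict_mono (s :: nat \<Rightarrow> nat)" "nnapp U u g \<xi>" "AE x in lebesgue. (\<lambda>n. \<psi> (s n) x) \<longlonglongrightarrow> u x"
    "sqint g \<le> A" "L2to (\<lambda>n x. sqrt (V x) * \<xi> n x) (\<lambda>x. sqrt (V x) * u x)"
    "wint V u \<le> B"
proof -
  have "bounded (range (\<lambda>n. sqint (cgrad (\<psi> n))))"
    using G convergent_imp_bounded by blast
  then obtain A' where A': "\<And>n. sqint (cgrad (\<psi> n)) \<le> A'"
    unfolding bounded_iff by (metis abs_le_D1 rangeI real_norm_def)
  obtain s0 F where s0: "strict_mono (s0 :: nat \<Rightarrow> nat)" "L2to (\<lambda>n x. wt x * \<psi> (s0 n) x) F"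
    by (rule Rellich[OF \<psi>(1) A' M])
  obtain s1 where s1: "strict_mono s1" "AE x in lebesgue. (\<lambda>n. wt x * \<psi> (s0 (s1 n)) x) \<longlonglongrightarrow> F x"
    by (rule L2to_AE_subseq[OF s0(2)])
  have sVc: "continuous_on UNIV (\<lambda>x. sqrt (V x))" by (intro continuous_intros V)
  have sVm: "(\<lambda>x. sqrt (V x)) \<in> borel_measurable lebesgue" by (rule continuous_imp_lebesgue[OF sVc])
  \<comment> \<open>Function, gradient and V-weighted function are packed into one vector, so that a
    single minimisation makes all three converge.\<close>
  define \<Phi> where "\<Phi> \<phi> x = (\<phi> x, cgrad \<phi> x, sqrt (V x) * \<phi> x)" for \<phi> :: "R3 \<Rightarrow> real" and x
  define P where "P n \<phi> \<longleftrightarrow> test_fun U \<phi> \<and> (\<forall>x. \<phi> x \<ge> 0) \<and> sqint (cgrad \<phi>) \<le> A + 1 / real (Suc n)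
     \<and> (\<integral>x. (norm (sqrt (V x) * \<phi> x))\<^sup>2 \<partial>lebesgue) \<le> B + 1 / real (Suc n) \<and> (\<integral>x. (norm (wt x * \<phi> x - F x))\<^sup>2 \<partial>lebesgue) \<le> 1 / real (Suc n)
     \<and> sqint \<phi> \<le> M" for n \<phi>
  define C where "C n = \<Phi> ` Collect (P n)" for n
  have sF: "sqi F" using s0(2) by (rule L2to_sqi)
  note st = sqi_test_fun sqi_cgrad sqi_test_fun_mult(1)[OF sVc] sqi_test_fun_mult(1)[OF continuous_on_wt]
  have n\<Phi>: "(norm (\<Phi> \<phi> x))\<^sup>2 = (norm (\<phi> x))\<^sup>2 + ((norm (cgrad \<phi> x))\<^sup>2 + (norm (sqrt (V x) * \<phi> x))\<^sup>2)" for \<phi> x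
    unfolding \<Phi>_def by (simp add: norm_Pair real_sqrt_pow2 sum_power2_ge_zero)
  have \<Phi>m: "\<Phi> \<phi> \<in> borel_measurable lebesgue" if "test_fun U \<phi>" for \<phi>
    unfolding \<Phi>_def by (intro continuous_imp_lebesgue continuous_intros test_fun_continuous[OF that] test_fun_continuous_cgrad[OF that] V)
  have s\<Phi>: "sqi (\<Phi> \<phi>)" if "test_fun U \<phi>" for \<phi>
    unfolding sqi_def n\<Phi> using \<Phi>m[OF that] st[OF that, THEN sqi_integrable] by simp
  have ne: "C n \<noteq> {}" for n
  proof -
    have ev1: "\<forall>\<^sub>F k in sequentially. (sqint (cgrad (\<psi> (s0 k)))) < A + 1 / real (Suc n)"
      using LIMSEQ_subseq_LIMSEQ[OF G s0(1)] by (intro order_tendstoD(2)) (auto simp: o_def)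
    have ev2: "\<forall>\<^sub>F k in sequentially. (wint V (\<psi> (s0 k))) < B + 1 / real (Suc n)"
      using LIMSEQ_subseq_LIMSEQ[OF W s0(1)] by (intro order_tendstoD(2)) (auto simp: o_def)
    have ev3: "\<forall>\<^sub>F k in sequentially. (\<integral>x. (norm (wt x * \<psi> (s0 k) x - F x))\<^sup>2 \<partial>lebesgue) < 1 / real (Suc n)"
      using L2to_lim[OF s0(2)] by (intro order_tendstoD(2)) auto
    obtain k where "sqint (cgrad (\<psi> (s0 k))) < A + 1 / real (Suc n)"
       "wint V (\<psi> (s0 k)) < B + 1 / real (Suc n)"
       "(\<integral>x. (norm (wt x * \<psi> (s0 k) x - F x))\<^sup>2 \<partial>lebesgue) < 1 / real (Suc n)"
      using eventually_happens[OF eventually_conj[OF ev1 eventually_conj[OF ev2 ev3]]] by auto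
    then have "P n (\<psi> (s0 k))" unfolding P_def using \<psi> M by (simp add: power_mult_distrib V(2))
    then show ?thesis unfolding C_def by blast
  qed
  have "1 / real (Suc (Suc n)) \<le> 1 / real (Suc n)" for n by (simp add: frac_le)
  then have "P (Suc n) \<phi> \<Longrightarrow> P n \<phi>" for n \<phi> unfolding P_def by (meson add_left_mono order_trans)
  then have dec: "C (Suc n) \<subseteq> C n" for n unfolding C_def by blast
  have mid: "(\<lambda>x. (1/2) *\<^sub>R (f x + h x)) \<in> C n" if fh: "f \<in> C n" "h \<in> C n" for n f h
  proof -
    obtain \<phi>1 \<phi>2 where p: "P n \<phi>1" "P n \<phi>2" "f = \<Phi> \<phi>1" "h = \<Phi> \<phi>2" using fh unfolding C_def by blast
    have t: "test_fun U \<phi>1" "test_fun U \<phi>2" using p by (auto simp: P_def)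
    define \<phi> where "\<phi> x = (1/2) * (\<phi>1 x + \<phi>2 x)" for x
    have t\<phi>: "test_fun U \<phi>" unfolding \<phi>_def by (intro test_fun_cmult test_fun_add t)
    have c\<phi>: "cgrad \<phi> x = (1/2) *\<^sub>R (cgrad \<phi>1 x + cgrad \<phi>2 x)" for x
      unfolding \<phi>_def using t[THEN test_fun_smooth] by (subst cgrad_cmult) (auto simp: cgrad_add smooth_on_add)
    have e1: "\<phi> x = (1/2) *\<^sub>R (\<phi>1 x + \<phi>2 x)" for x by (simp add: \<phi>_def)
    have e2: "sqrt (V x) * \<phi> x = (1/2) *\<^sub>R (sqrt (V x) * \<phi>1 x + sqrt (V x) * \<phi>2 x)" for x by (simp add: \<phi>_def algebra_simps)
    have e3: "wt x * \<phi> x - F x = (1/2) *\<^sub>R ((wt x * \<phi>1 x - F x) + (wt x * \<phi>2 x - F x))" for x by (simp add: \<phi>_def algebra_simps)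
    have "P n \<phi>" unfolding P_def e3 e2 c\<phi>
    proof (intro conjI sqi_midpoint_le)
      show "sqint \<phi> \<le> M" unfolding e1 using p by (intro sqi_midpoint_le st t) (auto simp: P_def)
      show "\<forall>x. \<phi> x \<ge> 0" using p by (auto simp: \<phi>_def P_def)
    qed (use p t t\<phi> st sF in \<open>auto simp: P_def intro!: sqi_diff\<close>)
    moreover have "(\<lambda>x. (1/2) *\<^sub>R (f x + h x)) = \<Phi> \<phi>"
      unfolding p(3,4) \<Phi>_def c\<phi> e2 by (rule ext) (simp add: e1)
    ultimately show ?thesis unfolding C_def by blast
  qed
  have sC: "sqi f" if "f \<in> C 0" for f using that s\<Phi> by (auto simp: C_def P_def)
  have bC: "sqint f \<le> M + ((A + 1) + (B + 1))" if fC: "f \<in> C 0" for f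
  proof -
    obtain \<phi> where p: "P 0 \<phi>" "f = \<Phi> \<phi>" using fC unfolding C_def by blast
    have t: "test_fun U \<phi>" using p by (auto simp: P_def)
    show ?thesis using p(1) st[OF t, THEN sqi_integrable] unfolding p(2) n\<Phi> P_def by simp
  qed
  obtain X Y where XY: "\<And>n. X n \<in> C n" "L2to X Y"
    by (rule convex_minimisers_Cauchy[of C, OF ne dec mid sC bC]) (assumption+, rule that)
  have "\<forall>n. \<exists>\<phi>. P n \<phi> \<and> X n = \<Phi> \<phi>" using XY(1) unfolding C_def by blast
  then obtain \<xi> where \<xi>: "\<And>n. P n (\<xi> n)" "\<And>n. X n = \<Phi> (\<xi> n)" by metis
  define u where "u x = fst (Y x)" for x
  define g where "g x = fst (snd (Y x))" for x
  define v where "v x = snd (snd (Y x))" for x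
  have L1: "L2to \<xi> u" using L2to_fst[OF XY(2)] unfolding \<xi>(2) \<Phi>_def u_def by simp
  have L2: "L2to (\<lambda>n. cgrad (\<xi> n)) g" using L2to_fst[OF L2to_snd[OF XY(2)]] unfolding \<xi>(2) \<Phi>_def g_def by simp
  have L3: "L2to (\<lambda>n x. sqrt (V x) * \<xi> n x) v" using L2to_snd[OF L2to_snd[OF XY(2)]] unfolding \<xi>(2) \<Phi>_def v_def by simp
  have \<xi>t: "test_fun U (\<xi> n)" for n using \<xi>(1) by (simp add: P_def)
  have L4: "L2to (\<lambda>n x. wt x * \<xi> n x) F" unfolding L2to_def
  proof (intro conjI allI sF)
    show "sqi (\<lambda>x. wt x * \<xi> n x)" for n by (rule st(4)[OF \<xi>t])
    show "(\<lambda>n. \<integral>x. (norm (wt x * \<xi> n x - F x))\<^sup>2 \<partial>lebesgue) \<longlonglongrightarrow> 0"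
      by (rule tendsto_zero_le[OF _ _ LIMSEQ_Suc[OF lim_1_over_n]]) (use \<xi>(1) in \<open>auto simp: P_def\<close>)
  qed
  obtain r where r: "strict_mono r" "AE x in lebesgue. (\<lambda>n. X (r n) x) \<longlonglongrightarrow> Y x" by (rule L2to_AE_subseq[OF XY(2)])
  obtain r' where r': "strict_mono r'" "AE x in lebesgue. (\<lambda>n. wt x * \<xi> (r' n) x) \<longlonglongrightarrow> F x" by (rule L2to_AE_subseq[OF L4])
  obtain r2 where r2: "strict_mono r2" "AE x in lebesgue. (\<lambda>n. \<xi> (r' (r2 n)) x) \<longlonglongrightarrow> u x"
    by (rule L2to_AE_subseq[OF L2to_subseq[OF L1 r'(1)]])
  \<comment> \<open>The near-minimisers tend to F in weighted form and to u without weight, so F =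
    wt u. Dividing by the positive weight then identifies the limit of the original subsequence with
    u.\<close>
  have Feq: "AE x in lebesgue. F x = wt x * u x"
    using r'(2) r2(2)
  proof eventually_elim
    case (elim x)
    have "(\<lambda>n. wt x * \<xi> (r' (r2 n)) x) \<longlonglongrightarrow> F x" using LIMSEQ_subseq_LIMSEQ[OF elim(1) r2(1)] by (simp add: o_def)
    moreover have "(\<lambda>n. wt x * \<xi> (r' (r2 n)) x) \<longlonglongrightarrow> wt x * u x" by (intro tendsto_intros elim)
    ultimately show ?case by (rule LIMSEQ_unique)
  qed
  have ua: "AE x in lebesgue. (\<lambda>n. \<xi> (r n) x) \<longlonglongrightarrow> u x"
    using r(2) by eventually_elim (auto simp: \<xi>(2) \<Phi>_def u_def dest: tendsto_fst)
  have va: "AE x in lebesgue. v x = sqrt (V x) * u x"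
    using r(2) ua
  proof eventually_elim
    case (elim x)
    have "(\<lambda>n. sqrt (V x) * \<xi> (r n) x) \<longlonglongrightarrow> v x"
      using tendsto_snd[OF tendsto_snd[OF elim(1)]] by (simp add: \<xi>(2) \<Phi>_def v_def)
    moreover have "(\<lambda>n. sqrt (V x) * \<xi> (r n) x) \<longlonglongrightarrow> sqrt (V x) * u x" by (intro tendsto_intros elim)
    ultimately show ?case by (rule LIMSEQ_unique)
  qed
  have um: "u \<in> borel_measurable lebesgue" using L2to_sqi(2)[OF L1] by (rule sqi_measurable)
  have L5: "L2to (\<lambda>n x. sqrt (V x) * \<xi> n x) (\<lambda>x. sqrt (V x) * u x)"
    by (rule L2to_cong_AE[OF L3 va]) (use sVm um in auto)
  have lim1: "(\<lambda>n. K + 1 / real (Suc n)) \<longlonglongrightarrow> K" for K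
    using tendsto_add[OF tendsto_const[of K] LIMSEQ_Suc[OF lim_1_over_n]] by simp
  show ?thesis
  proof (rule that)
    show "strict_mono (\<lambda>n. s0 (s1 n))" using s0(1) s1(1) by (auto simp: strict_mono_def)
    show "nnapp U u g (\<lambda>n. \<xi> (r n))"
      unfolding nnapp_def using L2to_subseq[OF L1 r(1)] L2to_subseq[OF L2 r(1)] ua \<xi>(1) by (auto simp: P_def)
    show "AE x in lebesgue. (\<lambda>n. \<psi> (s0 (s1 n)) x) \<longlonglongrightarrow> u x"
      using s1(2) Feq
    proof eventually_elim
      case (elim x)
      note l = elim(1)[unfolded elim(2)]
      have "(\<lambda>n. inverse (wt x) * (wt x * \<psi> (s0 (s1 n)) x)) \<longlonglongrightarrow> inverse (wt x) * (wt x * u x)"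
        by (rule tendsto_mult[OF tendsto_const l])
      moreover have "inverse (wt x) * (wt x * t) = t" for t using wt_pos[of x] by simp
      ultimately show ?case by (simp only:)
    qed
    show "sqint g \<le> A"
      by (rule LIMSEQ_le[OF L2to_norm[OF L2] lim1]) (use \<xi>(1) in \<open>auto simp: P_def\<close>)
    show "L2to (\<lambda>n x. sqrt (V x) * \<xi> (r n) x) (\<lambda>x. sqrt (V x) * u x)" by (rule L2to_subseq[OF L5 r(1)])
    have "(\<integral>x. (norm (sqrt (V x) * u x))\<^sup>2 \<partial>lebesgue) \<le> B"
      by (rule LIMSEQ_le[OF L2to_norm[OF L5] lim1]) (use \<xi>(1) in \<open>auto simp: P_def\<close>)
    then show "wint V u \<le> B" by (simp add: power_mult_distrib V(2))
  qed
qed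

subsection \<open>Logarithmic test functions\<close>

lemma nnappD:
  assumes "nnapp U u g \<xi>"
  shows "test_fun U (\<xi> n)" "\<xi> n x \<ge> 0" "L2to \<xi> u" "L2to (\<lambda>n. cgrad (\<xi> n)) g"
    "AE x in lebesgue. (\<lambda>n. \<xi> n x) \<longlonglongrightarrow> u x" "sqi u" "sqi g" "u \<in> borel_measurable lebesgue" "g \<in> borel_measurable lebesgue"
    "AE x in lebesgue. u x \<ge> 0"
proof -
  show 1: "test_fun U (\<xi> n)" "\<xi> n x \<ge> 0" "L2to \<xi> u" "L2to (\<lambda>n. cgrad (\<xi> n)) g"
    "AE x in lebesgue. (\<lambda>n. \<xi> n x) \<longlonglongrightarrow> u x" for n x using assms by (auto simp: nnapp_def)
  show "sqi u" "sqi g" using L2to_sqi(2)[OF 1(3)] L2to_sqi(2)[OF 1(4)] by auto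
  then show "u \<in> borel_measurable lebesgue" "g \<in> borel_measurable lebesgue" by (auto simp: sqi_def)
  show "AE x in lebesgue. u x \<ge> 0"
    using 1(5) by eventually_elim (use 1(2) in \<open>auto intro: LIMSEQ_le_const\<close>)
qed

lemma test_fun_bounded:
  assumes "test_fun U \<phi>"
  obtains B where "B > 0" "\<And>x. \<bar>\<phi> x\<bar> \<le> B"
proof -
  obtain K where K: "compact K" "\<And>x. x \<notin> K \<Longrightarrow> \<phi> x = 0" using test_funE[OF assms] by metis
  show ?thesis using continuous_compact_bounded[OF test_fun_continuous[OF assms] K] that by auto
qed

lemma test_fun_quotient:
  assumes \<eta>: "test_fun U \<eta>" and \<psi>: "test_fun U \<psi>" "\<And>x. \<psi> x \<ge> 0" and \<delta>: "\<delta> > 0"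
  defines "\<theta> \<equiv> \<lambda>x. inverse (\<psi> x + \<delta>) * (\<eta> x)\<^sup>2"
  shows "test_fun U \<theta>"
    "cgrad \<theta> x = (2 * \<eta> x * inverse (\<psi> x + \<delta>)) *\<^sub>R cgrad \<eta> x + (- (\<eta> x * inverse (\<psi> x + \<delta>))\<^sup>2) *\<^sub>R cgrad \<psi> x"
proof -
  note s = test_fun_smooth[OF \<eta>] test_fun_smooth[OF \<psi>(1)]
  have pos: "\<psi> x + \<delta> > 0" for x using \<psi>(2)[of x] \<delta> by linarith
  have si: "smooth_on UNIV (\<lambda>x. inverse (\<psi> x + \<delta>))"
    by (intro smooth_on_inverse smooth_on_add smooth_on_const s pos)
  have t2: "test_fun U (\<lambda>x. (\<eta> x)\<^sup>2)" using test_fun_power[OF \<eta>, of 2] by simp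
  show "test_fun U \<theta>" unfolding \<theta>_def by (rule test_fun_mult[OF si t2])
  have g1: "cgrad (\<lambda>x. inverse (\<psi> x + \<delta>)) x = (- (inverse (\<psi> x + \<delta>))\<^sup>2) *\<^sub>R cgrad \<psi> x"
    by (rule cgrad_compose[OF s(2)]) (use pos[of x] in \<open>auto intro!: derivative_eq_intros simp: power2_eq_square\<close>)
  have g2: "cgrad (\<lambda>x. (\<eta> x)\<^sup>2) x = (2 * \<eta> x) *\<^sub>R cgrad \<eta> x"
    by (rule cgrad_compose[OF s(1)]) (auto intro!: derivative_eq_intros)
  show "cgrad \<theta> x = (2 * \<eta> x * inverse (\<psi> x + \<delta>)) *\<^sub>R cgrad \<eta> x + (- (\<eta> x * inverse (\<psi> x + \<delta>))\<^sup>2) *\<^sub>R cgrad \<psi> x"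
    unfolding \<theta>_def by (subst cgrad_mult[OF si test_fun_smooth[OF t2]]) (simp add: g1 g2 power_mult_distrib mult_ac)
qed

text \<open>Formally this is the equation tested with \<eta>^2 / (u + \<delta>). The test is carried
  out with \<xi> n in the denominator, where the quotient is a test function, and the limit is taken
  afterwards. The subtracted integral is that of \<eta>^2 |grad ln (u + \<delta>)|^2: the quantity
  to be bounded in the maximum principle, and the square that makes Picone's inequality
  work.\<close>

lemma log_identity:
  assumes app: "nnapp U u g \<xi>" and \<eta>: "test_fun U \<eta>" and \<delta>: "\<delta> > 0"
    and eq: "\<And>\<phi>. test_fun U \<phi> \<Longrightarrow> K * (\<integral>x. g x \<bullet> cgrad \<phi> x \<partial>lebesgue) = (\<integral>x. c x * \<phi> x \<partial>lebesgue)"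
    and c: "c \<in> borel_measurable lebesgue" "\<And>\<phi>. test_fun U \<phi> \<Longrightarrow> integrable lebesgue (\<lambda>x. c x * \<phi> x)"
  defines "m \<equiv> \<lambda>x. inverse (u x + \<delta>)"
  shows "sqi (\<lambda>x. (\<eta> x * m x) *\<^sub>R g x)" "integrable lebesgue (\<lambda>x. 2 * \<eta> x * m x * (g x \<bullet> cgrad \<eta> x))"
    "integrable lebesgue (\<lambda>x. c x * ((\<eta> x)\<^sup>2 * m x))"
    "K * ((\<integral>x. 2 * \<eta> x * m x * (g x \<bullet> cgrad \<eta> x) \<partial>lebesgue) - (\<integral>x. (norm ((\<eta> x * m x) *\<^sub>R g x))\<^sup>2 \<partial>lebesgue))
      = (\<integral>x. c x * ((\<eta> x)\<^sup>2 * m x) \<partial>lebesgue)"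
proof -
  note A = nnappD[OF app]
  obtain B where B: "B > 0" "\<And>x. \<bar>\<eta> x\<bar> \<le> B" using test_fun_bounded[OF \<eta>] by blast
  define mn where "mn n x = inverse (\<xi> n x + \<delta>)" for n x
  have mnb: "0 \<le> mn n x" "mn n x \<le> inverse \<delta>" for n x
    using A(2)[of n x] \<delta> unfolding mn_def by (auto intro!: le_imp_inverse_le)
  have mb: "AE x in lebesgue. 0 \<le> m x \<and> m x \<le> inverse \<delta>"
    using A(10) by eventually_elim (use \<delta> in \<open>auto simp: m_def intro!: le_imp_inverse_le\<close>)
  have [measurable]: "\<eta> \<in> borel_measurable lebesgue" by (rule test_fun_measurable[OF \<eta>])
  have [measurable]: "\<xi> n \<in> borel_measurable lebesgue" for n by (rule test_fun_measurable[OF A(1)])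
  note [measurable] = A(8) c(1)
  have mnm [measurable]: "mn n \<in> borel_measurable lebesgue" for n unfolding mn_def by measurable
  have mm [measurable]: "m \<in> borel_measurable lebesgue" unfolding m_def by measurable
  have mlim: "AE x in lebesgue. (\<lambda>n. mn n x) \<longlonglongrightarrow> m x"
    using A(5,10)
  proof eventually_elim
    case (elim x)
    then show ?case unfolding mn_def m_def using \<delta> by (intro tendsto_intros) auto
  qed
  have em: "\<bar>\<eta> x * mn n x\<bar> \<le> B * inverse \<delta>" for n x
    unfolding abs_mult using B(1) B(2)[of x] mnb[of n x] by (intro mult_mono) auto
  have em': "AE x in lebesgue. \<bar>\<eta> x * m x\<bar> \<le> B * inverse \<delta>"
    using mb by eventually_elim (unfold abs_mult, use B in \<open>auto intro!: mult_mono\<close>)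
  show s1: "sqi (\<lambda>x. (\<eta> x * m x) *\<^sub>R g x)" by (rule sqi_bounded_mult[OF A(7) _ em']) measurable
  have L1: "L2to (\<lambda>n x. (2 * \<eta> x * mn n x) *\<^sub>R cgrad \<eta> x) (\<lambda>x. (2 * \<eta> x * m x) *\<^sub>R cgrad \<eta> x)"
  proof (rule L2to_mult[OF L2to_const[OF sqi_cgrad[OF \<eta>]], where C="2 * (B * inverse \<delta>)"])
    show "\<bar>2 * \<eta> x * mn n x\<bar> \<le> 2 * (B * inverse \<delta>)" for n x using em[of x n] by (simp add: abs_mult)
    show "AE x in lebesgue. (\<lambda>n. 2 * \<eta> x * mn n x) \<longlonglongrightarrow> 2 * \<eta> x * m x"
      using mlim by eventually_elim (auto intro!: tendsto_intros)
  qed measurable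
  have L2: "L2to (\<lambda>n x. (- (\<eta> x * mn n x)\<^sup>2) *\<^sub>R cgrad (\<xi> n) x) (\<lambda>x. (- (\<eta> x * m x)\<^sup>2) *\<^sub>R g x)"
  proof (rule L2to_mult[OF A(4), where C="(B * inverse \<delta>)\<^sup>2"])
    show "\<bar>- (\<eta> x * mn n x)\<^sup>2\<bar> \<le> (B * inverse \<delta>)\<^sup>2" for n x
      using em[of x n] B(1) \<delta> power_mono[OF em abs_ge_zero, of x n 2] by simp
    show "AE x in lebesgue. (\<lambda>n. - (\<eta> x * mn n x)\<^sup>2) \<longlonglongrightarrow> - (\<eta> x * m x)\<^sup>2"
      using mlim by eventually_elim (auto intro!: tendsto_intros)
  qed measurable
  note L = L2to_inner[OF L2to_const[OF A(7)] L2to_add[OF L1 L2]]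
  define \<theta> where "\<theta> n x = inverse (\<xi> n x + \<delta>) * (\<eta> x)\<^sup>2" for n x
  note q = test_fun_quotient[OF \<eta> A(1,2) \<delta>, folded \<theta>_def]
  have c2: "integrable lebesgue (\<lambda>x. c x * (\<eta> x)\<^sup>2)"
    using c(2)[OF test_fun_power[OF \<eta>, of 2]] by simp
  have dom: "AE x in lebesgue. \<bar>c x * ((\<eta> x)\<^sup>2 * m x)\<bar> \<le> inverse \<delta> * \<bar>c x * (\<eta> x)\<^sup>2\<bar>"
    using mb
  proof eventually_elim
    case (elim x)
    have "\<bar>c x * (\<eta> x)\<^sup>2\<bar> * m x \<le> \<bar>c x * (\<eta> x)\<^sup>2\<bar> * inverse \<delta>" using elim by (intro mult_left_mono) auto
    then show ?case using elim by (simp add: abs_mult mult_ac)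
  qed
  have ci: "integrable lebesgue (\<lambda>x. inverse \<delta> * \<bar>c x * (\<eta> x)\<^sup>2\<bar>)" using c2 by simp
  show i3: "integrable lebesgue (\<lambda>x. c x * ((\<eta> x)\<^sup>2 * m x))"
    by (rule integrable_real_bound[OF ci _ dom]) measurable
  have R: "(\<lambda>n. \<integral>x. c x * \<theta> n x \<partial>lebesgue) \<longlonglongrightarrow> (\<integral>x. c x * ((\<eta> x)\<^sup>2 * m x) \<partial>lebesgue)"
  proof (rule integral_dominated_convergence[OF _ _ ci])
    show "AE x in lebesgue. (\<lambda>n. c x * \<theta> n x) \<longlonglongrightarrow> c x * ((\<eta> x)\<^sup>2 * m x)"
      using mlim
    proof eventually_elim
      case (elim x)
      have "(\<lambda>n. c x * (mn n x * (\<eta> x)\<^sup>2)) \<longlonglongrightarrow> c x * (m x * (\<eta> x)\<^sup>2)" by (intro tendsto_intros elim)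
      then show ?case by (simp add: \<theta>_def mn_def mult_ac)
    qed
    show "AE x in lebesgue. norm (c x * \<theta> n x) \<le> inverse \<delta> * \<bar>c x * (\<eta> x)\<^sup>2\<bar>" for n
    proof (rule AE_I2)
      fix x
      have "\<bar>c x * (\<eta> x)\<^sup>2\<bar> * mn n x \<le> \<bar>c x * (\<eta> x)\<^sup>2\<bar> * inverse \<delta>" using mnb by (intro mult_left_mono) auto
      then show "norm (c x * \<theta> n x) \<le> inverse \<delta> * \<bar>c x * (\<eta> x)\<^sup>2\<bar>"
        using mnb(1)[of n x] by (simp add: \<theta>_def mn_def abs_mult mult_ac)
    qed
    show "(\<lambda>x. c x * \<theta> n x) \<in> borel_measurable lebesgue" for n unfolding \<theta>_def by measurable
  qed measurable
  have "(\<integral>x. c x * \<theta> n x \<partial>lebesgue) = K * (\<integral>x. g x \<bullet> ((2 * \<eta> x * mn n x) *\<^sub>R cgrad \<eta> x + (- (\<eta> x * mn n x)\<^sup>2) *\<^sub>R cgrad (\<xi> n) x) \<partial>lebesgue)" for n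
    using eq[OF q(1)[of n]] unfolding q(2) mn_def by simp
  then have "(\<integral>x. c x * ((\<eta> x)\<^sup>2 * m x) \<partial>lebesgue) = K * (\<integral>x. g x \<bullet> ((2 * \<eta> x * m x) *\<^sub>R cgrad \<eta> x + (- (\<eta> x * m x)\<^sup>2) *\<^sub>R g x) \<partial>lebesgue)"
    using LIMSEQ_unique[OF R] tendsto_mult[OF tendsto_const[of K] L] by simp
  moreover have i1: "integrable lebesgue (\<lambda>x. g x \<bullet> ((2 * \<eta> x * m x) *\<^sub>R cgrad \<eta> x))"
    by (rule sqi_inner[OF A(7) L2to_sqi(2)[OF L1]])
  then show i1': "integrable lebesgue (\<lambda>x. 2 * \<eta> x * m x * (g x \<bullet> cgrad \<eta> x))" by simp
  have i2: "integrable lebesgue (\<lambda>x. (norm ((\<eta> x * m x) *\<^sub>R g x))\<^sup>2)" by (rule sqi_integrable[OF s1])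
  have "(\<integral>x. g x \<bullet> ((2 * \<eta> x * m x) *\<^sub>R cgrad \<eta> x + (- (\<eta> x * m x)\<^sup>2) *\<^sub>R g x) \<partial>lebesgue)
     = (\<integral>x. 2 * \<eta> x * m x * (g x \<bullet> cgrad \<eta> x) - (norm ((\<eta> x * m x) *\<^sub>R g x))\<^sup>2 \<partial>lebesgue)"
    by (intro Bochner_Integration.integral_cong refl)
       (simp add: inner_add_right inner_diff_right power_mult_distrib power2_norm_eq_inner)
  ultimately show "K * ((\<integral>x. 2 * \<eta> x * m x * (g x \<bullet> cgrad \<eta> x) \<partial>lebesgue) - (\<integral>x. (norm ((\<eta> x * m x) *\<^sub>R g x))\<^sup>2 \<partial>lebesgue))
      = (\<integral>x. c x * ((\<eta> x)\<^sup>2 * m x) \<partial>lebesgue)"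
    using i1' i2 by simp
qed

subsection \<open>The strong maximum principle\<close>

lemma ln_add_one_Lipschitz: "0 \<le> a \<Longrightarrow> 0 \<le> b \<Longrightarrow> \<bar>ln (1 + a) - ln (1 + b)\<bar> \<le> \<bar>a - b :: real\<bar>"
proof -
  have *: "ln (1 + a) - ln (1 + b) \<le> a - b" if "0 \<le> b" "b \<le> a" for a b :: real
  proof -
    have "ln (1 + a) - ln (1 + b) = ln ((1 + a) / (1 + b))" using that by (simp add: ln_div)
    also have "\<dots> \<le> (1 + a) / (1 + b) - 1" using that by (intro ln_le_minus_one) auto
    also have "\<dots> = (a - b) / (1 + b)" using that by (simp add: field_simps)
    also have "\<dots> \<le> a - b" using that mult_left_mono[of 1 "1 + b" "a - b"] by (simp add: divide_le_eq)
    finally show ?thesis .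
  qed
  assume "0 \<le> a" "0 \<le> b"
  then show ?thesis using *[of b a] *[of a b] by (cases "b \<le> a") (auto simp: abs_if)
qed

text \<open>The gradient of ln (1 + u / \<delta>) is g / (u + \<delta>), so on the ball, where
  \<eta> = 1, Poincare's inequality produces a part of the integral in \<open>log_identity\<close>.
  Dividing u by \<delta> makes the logarithm vanish where u does, and the Lipschitz bound for ln (1
  + t) gives the L2 convergence of the approximants. The constant is 4 (2r)^2, with 2r the
  diameter.\<close>

lemma log_Poincare:
  assumes app: "nnapp U u g \<xi>" and r: "r > 0" and \<delta>: "\<delta> > 0" and \<eta>: "\<And>x. x \<in> ball z r \<Longrightarrow> \<eta> x = 1"
    and s: "sqi (\<lambda>x. (\<eta> x * inverse (u x + \<delta>)) *\<^sub>R g x)"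
  defines "B \<equiv> ball z r" and "w \<equiv> \<lambda>x. ln (1 + u x / \<delta>)"
  shows "sqi (\<lambda>x. indicator B x * w x)"
    "measure lebesgue B * (\<integral>x. (indicator B x * w x)\<^sup>2 \<partial>lebesgue) \<le> (\<integral>x. indicator B x * w x \<partial>lebesgue)\<^sup>2
      + 16 * r\<^sup>2 * measure lebesgue B * (\<integral>x. (norm ((\<eta> x * inverse (u x + \<delta>)) *\<^sub>R g x))\<^sup>2 \<partial>lebesgue)"
proof -
  note A = nnappD[OF app]
  define wn where "wn n x = ln (1 + \<xi> n x / \<delta>)" for n x
  have [measurable]: "B \<in> sets lebesgue" "B \<in> sets borel" by (auto simp: B_def)
  have [measurable]: "\<xi> n \<in> borel_measurable lebesgue" for n by (rule test_fun_measurable[OF A(1)])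
  note [measurable] = A(8)
  have wm: "w \<in> borel_measurable lebesgue" unfolding w_def by measurable
  have pos: "1 + \<xi> n x / \<delta> > 0" for n x using A(2)[of n x] \<delta> by (simp add: add_pos_nonneg)
  have wt: "test_fun U (wn n)" for n
    unfolding wn_def
  proof (rule test_fun_vanish[OF _ A(1)[of n]])
    show "smooth_on UNIV (\<lambda>x. ln (1 + \<xi> n x / \<delta>))"
      using smooth_on_cmult[OF test_fun_smooth[OF A(1)[of n]], of "1/\<delta>"] pos[of n]
      by (intro smooth_on_ln smooth_on_add smooth_on_const) (auto simp: divide_inverse mult.commute)
  qed auto
  have wg: "cgrad (wn n) x = inverse (\<xi> n x + \<delta>) *\<^sub>R cgrad (\<xi> n) x" for n x
    unfolding wn_def
    by (rule cgrad_compose[OF test_fun_smooth[OF A(1)[of n]]])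
       (use pos[of n x] \<delta> A(2)[of n x] in \<open>auto intro!: derivative_eq_intros simp: field_simps add_nonneg_eq_0_iff\<close>)
  have bd: "\<bar>w x\<bar> \<le> inverse \<delta> * u x" "\<bar>wn n x - w x\<bar> \<le> inverse \<delta> * \<bar>\<xi> n x - u x\<bar>" if "u x \<ge> 0" for n x
  proof -
    show "\<bar>w x\<bar> \<le> inverse \<delta> * u x"
      using ln_add_one_Lipschitz[of "u x / \<delta>" 0] that \<delta> by (simp add: w_def divide_inverse mult.commute)
    show "\<bar>wn n x - w x\<bar> \<le> inverse \<delta> * \<bar>\<xi> n x - u x\<bar>"
    proof -
      have "\<bar>wn n x - w x\<bar> \<le> \<bar>\<xi> n x / \<delta> - u x / \<delta>\<bar>"
        unfolding w_def wn_def using that \<delta> A(2)[of n x] by (intro ln_add_one_Lipschitz) auto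
      also have "\<dots> = inverse \<delta> * \<bar>\<xi> n x - u x\<bar>"
        using \<delta> unfolding diff_divide_distrib[symmetric] abs_divide by (simp add: divide_inverse mult.commute)
      finally show ?thesis .
    qed
  qed
  have sw: "sqi w" unfolding sqi_def
  proof
    show "integrable lebesgue (\<lambda>x. (norm (w x))\<^sup>2)"
    proof (rule integrable_real_bound[of _ "\<lambda>x. (inverse \<delta>)\<^sup>2 * (norm (u x))\<^sup>2"])
      show "AE x in lebesgue. \<bar>(norm (w x))\<^sup>2\<bar> \<le> (inverse \<delta>)\<^sup>2 * (norm (u x))\<^sup>2"
        using A(10)
      proof eventually_elim
        case (elim x)
        have "(\<bar>w x\<bar>)\<^sup>2 \<le> (inverse \<delta> * u x)\<^sup>2" using bd(1)[OF elim] by (intro power_mono) auto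
        then show ?case by (simp add: power_mult_distrib)
      qed
    qed (use A(6) wm in \<open>auto simp: sqi_def\<close>)
  qed (rule wm)
  have L: "L2to wn w" unfolding L2to_def
  proof (intro conjI allI sw)
    show sn: "sqi (wn n)" for n by (rule sqi_test_fun[OF wt])
    show "(\<lambda>n. \<integral>x. (norm (wn n x - w x))\<^sup>2 \<partial>lebesgue) \<longlonglongrightarrow> 0"
    proof (rule tendsto_zero_le)
      have "(\<lambda>n. (inverse \<delta>)\<^sup>2 * (\<integral>x. (norm (\<xi> n x - u x))\<^sup>2 \<partial>lebesgue)) \<longlonglongrightarrow> (inverse \<delta>)\<^sup>2 * 0"
        by (intro tendsto_intros L2to_lim[OF A(3)])
      then show "(\<lambda>n. (inverse \<delta>)\<^sup>2 * (\<integral>x. (norm (\<xi> n x - u x))\<^sup>2 \<partial>lebesgue)) \<longlonglongrightarrow> 0" by simp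
      fix n
      have "(\<integral>x. (norm (wn n x - w x))\<^sup>2 \<partial>lebesgue) \<le> (\<integral>x. (inverse \<delta>)\<^sup>2 * (norm (\<xi> n x - u x))\<^sup>2 \<partial>lebesgue)"
      proof (rule integral_mono_AE)
        show "AE x in lebesgue. (norm (wn n x - w x))\<^sup>2 \<le> (inverse \<delta>)\<^sup>2 * (norm (\<xi> n x - u x))\<^sup>2"
          using A(10)
        proof eventually_elim
          case (elim x)
          have "(\<bar>wn n x - w x\<bar>)\<^sup>2 \<le> (inverse \<delta> * \<bar>\<xi> n x - u x\<bar>)\<^sup>2" using bd(2)[OF elim] by (intro power_mono) auto
          then show ?case by (simp add: power_mult_distrib)
        qed
        show "integrable lebesgue (\<lambda>x. (norm (wn n x - w x))\<^sup>2)" by (intro sqi_integrable sqi_diff sn sw)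
        show "integrable lebesgue (\<lambda>x. (inverse \<delta>)\<^sup>2 * (norm (\<xi> n x - u x))\<^sup>2)"
          by (intro integrable_mult_right sqi_integrable sqi_diff A sqi_test_fun[OF A(1)])
      qed
      then show "(\<integral>x. (norm (wn n x - w x))\<^sup>2 \<partial>lebesgue) \<le> (inverse \<delta>)\<^sup>2 * (\<integral>x. (norm (\<xi> n x - u x))\<^sup>2 \<partial>lebesgue)" by simp
    qed simp
  qed
  have LB: "L2to (\<lambda>n x. indicator B x *\<^sub>R wn n x) (\<lambda>x. indicator B x *\<^sub>R w x)"
    by (rule L2to_mult[OF L, where C=1]) (auto simp: indicator_def)
  have Lg: "L2to (\<lambda>n x. (indicator B x * inverse (\<xi> n x + \<delta>)) *\<^sub>R cgrad (\<xi> n) x) (\<lambda>x. (indicator B x * inverse (u x + \<delta>)) *\<^sub>R g x)"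
  proof (rule L2to_mult[OF A(4), where C="inverse \<delta>"])
    fix n x show "\<bar>indicator B x * inverse (\<xi> n x + \<delta>)\<bar> \<le> inverse \<delta>"
      using A(2)[of n x] \<delta> by (auto simp: indicator_def intro!: le_imp_inverse_le)
  next
    show "AE x in lebesgue. (\<lambda>n. indicator B x * inverse (\<xi> n x + \<delta>)) \<longlonglongrightarrow> indicator B x * inverse (u x + \<delta>)"
      using A(5,10)
    proof eventually_elim
      case (elim x) then show ?case using \<delta> by (intro tendsto_intros) auto
    qed
  qed measurable
  show sB: "sqi (\<lambda>x. indicator B x * w x)" using L2to_sqi(2)[OF LB] by simp
  have finB: "integrable lebesgue (indicator B :: R3 \<Rightarrow> real)"
    using lmeasurable_ball[of z r] unfolding B_def by (intro integrable_real_indicator) (auto simp: fmeasurable_def)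
  have si: "sqi (indicator B :: R3 \<Rightarrow> real)" unfolding sqi_def
  proof
    have "(\<lambda>x. (norm (indicator B x :: real))\<^sup>2) = indicator B" by (auto simp: indicator_def)
    then show "integrable lebesgue (\<lambda>x. (norm (indicator B x :: real))\<^sup>2)" using finB by simp
  qed measurable
  have lim1: "(\<lambda>n. \<integral>x. indicator B x * wn n x \<partial>lebesgue) \<longlonglongrightarrow> (\<integral>x. indicator B x * w x \<partial>lebesgue)"
    using L2to_inner[OF L2to_const[OF si] L] by simp
  have lim2: "(\<lambda>n. \<integral>x. indicator B x * (wn n x)\<^sup>2 \<partial>lebesgue) \<longlonglongrightarrow> (\<integral>x. (indicator B x * w x)\<^sup>2 \<partial>lebesgue)"
  proof -
    have "(norm (indicator B x *\<^sub>R t))\<^sup>2 = indicator B x * t\<^sup>2" for x and t :: real by (auto simp: indicator_def)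
    then show ?thesis using L2to_norm[OF LB] by simp
  qed
  have lim3: "(\<lambda>n. \<integral>x. indicator B x * (norm (cgrad (wn n) x))\<^sup>2 \<partial>lebesgue) \<longlonglongrightarrow> (\<integral>x. (norm ((indicator B x * inverse (u x + \<delta>)) *\<^sub>R g x))\<^sup>2 \<partial>lebesgue)"
  proof -
    have "indicator B x * (norm (cgrad (wn n) x))\<^sup>2 = (norm ((indicator B x * inverse (\<xi> n x + \<delta>)) *\<^sub>R cgrad (\<xi> n) x))\<^sup>2" for n x
      unfolding wg by (auto simp: indicator_def)
    then show ?thesis using L2to_norm[OF Lg] by simp
  qed
  have "measure lebesgue B * (\<integral>x. indicator B x * (wn n x)\<^sup>2 \<partial>lebesgue) \<le> (\<integral>x. indicator B x * wn n x \<partial>lebesgue)\<^sup>2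
      + 4 * (2 * r)\<^sup>2 * measure lebesgue B * (\<integral>x. indicator B x * (norm (cgrad (wn n) x))\<^sup>2 \<partial>lebesgue)" for n
  proof (rule Poincare_variance[OF wt])
    fix x y assume "x \<in> B" "y \<in> B"
    then show "dist x y \<le> 2 * r" unfolding B_def mem_ball using dist_triangle3[of x y z] by linarith
  qed (auto simp: B_def)
  then have "measure lebesgue B * (\<integral>x. (indicator B x * w x)\<^sup>2 \<partial>lebesgue) \<le> (\<integral>x. indicator B x * w x \<partial>lebesgue)\<^sup>2
      + 4 * (2 * r)\<^sup>2 * measure lebesgue B * (\<integral>x. (norm ((indicator B x * inverse (u x + \<delta>)) *\<^sub>R g x))\<^sup>2 \<partial>lebesgue)"
    by (intro LIMSEQ_le[OF tendsto_mult[OF tendsto_const lim2] tendsto_add[OF tendsto_power[OF lim1] tendsto_mult[OF tendsto_const lim3]]]) blast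
  also have "(\<integral>x. (norm ((indicator B x * inverse (u x + \<delta>)) *\<^sub>R g x))\<^sup>2 \<partial>lebesgue) \<le> (\<integral>x. (norm ((\<eta> x * inverse (u x + \<delta>)) *\<^sub>R g x))\<^sup>2 \<partial>lebesgue)"
  proof (rule integral_mono[OF sqi_integrable[OF L2to_sqi(2)[OF Lg]] sqi_integrable[OF s]])
    fix x show "(norm ((indicator B x * inverse (u x + \<delta>)) *\<^sub>R g x))\<^sup>2 \<le> (norm ((\<eta> x * inverse (u x + \<delta>)) *\<^sub>R g x))\<^sup>2"
      using \<eta>[of x] by (cases "x \<in> B") (auto simp: B_def)
  qed
  finally show "measure lebesgue B * (\<integral>x. (indicator B x * w x)\<^sup>2 \<partial>lebesgue) \<le> (\<integral>x. indicator B x * w x \<partial>lebesgue)\<^sup>2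
      + 16 * r\<^sup>2 * measure lebesgue B * (\<integral>x. (norm ((\<eta> x * inverse (u x + \<delta>)) *\<^sub>R g x))\<^sup>2 \<partial>lebesgue)"
    by (simp add: mult_left_mono power_mult_distrib)
qed

text \<open>The logarithmic gradient is bounded independently of \<delta>. If u vanishes on a part
  ZB of the ball B with positive measure, so does w = ln (1 + u / \<delta>), and Cauchy-Schwarz on
  the rest bounds the squared mean in Poincare's inequality by |B| - |ZB| times the integral of w^2.
  Hence that integral stays bounded as \<delta> tends to 0, whereas w tends to infinity wherever u >
  0. The condition |c| <= c0 u with c0 locally integrable admits the unbounded weight f.\<close>

lemma maximum_principle_ball:
  assumes app: "nnapp U u g \<xi>" and U: "open U" and K: "K > 0"
    and eq: "\<And>\<phi>. test_fun U \<phi> \<Longrightarrow> K * (\<integral>x. g x \<bullet> cgrad \<phi> x \<partial>lebesgue) = (\<integral>x. c x * \<phi> x \<partial>lebesgue)"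
    and c: "c \<in> borel_measurable lebesgue" "\<And>\<phi>. test_fun U \<phi> \<Longrightarrow> integrable lebesgue (\<lambda>x. c x * \<phi> x)"
    and c0: "\<And>\<phi>. test_fun U \<phi> \<Longrightarrow> integrable lebesgue (\<lambda>x. c0 x * \<phi> x)" "AE x in lebesgue. \<bar>c x\<bar> \<le> c0 x * u x"
      "\<And>x. c0 x \<ge> 0"
    and r: "r > 0" "cball z r \<subseteq> U" and Z: "\<not> (AE x in lebesgue. x \<in> ball z r \<longrightarrow> u x \<noteq> 0)"
  shows "AE x in lebesgue. x \<in> ball z r \<longrightarrow> u x = 0"
proof -
  note A = nnappD[OF app]
  note [measurable] = A(8)
  obtain \<eta> where \<eta>: "test_fun U \<eta>" "\<And>x. 0 \<le> \<eta> x" "\<And>x. \<eta> x \<le> 1" "\<And>x. x \<in> cball z r \<Longrightarrow> \<eta> x = 1"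
    using cutoff_exists[OF compact_cball U r(2)] by metis
  have \<eta>1: "\<And>x. x \<in> ball z r \<Longrightarrow> \<eta> x = 1" using \<eta>(4) by auto
  have c02: "integrable lebesgue (\<lambda>x. c0 x * (\<eta> x)\<^sup>2)" using c0(1)[OF test_fun_power[OF \<eta>(1), of 2]] by simp
  define B where "B = ball z r"
  \<comment> \<open>The bound that remains for the logarithmic gradient once half of it, lost to
    Young's inequality, has been moved to the left and K divided out. It does not contain
    \<delta>.\<close>
  define M where "M = 4 * sqint (cgrad \<eta>) + 2 / K * (\<integral>x. c0 x * (\<eta> x)\<^sup>2 \<partial>lebesgue)"
  have Bm [measurable]: "B \<in> sets lebesgue" by (auto simp: B_def)
  define ZB where "ZB = {x \<in> B. u x = 0}"
  have ZBm [measurable]: "ZB \<in> sets lebesgue"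
  proof -
    have "ZB = B \<inter> {x \<in> space lebesgue. u x = 0}" by (auto simp: ZB_def)
    also have "\<dots> \<in> sets lebesgue" by measurable
    finally show ?thesis .
  qed
  have finB: "B \<in> lmeasurable" by (simp add: B_def)
  have finZ: "ZB \<in> lmeasurable" by (rule fmeasurableI2[OF finB]) (auto simp: ZB_def)
  have mB: "measure lebesgue B \<ge> 0" by simp
  have mZ: "measure lebesgue ZB > 0"
  proof (rule ccontr)
    assume "\<not> measure lebesgue ZB > 0"
    then have "measure lebesgue ZB = 0" using measure_nonneg[of lebesgue ZB] by linarith
    then have "ZB \<in> null_sets lebesgue" using emeasure_eq_measure2[OF finZ] by (intro null_setsI) auto
    then have "AE x in lebesgue. x \<notin> ZB" by (rule AE_not_in)
    then show False using Z by (auto simp: ZB_def B_def elim!: eventually_mono)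
  qed
  have key: "measure lebesgue ZB * (\<integral>x. (indicator B x * ln (1 + u x / \<delta>))\<^sup>2 \<partial>lebesgue) \<le> 16 * r\<^sup>2 * measure lebesgue B * M" if \<delta>: "\<delta> > 0" for \<delta>
  proof -
    note LI = log_identity[OF app \<eta>(1) \<delta> eq c]
    define m where "m x = inverse (u x + \<delta>)" for x
    define E where "E = (\<integral>x. (norm ((\<eta> x * m x) *\<^sub>R g x))\<^sup>2 \<partial>lebesgue)"
    have iE: "integrable lebesgue (\<lambda>x. (norm ((\<eta> x * m x) *\<^sub>R g x))\<^sup>2)" using sqi_integrable[OF LI(1)] by (simp add: m_def)
    have b1: "(\<integral>x. 2 * \<eta> x * m x * (g x \<bullet> cgrad \<eta> x) \<partial>lebesgue) \<le> 1/2 * E + 2 * sqint (cgrad \<eta>)"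
    proof -
      have "(\<integral>x. 2 * \<eta> x * m x * (g x \<bullet> cgrad \<eta> x) \<partial>lebesgue) \<le> (\<integral>x. 1/2 * (norm ((\<eta> x * m x) *\<^sub>R g x))\<^sup>2 + 2 * (norm (cgrad \<eta> x))\<^sup>2 \<partial>lebesgue)"
      proof (rule integral_mono)
        show "integrable lebesgue (\<lambda>x. 2 * \<eta> x * m x * (g x \<bullet> cgrad \<eta> x))" using LI(2) by (simp add: m_def)
        show "integrable lebesgue (\<lambda>x. 1/2 * (norm ((\<eta> x * m x) *\<^sub>R g x))\<^sup>2 + 2 * (norm (cgrad \<eta> x))\<^sup>2)"
          using iE sqi_integrable[OF sqi_cgrad[OF \<eta>(1)]] by simp
        fix x
        define a where "a = (\<eta> x * m x) *\<^sub>R g x"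
        have "2 * \<eta> x * m x * (g x \<bullet> cgrad \<eta> x) = 2 * (a \<bullet> cgrad \<eta> x)" by (simp add: a_def)
        also have "\<dots> \<le> 2 * (norm a * norm (cgrad \<eta> x))" using norm_cauchy_schwarz[of a "cgrad \<eta> x"] by simp
        also have "\<dots> \<le> 1/2 * (norm a)\<^sup>2 + 2 * (norm (cgrad \<eta> x))\<^sup>2"
          using sum_squares_bound[of "norm a" "2 * norm (cgrad \<eta> x)"] by (simp add: power_mult_distrib)
        finally show "2 * \<eta> x * m x * (g x \<bullet> cgrad \<eta> x) \<le> 1/2 * (norm ((\<eta> x * m x) *\<^sub>R g x))\<^sup>2 + 2 * (norm (cgrad \<eta> x))\<^sup>2"
          by (simp add: a_def)
      qed
      also have "\<dots> = 1/2 * E + 2 * sqint (cgrad \<eta>)"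
        using iE sqi_integrable[OF sqi_cgrad[OF \<eta>(1)]] by (simp add: E_def)
      finally show ?thesis .
    qed
    \<comment> \<open>Here \<delta> disappears because |c| <= c0 u and u / (u + \<delta>) <=
      1.\<close>
    have b2: "- (\<integral>x. c x * ((\<eta> x)\<^sup>2 * m x) \<partial>lebesgue) \<le> (\<integral>x. c0 x * (\<eta> x)\<^sup>2 \<partial>lebesgue)"
    proof -
      have "(\<integral>x. - (c x * ((\<eta> x)\<^sup>2 * m x)) \<partial>lebesgue) \<le> (\<integral>x. c0 x * (\<eta> x)\<^sup>2 \<partial>lebesgue)"
      proof (rule integral_mono_AE)
        show "AE x in lebesgue. - (c x * ((\<eta> x)\<^sup>2 * m x)) \<le> c0 x * (\<eta> x)\<^sup>2"
          using c0(2) A(10)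
        proof eventually_elim
          case (elim x)
          have m: "m x \<ge> 0" "u x * m x \<le> 1" using elim \<delta> by (auto simp: m_def field_simps)
          have "- (c x * ((\<eta> x)\<^sup>2 * m x)) \<le> \<bar>c x\<bar> * ((\<eta> x)\<^sup>2 * m x)"
            using m mult_right_mono[of "- c x" "\<bar>c x\<bar>" "(\<eta> x)\<^sup>2 * m x"] by simp
          also have "\<dots> \<le> (c0 x * u x) * ((\<eta> x)\<^sup>2 * m x)" using elim m by (intro mult_right_mono) auto
          also have "\<dots> = c0 x * (\<eta> x)\<^sup>2 * (u x * m x)" by simp
          also have "\<dots> \<le> c0 x * (\<eta> x)\<^sup>2 * 1" using m c0(3)[of x] by (intro mult_left_mono) auto
          finally show ?case by simp
        qed
      qed (use LI(3) c02 in \<open>auto simp: m_def\<close>)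
      then show ?thesis by simp
    qed
    have LI4: "K * ((\<integral>x. 2 * \<eta> x * m x * (g x \<bullet> cgrad \<eta> x) \<partial>lebesgue) - E) = (\<integral>x. c x * ((\<eta> x)\<^sup>2 * m x) \<partial>lebesgue)"
      using LI(4) by (simp add: m_def E_def)
    have gen: "x - y = z \<Longrightarrow> x \<le> a \<Longrightarrow> - z \<le> b \<Longrightarrow> y \<le> a + b" for x y z a b :: real by linarith
    from LI4[unfolded right_diff_distrib] have "K * E \<le> K * (1/2 * E + 2 * sqint (cgrad \<eta>)) + (\<integral>x. c0 x * (\<eta> x)\<^sup>2 \<partial>lebesgue)"
      using mult_left_mono[OF b1 less_imp_le[OF K]] b2 gen by blast
    then have EM: "E \<le> M" unfolding M_def using K by (simp add: field_simps)
    define w where "w x = ln (1 + u x / \<delta>)" for x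
    have LP: "sqi (\<lambda>x. indicator B x * w x)" "measure lebesgue B * (\<integral>x. (indicator B x * w x)\<^sup>2 \<partial>lebesgue) \<le> (\<integral>x. indicator B x * w x \<partial>lebesgue)\<^sup>2
      + 16 * r\<^sup>2 * measure lebesgue B * E"
      using log_Poincare[OF app r(1) \<delta> \<eta>1 LI(1)] by (auto simp: B_def w_def E_def m_def)
    define I2 where "I2 = (\<integral>x. (indicator B x * w x)\<^sup>2 \<partial>lebesgue)"
    have finP: "B - ZB \<in> lmeasurable" using finB ZBm by (rule fmeasurable_Diff)
    have iP: "integrable lebesgue (indicator (B - ZB) :: R3 \<Rightarrow> real)" using finP by (intro integrable_real_indicator) (auto simp: fmeasurable_def)
    have iPn: "(\<lambda>x. (norm (indicator (B - ZB) x :: real))\<^sup>2) = indicator (B - ZB)" by (auto simp: indicator_def)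
    have sP: "sqi (indicator (B - ZB) :: R3 \<Rightarrow> real)" unfolding sqi_def iPn using iP by auto
    \<comment> \<open>Since w vanishes on ZB, its integral over B is a scalar product with the
      indicator of B - ZB; this is where the measure of the zero set is gained.\<close>
    have "(\<integral>x. indicator B x * w x \<partial>lebesgue) = (\<integral>x. indicator (B - ZB) x \<bullet> (indicator B x * w x) \<partial>lebesgue)"
      by (intro Bochner_Integration.integral_cong) (auto simp: ZB_def w_def indicator_def)
    then have "(\<integral>x. indicator B x * w x \<partial>lebesgue)\<^sup>2 \<le> measure lebesgue (B - ZB) * I2"
      using sqi_Cauchy_Schwarz[OF sP LP(1)] finP unfolding iPn I2_def by simp
    also have "measure lebesgue (B - ZB) = measure lebesgue B - measure lebesgue ZB"
      using finB finZ by (intro measure_Diff) (auto simp: ZB_def fmeasurable_def)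
    finally have "measure lebesgue ZB * I2 \<le> 16 * r\<^sup>2 * measure lebesgue B * E"
      using LP(2) unfolding I2_def[symmetric] by (simp add: left_diff_distrib)
    also have "\<dots> \<le> 16 * r\<^sup>2 * measure lebesgue B * M" using EM by (intro mult_left_mono) auto
    finally show ?thesis by (simp add: I2_def w_def)
  qed
  define M' where "M' = 16 * r\<^sup>2 * measure lebesgue B * M / measure lebesgue ZB"
  have small: "AE x in lebesgue. x \<in> B \<longrightarrow> u x < \<epsilon>" if \<epsilon>: "\<epsilon> > 0" for \<epsilon>
  proof -
    define P where "P = {x \<in> B. u x \<ge> \<epsilon>}"
    have Pm: "P \<in> sets lebesgue"
    proof -
      have "P = B \<inter> {x \<in> space lebesgue. u x \<ge> \<epsilon>}" by (auto simp: P_def)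
      also have "\<dots> \<in> sets lebesgue" by measurable
      finally show ?thesis .
    qed
    have finP: "P \<in> lmeasurable" by (rule fmeasurableI2[OF finB _ Pm]) (auto simp: P_def)
    have R: "measure lebesgue P * R\<^sup>2 \<le> M'" if R: "R > 0" for R
    proof -
      \<comment> \<open>With this choice u >= \<epsilon> implies 1 + u / \<delta> >= exp R, so the
        logarithm is at least R on P, while the bound in \<open>key\<close> is free of
        \<delta>.\<close>
      define \<delta> where "\<delta> = \<epsilon> * exp (- R)"
      have \<delta>: "\<delta> > 0" using \<epsilon> by (simp add: \<delta>_def)
      note LI = log_identity[OF app \<eta>(1) \<delta> eq c]
      have sw: "sqi (\<lambda>x. indicator B x * ln (1 + u x / \<delta>))"
        using log_Poincare(1)[OF app r(1) \<delta> \<eta>1 LI(1)] by (simp add: B_def)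
      have "measure lebesgue P * R\<^sup>2 = (\<integral>x. indicator P x * R\<^sup>2 \<partial>lebesgue)"
        using finP by simp
      also have "\<dots> \<le> (\<integral>x. (norm (indicator B x * ln (1 + u x / \<delta>)))\<^sup>2 \<partial>lebesgue)"
      proof (rule integral_mono[OF _ sqi_integrable[OF sw]])
        show "integrable lebesgue (\<lambda>x. indicator P x * R\<^sup>2)" using finP by (intro integrable_mult_left integrable_real_indicator) (auto simp: fmeasurable_def)
        fix x
        show "indicator P x * R\<^sup>2 \<le> (norm (indicator B x * ln (1 + u x / \<delta>)))\<^sup>2"
        proof (cases "x \<in> P")
          case True
          have "exp R = \<epsilon> / \<delta>" using \<epsilon> by (simp add: \<delta>_def exp_minus divide_inverse)
          also have "\<dots> \<le> 1 + u x / \<delta>" using True \<delta> by (simp add: P_def divide_right_mono add_increasing)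
          finally have "R \<le> ln (1 + u x / \<delta>)" by (metis exp_gt_zero ln_exp ln_mono order_less_le_trans)
          then have "R\<^sup>2 \<le> (ln (1 + u x / \<delta>))\<^sup>2" using R by (intro power_mono) auto
          then show ?thesis using True by (simp add: P_def)
        qed simp
      qed
      also have "\<dots> = (\<integral>x. (indicator B x * ln (1 + u x / \<delta>))\<^sup>2 \<partial>lebesgue)" by simp
      also have "\<dots> \<le> M'" using key[OF \<delta>] mZ by (simp add: M'_def field_simps)
      finally show ?thesis .
    qed
    have "measure lebesgue P = 0"
    proof (rule ccontr)
      assume "measure lebesgue P \<noteq> 0"
      then have mp: "measure lebesgue P > 0" using measure_nonneg[of lebesgue P] by linarith
      have "M' \<ge> 0" using R[of 1] mp by simp
      then have "measure lebesgue P * (sqrt ((M' + 1) / measure lebesgue P))\<^sup>2 \<le> M'"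
        using mp by (intro R) auto
      then show False using mp \<open>M' \<ge> 0\<close> by simp
    qed
    then have "P \<in> null_sets lebesgue" using emeasure_eq_measure2[OF finP] Pm by (intro null_setsI) auto
    then have "AE x in lebesgue. x \<notin> P" by (rule AE_not_in)
    then show ?thesis by (auto simp: P_def elim!: eventually_mono)
  qed
  have "AE x in lebesgue. \<forall>n. x \<in> B \<longrightarrow> u x < 1 / real (Suc n)"
    unfolding AE_all_countable by (intro allI small) simp
  then show ?thesis using A(10)
  proof eventually_elim
    case (elim x)
    show ?case
    proof
      assume "x \<in> ball z r"
      then have *: "u x < 1 / real (Suc n)" for n using elim by (simp add: B_def)
      show "u x = 0"
      proof (rule ccontr)
        assume "u x \<noteq> 0"
        then have "u x > 0" using elim by simp
        then obtain n where "1 / real (Suc n) < u x" using nat_approx_posE by blast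
        then show False using *[of n] by simp
      qed
    qed
  qed
qed

text \<open>With a = (\<eta> / (u + \<delta>)) g, \<open>log_identity\<close> leaves the integral of
  2 a . grad \<eta> - |a|^2, which is at most |grad \<eta>|^2. As \<delta> tends to 0 the factor u /
  (u + \<delta>) tends to 1 on U, where u > 0. The inequality compares a positive eigenfunction with
  arbitrary test functions and so yields the uniqueness of the principal eigenvalue.\<close>

lemma Picone_inequality:
  assumes app: "nnapp U u g \<xi>" and \<eta>: "test_fun U \<eta>" and upos: "AE x in lebesgue. x \<in> U \<longrightarrow> u x > 0"
    and eq: "\<And>\<phi>. test_fun U \<phi> \<Longrightarrow> (\<integral>x. g x \<bullet> cgrad \<phi> x \<partial>lebesgue) = l * (\<integral>x. f x * u x * \<phi> x \<partial>lebesgue)"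
    and f: "f \<in> borel_measurable lebesgue" "\<And>\<phi>. test_fun U \<phi> \<Longrightarrow> integrable lebesgue (\<lambda>x. f x * u x * \<phi> x)"
      "\<And>\<phi>. test_fun U \<phi> \<Longrightarrow> integrable lebesgue (\<lambda>x. f x * \<phi> x)"
  shows "l * wint f \<eta> \<le> sqint (cgrad \<eta>)"
proof -
  note A = nnappD[OF app]
  note [measurable] = A(8) f(1)
  have [measurable]: "\<eta> \<in> borel_measurable lebesgue" by (rule test_fun_measurable[OF \<eta>])
  define \<delta> where "\<delta> n = 1 / real (Suc n)" for n
  have \<delta>: "\<delta> n > 0" for n by (simp add: \<delta>_def)
  have \<delta>0: "\<delta> \<longlonglongrightarrow> 0" unfolding \<delta>_def using LIMSEQ_Suc[OF lim_1_over_n] by simp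
  have eq': "1 * (\<integral>x. g x \<bullet> cgrad \<phi> x \<partial>lebesgue) = (\<integral>x. l * (f x * u x) * \<phi> x \<partial>lebesgue)" if "test_fun U \<phi>" for \<phi>
    using eq[OF that] by (simp add: mult.assoc)
  have ci: "integrable lebesgue (\<lambda>x. l * (f x * u x) * \<phi> x)" if "test_fun U \<phi>" for \<phi>
    using integrable_mult_right[of l, OF f(2)[OF that]] by (simp add: mult.assoc)
  have cm: "(\<lambda>x. l * (f x * u x)) \<in> borel_measurable lebesgue" by measurable
  note LI = log_identity[OF app \<eta> \<delta> eq' cm ci]
  have if2: "integrable lebesgue (\<lambda>x. f x * (\<eta> x)\<^sup>2)" using f(3)[OF test_fun_power[OF \<eta>, of 2]] by simp
  have "(\<lambda>n. \<integral>x. f x * (\<eta> x)\<^sup>2 * (u x * inverse (u x + \<delta> n)) \<partial>lebesgue) \<longlonglongrightarrow> wint f \<eta>"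
  proof (rule integral_dominated_convergence[where w="\<lambda>x. \<bar>f x * (\<eta> x)\<^sup>2\<bar>"])
    show "AE x in lebesgue. (\<lambda>n. f x * (\<eta> x)\<^sup>2 * (u x * inverse (u x + \<delta> n))) \<longlonglongrightarrow> f x * (\<eta> x)\<^sup>2"
      using upos
    proof eventually_elim
      case (elim x)
      show ?case
      proof (cases "x \<in> U")
        case True
        have "(\<lambda>n. f x * (\<eta> x)\<^sup>2 * (u x * inverse (u x + \<delta> n))) \<longlonglongrightarrow> f x * (\<eta> x)\<^sup>2 * (u x * inverse (u x + 0))"
          using elim True by (intro tendsto_intros \<delta>0) auto
        then show ?thesis using elim True by simp
      next
        case False then show ?thesis using test_fun_eq0_outside[OF \<eta>] by simp
      qed
    qed
    show "AE x in lebesgue. norm (f x * (\<eta> x)\<^sup>2 * (u x * inverse (u x + \<delta> n))) \<le> \<bar>f x * (\<eta> x)\<^sup>2\<bar>" for n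
      using A(10)
    proof eventually_elim
      case (elim x)
      have "0 \<le> u x * inverse (u x + \<delta> n)" "u x * inverse (u x + \<delta> n) \<le> 1" using elim \<delta>[of n] by (auto simp: field_simps)
      then have "\<bar>u x * inverse (u x + \<delta> n)\<bar> \<le> 1" by simp
      then show ?case unfolding real_norm_def abs_mult[of "f x * (\<eta> x)\<^sup>2"] by (intro mult_left_le) auto
    qed
  qed (use if2 in \<open>auto\<close>)
  moreover have "l * (\<integral>x. f x * (\<eta> x)\<^sup>2 * (u x * inverse (u x + \<delta> n)) \<partial>lebesgue) \<le> sqint (cgrad \<eta>)" for n
  proof -
    define a where "a x = (\<eta> x * inverse (u x + \<delta> n)) *\<^sub>R g x" for x
    have "l * (\<integral>x. f x * (\<eta> x)\<^sup>2 * (u x * inverse (u x + \<delta> n)) \<partial>lebesgue) = (\<integral>x. l * (f x * u x) * ((\<eta> x)\<^sup>2 * inverse (u x + \<delta> n)) \<partial>lebesgue)"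
      by (subst integral_mult_right_zero[symmetric]) (simp add: mult_ac)
    also have "\<dots> = (\<integral>x. 2 * \<eta> x * inverse (u x + \<delta> n) * (g x \<bullet> cgrad \<eta> x) \<partial>lebesgue) - sqint a"
      using LI(4)[of n] by (simp add: a_def)
    also have "\<dots> = (\<integral>x. 2 * \<eta> x * inverse (u x + \<delta> n) * (g x \<bullet> cgrad \<eta> x) - (norm (a x))\<^sup>2 \<partial>lebesgue)"
      using LI(2)[of n] sqi_integrable[OF LI(1)[of n]] unfolding a_def by simp
    also have "\<dots> \<le> sqint (cgrad \<eta>)"
    proof (rule integral_mono)
      show "integrable lebesgue (\<lambda>x. 2 * \<eta> x * inverse (u x + \<delta> n) * (g x \<bullet> cgrad \<eta> x) - (norm (a x))\<^sup>2)"
        using LI(2)[of n] sqi_integrable[OF LI(1)[of n]] unfolding a_def by simp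
      show "integrable lebesgue (\<lambda>x. (norm (cgrad \<eta> x))\<^sup>2)" by (rule sqi_integrable[OF sqi_cgrad[OF \<eta>]])
      fix x
      have "2 * \<eta> x * inverse (u x + \<delta> n) * (g x \<bullet> cgrad \<eta> x) = 2 * (a x \<bullet> cgrad \<eta> x)" by (simp add: a_def)
      also have "\<dots> \<le> 2 * (norm (a x) * norm (cgrad \<eta> x))" using norm_cauchy_schwarz[of "a x" "cgrad \<eta> x"] by simp
      also have "\<dots> \<le> (norm (a x))\<^sup>2 + (norm (cgrad \<eta> x))\<^sup>2" using sum_squares_bound[of "norm (a x)" "norm (cgrad \<eta> x)"] by simp
      finally show "2 * \<eta> x * inverse (u x + \<delta> n) * (g x \<bullet> cgrad \<eta> x) - (norm (a x))\<^sup>2 \<le> (norm (cgrad \<eta> x))\<^sup>2" by simp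
    qed
    finally show ?thesis .
  qed
  ultimately show ?thesis
    by (intro LIMSEQ_le_const2[OF tendsto_mult[OF tendsto_const]]) auto
qed

subsection \<open>Growth estimates\<close>

text \<open>The split is at the number R with R powr (p - q) = \<tau>: below it the lower power with
  a large constant suffices, above it the higher power with the small one.\<close>

lemma powr_interpolate:
  fixes p q \<tau> :: real
  assumes r: "0 \<le> r" "r < p" "p < q" and \<tau>: "\<tau> > 0"
  obtains K where "K \<ge> 0" "\<And>s. s > 0 \<Longrightarrow> s powr p \<le> K * s powr r + \<tau> * s powr q"
proof -
  define R where "R = \<tau> powr (1 / (p - q))"
  have R: "R > 0" using \<tau> by (simp add: R_def)
  show ?thesis
  proof (rule that[of "R powr (p - r)"])
    fix s :: real assume s: "s > 0"
    show "s powr p \<le> R powr (p - r) * s powr r + \<tau> * s powr q"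
    proof (cases "s \<le> R")
      case True
      have "s powr p = s powr (p - r) * s powr r" using s by (simp flip: powr_add)
      also have "\<dots> \<le> R powr (p - r) * s powr r" using True s r by (intro mult_right_mono powr_mono2) auto
      finally show ?thesis using \<tau> by (simp add: add_increasing2)
    next
      case False
      have "s powr p = s powr (p - q) * s powr q" using s by (simp flip: powr_add)
      also have "\<dots> \<le> R powr (p - q) * s powr q" using False R r by (intro mult_right_mono powr_mono2') auto
      also have "R powr (p - q) = \<tau>" using \<tau> r by (simp add: R_def powr_powr)
      finally show ?thesis by (simp add: add_increasing)
    qed
  qed simp
qed

lemma powr_interpolate_2:
  fixes p \<tau> :: real
  assumes "2 < p" "p < 6" "\<tau> > 0"
  obtains K where "K \<ge> 0" "\<And>s. \<bar>s\<bar> powr p \<le> K * s\<^sup>2 + \<tau> * s ^ 6"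
proof -
  obtain K where K: "K \<ge> 0" "\<And>s. s > 0 \<Longrightarrow> s powr p \<le> K * s powr 2 + \<tau> * s powr 6"
    using powr_interpolate[of 2 p 6 \<tau>] assms by auto
  show ?thesis
  proof (rule that[OF K(1)])
    fix s :: real
    show "\<bar>s\<bar> powr p \<le> K * s\<^sup>2 + \<tau> * s ^ 6"
      using K(2)[of "\<bar>s\<bar>"] by (cases "s = 0") (auto simp: powr_numeral power_even_abs)
  qed
qed

lemma powr_interpolate_4:
  fixes p \<tau> :: real
  assumes "2 < p" "p < 4" "\<tau> > 0"
  obtains K where "K \<ge> 0" "\<And>s. \<bar>s\<bar> powr p \<le> K * s\<^sup>2 + \<tau> * s ^ 4"
proof -
  obtain K where K: "K \<ge> 0" "\<And>s. s > 0 \<Longrightarrow> s powr p \<le> K * s powr 2 + \<tau> * s powr 4"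
    using powr_interpolate[of 2 p 4 \<tau>] assms by auto
  show ?thesis
  proof (rule that[OF K(1)])
    fix s :: real
    show "\<bar>s\<bar> powr p \<le> K * s\<^sup>2 + \<tau> * s ^ 4"
      using K(2)[of "\<bar>s\<bar>"] by (cases "s = 0") (auto simp: powr_numeral power_even_abs)
  qed
qed

lemma powr_interpolate_0:
  fixes p \<tau> :: real
  assumes "0 < p" "p < 6" "\<tau> > 0"
  obtains K where "K \<ge> 0" "\<And>s. \<bar>s\<bar> powr p \<le> K + \<tau> * s ^ 6"
proof -
  obtain K where K: "K \<ge> 0" "\<And>s. s > 0 \<Longrightarrow> s powr p \<le> K * s powr 0 + \<tau> * s powr 6"
    using powr_interpolate[of 0 p 6 \<tau>] assms by auto
  show ?thesis
  proof (rule that[OF K(1)])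
    fix s :: real
    show "\<bar>s\<bar> powr p \<le> K + \<tau> * s ^ 6"
      using K(2)[of "\<bar>s\<bar>"] K(1) by (cases "s = 0") (auto simp: powr_numeral power_even_abs)
  qed
qed

lemma abs_powr_le_2_6: "2 \<le> p \<Longrightarrow> p \<le> 6 \<Longrightarrow> \<bar>s\<bar> powr p \<le> s\<^sup>2 + s ^ 6" for s p :: real
proof (cases "s = 0")
  case False
  assume p: "2 \<le> p" "p \<le> 6"
  show ?thesis
  proof (cases "\<bar>s\<bar> \<le> 1")
    case True
    have "\<bar>s\<bar> powr p \<le> \<bar>s\<bar> powr 2" using p True False by (intro powr_mono') auto
    then show ?thesis using False by (simp add: powr_numeral add_increasing2)
  next
    case f: False
    have "\<bar>s\<bar> powr p \<le> \<bar>s\<bar> powr 6" using p f by (intro powr_mono) auto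
    then show ?thesis using False by (simp add: powr_numeral power_even_abs add_increasing)
  qed
qed simp

text \<open>A pointwise substitute for Hoelder's inequality with exponents 3/2 and 3: if t <= \<tau>
  s^4 the sixth power bounds the product, otherwise s^2 is below sqrt (t / \<tau>). The free
  parameter gives smallness in limits and, when optimised, the right scaling.\<close>

lemma weight_square_le:
  fixes t s \<tau> :: real
  assumes "t \<ge> 0" "\<tau> > 0"
  shows "t * s\<^sup>2 \<le> inverse (sqrt \<tau>) * t powr (3/2) + \<tau> * s ^ 6"
proof (cases "t \<le> \<tau> * s ^ 4")
  case True
  have "t * s\<^sup>2 \<le> \<tau> * s ^ 4 * s\<^sup>2" using True by (intro mult_right_mono) auto
  also have "\<dots> = \<tau> * s ^ 6" by (simp add: mult.assoc flip: power_add)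
  finally show ?thesis using assms by (simp add: add_increasing)
next
  case False
  moreover have "0 \<le> \<tau> * s ^ 4" using assms by (simp add: zero_le_even_power)
  ultimately have t: "t > 0" by linarith
  have "s\<^sup>2 = sqrt (s ^ 4)" by (simp add: real_sqrt_unique[symmetric] flip: power_mult)
  also have "\<dots> \<le> sqrt (t / \<tau>)" using False assms by (intro real_sqrt_le_mono) (simp add: field_simps)
  finally have "t * s\<^sup>2 \<le> t * (sqrt t / sqrt \<tau>)" using t by (intro mult_left_mono) (auto simp: real_sqrt_divide)
  also have "\<dots> = inverse (sqrt \<tau>) * t powr (3/2)"
  proof -
    have "t powr (3/2) = t powr (1 + 1/2)" by simp
    also have "\<dots> = t powr 1 * t powr (1/2)" by (rule powr_add)
    also have "t powr (1/2) = sqrt t" using t by (intro powr_half_sqrt) auto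
    also have "t powr 1 = t" using t by simp
    finally have "t powr (3/2) = t * sqrt t" .
    then show ?thesis by (simp only: divide_inverse mult_ac)
  qed
  finally show ?thesis using assms by (simp add: add_increasing2)
qed

lemma test_fun_pow_integrable:
  assumes "test_fun U \<phi>"
  shows "integrable lebesgue (\<lambda>x. (\<phi> x)\<^sup>2)" "integrable lebesgue (\<lambda>x. \<phi> x ^ 6)" "integrable lebesgue (\<lambda>x. (norm (cgrad \<phi> x))\<^sup>2)"
    "continuous_on UNIV h \<Longrightarrow> integrable lebesgue (\<lambda>x. h x * (\<phi> x)\<^sup>2)"
    "continuous_on UNIV h \<Longrightarrow> integrable lebesgue (\<lambda>x. h x * \<phi> x ^ 4)"
proof -
  obtain K where K: "compact K" "\<And>x. x \<notin> K \<Longrightarrow> \<phi> x = 0" "\<And>x. x \<notin> K \<Longrightarrow> cgrad \<phi> x = 0"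
    using test_funE[OF assms] by metis
  note ci = integrable_lebesgue_continuous_compact[OF _ K(1)] and c = test_fun_continuous[OF assms] test_fun_continuous_cgrad[OF assms]
  show "integrable lebesgue (\<lambda>x. (\<phi> x)\<^sup>2)" by (rule ci) (auto intro!: continuous_intros c simp: K)
  show "integrable lebesgue (\<lambda>x. \<phi> x ^ 6)" by (rule ci) (auto intro!: continuous_intros c simp: K)
  show "integrable lebesgue (\<lambda>x. (norm (cgrad \<phi> x))\<^sup>2)" by (rule ci) (auto intro!: continuous_intros c simp: K)
  assume h: "continuous_on UNIV h"
  show "integrable lebesgue (\<lambda>x. h x * (\<phi> x)\<^sup>2)" by (rule ci) (auto intro!: continuous_intros c h simp: K)
  show "integrable lebesgue (\<lambda>x. h x * \<phi> x ^ 4)" by (rule ci) (auto intro!: continuous_intros c h simp: K)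
qed

lemma continuous_on_sqrt_wt: "continuous_on S (\<lambda>x. sqrt (wt x))"
  by (intro continuous_intros continuous_on_wt)

text \<open>Written as the product of sqrt (wt) \<phi> and \<phi>^3, the integrand is split by
  Cauchy-Schwarz into a Hardy and a Sobolev factor, and 4 times 4096 is 128^2. So a fourth power
  with a weight of order 1/|x| lies on the level of the Kirchhoff term.\<close>

lemma quartic_bound:
  assumes "test_fun U \<phi>"
  shows "(\<integral>x. sqrt (wt x) * \<phi> x ^ 4 \<partial>lebesgue) \<le> 128 * (sqint (cgrad \<phi>))\<^sup>2"
proof -
  define G where "G = sqint (cgrad \<phi>)"
  have G0: "G \<ge> 0" by (simp add: G_def)
  have s1: "sqi (\<lambda>x. sqrt (wt x) * \<phi> x)" by (rule sqi_test_fun_mult(1)[OF continuous_on_sqrt_wt assms])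
  have s2: "sqi (\<lambda>x. \<phi> x ^ 3)" by (rule sqi_test_fun[OF test_fun_power[OF assms]]) simp
  have "(\<integral>x. sqrt (wt x) * \<phi> x ^ 4 \<partial>lebesgue) = (\<integral>x. (sqrt (wt x) * \<phi> x) \<bullet> (\<phi> x ^ 3) \<partial>lebesgue)"
    by (intro Bochner_Integration.integral_cong) (auto simp: eval_nat_numeral)
  then have "(\<integral>x. sqrt (wt x) * \<phi> x ^ 4 \<partial>lebesgue)\<^sup>2 \<le> (\<integral>x. (norm (sqrt (wt x) * \<phi> x))\<^sup>2 \<partial>lebesgue) * (\<integral>x. (norm (\<phi> x ^ 3))\<^sup>2 \<partial>lebesgue)"
    using sqi_Cauchy_Schwarz[OF s1 s2] by simp
  also have "(\<integral>x. (norm (sqrt (wt x) * \<phi> x))\<^sup>2 \<partial>lebesgue) = (\<integral>x. (\<phi> x)\<^sup>2 / (1 + (norm x)\<^sup>2) \<partial>lebesgue)"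
    by (intro Bochner_Integration.integral_cong)
       (auto simp: power_mult_distrib less_imp_le[OF wt_pos], simp add: wt_def divide_inverse mult.commute)
  also have "(\<integral>x. (norm (\<phi> x ^ 3))\<^sup>2 \<partial>lebesgue) = (\<integral>x. \<phi> x ^ 6 \<partial>lebesgue)"
    by (simp flip: power_mult)
  also have "(\<integral>x. (\<phi> x)\<^sup>2 / (1 + (norm x)\<^sup>2) \<partial>lebesgue) * (\<integral>x. \<phi> x ^ 6 \<partial>lebesgue) \<le> (4 * G) * (4096 * G ^ 3)"
    unfolding G_def by (intro mult_mono Hardy_test_fun[OF assms] Sobolev_test_fun[OF assms]) auto
  also have "\<dots> = (128 * G\<^sup>2)\<^sup>2" by (simp add: power_mult_distrib eval_nat_numeral)
  finally show ?thesis unfolding G_def[symmetric] by (rule power2_le_imp_le) simp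
qed

text \<open>The witnesses of the existential hypotheses become parameters. The bound C is taken at
  least 1, so that interpolation can be done with constants such as \<tau> / C.\<close>

locale kirchhoff_data =
  fixes V f Q :: "R3 \<Rightarrow> real" and p C c cs Rs :: real
  assumes p: "2 < p" "p < 4"
    and V: "\<And>x. V x \<ge> 0" "continuous_on UNIV V"
    and c: "c > 0" "emeasure lebesgue {x. V x < c} < \<infinity>"
    and f: "f \<in> borel_measurable lebesgue" "integrable lebesgue (\<lambda>x. \<bar>f x\<bar> powr (3/2))"
    and Q: "Q \<in> borel_measurable lebesgue" "AE x in lebesgue. \<bar>Q x\<bar> \<le> C" "C \<ge> 1"
    and D3: "cs > 0" "Rs > 0" "\<And>x. norm x > Rs \<Longrightarrow> norm x powr (p - 2) * Q x \<le> cs * V x powr (4 - p)"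
begin

text \<open>The growth condition only bounds \<open>Q\<close> by a multiple of \<open>V powr (4 - p)\<close>; combined with the boundedness of \<open>Q\<close>
  it yields the geometric mean \<open>V powr ((4 - p) / 2) * norm x powr (- (p - 2) / 2)\<close>, which scales correctly.\<close>
lemma Q_coercive_pointwise:
  assumes \<epsilon>: "\<epsilon> > 0"
  obtains K where "K \<ge> 0" "AE x in lebesgue. \<forall>s. Q x * \<bar>s\<bar> powr p \<le> \<epsilon> * (sqrt (wt x) * s ^ 4) + K * ((V x + wt x) * s\<^sup>2)"
proof -
  define R where "R = max Rs 1"
  have R: "R \<ge> Rs" "R \<ge> 1" by (auto simp: R_def)
  \<comment> \<open>On the ball of radius R this makes \<open>R' * sqrt (wt x)\<close> at least 1,
    so that an estimate without weight can be given one.\<close>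
  define R' where "R' = sqrt (1 + R\<^sup>2)"
  have R': "R' > 0" by (simp add: R'_def add_pos_nonneg)
  obtain K1 where K1: "K1 \<ge> 0" "\<And>s. \<bar>s\<bar> powr p \<le> K1 * s\<^sup>2 + \<epsilon> / (C * R') * s ^ 4"
    using powr_interpolate_4[of p "\<epsilon> / (C * R')"] p \<epsilon> Q(3) R' by auto
  \<comment> \<open>If the quartic term fails to dominate, then S powr (4 - p) < q / (\<epsilon>
    o'). Raising this to the power \<theta> bounds S powr (p - 2), the excess of S powr p over the
    square.\<close>
  define \<theta> where "\<theta> = (p - 2) / (4 - p)"
  have \<theta>: "\<theta> > 0" using p by (simp add: \<theta>_def)
  define K2 where "K2 = (C * cs) powr (1 / (4 - p)) * \<epsilon> powr (- \<theta>) * 2 powr \<theta>"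
  define K where "K = max (C * K1 * (1 + R\<^sup>2)) K2"
  have K0: "K \<ge> 0" using K1 Q(3) by (auto simp: K_def le_max_iff_disj)
  have pw: "Q x * \<bar>s\<bar> powr p \<le> \<epsilon> * (sqrt (wt x) * s ^ 4) + K * ((V x + wt x) * s\<^sup>2)" if QC: "\<bar>Q x\<bar> \<le> C" for x s
  proof -
    have n0: "\<epsilon> * (sqrt (wt x) * s ^ 4) \<ge> 0" "(V x + wt x) * s\<^sup>2 \<ge> 0" using \<epsilon> V(1)[of x] wt_pos[of x] by auto
    consider "Q x \<le> 0 \<or> s = 0" | "Q x > 0" "s \<noteq> 0" "norm x \<le> R" | "Q x > 0" "s \<noteq> 0" "norm x > R" by linarith
    then show ?thesis
    proof cases
      case 1
      then have "Q x * \<bar>s\<bar> powr p \<le> 0" by (auto simp: mult_nonpos_nonneg)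
      then show ?thesis using n0 K0 by (meson add_nonneg_nonneg mult_nonneg_nonneg order_trans)
    next
      case 2
      have wl: "1 \<le> (1 + R\<^sup>2) * wt x"
      proof -
        have "(norm x)\<^sup>2 \<le> R\<^sup>2" using 2 by (intro power_mono) auto
        then show ?thesis unfolding wt_def divide_inverse[symmetric] by (subst le_divide_eq) (auto simp: add_pos_nonneg)
      qed
      have "sqrt 1 \<le> sqrt ((1 + R\<^sup>2) * wt x)" using wl by (rule real_sqrt_le_mono)
      then have wl': "1 \<le> R' * sqrt (wt x)" by (simp add: R'_def real_sqrt_mult)
      have "Q x * \<bar>s\<bar> powr p \<le> C * (K1 * s\<^sup>2 + \<epsilon> / (C * R') * s ^ 4)"
        using QC K1(2)[of s] 2 by (intro mult_mono) auto
      also have "\<dots> = C * K1 * s\<^sup>2 * 1 + \<epsilon> / R' * s ^ 4 * 1" using Q(3) by (simp add: field_simps)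
      also have "\<dots> \<le> C * K1 * s\<^sup>2 * ((1 + R\<^sup>2) * wt x) + \<epsilon> / R' * s ^ 4 * (R' * sqrt (wt x))"
        using Q(3) K1(1) \<epsilon> R' wl wl' by (intro add_mono mult_left_mono) auto
      also have "\<dots> = (C * K1 * (1 + R\<^sup>2)) * (wt x * s\<^sup>2) + \<epsilon> * (sqrt (wt x) * s ^ 4)" using R' by (simp add: field_simps)
      also have "(C * K1 * (1 + R\<^sup>2)) * (wt x * s\<^sup>2) \<le> K * ((V x + wt x) * s\<^sup>2)"
        using K0 V(1)[of x] wt_pos[of x] by (intro mult_mono mult_right_mono) (auto simp: K_def)
      finally show ?thesis by simp
    next
      case 3
      define q where "q = Q x"
      define S where "S = \<bar>s\<bar>"
      define o' where "o' = sqrt (wt x)"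
      have pos: "q > 0" "S > 0" "o' > 0" "norm x > 1" "norm x > Rs" using 3 R wt_pos[of x] by (auto simp: q_def S_def o'_def)
      \<comment> \<open>Far out o' is at least of order 1/|x|; at the end this lets o' powr (-
        \<theta>) be paid for by the factor |x| powr \<theta> from the growth condition.\<close>
      have xo: "1/2 \<le> norm x * o'"
      proof -
        have "1 + (norm x)\<^sup>2 \<le> 4 * (norm x)\<^sup>2" using pos(4) one_le_power[of "norm x" 2] by linarith
        then have "1/4 \<le> (norm x)\<^sup>2 * wt x" unfolding wt_def divide_inverse[symmetric] by (subst le_divide_eq) (auto simp: add_pos_nonneg)
        then have "sqrt ((1/2)\<^sup>2) \<le> sqrt ((norm x)\<^sup>2 * wt x)" by (intro real_sqrt_le_mono) (simp add: power2_eq_square)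
        then show ?thesis by (simp add: o'_def real_sqrt_mult)
      qed
      show ?thesis
      proof (cases "q * S powr p \<le> \<epsilon> * (o' * S ^ 4)")
        case True
        then have "Q x * \<bar>s\<bar> powr p \<le> \<epsilon> * (sqrt (wt x) * s ^ 4)" by (simp add: q_def S_def o'_def power_even_abs)
        then show ?thesis using mult_nonneg_nonneg[OF K0 n0(2)] by linarith
      next
        case False
        have "S ^ 4 = S powr p * S powr (4 - p)" using pos by (simp add: powr_numeral flip: powr_add)
        then have "\<epsilon> * o' * S powr (4 - p) * S powr p < q * S powr p" using False by (simp add: mult_ac)
        then have "\<epsilon> * o' * S powr (4 - p) < q" using pos by simp
        then have "S powr (4 - p) < q / (\<epsilon> * o')" using pos \<epsilon> by (simp add: field_simps)
        then have "(S powr (4 - p)) powr \<theta> \<le> (q / (\<epsilon> * o')) powr \<theta>" using \<theta> pos by (intro powr_mono2) auto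
        moreover have "(4 - p) * \<theta> = p - 2" using p by (simp add: \<theta>_def)
        ultimately have Sb: "S powr (p - 2) \<le> (q / (\<epsilon> * o')) powr \<theta>" by (simp add: powr_powr)
        have "norm x powr (p - 2) * q \<le> cs * V x powr (4 - p)" using D3(3) pos by (simp add: q_def)
        then have "(norm x powr (p - 2) * q) powr (1 / (4 - p)) \<le> (cs * V x powr (4 - p)) powr (1 / (4 - p))"
          using p pos by (intro powr_mono2) auto
        then have q1: "norm x powr \<theta> * q powr (1 / (4 - p)) \<le> cs powr (1 / (4 - p)) * V x"
          using p D3(1) V(1)[of x] pos by (simp add: powr_mult powr_powr \<theta>_def)
        have q2: "q powr (1 / (4 - p)) \<le> C powr (1 / (4 - p))" using QC pos p by (intro powr_mono2) (auto simp: q_def)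
        \<comment> \<open>Because 1 + \<theta> = 2 / (4 - p), there are two equal factors: one is
          bounded through C, the other through the growth condition, whose root of order 4 - p is
          linear in V. The result contains V to the first power, which is what \<mu> V can
          absorb.\<close>
        have "q * q powr \<theta> = q powr (1 / (4 - p)) * q powr (1 / (4 - p))"
        proof -
          have "1 + \<theta> = 1 / (4 - p) + 1 / (4 - p)" using p by (simp add: \<theta>_def field_simps)
          then show ?thesis using pos by (metis powr_add powr_one less_imp_le)
        qed
        then have qq: "norm x powr \<theta> * (q * q powr \<theta>) \<le> C powr (1 / (4 - p)) * (cs powr (1 / (4 - p)) * V x)"
          using mult_mono[OF q2 q1] by (simp add: mult_ac)
        have "q * S powr p = q * S powr (p - 2) * S\<^sup>2" using pos by (simp add: mult.assoc flip: powr_numeral powr_add)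
        also have "\<dots> \<le> q * (q / (\<epsilon> * o')) powr \<theta> * S\<^sup>2" using Sb pos by (intro mult_right_mono mult_left_mono) auto
        also have "(q / (\<epsilon> * o')) powr \<theta> = q powr \<theta> * (\<epsilon> powr (- \<theta>) * o' powr (- \<theta>))"
          using pos \<epsilon> by (simp add: powr_divide powr_mult powr_minus field_simps)
        also have "q * (q powr \<theta> * (\<epsilon> powr (- \<theta>) * o' powr (- \<theta>))) = (norm x powr \<theta> * (q * q powr \<theta>)) * (\<epsilon> powr (- \<theta>) * (norm x * o') powr (- \<theta>))"
        proof -
          have "x \<noteq> 0" using pos by auto
          then show ?thesis using pos by (simp add: powr_mult powr_minus field_simps)
        qed
        also have "\<dots> \<le> (C powr (1 / (4 - p)) * (cs powr (1 / (4 - p)) * V x)) * (\<epsilon> powr (- \<theta>) * (1/2) powr (- \<theta>))"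
        proof (rule mult_mono[OF qq])
          have "(norm x * o') powr (- \<theta>) \<le> (1/2) powr (- \<theta>)" using xo \<theta> by (intro powr_mono2') auto
          then show "\<epsilon> powr (- \<theta>) * (norm x * o') powr (- \<theta>) \<le> \<epsilon> powr (- \<theta>) * (1/2) powr (- \<theta>)" by (intro mult_left_mono) auto
        qed (use V(1)[of x] in auto)
        also have "\<dots> = K2 * V x"
        proof -
          have h: "(1/2) powr (- \<theta>) = 2 powr \<theta>" by (simp add: powr_minus powr_divide)
          have m: "(C * cs) powr (1 / (4 - p)) = C powr (1 / (4 - p)) * cs powr (1 / (4 - p))"
            by (rule powr_mult)
          show ?thesis by (simp only: K2_def h m mult_ac)
        qed
        finally have "q * S powr p \<le> K2 * V x * S\<^sup>2" by (simp add: mult_right_mono)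
        also have "K2 * V x * S\<^sup>2 \<le> K * ((V x + wt x) * S\<^sup>2)"
          unfolding mult.assoc using K0 V(1)[of x] wt_pos[of x] by (intro mult_mono mult_right_mono) (auto simp: K_def)
        finally show ?thesis using n0 by (simp add: q_def S_def)
      qed
    qed
  qed
  show ?thesis by (rule that[OF K0]) (use Q(2) pw in \<open>auto elim!: eventually_mono\<close>)
qed

text \<open>Inside a large ball a constant and a small sixth power suffice. Outside, if V <= M, the
  growth condition makes Q itself small since |x| powr (p - 2) is large; if V > M, the quadratic
  part of the interpolation is absorbed by V s^2. The estimate prevents positive mass of the Q-term
  from escaping to infinity.\<close>

lemma Q_tail_pointwise:
  assumes \<tau>: "\<tau> > 0"
  obtains K R where "K \<ge> 0" "AE x in lebesgue. \<forall>s. Q x * \<bar>s\<bar> powr p \<le> K * indicator (cball 0 R) x + \<tau> * (V x * s\<^sup>2 + s\<^sup>2 + s ^ 6)"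
proof -
  obtain K1 where K1: "K1 \<ge> 0" "\<And>s. \<bar>s\<bar> powr p \<le> K1 * s\<^sup>2 + \<tau> / C * s ^ 6"
    using powr_interpolate_2[of p "\<tau> / C"] p \<tau> Q(3) by auto
  obtain K0 where K0: "K0 \<ge> 0" "\<And>s. \<bar>s\<bar> powr p \<le> K0 + \<tau> / C * s ^ 6"
    using powr_interpolate_0[of p "\<tau> / C"] p \<tau> Q(3) by auto
  \<comment> \<open>M satisfies C K1 = \<tau> M, so that beyond it V s^2 takes over. R is then
    chosen with cs M powr (4 - p) <= \<tau> R powr (p - 2), for the region V <= M.\<close>
  define M where "M = C * K1 / \<tau>"
  have M0: "M \<ge> 0" using K1(1) Q(3) \<tau> by (simp add: M_def)
  define R where "R = max Rs (max 1 ((cs * M powr (4 - p) / \<tau>) powr (1 / (p - 2))))"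
  have R: "R \<ge> Rs" "R \<ge> 1" "R \<ge> (cs * M powr (4 - p) / \<tau>) powr (1 / (p - 2))" by (auto simp: R_def)
  have pw: "Q x * \<bar>s\<bar> powr p \<le> C * K0 * indicator (cball 0 R) x + \<tau> * (V x * s\<^sup>2 + s\<^sup>2 + s ^ 6)" if QC: "\<bar>Q x\<bar> \<le> C" for x s
  proof -
    have n0: "V x * s\<^sup>2 \<ge> 0" "s\<^sup>2 \<ge> 0" "s ^ 6 \<ge> 0" using V(1)[of x] by (auto simp: zero_le_even_power)
    have QCp: "Q x * \<bar>s\<bar> powr p \<le> C * \<bar>s\<bar> powr p" using QC by (intro mult_right_mono) auto
    show ?thesis
    proof (cases "norm x \<le> R")
      case True
      have "C * \<bar>s\<bar> powr p \<le> C * (K0 + \<tau> / C * s ^ 6)" using K0(2)[of s] Q(3) by (intro mult_left_mono) auto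
      also have "\<dots> = C * K0 + \<tau> * s ^ 6" using Q(3) by (simp add: field_simps)
      also have "\<dots> \<le> C * K0 + \<tau> * (V x * s\<^sup>2 + s\<^sup>2 + s ^ 6)" using n0 \<tau> by (intro add_left_mono mult_left_mono) auto
      finally show ?thesis using QCp True by simp
    next
      case False
      have "Q x * \<bar>s\<bar> powr p \<le> \<tau> * (V x * s\<^sup>2 + s\<^sup>2 + s ^ 6)"
      proof (cases "V x \<le> M")
        case True
        have "Q x \<le> \<tau>"
        proof -
          have "((cs * M powr (4 - p) / \<tau>) powr (1 / (p - 2))) powr (p - 2) \<le> norm x powr (p - 2)"
            using R False p by (intro powr_mono2) auto
          then have n1: "cs * M powr (4 - p) / \<tau> \<le> norm x powr (p - 2)" using p D3(1) \<tau> by (simp add: powr_powr)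
          have n2: "norm x powr (p - 2) > 0" using False R by auto
          have "norm x powr (p - 2) * Q x \<le> cs * V x powr (4 - p)" using D3(3) False R by auto
          also have "\<dots> \<le> cs * M powr (4 - p)" using True V(1)[of x] p D3(1) by (intro mult_left_mono powr_mono2) auto
          also have "\<dots> \<le> norm x powr (p - 2) * \<tau>" using n1 \<tau> by (simp add: field_simps)
          finally show ?thesis using n2 by simp
        qed
        then have "Q x * \<bar>s\<bar> powr p \<le> \<tau> * \<bar>s\<bar> powr p" by (intro mult_right_mono) auto
        also have "\<dots> \<le> \<tau> * (s\<^sup>2 + s ^ 6)" using abs_powr_le_2_6[of p s] p \<tau> by (intro mult_left_mono) auto
        also have "\<dots> \<le> \<tau> * (V x * s\<^sup>2 + s\<^sup>2 + s ^ 6)" using n0 \<tau> by (intro mult_left_mono) auto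
        finally show ?thesis .
      next
        case f: False
        have "C * \<bar>s\<bar> powr p \<le> C * (K1 * s\<^sup>2 + \<tau> / C * s ^ 6)" using K1(2)[of s] Q(3) by (intro mult_left_mono) auto
        also have "\<dots> = \<tau> * (M * s\<^sup>2) + \<tau> * s ^ 6" using Q(3) \<tau> by (simp add: M_def field_simps)
        also have "\<tau> * (M * s\<^sup>2) \<le> \<tau> * (V x * s\<^sup>2)" using f \<tau> by (intro mult_left_mono mult_right_mono) auto
        also have "\<tau> * (V x * s\<^sup>2) + \<tau> * s ^ 6 \<le> \<tau> * (V x * s\<^sup>2 + s\<^sup>2 + s ^ 6)" using n0 \<tau> by (simp add: distrib_left)
        finally show ?thesis using QCp by simp
      qed
      then show ?thesis using False by simp
    qed
  qed
  show ?thesis by (rule that[of "C * K0" R]) (use Q(2,3) K0(1) pw in \<open>auto elim!: eventually_mono\<close>)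
qed

lemma f_weight_integrable:
  assumes "u \<in> borel_measurable lebesgue" "integrable lebesgue (\<lambda>x. u x ^ 6)"
  shows "integrable lebesgue (\<lambda>x. f x * (u x)\<^sup>2)"
proof (rule integrable_real_bound[of _ "\<lambda>x. \<bar>f x\<bar> powr (3/2) + u x ^ 6"])
  show "AE x in lebesgue. \<bar>f x * (u x)\<^sup>2\<bar> \<le> \<bar>f x\<bar> powr (3/2) + u x ^ 6"
    using weight_square_le[of "\<bar>f x\<bar>" 1 "u x" for x] by (auto simp: abs_mult)
qed (use assms f in auto)

text \<open>Hoelder and Sobolev combined. The pointwise estimate with parameter t gives t I + 4096
  G^3 / t^2, and t = G makes both parts linear in G. If G = 0, the parameter is made arbitrarily
  small instead.\<close>

lemma f_weight_test:
  assumes "test_fun U \<phi>"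
  shows "integrable lebesgue (\<lambda>x. f x * (\<phi> x)\<^sup>2)"
    "\<bar>wint f \<phi>\<bar> \<le> ((\<integral>x. \<bar>f x\<bar> powr (3/2) \<partial>lebesgue) + 4096) * sqint (cgrad \<phi>)"
proof -
  show i: "integrable lebesgue (\<lambda>x. f x * (\<phi> x)\<^sup>2)"
    by (rule f_weight_integrable[OF test_fun_measurable[OF assms] test_fun_pow_integrable(2)[OF assms]])
  define G where "G = sqint (cgrad \<phi>)"
  define I where "I = (\<integral>x. \<bar>f x\<bar> powr (3/2) \<partial>lebesgue)"
  have G0: "G \<ge> 0" by (simp add: G_def)
  have S: "(\<integral>x. \<phi> x ^ 6 \<partial>lebesgue) \<le> 4096 * G ^ 3" unfolding G_def by (rule Sobolev_test_fun[OF assms])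
  have b: "\<bar>wint f \<phi>\<bar> \<le> t * I + inverse (t\<^sup>2) * (4096 * G ^ 3)" if t: "t > 0" for t
  proof -
    have "\<bar>wint f \<phi>\<bar> \<le> (\<integral>x. \<bar>f x * (\<phi> x)\<^sup>2\<bar> \<partial>lebesgue)" by (rule integral_abs_bound)
    also have "\<dots> \<le> (\<integral>x. t * \<bar>f x\<bar> powr (3/2) + inverse (t\<^sup>2) * \<phi> x ^ 6 \<partial>lebesgue)"
    proof (rule integral_mono)
      fix x
      have "\<bar>f x\<bar> * (\<phi> x)\<^sup>2 \<le> inverse (sqrt (inverse (t\<^sup>2))) * \<bar>f x\<bar> powr (3/2) + inverse (t\<^sup>2) * \<phi> x ^ 6"
        using t by (intro weight_square_le) auto
      then show "\<bar>f x * (\<phi> x)\<^sup>2\<bar> \<le> t * \<bar>f x\<bar> powr (3/2) + inverse (t\<^sup>2) * \<phi> x ^ 6"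
        using t by (simp add: abs_mult real_sqrt_inverse)
    qed (use i f(2) test_fun_pow_integrable(2)[OF assms] in auto)
    also have "\<dots> = t * I + inverse (t\<^sup>2) * (\<integral>x. \<phi> x ^ 6 \<partial>lebesgue)"
      using f(2) test_fun_pow_integrable(2)[OF assms] by (simp add: I_def)
    also have "\<dots> \<le> t * I + inverse (t\<^sup>2) * (4096 * G ^ 3)" using S by (intro add_left_mono mult_left_mono) auto
    finally show ?thesis .
  qed
  show "\<bar>wint f \<phi>\<bar> \<le> (I + 4096) * G"
  proof (cases "G = 0")
    case False
    then have "G > 0" using G0 by simp
    from b[OF this] show ?thesis using False by (simp add: power2_eq_square power3_eq_cube field_simps)
  next
    case True
    have "\<bar>wint f \<phi>\<bar> \<le> 0"
    proof (rule field_le_epsilon)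
      fix e :: real assume e: "e > 0"
      have I0: "I \<ge> 0" by (simp add: I_def)
      have "\<bar>wint f \<phi>\<bar> \<le> e / (I + 1) * I" using b[of "e / (I + 1)"] e I0 True by simp
      also have "\<dots> \<le> e" using e I0 by (simp add: field_simps)
      finally show "\<bar>wint f \<phi>\<bar> \<le> 0 + e" by simp
    qed
    then show ?thesis using True by simp
  qed
qed

lemma Q_term_integrable:
  assumes "u \<in> borel_measurable lebesgue" "integrable lebesgue (\<lambda>x. (u x)\<^sup>2)" "integrable lebesgue (\<lambda>x. u x ^ 6)"
  shows "integrable lebesgue (\<lambda>x. Q x * \<bar>u x\<bar> powr p)"
proof (rule integrable_real_bound[of _ "\<lambda>x. C * ((u x)\<^sup>2 + u x ^ 6)"])
  show "AE x in lebesgue. \<bar>Q x * \<bar>u x\<bar> powr p\<bar> \<le> C * ((u x)\<^sup>2 + u x ^ 6)"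
    using Q(2)
  proof eventually_elim
    case (elim x)
    have "\<bar>Q x\<bar> * \<bar>u x\<bar> powr p \<le> C * ((u x)\<^sup>2 + u x ^ 6)"
      using elim abs_powr_le_2_6[of p "u x"] p Q(3) by (intro mult_mono) auto
    then show ?case by (simp add: abs_mult)
  qed
qed (use assms Q in auto)

text \<open>Where V >= c the potential controls \<phi>^2; on the set V < c, of finite measure,
  \<phi>^2 <= 1 + \<phi>^6 and Sobolev's inequality takes over. So bounds on the gradient and the
  V-integral are all that compactness asks for.\<close>

lemma L2_bound:
  assumes "test_fun U \<phi>"
  shows "(\<integral>x. (\<phi> x)\<^sup>2 \<partial>lebesgue) \<le> wint V \<phi> / c + measure lebesgue {x. V x < c}
     + 4096 * (sqint (cgrad \<phi>)) ^ 3"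
proof -
  have A: "open {x. V x < c}" by (intro open_Collect_less V continuous_intros)
  have fin: "{x. V x < c} \<in> lmeasurable" using c(2) A by (intro fmeasurableI) auto
  have i1: "integrable lebesgue (\<lambda>x. V x * (\<phi> x)\<^sup>2)" by (rule test_fun_pow_integrable(4)[OF assms V(2)])
  note i2 = test_fun_pow_integrable(1,2)[OF assms]
  have i3: "integrable lebesgue (indicator {x. V x < c} :: R3 \<Rightarrow> real)" using fin by (intro integrable_real_indicator) (auto simp: fmeasurable_def)
  have "(\<integral>x. (\<phi> x)\<^sup>2 \<partial>lebesgue) \<le> (\<integral>x. V x * (\<phi> x)\<^sup>2 / c + indicator {x. V x < c} x + \<phi> x ^ 6 \<partial>lebesgue)"
  proof (rule integral_mono)
    fix x
    show "(\<phi> x)\<^sup>2 \<le> V x * (\<phi> x)\<^sup>2 / c + indicator {x. V x < c} x + \<phi> x ^ 6"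
    proof (cases "V x < c")
      case True
      have "(\<phi> x)\<^sup>2 \<le> 1 + \<phi> x ^ 6"
      proof (cases "\<bar>\<phi> x\<bar> \<le> 1")
        case True
        then have "(\<phi> x)\<^sup>2 \<le> 1" by (simp add: abs_square_le_1)
        then show ?thesis by (simp add: add_increasing2 zero_le_even_power)
      next
        case False
        then have "\<bar>\<phi> x\<bar> ^ 2 \<le> \<bar>\<phi> x\<bar> ^ 6" by (intro power_increasing) auto
        then show ?thesis by (simp add: power_even_abs)
      qed
      moreover have "0 \<le> V x * (\<phi> x)\<^sup>2 / c" using V(1)[of x] c(1) by simp
      ultimately show ?thesis using True by simp
    next
      case False
      then have "1 * (\<phi> x)\<^sup>2 \<le> V x / c * (\<phi> x)\<^sup>2" using c(1) by (intro mult_right_mono) auto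
      then show ?thesis using False by (simp add: add_increasing2 zero_le_even_power)
    qed
  qed (use i1 i2 i3 in auto)
  also have "\<dots> = wint V \<phi> / c + measure lebesgue {x. V x < c} + (\<integral>x. \<phi> x ^ 6 \<partial>lebesgue)"
    using i1 i2 i3 A by simp
  also have "(\<integral>x. \<phi> x ^ 6 \<partial>lebesgue) \<le> 4096 * (sqint (cgrad \<phi>)) ^ 3" by (rule Sobolev_test_fun[OF assms])
  finally show ?thesis by simp
qed

text \<open>The parameter a/1024 is turned by the 128 of \<open>quartic_bound\<close> into a/8, half
  of the Kirchhoff coefficient. The multiple K1 of the V-integral is covered by \<mu>/2, with one
  more V-integral to spare because \<mu> > 2 K1 + 2. Hardy's inequality and the bound for f
  contribute multiples of the squared gradient norm, collected in K.\<close>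

lemma energy_coercive:
  assumes a: "a > 0" and lam: "lam \<ge> 0"
  obtains \<mu>s K where "\<mu>s > 0" "K \<ge> 0" "\<And>\<mu> \<phi>. \<mu> > \<mu>s \<Longrightarrow> test_fun UNIV \<phi> \<Longrightarrow>
     a / 8 * (sqint (cgrad \<phi>))\<^sup>2 + wint V \<phi> - K * (sqint (cgrad \<phi>))
       \<le> energy a \<mu> lam p V f Q \<phi> (cgrad \<phi>)"
proof -
  obtain K1 where K1: "K1 \<ge> 0" "AE x in lebesgue. \<forall>s. Q x * \<bar>s\<bar> powr p \<le> (a / 1024) * (sqrt (wt x) * s ^ 4) + K1 * ((V x + wt x) * s\<^sup>2)"
    using Q_coercive_pointwise[of "a / 1024"] a by auto
  define Cf where "Cf = (\<integral>x. \<bar>f x\<bar> powr (3/2) \<partial>lebesgue) + 4096"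
  have Cf: "Cf \<ge> 0" by (simp add: Cf_def)
  define K where "K = 4 * K1 + lam / 2 * Cf"
  show ?thesis
  proof (rule that[of "2 * K1 + 2" K])
    show "2 * K1 + 2 > 0" "K \<ge> 0" using K1(1) Cf lam by (auto simp: K_def)
    fix \<mu> \<phi> assume \<mu>: "\<mu> > 2 * K1 + 2" and \<phi>: "test_fun UNIV \<phi>"
    define G where "G = sqint (cgrad \<phi>)"
    define W where "W = wint V \<phi>"
    define F where "F = wint f \<phi>"
    define q where "q = (\<integral>x. Q x * \<bar>\<phi> x\<bar> powr p \<partial>lebesgue)"
    have G0: "G \<ge> 0" by (simp add: G_def)
    have W0: "W \<ge> 0" unfolding W_def by (intro Bochner_Integration.integral_nonneg) (use V(1) in auto)
    note ti = test_fun_pow_integrable[OF \<phi>]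
    have iw: "integrable lebesgue (\<lambda>x. wt x * (\<phi> x)\<^sup>2)" by (rule ti(4)[OF continuous_on_wt])
    have iV: "integrable lebesgue (\<lambda>x. V x * (\<phi> x)\<^sup>2)" by (rule ti(4)[OF V(2)])
    have i4: "integrable lebesgue (\<lambda>x. sqrt (wt x) * \<phi> x ^ 4)" by (rule ti(5)[OF continuous_on_sqrt_wt])
    have "q \<le> (\<integral>x. (a / 1024) * (sqrt (wt x) * \<phi> x ^ 4) + (K1 * (V x * (\<phi> x)\<^sup>2) + K1 * (wt x * (\<phi> x)\<^sup>2)) \<partial>lebesgue)"
      unfolding q_def
    proof (rule integral_mono_AE)
      show "integrable lebesgue (\<lambda>x. Q x * \<bar>\<phi> x\<bar> powr p)" by (rule Q_term_integrable[OF test_fun_measurable[OF \<phi>] ti(1,2)])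
      show "AE x in lebesgue. Q x * \<bar>\<phi> x\<bar> powr p \<le> (a / 1024) * (sqrt (wt x) * \<phi> x ^ 4) + (K1 * (V x * (\<phi> x)\<^sup>2) + K1 * (wt x * (\<phi> x)\<^sup>2))"
        using K1(2) by eventually_elim (simp add: distrib_left distrib_right)
    qed (use iw iV i4 in auto)
    also have "\<dots> = (a / 1024) * (\<integral>x. sqrt (wt x) * \<phi> x ^ 4 \<partial>lebesgue) + (K1 * W + K1 * (\<integral>x. wt x * (\<phi> x)\<^sup>2 \<partial>lebesgue))"
      using iw iV i4 by (simp add: W_def)
    also have "(\<integral>x. wt x * (\<phi> x)\<^sup>2 \<partial>lebesgue) \<le> 4 * G"
      using Hardy_test_fun[OF \<phi>] by (simp add: G_def wt_def divide_inverse mult.commute)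
    also have "(\<integral>x. sqrt (wt x) * \<phi> x ^ 4 \<partial>lebesgue) \<le> 128 * G\<^sup>2" unfolding G_def by (rule quartic_bound[OF \<phi>])
    finally have q: "q \<le> a / 8 * G\<^sup>2 + K1 * W + 4 * K1 * G" using a K1(1) by (simp add: mult_left_mono)
    have q': "q / p \<le> a / 8 * G\<^sup>2 + K1 * W + 4 * K1 * G"
    proof (cases "q \<ge> 0")
      case True
      then have "q / p \<le> q / 1" using p by (intro divide_left_mono) auto
      then show ?thesis using q by simp
    next
      case False
      then have "q / p \<le> 0" using p by (simp add: divide_nonpos_pos)
      moreover have "0 \<le> a / 8 * G\<^sup>2 + K1 * W + 4 * K1 * G" using a G0 W0 K1(1) by simp
      ultimately show ?thesis by linarith
    qed
    have "F \<le> Cf * G" using f_weight_test(2)[OF \<phi>] by (simp add: F_def Cf_def G_def)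
    then have F: "lam / 2 * F \<le> lam / 2 * (Cf * G)" using lam by (intro mult_left_mono) auto
    have \<mu>W: "(2 * K1 + 2) * W \<le> \<mu> * W" using \<mu> W0 by (intro mult_right_mono) auto
    have "a / 8 * G\<^sup>2 + W - K * G \<le> a / 4 * G\<^sup>2 + 1 / 2 * (G + \<mu> * W) - q / p - lam / 2 * F"
    proof -
      \<comment> \<open>Products are replaced by variables, which turns the claim into linear
        arithmetic.\<close>
      have gen: "kG = g4 + L \<Longrightarrow> k2 = 2 * kw + 2 * w \<Longrightarrow> e2 = 2 * e \<Longrightarrow> r \<le> e + kw + g4 \<Longrightarrow> l \<le> L \<Longrightarrow> k2 \<le> mw \<Longrightarrow> 0 \<le> g
         \<Longrightarrow> e + w - kG \<le> e2 + 1 / 2 * (g + mw) - r - l" for kG g4 L k2 kw w e2 e r l mw g :: real by argo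
      have "K * G = 4 * K1 * G + lam / 2 * (Cf * G)" "(2 * K1 + 2) * W = 2 * (K1 * W) + 2 * W"
        by (simp_all add: K_def algebra_simps)
      moreover have "a / 4 * G\<^sup>2 = 2 * (a / 8 * G\<^sup>2)" by simp
      ultimately show ?thesis using q' F \<mu>W G0 gen by blast
    qed
    then show "a / 8 * (sqint (cgrad \<phi>))\<^sup>2 + wint V \<phi> - K * (sqint (cgrad \<phi>))
       \<le> energy a \<mu> lam p V f Q \<phi> (cgrad \<phi>)"
      unfolding energy_def G_def W_def F_def q_def by simp
  qed
qed

subsection \<open>Continuity of the lower-order terms\<close>

lemma sixth_power_limit:
  assumes \<psi>: "\<And>n. test_fun U (\<psi> n)" and G: "\<And>n. sqint (cgrad (\<psi> n)) \<le> A"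
    and u: "u \<in> borel_measurable lebesgue" and lim: "AE x in lebesgue. (\<lambda>n. \<psi> n x) \<longlonglongrightarrow> u x"
  shows "integrable lebesgue (\<lambda>x. u x ^ 6)" "(\<integral>x. u x ^ 6 \<partial>lebesgue) \<le> 4096 * A ^ 3"
    "(\<integral>x. \<psi> n x ^ 6 \<partial>lebesgue) \<le> 4096 * A ^ 3"
proof -
  show b: "(\<integral>x. \<psi> n x ^ 6 \<partial>lebesgue) \<le> 4096 * A ^ 3" for n
  proof -
    have "(\<integral>x. \<psi> n x ^ 6 \<partial>lebesgue) \<le> 4096 * (sqint (cgrad (\<psi> n))) ^ 3" by (rule Sobolev_test_fun[OF \<psi>])
    also have "\<dots> \<le> 4096 * A ^ 3" by (intro mult_left_mono power_mono G) auto
    finally show ?thesis .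
  qed
  have l6: "AE x in lebesgue. (\<lambda>n. \<psi> n x ^ 6) \<longlonglongrightarrow> u x ^ 6"
    using lim by eventually_elim (intro tendsto_intros)
  note FB = Fatou_bound[OF test_fun_pow_integrable(2)[OF \<psi>] _ _ l6 b]
  show "integrable lebesgue (\<lambda>x. u x ^ 6)" "(\<integral>x. u x ^ 6 \<partial>lebesgue) \<le> 4096 * A ^ 3"
    by (rule FB; use u in \<open>auto simp: zero_le_even_power\<close>)+
qed

text \<open>Bounded gradients and convergence almost everywhere suffice: in Vitali's theorem |f|
  powr (3/2) serves as the fixed majorant, by \<open>weight_square_le\<close>, and the sixth powers
  are bounded by Sobolev's inequality. So the f-term is continuous even where only weak convergence
  would be at hand.\<close>

lemma f_term_tendsto:
  assumes \<psi>: "\<And>n. test_fun U (\<psi> n)" and G: "\<And>n. sqint (cgrad (\<psi> n)) \<le> A"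
    and u: "u \<in> borel_measurable lebesgue" and lim: "AE x in lebesgue. (\<lambda>n. \<psi> n x) \<longlonglongrightarrow> u x"
  shows "(\<lambda>n. wint f (\<psi> n)) \<longlonglongrightarrow> wint f u"
proof -
  note S = sixth_power_limit[OF assms]
  have [measurable]: "\<psi> n \<in> borel_measurable lebesgue" for n by (rule test_fun_measurable[OF \<psi>])
  note [measurable] = u f(1)
  have if1: "integrable lebesgue (\<lambda>x. f x * (\<psi> n x)\<^sup>2)" for n by (rule f_weight_test(1)[OF \<psi>])
  have if2: "integrable lebesgue (\<lambda>x. f x * (u x)\<^sup>2)" by (rule f_weight_integrable[OF u S(1)])
  have "(\<lambda>n. \<integral>x. \<bar>f x * (\<psi> n x)\<^sup>2 - f x * (u x)\<^sup>2\<bar> \<partial>lebesgue) \<longlonglongrightarrow> 0"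
  proof (rule Vitali_tendsto_zero[where e="\<lambda>n x. \<psi> n x ^ 6 + u x ^ 6" and B="4096 * A ^ 3 + 4096 * A ^ 3"])
    show "AE x in lebesgue. (\<lambda>n. \<bar>f x * (\<psi> n x)\<^sup>2 - f x * (u x)\<^sup>2\<bar>) \<longlonglongrightarrow> 0"
      using lim
    proof eventually_elim
      case (elim x)
      have "(\<lambda>n. \<bar>f x * (\<psi> n x)\<^sup>2 - f x * (u x)\<^sup>2\<bar>) \<longlonglongrightarrow> \<bar>f x * (u x)\<^sup>2 - f x * (u x)\<^sup>2\<bar>" by (intro tendsto_intros elim)
      then show ?case by simp
    qed
    show "(\<integral>x. \<psi> n x ^ 6 + u x ^ 6 \<partial>lebesgue) \<le> 4096 * A ^ 3 + 4096 * A ^ 3" for n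
      using S(1,2) S(3)[of n] test_fun_pow_integrable(2)[OF \<psi>[of n]] by simp
    fix \<tau> :: real assume \<tau>: "\<tau> > 0"
    have "\<bar>f x * (\<psi> n x)\<^sup>2 - f x * (u x)\<^sup>2\<bar> \<le> 2 * (inverse (sqrt \<tau>) * \<bar>f x\<bar> powr (3/2)) + 0 + \<tau> * (\<psi> n x ^ 6 + u x ^ 6)" for n x
    proof -
      have "\<bar>f x * (\<psi> n x)\<^sup>2 - f x * (u x)\<^sup>2\<bar> \<le> \<bar>f x\<bar> * (\<psi> n x)\<^sup>2 + \<bar>f x\<bar> * (u x)\<^sup>2"
        using abs_triangle_ineq4[of "f x * (\<psi> n x)\<^sup>2" "f x * (u x)\<^sup>2"] by (simp add: abs_mult)
      also have "\<dots> \<le> 2 * (inverse (sqrt \<tau>) * \<bar>f x\<bar> powr (3/2)) + \<tau> * (\<psi> n x ^ 6 + u x ^ 6)"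
        using weight_square_le[of "\<bar>f x\<bar>" \<tau> "\<psi> n x"] weight_square_le[of "\<bar>f x\<bar>" \<tau> "u x"] \<tau> by (simp add: distrib_left)
      finally show ?thesis by simp
    qed
    then show "\<exists>k d. integrable lebesgue k \<and> (\<forall>n. integrable lebesgue (d n)) \<and> (\<forall>n. AE x in lebesgue. d n x \<ge> 0) \<and>
        (\<lambda>n. integral\<^sup>L lebesgue (d n)) \<longlonglongrightarrow> 0 \<and> (\<forall>n. AE x in lebesgue. \<bar>f x * (\<psi> n x)\<^sup>2 - f x * (u x)\<^sup>2\<bar> \<le> k x + d n x + \<tau> * (\<psi> n x ^ 6 + u x ^ 6))"
      using f(2) by (intro exI[of _ "\<lambda>x. 2 * (inverse (sqrt \<tau>) * \<bar>f x\<bar> powr (3/2))"] exI[of _ "\<lambda>n x. 0"]) auto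
  qed (use if1 if2 S(1) test_fun_pow_integrable(2)[OF \<psi>] in \<open>auto simp: zero_le_even_power\<close>)
  then have "(\<lambda>n. (wint f (\<psi> n)) - wint f u) \<longlonglongrightarrow> 0"
  proof (rule Lim_null_comparison[rotated])
    show "\<forall>\<^sub>F n in sequentially. norm (wint f (\<psi> n) - wint f u) \<le> (\<integral>x. \<bar>f x * (\<psi> n x)\<^sup>2 - f x * (u x)\<^sup>2\<bar> \<partial>lebesgue)"
    proof (rule always_eventually, rule allI)
      fix n
      have "wint f (\<psi> n) - wint f u = (\<integral>x. f x * (\<psi> n x)\<^sup>2 - f x * (u x)\<^sup>2 \<partial>lebesgue)" using if1 if2 by simp
      then show "norm (wint f (\<psi> n) - wint f u) \<le> (\<integral>x. \<bar>f x * (\<psi> n x)\<^sup>2 - f x * (u x)\<^sup>2\<bar> \<partial>lebesgue)"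
        using integral_abs_bound[of lebesgue "\<lambda>x. f x * (\<psi> n x)\<^sup>2 - f x * (u x)\<^sup>2"] by simp
    qed
  qed
  then show ?thesis by (simp add: LIM_zero_iff)
qed

text \<open>Only the positive part of the difference is dominated by
  \<open>Q_tail_pointwise\<close>, since the growth condition limits Q from above and not from
  below. The term enters the energy with a minus sign, so this is the direction that a minimising
  sequence needs.\<close>

lemma Q_term_upper:
  assumes \<psi>: "\<And>n. test_fun U (\<psi> n)" and G: "\<And>n. sqint (cgrad (\<psi> n)) \<le> A"
    and W: "\<And>n. wint V (\<psi> n) \<le> B" and M: "\<And>n. (\<integral>x. (\<psi> n x)\<^sup>2 \<partial>lebesgue) \<le> M"
    and u: "u \<in> borel_measurable lebesgue" "integrable lebesgue (\<lambda>x. (u x)\<^sup>2)" and lim: "AE x in lebesgue. (\<lambda>n. \<psi> n x) \<longlonglongrightarrow> u x"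
  obtains r where "r \<longlonglongrightarrow> 0" "\<And>n. (\<integral>x. Q x * \<bar>\<psi> n x\<bar> powr p \<partial>lebesgue) \<le> (\<integral>x. Q x * \<bar>u x\<bar> powr p \<partial>lebesgue) + r n"
proof -
  note S = sixth_power_limit[OF \<psi> G u(1) lim]
  note ti = test_fun_pow_integrable[OF \<psi>]
  have [measurable]: "\<psi> n \<in> borel_measurable lebesgue" for n by (rule test_fun_measurable[OF \<psi>])
  note [measurable] = u(1) Q(1)
  have i1: "integrable lebesgue (\<lambda>x. Q x * \<bar>\<psi> n x\<bar> powr p)" for n by (rule Q_term_integrable) (use ti in auto)
  have i2: "integrable lebesgue (\<lambda>x. Q x * \<bar>u x\<bar> powr p)" by (rule Q_term_integrable[OF u S(1)])
  define h where "h n x = max 0 (Q x * \<bar>\<psi> n x\<bar> powr p - Q x * \<bar>u x\<bar> powr p)" for n x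
  define e where "e n x = V x * (\<psi> n x)\<^sup>2 + (\<psi> n x)\<^sup>2 + \<psi> n x ^ 6" for n x
  have hi: "integrable lebesgue (h n)" for n unfolding h_def using i1 i2 by (intro integrable_max) auto
  have "(\<lambda>n. integral\<^sup>L lebesgue (h n)) \<longlonglongrightarrow> 0"
  proof (rule Vitali_tendsto_zero[where e=e and B="B + M + 4096 * A ^ 3"])
    show "AE x in lebesgue. (\<lambda>n. h n x) \<longlonglongrightarrow> 0"
      using lim
    proof eventually_elim
      case (elim x)
      have "(\<lambda>n. h n x) \<longlonglongrightarrow> max 0 (Q x * \<bar>u x\<bar> powr p - Q x * \<bar>u x\<bar> powr p)"
        unfolding h_def using p by (intro tendsto_intros tendsto_powr' elim) auto
      then show ?case by simp
    qed
    show "integrable lebesgue (e n)" for n unfolding e_def using ti V(2) by auto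
    show "integral\<^sup>L lebesgue (e n) \<le> B + M + 4096 * A ^ 3" for n
      unfolding e_def using ti V(2) W[of n] M[of n] S(3)[of n] by simp
    show "AE x in lebesgue. e n x \<ge> 0" for n unfolding e_def using V(1) by (auto simp: zero_le_even_power)
    fix \<tau> :: real assume \<tau>: "\<tau> > 0"
    obtain K R where KR: "K \<ge> 0" "AE x in lebesgue. \<forall>s. Q x * \<bar>s\<bar> powr p \<le> K * indicator (cball 0 R) x + \<tau> * (V x * s\<^sup>2 + s\<^sup>2 + s ^ 6)"
      by (rule Q_tail_pointwise[OF \<tau>])
    have "AE x in lebesgue. h n x \<le> (K * indicator (cball 0 R) x + \<bar>Q x * \<bar>u x\<bar> powr p\<bar>) + 0 + \<tau> * e n x" for n
      using KR(2)
    proof eventually_elim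
      case (elim x)
      have "0 \<le> \<tau> * e n x" "0 \<le> K * indicator (cball 0 R) x" using \<tau> V(1)[of x] KR(1) by (auto simp: e_def zero_le_even_power)
      then show ?case using elim[rule_format, of "\<psi> n x"] unfolding h_def e_def by auto
    qed
    moreover have "integrable lebesgue (\<lambda>x. K * indicator (cball 0 R) x + \<bar>Q x * \<bar>u x\<bar> powr p\<bar>)"
      using i2 lmeasurable_cball[of "0::R3" R] by (intro Bochner_Integration.integrable_add integrable_mult_right integrable_real_indicator integrable_abs) (auto simp: fmeasurable_def)
    ultimately show "\<exists>k d. integrable lebesgue k \<and> (\<forall>n. integrable lebesgue (d n)) \<and> (\<forall>n. AE x in lebesgue. d n x \<ge> 0) \<and>
        (\<lambda>n. integral\<^sup>L lebesgue (d n)) \<longlonglongrightarrow> 0 \<and> (\<forall>n. AE x in lebesgue. h n x \<le> k x + d n x + \<tau> * e n x)"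
      by (intro exI[of _ "\<lambda>x. K * indicator (cball 0 R) x + \<bar>Q x * \<bar>u x\<bar> powr p\<bar>"] exI[of _ "\<lambda>n x. 0"]) auto
  qed (use hi in \<open>auto simp: h_def\<close>)
  moreover have "(\<integral>x. Q x * \<bar>\<psi> n x\<bar> powr p \<partial>lebesgue) \<le> (\<integral>x. Q x * \<bar>u x\<bar> powr p \<partial>lebesgue) + integral\<^sup>L lebesgue (h n)" for n
  proof -
    have "(\<integral>x. Q x * \<bar>\<psi> n x\<bar> powr p \<partial>lebesgue) \<le> (\<integral>x. Q x * \<bar>u x\<bar> powr p + h n x \<partial>lebesgue)"
      using i1 i2 hi by (intro integral_mono) (auto simp: h_def)
    then show ?thesis using i2 hi by simp
  qed
  ultimately show ?thesis using that by blast
qed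

text \<open>Strong L2 convergence replaces the decay at infinity: after interpolation the quadratic
  part is compared with u^2 plus the vanishing L2 distance. It is meant for the approximants of a
  fixed function, where the limit is needed in both directions.\<close>

lemma Q_term_tendsto:
  assumes \<psi>: "\<And>n. test_fun U (\<psi> n)" and G: "\<And>n. sqint (cgrad (\<psi> n)) \<le> A"
    and L: "L2to \<psi> u" and lim: "AE x in lebesgue. (\<lambda>n. \<psi> n x) \<longlonglongrightarrow> u x"
  shows "(\<lambda>n. \<integral>x. Q x * \<bar>\<psi> n x\<bar> powr p \<partial>lebesgue) \<longlonglongrightarrow> (\<integral>x. Q x * \<bar>u x\<bar> powr p \<partial>lebesgue)"
proof -
  have um: "u \<in> borel_measurable lebesgue" using L2to_sqi(2)[OF L] by (rule sqi_measurable)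
  have u2: "integrable lebesgue (\<lambda>x. (u x)\<^sup>2)" using sqi_integrable[OF L2to_sqi(2)[OF L]] by simp
  note S = sixth_power_limit[OF \<psi> G um lim]
  note ti = test_fun_pow_integrable[OF \<psi>]
  have [measurable]: "\<psi> n \<in> borel_measurable lebesgue" for n by (rule test_fun_measurable[OF \<psi>])
  note [measurable] = um Q(1)
  have i1: "integrable lebesgue (\<lambda>x. Q x * \<bar>\<psi> n x\<bar> powr p)" for n by (rule Q_term_integrable) (use ti in auto)
  have i2: "integrable lebesgue (\<lambda>x. Q x * \<bar>u x\<bar> powr p)" by (rule Q_term_integrable[OF um u2 S(1)])
  define h where "h n x = \<bar>Q x * \<bar>\<psi> n x\<bar> powr p - Q x * \<bar>u x\<bar> powr p\<bar>" for n x
  have hi: "integrable lebesgue (h n)" for n unfolding h_def using i1 i2 by auto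
  have id: "integrable lebesgue (\<lambda>x. (norm (\<psi> n x - u x))\<^sup>2)" for n by (intro sqi_integrable sqi_diff L2to_sqi[OF L])
  have "(\<lambda>n. integral\<^sup>L lebesgue (h n)) \<longlonglongrightarrow> 0"
  proof (rule Vitali_tendsto_zero[where e="\<lambda>n x. \<psi> n x ^ 6" and B="4096 * A ^ 3"])
    show "AE x in lebesgue. (\<lambda>n. h n x) \<longlonglongrightarrow> 0"
      using lim
    proof eventually_elim
      case (elim x)
      have "(\<lambda>n. h n x) \<longlonglongrightarrow> \<bar>Q x * \<bar>u x\<bar> powr p - Q x * \<bar>u x\<bar> powr p\<bar>"
        unfolding h_def using p by (intro tendsto_intros tendsto_powr' elim) auto
      then show ?case by simp
    qed
    show "integral\<^sup>L lebesgue (\<lambda>x. \<psi> n x ^ 6) \<le> 4096 * A ^ 3" for n by (rule S(3))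
    fix \<tau> :: real assume \<tau>: "\<tau> > 0"
    obtain K where K: "K \<ge> 0" "\<And>s. \<bar>s\<bar> powr p \<le> K * s\<^sup>2 + \<tau> / C * s ^ 6"
      using powr_interpolate_2[of p "\<tau> / C"] p \<tau> Q(3) by auto
    define k where "k x = \<bar>Q x * \<bar>u x\<bar> powr p\<bar> + 2 * C * K * (u x)\<^sup>2" for x
    define d where "d n x = 2 * C * K * (norm (\<psi> n x - u x))\<^sup>2" for n x
    have "AE x in lebesgue. h n x \<le> k x + d n x + \<tau> * \<psi> n x ^ 6" for n
      using Q(2)
    proof eventually_elim
      case (elim x)
      have "\<bar>Q x\<bar> * \<bar>\<psi> n x\<bar> powr p \<le> C * (K * (\<psi> n x)\<^sup>2 + \<tau> / C * \<psi> n x ^ 6)" using elim K(2)[of "\<psi> n x"] by (intro mult_mono) auto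
      also have "\<dots> = C * K * (\<psi> n x)\<^sup>2 + \<tau> * \<psi> n x ^ 6" using Q(3) by (simp add: field_simps)
      also have "C * K * (\<psi> n x)\<^sup>2 \<le> C * K * (2 * (u x)\<^sup>2 + 2 * (norm (\<psi> n x - u x))\<^sup>2)"
        using norm_add_square_le[of "u x" "\<psi> n x - u x"] K(1) Q(3) by (intro mult_left_mono) auto
      finally show ?case
        using abs_triangle_ineq4[of "Q x * \<bar>\<psi> n x\<bar> powr p" "Q x * \<bar>u x\<bar> powr p"]
        unfolding h_def k_def d_def by (simp add: abs_mult distrib_left)
    qed
    moreover have "(\<lambda>n. integral\<^sup>L lebesgue (d n)) \<longlonglongrightarrow> 0"
      unfolding d_def using tendsto_mult[OF tendsto_const[of "2 * C * K"] L2to_lim[OF L]] by simp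
    moreover have kd: "integrable lebesgue k" "integrable lebesgue (d n)" "d n x \<ge> 0" for n x
      unfolding k_def d_def using i2 u2 id K(1) Q(3) by auto
    ultimately show "\<exists>k d. integrable lebesgue k \<and> (\<forall>n. integrable lebesgue (d n)) \<and> (\<forall>n. AE x in lebesgue. d n x \<ge> 0) \<and>
        (\<lambda>n. integral\<^sup>L lebesgue (d n)) \<longlonglongrightarrow> 0 \<and> (\<forall>n. AE x in lebesgue. h n x \<le> k x + d n x + \<tau> * \<psi> n x ^ 6)"
      using kd by (intro exI[of _ k] exI[of _ d]) auto
  qed (use hi ti in \<open>auto simp: h_def zero_le_even_power\<close>)
  then have "(\<lambda>n. (\<integral>x. Q x * \<bar>\<psi> n x\<bar> powr p \<partial>lebesgue) - (\<integral>x. Q x * \<bar>u x\<bar> powr p \<partial>lebesgue)) \<longlonglongrightarrow> 0"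
  proof (rule Lim_null_comparison[rotated])
    show "\<forall>\<^sub>F n in sequentially. norm ((\<integral>x. Q x * \<bar>\<psi> n x\<bar> powr p \<partial>lebesgue) - (\<integral>x. Q x * \<bar>u x\<bar> powr p \<partial>lebesgue)) \<le> integral\<^sup>L lebesgue (h n)"
    proof (rule always_eventually, rule allI)
      fix n
      have "(\<integral>x. Q x * \<bar>\<psi> n x\<bar> powr p \<partial>lebesgue) - (\<integral>x. Q x * \<bar>u x\<bar> powr p \<partial>lebesgue) = (\<integral>x. Q x * \<bar>\<psi> n x\<bar> powr p - Q x * \<bar>u x\<bar> powr p \<partial>lebesgue)" using i1 i2 by simp
      then show "norm ((\<integral>x. Q x * \<bar>\<psi> n x\<bar> powr p \<partial>lebesgue) - (\<integral>x. Q x * \<bar>u x\<bar> powr p \<partial>lebesgue)) \<le> integral\<^sup>L lebesgue (h n)"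
        using integral_abs_bound[of lebesgue "\<lambda>x. Q x * \<bar>\<psi> n x\<bar> powr p - Q x * \<bar>u x\<bar> powr p"] by (simp add: h_def[abs_def])
    qed
  qed
  then show ?thesis by (simp add: LIM_zero_iff)
qed

end

subsection \<open>Non-negative approximations\<close>

text \<open>A smooth stand-in for |s|. It vanishes at 0, so composition keeps supports, and its
  derivative is at most 1 in absolute value, so gradients do not grow.\<close>

definition sabs :: "real \<Rightarrow> real \<Rightarrow> real" where
  "sabs e s = sqrt (s\<^sup>2 + e\<^sup>2) - e"

lemma sabs_props:
  assumes "e > 0"
  shows "sabs e s \<ge> 0" "sabs e s \<le> \<bar>s\<bar>" "sabs e s = s / (sqrt (s\<^sup>2 + e\<^sup>2) + e) * s" "\<bar>s\<bar> - e \<le> sabs e s"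
proof -
  have pos: "s\<^sup>2 + e\<^sup>2 > 0" using assms by (simp add: add_nonneg_pos)
  have "sqrt (e\<^sup>2) \<le> sqrt (s\<^sup>2 + e\<^sup>2)" by (intro real_sqrt_le_mono) simp
  then show "sabs e s \<ge> 0" using assms by (simp add: sabs_def)
  have "s\<^sup>2 + e\<^sup>2 \<le> (\<bar>s\<bar> + e)\<^sup>2" using assms by (simp add: power2_sum)
  then have "sqrt (s\<^sup>2 + e\<^sup>2) \<le> \<bar>s\<bar> + e" using assms by (intro real_le_lsqrt) auto
  then show "sabs e s \<le> \<bar>s\<bar>" by (simp add: sabs_def)
  have "sqrt (s\<^sup>2) \<le> sqrt (s\<^sup>2 + e\<^sup>2)" by (intro real_sqrt_le_mono) simp
  then show "\<bar>s\<bar> - e \<le> sabs e s" by (simp add: sabs_def)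
  have d: "sqrt (s\<^sup>2 + e\<^sup>2) + e > 0" using pos assms by (intro add_pos_pos) auto
  have "sabs e s * (sqrt (s\<^sup>2 + e\<^sup>2) + e) = (sqrt (s\<^sup>2 + e\<^sup>2))\<^sup>2 - e\<^sup>2" by (simp add: sabs_def power2_eq_square algebra_simps)
  also have "\<dots> = s * s" using pos by (simp add: power2_eq_square)
  finally show "sabs e s = s / (sqrt (s\<^sup>2 + e\<^sup>2) + e) * s" using d by (simp add: field_simps)
qed

lemma test_fun_sabs:
  assumes "test_fun U \<phi>" "e > 0"
  shows "test_fun U (\<lambda>x. sabs e (\<phi> x))" 
    "cgrad (\<lambda>x. sabs e (\<phi> x)) x = (\<phi> x / sqrt ((\<phi> x)\<^sup>2 + e\<^sup>2)) *\<^sub>R cgrad \<phi> x"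
    "\<bar>\<phi> x / sqrt ((\<phi> x)\<^sup>2 + e\<^sup>2)\<bar> \<le> 1" "norm (cgrad (\<lambda>x. sabs e (\<phi> x)) x) \<le> norm (cgrad \<phi> x)"
proof -
  note s = test_fun_smooth[OF assms(1)]
  have pos: "t\<^sup>2 + e\<^sup>2 > 0" for t using assms by (simp add: add_nonneg_pos)
  show "test_fun U (\<lambda>x. sabs e (\<phi> x))"
  proof (rule test_fun_vanish[OF _ assms(1)])
    show "smooth_on UNIV (\<lambda>x. sabs e (\<phi> x))" unfolding sabs_def
      by (intro smooth_on_diff smooth_on_sqrt smooth_on_add smooth_on_power smooth_on_const s pos)
  qed (use assms in \<open>auto simp: sabs_def\<close>)
  show g: "cgrad (\<lambda>x. sabs e (\<phi> x)) x = (\<phi> x / sqrt ((\<phi> x)\<^sup>2 + e\<^sup>2)) *\<^sub>R cgrad \<phi> x"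
    by (rule cgrad_compose[OF s]) (use pos[of "\<phi> x"] in \<open>auto intro!: derivative_eq_intros simp: sabs_def field_simps\<close>)
  have "\<bar>\<phi> x\<bar> \<le> sqrt ((\<phi> x)\<^sup>2 + e\<^sup>2)" by (intro real_le_rsqrt) simp
  then show b: "\<bar>\<phi> x / sqrt ((\<phi> x)\<^sup>2 + e\<^sup>2)\<bar> \<le> 1" using pos[of "\<phi> x"] by (simp add: abs_divide divide_le_eq)
  show "norm (cgrad (\<lambda>x. sabs e (\<phi> x)) x) \<le> norm (cgrad \<phi> x)"
    unfolding g norm_scaleR using b by (intro mult_left_le_one_le) auto
qed

lemma sabs_tendsto: "(\<lambda>n. sabs (1 / real (Suc n)) s) \<longlonglongrightarrow> \<bar>s\<bar>"
proof (rule tendsto_sandwich[of "\<lambda>n. \<bar>s\<bar> - 1 / real (Suc n)" _ _ "\<lambda>n. \<bar>s\<bar>"])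
  show "(\<lambda>n. \<bar>s\<bar> - 1 / real (Suc n)) \<longlonglongrightarrow> \<bar>s\<bar>"
    using tendsto_diff[OF tendsto_const[of "\<bar>s\<bar>"] LIMSEQ_Suc[OF lim_1_over_n]] by simp
qed (use sabs_props in auto)

lemma test_fun_sabs_integrals:
  assumes \<phi>: "test_fun U \<phi>" and e: "e > 0" and V: "continuous_on UNIV V" "\<And>x. V x \<ge> 0"
  shows "sqint (cgrad (\<lambda>x. sabs e (\<phi> x))) \<le> sqint (cgrad \<phi>)"
    "(\<integral>x. V x * (sabs e (\<phi> x))\<^sup>2 \<partial>lebesgue) \<le> wint V \<phi>"
proof -
  note t = test_fun_sabs[OF \<phi> e]
  note i = test_fun_pow_integrable[OF \<phi>] test_fun_pow_integrable[OF t(1)]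
  show "sqint (cgrad (\<lambda>x. sabs e (\<phi> x))) \<le> sqint (cgrad \<phi>)"
    by (intro integral_mono power_mono t(4) i) auto
  show "(\<integral>x. V x * (sabs e (\<phi> x))\<^sup>2 \<partial>lebesgue) \<le> wint V \<phi>"
  proof (rule integral_mono)
    fix x
    have "(sabs e (\<phi> x))\<^sup>2 \<le> (\<bar>\<phi> x\<bar>)\<^sup>2" using sabs_props[OF e, of "\<phi> x"] by (intro power_mono) auto
    then show "V x * (sabs e (\<phi> x))\<^sup>2 \<le> V x * (\<phi> x)\<^sup>2" using V(2)[of x] by (intro mult_left_mono) auto
  qed (use i V in auto)
qed

lemma sabs_weighted_tendsto:
  assumes \<phi>: "test_fun U \<phi>" and w: "w \<in> borel_measurable lebesgue" "integrable lebesgue (\<lambda>x. w x * \<bar>\<phi> x\<bar> powr q)" and q: "q > 0"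
  shows "(\<lambda>n. \<integral>x. w x * \<bar>sabs (1 / real (Suc n)) (\<phi> x)\<bar> powr q \<partial>lebesgue) \<longlonglongrightarrow> (\<integral>x. w x * \<bar>\<phi> x\<bar> powr q \<partial>lebesgue)"
proof (rule integral_dominated_convergence[where w="\<lambda>x. \<bar>w x * \<bar>\<phi> x\<bar> powr q\<bar>"])
  have [measurable]: "\<phi> \<in> borel_measurable lebesgue" by (rule test_fun_measurable[OF \<phi>])
  note [measurable] = w(1)
  show "(\<lambda>x. w x * \<bar>sabs (1 / real (Suc n)) (\<phi> x)\<bar> powr q) \<in> borel_measurable lebesgue" for n
    unfolding sabs_def by measurable
  show "AE x in lebesgue. (\<lambda>n. w x * \<bar>sabs (1 / real (Suc n)) (\<phi> x)\<bar> powr q) \<longlonglongrightarrow> w x * \<bar>\<phi> x\<bar> powr q"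
  proof (rule AE_I2)
    fix x
    have "(\<lambda>n. \<bar>sabs (1 / real (Suc n)) (\<phi> x)\<bar> powr q) \<longlonglongrightarrow> \<bar>\<bar>\<phi> x\<bar>\<bar> powr q"
      using q by (intro tendsto_powr' tendsto_rabs sabs_tendsto tendsto_const) auto
    then show "(\<lambda>n. w x * \<bar>sabs (1 / real (Suc n)) (\<phi> x)\<bar> powr q) \<longlonglongrightarrow> w x * \<bar>\<phi> x\<bar> powr q"
      by (intro tendsto_mult tendsto_const) simp
  qed
  show "AE x in lebesgue. norm (w x * \<bar>sabs (1 / real (Suc n)) (\<phi> x)\<bar> powr q) \<le> \<bar>w x * \<bar>\<phi> x\<bar> powr q\<bar>" for n
  proof (rule AE_I2)
    fix x
    have "\<bar>sabs (1 / real (Suc n)) (\<phi> x)\<bar> powr q \<le> \<bar>\<phi> x\<bar> powr q"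
      using sabs_props[of "1 / real (Suc n)" "\<phi> x"] q by (intro powr_mono2) auto
    then show "norm (w x * \<bar>sabs (1 / real (Suc n)) (\<phi> x)\<bar> powr q) \<le> \<bar>w x * \<bar>\<phi> x\<bar> powr q\<bar>"
      by (simp add: abs_mult mult_left_mono)
  qed
qed (use w test_fun_measurable[OF \<phi>] in auto)

text \<open>Inner regularity gives a closed T inside the set E of points of U with h > 0, such that
  E - T has smaller measure than E; so T is not null. It is compact because U is bounded, and the
  weighted integrals of cutoffs shrinking to T tend to the integral of h over T, which is
  positive.\<close>

lemma positive_weight_test_fun:
  assumes U: "open U" "bounded U" and h: "h \<in> borel_measurable lebesgue" "integrable lebesgue (\<lambda>x. indicator U x * h x)"
    and pos: "\<not> (AE x in lebesgue. x \<in> U \<longrightarrow> h x \<le> 0)" and q: "q > 0"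
  obtains \<phi> where "test_fun U \<phi>" "\<And>x. \<phi> x \<ge> 0" "(\<integral>x. h x * \<bar>\<phi> x\<bar> powr q \<partial>lebesgue) > 0"
proof -
  note [measurable] = h(1)
  have Um [measurable]: "U \<in> sets lebesgue" using U by auto
  define E where "E = {x \<in> U. h x > 0}"
  have Em: "E \<in> sets lebesgue"
  proof -
    have "E = U \<inter> {x \<in> space lebesgue. h x > 0}" by (auto simp: E_def)
    also have "\<dots> \<in> sets lebesgue" by measurable
    finally show ?thesis .
  qed
  have fU: "U \<in> lmeasurable" using U by (simp add: lmeasurable_open)
  have fE: "E \<in> lmeasurable" by (rule fmeasurableI2[OF fU _ Em]) (auto simp: E_def)
  have mE: "measure lebesgue E > 0"
  proof (rule ccontr)
    assume "\<not> measure lebesgue E > 0"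
    then have "measure lebesgue E = 0" using measure_nonneg[of lebesgue E] by linarith
    then have "E \<in> null_sets lebesgue" using emeasure_eq_measure2[OF fE] Em by (intro null_setsI) auto
    then have "AE x in lebesgue. x \<notin> E" by (rule AE_not_in)
    then have "AE x in lebesgue. x \<in> U \<longrightarrow> h x \<le> 0" by eventually_elim (auto simp: E_def not_less)
    with pos show False by blast
  qed
  obtain T where T: "closed T" "T \<subseteq> E" "E - T \<in> lmeasurable" "emeasure lebesgue (E - T) < ennreal (measure lebesgue E)"
    by (rule sets_lebesgue_inner_closed[OF Em mE])
  have K: "compact T" using T(1,2) U(2) by (auto simp: compact_eq_bounded_closed E_def intro: bounded_subset)
  have TU: "T \<subseteq> U" using T(2) by (auto simp: E_def)
  have Tm [measurable]: "T \<in> sets lebesgue" using T(1) by auto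
  obtain \<eta> :: "nat \<Rightarrow> R3 \<Rightarrow> real" where \<eta>: "\<And>n. test_fun U (\<eta> n)" "\<And>n x. 0 \<le> \<eta> n x" "\<And>n x. \<eta> n x \<le> 1"
    "\<And>x. (\<lambda>n. \<eta> n x) \<longlonglongrightarrow> indicator T x" by (rule cutoff_seq_exists[OF K U(1) TU]) blast
  have [measurable]: "\<eta> n \<in> borel_measurable lebesgue" for n by (rule test_fun_measurable[OF \<eta>(1)])
  have lim: "(\<lambda>n. \<integral>x. h x * \<bar>\<eta> n x\<bar> powr q \<partial>lebesgue) \<longlonglongrightarrow> (\<integral>x. h x * indicator T x \<partial>lebesgue)"
  proof (rule integral_dominated_convergence[where w="\<lambda>x. \<bar>indicator U x * h x\<bar>"])
    show "AE x in lebesgue. (\<lambda>n. h x * \<bar>\<eta> n x\<bar> powr q) \<longlonglongrightarrow> h x * indicator T x"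
    proof (rule AE_I2)
      fix x
      have "(\<lambda>n. \<bar>\<eta> n x\<bar> powr q) \<longlonglongrightarrow> \<bar>indicator T x\<bar> powr q"
        using q by (intro tendsto_powr' tendsto_rabs \<eta>(4) tendsto_const) auto
      moreover have "\<bar>indicator T x\<bar> powr q = indicator T x" using q by (auto simp: indicator_def)
      ultimately show "(\<lambda>n. h x * \<bar>\<eta> n x\<bar> powr q) \<longlonglongrightarrow> h x * indicator T x"
        by (intro tendsto_mult tendsto_const) simp
    qed
    show "AE x in lebesgue. norm (h x * \<bar>\<eta> n x\<bar> powr q) \<le> \<bar>indicator U x * h x\<bar>" for n
    proof (rule AE_I2)
      fix x
      show "norm (h x * \<bar>\<eta> n x\<bar> powr q) \<le> \<bar>indicator U x * h x\<bar>"
      proof (cases "x \<in> U")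
        case True
        have "\<bar>\<eta> n x\<bar> powr q \<le> 1 powr q" using \<eta>(2,3) q by (intro powr_mono2) auto
        then show ?thesis using True by (simp add: abs_mult mult_left_le)
      next
        case False then show ?thesis using test_fun_eq0_outside[OF \<eta>(1)[of n]] by simp
      qed
    qed
  qed (use h in auto)
  have Ti: "integrable lebesgue (\<lambda>x. h x * indicator T x)"
    by (rule integrable_real_bound[of _ "\<lambda>x. \<bar>indicator U x * h x\<bar>"]) (use h(2) TU in \<open>auto simp: indicator_def\<close>)
  have Tpos: "h x * indicator T x \<ge> 0" for x using T(2) by (auto simp: E_def indicator_def)
  have "(\<integral>x. h x * indicator T x \<partial>lebesgue) \<noteq> 0"
  proof
    assume "(\<integral>x. h x * indicator T x \<partial>lebesgue) = 0"
    then have "AE x in lebesgue. h x * indicator T x = 0"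
      using integral_nonneg_eq_0_iff_AE[OF Ti] Tpos by simp
    then have "AE x in lebesgue. x \<notin> T" using T(2) by (auto simp: E_def indicator_def elim!: eventually_mono split: if_splits)
    then have "emeasure lebesgue T = 0" using Tm by (subst (asm) AE_iff_null_sets[symmetric]) (auto simp: null_sets_def)
    then have "emeasure lebesgue (E - T) = emeasure lebesgue E" 
      using Em Tm by (intro emeasure_Diff_null_set) (auto simp: null_sets_def)
    then show False using T(4) emeasure_eq_measure2[OF fE] by simp
  qed
  moreover have "(\<integral>x. h x * indicator T x \<partial>lebesgue) \<ge> 0" by (intro Bochner_Integration.integral_nonneg Tpos)
  ultimately have "(\<integral>x. h x * indicator T x \<partial>lebesgue) > 0" by linarith
  from order_tendstoD(1)[OF lim this] obtain n where "(\<integral>x. h x * \<bar>\<eta> n x\<bar> powr q \<partial>lebesgue) > 0"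
    by (meson eventually_happens trivial_limit_sequentially)
  then show ?thesis using that[OF \<eta>(1,2)] by blast
qed

text \<open>Lindeloef's theorem replaces the uncountable family of balls, each with its own
  exceptional null set, by a countable one.\<close>

lemma AE_local:
  assumes "\<And>x. x \<in> S \<Longrightarrow> \<exists>r>0. AE y in lebesgue. y \<in> ball x r \<longrightarrow> P y"
  shows "AE y in (lebesgue :: R3 measure). y \<in> S \<longrightarrow> P y"
proof -
  define F where "F = {B. open B \<and> (AE y in lebesgue. y \<in> B \<longrightarrow> P y)}"
  obtain F' where F': "F' \<subseteq> F" "countable F'" "\<Union>F' = \<Union>F" using Lindelof[of F] by (auto simp: F_def)
  have "AE y in lebesgue. \<forall>B\<in>F'. y \<in> B \<longrightarrow> P y"
    using F' by (subst AE_ball_countable) (auto simp: F_def)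
  moreover have "S \<subseteq> \<Union>F'" unfolding F'(3)
  proof
    fix x assume "x \<in> S"
    then obtain r where r: "r > 0" "AE y in lebesgue. y \<in> ball x r \<longrightarrow> P y" using assms by blast
    then have "ball x r \<in> F" unfolding F_def by blast
    then show "x \<in> \<Union>F" using r(1) centre_in_ball by blast
  qed
  ultimately show ?thesis by (auto elim!: eventually_mono)
qed

section \<open>Non-negative approximations and weak gradients\<close>

lemma nnapp_H1_grad:
  assumes "nnapp U u g \<xi>"
  shows "H1_grad u g"
proof -
  note A = nnappD[OF assms]
  have "weak_grad u g" unfolding weak_grad_def
  proof (intro allI impI)
    fix \<phi> i assume \<phi>: "test_fun UNIV \<phi>"
    obtain K where K: "compact K" "\<And>x. x \<notin> K \<Longrightarrow> \<phi> x = 0" "\<And>x. x \<notin> K \<Longrightarrow> cgrad \<phi> x = 0"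
      using test_funE[OF \<phi>] by metis
    have s1: "sqi (pdir i \<phi>)"
      by (rule sqi_continuous_compact[OF smooth_on_continuous[OF smooth_on_pdir[OF test_fun_smooth[OF \<phi>]]] K(1)])
         (simp add: pdir_eq_cgrad K(3))
    have s2: "sqi (\<lambda>x. \<phi> x *\<^sub>R axis i 1 :: R3)"
      by (rule sqi_continuous_compact[OF _ K(1)])
         (use K(2) in \<open>auto intro!: continuous_intros test_fun_continuous[OF \<phi>]\<close>)
    have l1: "(\<lambda>n. \<integral>x. \<xi> n x * pdir i \<phi> x \<partial>lebesgue) \<longlonglongrightarrow> (\<integral>x. u x * pdir i \<phi> x \<partial>lebesgue)"
      using L2to_inner[OF A(3) L2to_const[OF s1]] by simp
    have l2: "(\<lambda>n. - (\<integral>x. cgrad (\<xi> n) x $ i * \<phi> x \<partial>lebesgue)) \<longlonglongrightarrow> - (\<integral>x. g x $ i * \<phi> x \<partial>lebesgue)"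
      using tendsto_minus[OF L2to_inner[OF A(4) L2to_const[OF s2]]] by (simp add: inner_axis mult.commute)
    show "(\<integral>x. u x * pdir i \<phi> x \<partial>lebesgue) = - (\<integral>x. g x $ i * \<phi> x \<partial>lebesgue)"
      by (rule LIMSEQ_unique[OF l1]) (use l2 in \<open>simp add: integration_by_parts[OF test_fun_smooth[OF A(1)] \<phi>]\<close>)
  qed
  then show ?thesis using A(6,7) by (auto simp: H1_grad_def sqi_def)
qed

lemma nnapp_H10_grad:
  assumes "nnapp U u g \<xi>"
  shows "H10_grad U u g"
proof -
  note A = nnappD[OF assms]
  have i: "integrable lebesgue (\<lambda>x. (\<xi> n x - u x)\<^sup>2)" "integrable lebesgue (\<lambda>x. (norm (cgrad (\<xi> n) x - g x))\<^sup>2)" for n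
    using sqi_integrable[OF sqi_diff[OF L2to_sqi[OF A(3)]]] sqi_integrable[OF sqi_diff[OF L2to_sqi[OF A(4)]]] by auto
  have "(\<lambda>n. (\<integral>x. (\<xi> n x - u x)\<^sup>2 \<partial>lebesgue) + (\<integral>x. (norm (cgrad (\<xi> n) x - g x))\<^sup>2 \<partial>lebesgue)) \<longlonglongrightarrow> 0 + 0"
    using L2to_lim[OF A(3)] L2to_lim[OF A(4)] by (intro tendsto_add) auto
  then have "(\<lambda>n. \<integral>x. (\<xi> n x - u x)\<^sup>2 + (norm (cgrad (\<xi> n) x - g x))\<^sup>2 \<partial>lebesgue) \<longlonglongrightarrow> 0" using i by simp
  then show ?thesis unfolding H10_grad_def using nnapp_H1_grad[OF assms] A(1) by blast
qed

lemma nnapp_mono: "nnapp U u g \<xi> \<Longrightarrow> U \<subseteq> U' \<Longrightarrow> nnapp U' u g \<xi>"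
  unfolding nnapp_def using test_fun_mono by blast

lemma nnapp_eq0_outside: 
  assumes "nnapp U u g \<xi>"
  shows "AE x in lebesgue. x \<notin> U \<longrightarrow> u x = 0"
  using nnappD(5)[OF assms]
proof eventually_elim
  case (elim x)
  then show ?case using test_fun_eq0_outside[OF nnappD(1)[OF assms]] LIMSEQ_unique[OF _ tendsto_const] by fastforce
qed

lemma L2to_bounded:
  assumes "L2to X F"
  obtains A where "\<And>n. sqint (X n) \<le> A"
proof -
  have "bounded (range (\<lambda>n. sqint (X n)))"
    using L2to_norm[OF assms] convergent_imp_bounded by blast
  then show ?thesis using that unfolding bounded_iff by (metis abs_le_D1 rangeI real_norm_def)
qed

text \<open>\<open>H10_grad\<close> provides test functions of arbitrary sign. Passing to
  \<open>sabs\<close> of them multiplies function and gradient by factors m and s. Both factors tend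
  to the indicator of U: inside because u > 0 there, outside because the test functions vanish. This
  is why the smoothing parameter may go to 0 along the same sequence.\<close>

lemma H10_positive_nnapp:
  assumes H: "H10_grad U u g" and U: "open U" and pos: "AE x in lebesgue. x \<in> U \<longrightarrow> u x > 0"
  obtains \<xi> where "nnapp U u g \<xi>"
proof -
  from H obtain \<phi> where \<phi>: "\<And>n. test_fun U (\<phi> n)"
    and lim: "(\<lambda>n. \<integral>x. (\<phi> n x - u x)\<^sup>2 + (norm (cgrad (\<phi> n) x - g x))\<^sup>2 \<partial>lebesgue) \<longlonglongrightarrow> 0" by (auto simp: H10_grad_def)
  have s: "sqi u" "sqi g" using H by (auto simp: H10_grad_def H1_grad_def sqi_def)
  have i: "integrable lebesgue (\<lambda>x. (\<phi> n x - u x)\<^sup>2)" "integrable lebesgue (\<lambda>x. (norm (cgrad (\<phi> n) x - g x))\<^sup>2)" for n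
    using sqi_integrable[OF sqi_diff[OF sqi_test_fun[OF \<phi>] s(1)]] sqi_integrable[OF sqi_diff[OF sqi_cgrad[OF \<phi>] s(2)]] by auto
  have L1: "L2to \<phi> u" unfolding L2to_def
  proof (intro conjI allI s sqi_test_fun[OF \<phi>] tendsto_zero_le[OF _ _ lim])
    show "(\<integral>x. (norm (\<phi> n x - u x))\<^sup>2 \<partial>lebesgue) \<le> (\<integral>x. (\<phi> n x - u x)\<^sup>2 + (norm (cgrad (\<phi> n) x - g x))\<^sup>2 \<partial>lebesgue)" for n
      using i by (intro integral_mono) auto
  qed simp
  have L2: "L2to (\<lambda>n. cgrad (\<phi> n)) g" unfolding L2to_def
  proof (intro conjI allI s sqi_cgrad[OF \<phi>] tendsto_zero_le[OF _ _ lim])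
    show "(\<integral>x. (norm (cgrad (\<phi> n) x - g x))\<^sup>2 \<partial>lebesgue) \<le> (\<integral>x. (\<phi> n x - u x)\<^sup>2 + (norm (cgrad (\<phi> n) x - g x))\<^sup>2 \<partial>lebesgue)" for n
      using i by (intro integral_mono) auto
  qed simp
  obtain r1 where r1: "strict_mono r1" "AE x in lebesgue. (\<lambda>n. \<phi> (r1 n) x) \<longlonglongrightarrow> u x" by (rule L2to_AE_subseq[OF L1])
  obtain r2 where r2: "strict_mono r2" "AE x in lebesgue. (\<lambda>n. cgrad (\<phi> (r2 n)) x) \<longlonglongrightarrow> g x" by (rule L2to_AE_subseq[OF L2])
  have u0: "AE x in lebesgue. x \<notin> U \<longrightarrow> u x = 0"
    using r1(2)
  proof eventually_elim
    case (elim x) then show ?case using test_fun_eq0_outside[OF \<phi>] LIMSEQ_unique[OF _ tendsto_const] by fastforce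
  qed
  have g0: "AE x in lebesgue. x \<notin> U \<longrightarrow> g x = 0"
    using r2(2)
  proof eventually_elim
    case (elim x) then show ?case using test_fun_cgrad_eq0_outside[OF \<phi>] LIMSEQ_unique[OF _ tendsto_const] by fastforce
  qed
  define e where "e n = 1 / real (Suc n)" for n
  have e: "e n > 0" for n by (simp add: e_def)
  have e0: "e \<longlonglongrightarrow> 0" unfolding e_def using LIMSEQ_Suc[OF lim_1_over_n] by simp
  define \<psi> where "\<psi> n = \<phi> (r1 n)" for n
  have \<psi>: "test_fun U (\<psi> n)" for n by (simp add: \<psi>_def \<phi>)
  have \<psi>lim: "AE x in lebesgue. (\<lambda>n. \<psi> n x) \<longlonglongrightarrow> u x" using r1(2) by (simp add: \<psi>_def)
  have [measurable]: "\<psi> n \<in> borel_measurable lebesgue" for n by (rule test_fun_measurable[OF \<psi>])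
  have [measurable]: "U \<in> sets lebesgue" using U by auto
  have M1: "L2to \<psi> u" "L2to (\<lambda>n. cgrad (\<psi> n)) g" unfolding \<psi>_def using L2to_subseq[OF L1 r1(1)] L2to_subseq[OF L2 r1(1)] by auto
  define m where "m n x = \<psi> n x / (sqrt ((\<psi> n x)\<^sup>2 + (e n)\<^sup>2) + e n)" for n x
  define s where "s n x = \<psi> n x / sqrt ((\<psi> n x)\<^sup>2 + (e n)\<^sup>2)" for n x
  have sb: "\<bar>s n x\<bar> \<le> 1" for n x unfolding s_def by (rule test_fun_sabs(3)[OF \<psi> e])
  have mb: "\<bar>m n x\<bar> \<le> 1" for n x
  proof -
    have "\<bar>\<psi> n x\<bar> \<le> sqrt ((\<psi> n x)\<^sup>2 + (e n)\<^sup>2)" by (intro real_le_rsqrt) simp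
    then have le: "\<bar>\<psi> n x\<bar> \<le> sqrt ((\<psi> n x)\<^sup>2 + (e n)\<^sup>2) + e n" using e[of n] by linarith
    moreover have "sqrt ((\<psi> n x)\<^sup>2 + (e n)\<^sup>2) + e n > 0" using e[of n] by (simp add: add_nonneg_pos)
    ultimately show ?thesis unfolding m_def abs_divide by simp
  qed
  have ml: "AE x in lebesgue. (\<lambda>n. m n x) \<longlonglongrightarrow> indicator U x" and sl: "AE x in lebesgue. (\<lambda>n. s n x) \<longlonglongrightarrow> indicator U x"
  proof -
    have "AE x in lebesgue. ((\<lambda>n. m n x) \<longlonglongrightarrow> indicator U x) \<and> ((\<lambda>n. s n x) \<longlonglongrightarrow> indicator U x)"
      using \<psi>lim pos
    proof eventually_elim
      case (elim x)
      show ?case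
      proof (cases "x \<in> U")
        case True
        then have ux: "u x > 0" using elim by simp
        have "(\<lambda>n. m n x) \<longlonglongrightarrow> u x / (sqrt ((u x)\<^sup>2 + 0\<^sup>2) + 0)" unfolding m_def
          using ux by (intro tendsto_intros elim e0) auto
        moreover have "(\<lambda>n. s n x) \<longlonglongrightarrow> u x / sqrt ((u x)\<^sup>2 + 0\<^sup>2)" unfolding s_def
          using ux by (intro tendsto_intros elim e0) auto
        ultimately show ?thesis using True ux by simp
      next
        case False
        then show ?thesis using test_fun_eq0_outside[OF \<psi>] by (simp add: m_def s_def)
      qed
    qed
    then show "AE x in lebesgue. (\<lambda>n. m n x) \<longlonglongrightarrow> indicator U x" "AE x in lebesgue. (\<lambda>n. s n x) \<longlonglongrightarrow> indicator U x"
      by (auto elim!: eventually_mono)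
  qed
  define \<xi> where "\<xi> n x = sabs (e n) (\<psi> n x)" for n x
  have \<xi>m: "\<xi> n x = m n x *\<^sub>R \<psi> n x" for n x using sabs_props(3)[OF e] by (simp add: \<xi>_def m_def)
  have \<xi>g: "cgrad (\<xi> n) x = s n x *\<^sub>R cgrad (\<psi> n) x" for n x unfolding \<xi>_def s_def by (rule test_fun_sabs(2)[OF \<psi> e])
  have "L2to (\<lambda>n x. m n x *\<^sub>R \<psi> n x) (\<lambda>x. indicator U x *\<^sub>R u x)"
    by (rule L2to_mult[OF M1(1) _ mb _ ml]) (auto simp: m_def)
  then have N1: "L2to \<xi> u" unfolding \<xi>m[symmetric]
    by (rule L2to_cong_AE) (use u0 s in \<open>auto simp: sqi_def indicator_def elim!: eventually_mono\<close>)
  have "L2to (\<lambda>n x. s n x *\<^sub>R cgrad (\<psi> n) x) (\<lambda>x. indicator U x *\<^sub>R g x)"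
    by (rule L2to_mult[OF M1(2) _ sb _ sl]) (auto simp: s_def)
  then have N2: "L2to (\<lambda>n. cgrad (\<xi> n)) g" unfolding \<xi>g[symmetric]
    by (rule L2to_cong_AE) (use g0 s in \<open>auto simp: sqi_def indicator_def elim!: eventually_mono\<close>)
  have "AE x in lebesgue. (\<lambda>n. \<xi> n x) \<longlonglongrightarrow> u x"
    using \<psi>lim ml u0
  proof eventually_elim
    case (elim x)
    have "(\<lambda>n. \<xi> n x) \<longlonglongrightarrow> indicator U x *\<^sub>R u x" unfolding \<xi>m by (intro tendsto_intros elim)
    then show ?case using elim(3) by (auto simp: indicator_def split: if_splits)
  qed
  then have "nnapp U u g \<xi>" unfolding nnapp_def
    using N1 N2 test_fun_sabs(1)[OF \<psi> e] sabs_props(1)[OF e] by (auto simp: \<xi>_def[abs_def])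
  then show ?thesis by (rule that)
qed

text \<open>Sobolev's inequality for the tail of the approximating sequence, whose gradients are
  smaller than any given e, combined with Fatou's lemma, makes the integral of u^6 smaller than any
  positive number.\<close>

lemma nnapp_zero_grad:
  assumes app: "nnapp U u g \<xi>" and g: "sqint g = 0"
  shows "AE x in lebesgue. u x = 0"
proof -
  note A = nnappD[OF app]
  have S: "integrable lebesgue (\<lambda>x. u x ^ 6) \<and> (\<integral>x. u x ^ 6 \<partial>lebesgue) \<le> 4096 * e ^ 3" if e: "e > 0" for e
  proof -
    have "\<forall>\<^sub>F n in sequentially. (sqint (cgrad (\<xi> n))) < e"
      using order_tendstoD(2)[OF L2to_norm[OF A(4)]] g e by simp
    then obtain N where N: "\<And>n. n \<ge> N \<Longrightarrow> (sqint (cgrad (\<xi> n))) < e" by (auto simp: eventually_sequentially)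
    define \<psi> where "\<psi> n = \<xi> (n + N)" for n
    have \<psi>: "test_fun U (\<psi> n)" "sqint (cgrad (\<psi> n)) \<le> e" for n
      using A(1) N[of "n + N"] by (auto simp: \<psi>_def)
    have b: "(\<integral>x. \<psi> n x ^ 6 \<partial>lebesgue) \<le> 4096 * e ^ 3" for n
    proof -
      have "(\<integral>x. \<psi> n x ^ 6 \<partial>lebesgue) \<le> 4096 * (sqint (cgrad (\<psi> n))) ^ 3" by (rule Sobolev_test_fun[OF \<psi>(1)])
      also have "\<dots> \<le> 4096 * e ^ 3" by (intro mult_left_mono power_mono \<psi>) auto
      finally show ?thesis .
    qed
    have l6: "AE x in lebesgue. (\<lambda>n. \<psi> n x ^ 6) \<longlonglongrightarrow> u x ^ 6"
      using A(5) by eventually_elim (auto simp: \<psi>_def intro!: tendsto_intros LIMSEQ_ignore_initial_segment)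
    have um: "(\<lambda>x. u x ^ 6) \<in> borel_measurable lebesgue" using A(8) by simp
    show ?thesis using Fatou_bound[OF test_fun_pow_integrable(2)[OF \<psi>(1)] _ um l6 b] by (simp add: zero_le_even_power)
  qed
  have "(\<integral>x. u x ^ 6 \<partial>lebesgue) \<le> 0"
  proof (rule field_le_epsilon)
    fix e :: real assume e: "e > 0"
    define t where "t = min 1 (e / 4096)"
    have t: "t > 0" "t \<le> 1" "4096 * t \<le> e" using e by (auto simp: t_def)
    have "t ^ 3 \<le> t ^ 1" using t by (intro power_decreasing) auto
    then have "4096 * t ^ 3 \<le> e" using t(3) by simp
    then show "(\<integral>x. u x ^ 6 \<partial>lebesgue) \<le> 0 + e" using S[OF t(1)] by simp
  qed
  moreover have "(\<integral>x. u x ^ 6 \<partial>lebesgue) \<ge> 0" by (intro Bochner_Integration.integral_nonneg) (simp add: zero_le_even_power)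
  ultimately have "(\<integral>x. u x ^ 6 \<partial>lebesgue) = 0" by linarith
  then show ?thesis
    using integral_nonneg_eq_0_iff_AE[of lebesgue "\<lambda>x. u x ^ 6"] S[of 1] by (auto simp: zero_le_even_power)
qed

section \<open>Quadratic terms under perturbation by test functions\<close>

context kirchhoff_data
begin

lemma f_local_integrable:
  assumes "test_fun U \<phi>"
  shows "integrable lebesgue (\<lambda>x. f x * \<phi> x)" "integrable lebesgue (\<lambda>x. \<bar>f x\<bar> * \<phi> x)"
proof -
  obtain B where B: "B > 0" "\<And>x. \<bar>\<phi> x\<bar> \<le> B" using test_fun_bounded[OF assms] by blast
  obtain K where K: "compact K" "\<And>x. x \<notin> K \<Longrightarrow> \<phi> x = 0" using test_funE[OF assms] by metis
  have i: "integrable lebesgue (\<lambda>x. \<bar>\<phi> x\<bar> + B * \<bar>f x\<bar> powr (3/2))"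
    using integrable_lebesgue_continuous_compact[OF test_fun_continuous[OF assms] K] f(2) by simp
  have b: "\<bar>f x\<bar> * \<bar>\<phi> x\<bar> \<le> \<bar>\<phi> x\<bar> + B * \<bar>f x\<bar> powr (3/2)" for x
  proof (cases "\<bar>f x\<bar> \<le> 1")
    case True
    then have "\<bar>f x\<bar> * \<bar>\<phi> x\<bar> \<le> 1 * \<bar>\<phi> x\<bar>" by (intro mult_right_mono) auto
    moreover have "0 \<le> B * \<bar>f x\<bar> powr (3/2)" using B(1) by simp
    ultimately show ?thesis by linarith
  next
    case False
    then have "\<bar>f x\<bar> powr 1 \<le> \<bar>f x\<bar> powr (3/2)" by (intro powr_mono) auto
    then have "\<bar>f x\<bar> * \<bar>\<phi> x\<bar> \<le> \<bar>f x\<bar> powr (3/2) * B" using B(2)[of x] by (intro mult_mono) auto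
    then show ?thesis by (simp add: mult.commute add_increasing)
  qed
  show "integrable lebesgue (\<lambda>x. f x * \<phi> x)" "integrable lebesgue (\<lambda>x. \<bar>f x\<bar> * \<phi> x)"
    by (rule integrable_real_bound[OF i]; use b f(1) test_fun_measurable[OF assms] in \<open>auto simp: abs_mult\<close>)+
qed

lemma f_product_integrable:
  assumes "u \<in> borel_measurable lebesgue" "integrable lebesgue (\<lambda>x. u x ^ 6)"
    "v \<in> borel_measurable lebesgue" "integrable lebesgue (\<lambda>x. v x ^ 6)"
  shows "integrable lebesgue (\<lambda>x. f x * u x * v x)"
proof (rule integrable_real_bound[of _ "\<lambda>x. \<bar>f x * (u x)\<^sup>2\<bar> + \<bar>f x * (v x)\<^sup>2\<bar>"])
  have "\<bar>f x * u x * v x\<bar> \<le> \<bar>f x * (u x)\<^sup>2\<bar> + \<bar>f x * (v x)\<^sup>2\<bar>" for x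
  proof -
    have "\<bar>u x\<bar> * \<bar>v x\<bar> \<le> (u x)\<^sup>2 + (v x)\<^sup>2"
    proof -
      have "2 * (\<bar>u x\<bar> * \<bar>v x\<bar>) \<le> (u x)\<^sup>2 + (v x)\<^sup>2" using sum_squares_bound[of "\<bar>u x\<bar>" "\<bar>v x\<bar>"] by (simp add: mult.assoc)
      moreover have "0 \<le> \<bar>u x\<bar> * \<bar>v x\<bar>" by simp
      ultimately show ?thesis by linarith
    qed
    then have "\<bar>f x\<bar> * (\<bar>u x\<bar> * \<bar>v x\<bar>) \<le> \<bar>f x\<bar> * ((u x)\<^sup>2 + (v x)\<^sup>2)" by (intro mult_left_mono) auto
    then show ?thesis by (simp add: abs_mult distrib_left mult.assoc)
  qed
  then show "AE x in lebesgue. \<bar>f x * u x * v x\<bar> \<le> \<bar>f x * (u x)\<^sup>2\<bar> + \<bar>f x * (v x)\<^sup>2\<bar>" by simp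
qed (use f_weight_integrable assms f(1) in auto)

lemma nnapp_sixth: 
  assumes "nnapp U u g \<xi>"
  shows "integrable lebesgue (\<lambda>x. u x ^ 6)"
proof -
  obtain A where "\<And>n. sqint (cgrad (\<xi> n)) \<le> A" using L2to_bounded[OF nnappD(4)[OF assms]] by blast
  from sixth_power_limit(1)[OF nnappD(1)[OF assms] this nnappD(8,5)[OF assms]] show ?thesis .
qed

text \<open>Inequalities are known for test functions, hence at \<xi> n + t \<phi> and not at u + t
  \<phi>; these limits carry them over. The perturbed functions may change sign.\<close>

lemma perturbation_limits:
  fixes t :: real
  assumes app: "nnapp U u g \<xi>" and LV: "L2to (\<lambda>n x. sqrt (V x) * \<xi> n x) (\<lambda>x. sqrt (V x) * u x)" and \<phi>: "test_fun U \<phi>"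
  defines "\<psi> \<equiv> \<lambda>n x. \<xi> n x + t * \<phi> x"
  shows "test_fun U (\<psi> n)"
    "(\<lambda>n. sqint (cgrad (\<psi> n))) \<longlonglongrightarrow> (\<integral>x. (norm (g x + t *\<^sub>R cgrad \<phi> x))\<^sup>2 \<partial>lebesgue)"
    "(\<lambda>n. wint V (\<psi> n)) \<longlonglongrightarrow> (\<integral>x. V x * (u x + t * \<phi> x)\<^sup>2 \<partial>lebesgue)"
    "(\<lambda>n. wint f (\<psi> n)) \<longlonglongrightarrow> (\<integral>x. f x * (u x + t * \<phi> x)\<^sup>2 \<partial>lebesgue)"
    "(\<lambda>n. \<integral>x. Q x * \<bar>\<psi> n x\<bar> powr p \<partial>lebesgue) \<longlonglongrightarrow> (\<integral>x. Q x * \<bar>u x + t * \<phi> x\<bar> powr p \<partial>lebesgue)"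
proof -
  note A = nnappD[OF app]
  have t\<psi>: "test_fun U (\<psi> n)" for n unfolding \<psi>_def by (intro test_fun_add test_fun_cmult A \<phi>)
  then show "test_fun U (\<psi> n)" .
  have c\<psi>: "cgrad (\<psi> n) x = cgrad (\<xi> n) x + t *\<^sub>R cgrad \<phi> x" for n x
  proof -
    have "cgrad (\<psi> n) x = cgrad (\<xi> n) x + cgrad (\<lambda>x. t * \<phi> x) x"
      unfolding \<psi>_def by (intro cgrad_add smooth_on_cmult test_fun_smooth[OF A(1)] test_fun_smooth[OF \<phi>])
    then show ?thesis by (simp add: cgrad_cmult test_fun_smooth[OF \<phi>])
  qed
  have L1: "L2to \<psi> (\<lambda>x. u x + t * \<phi> x)"
    unfolding \<psi>_def using L2to_add[OF A(3) L2to_scaleR[OF L2to_const[OF sqi_test_fun[OF \<phi>]], of t]] by simp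
  have c\<psi>': "(\<lambda>n. cgrad (\<psi> n)) = (\<lambda>n x. cgrad (\<xi> n) x + t *\<^sub>R cgrad \<phi> x)" by (intro ext) (rule c\<psi>)
  have L2: "L2to (\<lambda>n. cgrad (\<psi> n)) (\<lambda>x. g x + t *\<^sub>R cgrad \<phi> x)"
    using L2to_add[OF A(4) L2to_scaleR[OF L2to_const[OF sqi_cgrad[OF \<phi>]], of t]] unfolding c\<psi>' .
  have sV: "sqi (\<lambda>x. sqrt (V x) * \<phi> x)" by (rule sqi_test_fun_mult(1)[OF _ \<phi>]) (intro continuous_intros V)
  have L3: "L2to (\<lambda>n x. sqrt (V x) * \<psi> n x) (\<lambda>x. sqrt (V x) * (u x + t * \<phi> x))"
    using L2to_add[OF LV L2to_scaleR[OF L2to_const[OF sV], of t]] by (simp add: \<psi>_def algebra_simps)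
  have lim: "AE x in lebesgue. (\<lambda>n. \<psi> n x) \<longlonglongrightarrow> u x + t * \<phi> x"
    using A(5) by eventually_elim (auto simp: \<psi>_def intro!: tendsto_intros)
  obtain B where B: "\<And>n. sqint (cgrad (\<psi> n)) \<le> B" using L2to_bounded[OF L2] by blast
  show "(\<lambda>n. sqint (cgrad (\<psi> n))) \<longlonglongrightarrow> (\<integral>x. (norm (g x + t *\<^sub>R cgrad \<phi> x))\<^sup>2 \<partial>lebesgue)" by (rule L2to_norm[OF L2])
  show "(\<lambda>n. wint V (\<psi> n)) \<longlonglongrightarrow> (\<integral>x. V x * (u x + t * \<phi> x)\<^sup>2 \<partial>lebesgue)"
    using L2to_norm[OF L3] by (simp add: power_mult_distrib V(1))
  show "(\<lambda>n. wint f (\<psi> n)) \<longlonglongrightarrow> (\<integral>x. f x * (u x + t * \<phi> x)\<^sup>2 \<partial>lebesgue)"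
    by (rule f_term_tendsto[OF t\<psi> B sqi_measurable[OF L2to_sqi(2)[OF L1]] lim])
  show "(\<lambda>n. \<integral>x. Q x * \<bar>\<psi> n x\<bar> powr p \<partial>lebesgue) \<longlonglongrightarrow> (\<integral>x. Q x * \<bar>u x + t * \<phi> x\<bar> powr p \<partial>lebesgue)"
    by (rule Q_term_tendsto[OF t\<psi> B L1 lim])
qed

lemma expand_quadratic:
  assumes app: "nnapp U u g \<xi>" and sV: "sqi (\<lambda>x. sqrt (V x) * u x)" and \<phi>: "test_fun U' \<phi>"
  shows "(\<integral>x. (norm (g x + t *\<^sub>R cgrad \<phi> x))\<^sup>2 \<partial>lebesgue) = sqint g + 2 * t * (\<integral>x. g x \<bullet> cgrad \<phi> x \<partial>lebesgue) + t\<^sup>2 * sqint (cgrad \<phi>)"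
    "(\<integral>x. V x * (u x + t * \<phi> x)\<^sup>2 \<partial>lebesgue) = wint V u + 2 * t * (\<integral>x. V x * u x * \<phi> x \<partial>lebesgue) + t\<^sup>2 * wint V \<phi>"
    "(\<integral>x. f x * (u x + t * \<phi> x)\<^sup>2 \<partial>lebesgue) = wint f u + 2 * t * (\<integral>x. f x * u x * \<phi> x \<partial>lebesgue) + t\<^sup>2 * wint f \<phi>"
    "integrable lebesgue (\<lambda>x. V x * u x * \<phi> x)" "integrable lebesgue (\<lambda>x. f x * u x * \<phi> x)" "integrable lebesgue (\<lambda>x. V x * (u x)\<^sup>2)"
proof -
  note A = nnappD[OF app]
  note ti = test_fun_pow_integrable[OF \<phi>]
  have i1: "integrable lebesgue (\<lambda>x. g x \<bullet> cgrad \<phi> x)" by (rule sqi_inner[OF A(7) sqi_cgrad[OF \<phi>]])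
  have sV2: "sqi (\<lambda>x. sqrt (V x) * \<phi> x)" by (rule sqi_test_fun_mult(1)[OF _ \<phi>]) (intro continuous_intros V)
  have VV: "sqrt (V x) * a * (sqrt (V x) * b) = V x * a * b" for x a b
  proof -
    have "sqrt (V x) * a * (sqrt (V x) * b) = (sqrt (V x) * sqrt (V x)) * a * b" by (simp only: mult_ac)
    then show ?thesis using V(1)[of x] by simp
  qed
  show i2: "integrable lebesgue (\<lambda>x. V x * u x * \<phi> x)" using sqi_mult[OF sV sV2] by (simp only: VV)
  show i3: "integrable lebesgue (\<lambda>x. f x * u x * \<phi> x)"
    by (rule f_product_integrable[OF A(8) nnapp_sixth[OF app] test_fun_measurable[OF \<phi>] ti(2)])
  show i4: "integrable lebesgue (\<lambda>x. V x * (u x)\<^sup>2)" using sqi_integrable[OF sV] by (simp add: power_mult_distrib V(1))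
  have i5: "integrable lebesgue (\<lambda>x. f x * (u x)\<^sup>2)" by (rule f_weight_integrable[OF A(8) nnapp_sixth[OF app]])
  have i6: "integrable lebesgue (\<lambda>x. f x * (\<phi> x)\<^sup>2)" by (rule f_weight_test(1)[OF \<phi>])
  have i7: "integrable lebesgue (\<lambda>x. V x * (\<phi> x)\<^sup>2)" by (rule ti(4)[OF V(2)])
  have i8: "integrable lebesgue (\<lambda>x. (norm (g x))\<^sup>2)" by (rule sqi_integrable[OF A(7)])
  have "(\<integral>x. (norm (g x + t *\<^sub>R cgrad \<phi> x))\<^sup>2 \<partial>lebesgue) = (\<integral>x. (norm (g x))\<^sup>2 + 2 * t * (g x \<bullet> cgrad \<phi> x) + t\<^sup>2 * (norm (cgrad \<phi> x))\<^sup>2 \<partial>lebesgue)"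
    by (intro Bochner_Integration.integral_cong)
       (auto simp: power2_norm_eq_inner inner_add_left inner_add_right inner_commute power2_eq_square[of t] algebra_simps)
  then show "(\<integral>x. (norm (g x + t *\<^sub>R cgrad \<phi> x))\<^sup>2 \<partial>lebesgue) = sqint g + 2 * t * (\<integral>x. g x \<bullet> cgrad \<phi> x \<partial>lebesgue) + t\<^sup>2 * sqint (cgrad \<phi>)"
    using i1 i8 ti(3) by simp
  have "(\<integral>x. V x * (u x + t * \<phi> x)\<^sup>2 \<partial>lebesgue) = (\<integral>x. V x * (u x)\<^sup>2 + 2 * t * (V x * u x * \<phi> x) + t\<^sup>2 * (V x * (\<phi> x)\<^sup>2) \<partial>lebesgue)"
    by (intro Bochner_Integration.integral_cong) (auto simp: power2_eq_square algebra_simps)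
  then show "(\<integral>x. V x * (u x + t * \<phi> x)\<^sup>2 \<partial>lebesgue) = wint V u + 2 * t * (\<integral>x. V x * u x * \<phi> x \<partial>lebesgue) + t\<^sup>2 * wint V \<phi>"
    using i2 i4 i7 by simp
  have "(\<integral>x. f x * (u x + t * \<phi> x)\<^sup>2 \<partial>lebesgue) = (\<integral>x. f x * (u x)\<^sup>2 + 2 * t * (f x * u x * \<phi> x) + t\<^sup>2 * (f x * (\<phi> x)\<^sup>2) \<partial>lebesgue)"
    by (intro Bochner_Integration.integral_cong) (auto simp: power2_eq_square algebra_simps)
  then show "(\<integral>x. f x * (u x + t * \<phi> x)\<^sup>2 \<partial>lebesgue) = wint f u + 2 * t * (\<integral>x. f x * u x * \<phi> x \<partial>lebesgue) + t\<^sup>2 * wint f \<phi>"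
    using i3 i5 i6 by simp
qed

text \<open>A vector at which a non-negative quadratic form is at most 0 lies in its kernel: the
  form along the line is a + 2 t b + t^2 d with a <= 0 <= d and stays non-negative, so b = 0. With
  \<mu> = 0 on \<open>Om\<close> this is the eigenvalue equation; on the whole space it enters the
  case of lam above \<open>lambda1\<close>.\<close>

lemma quadratic_stationary:
  assumes app: "nnapp U u g \<xi>" and LV: "L2to (\<lambda>n x. sqrt (V x) * \<xi> n x) (\<lambda>x. sqrt (V x) * u x)" and \<phi>: "test_fun U \<phi>"
    and q: "\<And>\<psi>. test_fun U \<psi> \<Longrightarrow> 0 \<le> sqint (cgrad \<psi>) + \<mu> * wint V \<psi> - l * wint f \<psi>"
    and qu: "sqint g + \<mu> * wint V u - l * wint f u \<le> 0"
  shows "(\<integral>x. g x \<bullet> cgrad \<phi> x \<partial>lebesgue) = l * (\<integral>x. f x * u x * \<phi> x \<partial>lebesgue) - \<mu> * (\<integral>x. V x * u x * \<phi> x \<partial>lebesgue)"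
proof -
  note P = perturbation_limits[OF app LV \<phi>]
  note E = expand_quadratic[OF app L2to_sqi(2)[OF LV] \<phi>]
  have ge: "0 \<le> (\<integral>x. (norm (g x + t *\<^sub>R cgrad \<phi> x))\<^sup>2 \<partial>lebesgue) + \<mu> * (\<integral>x. V x * (u x + t * \<phi> x)\<^sup>2 \<partial>lebesgue) - l * (\<integral>x. f x * (u x + t * \<phi> x)\<^sup>2 \<partial>lebesgue)" for t
    by (rule LIMSEQ_le_const[OF tendsto_diff[OF tendsto_add[OF P(2) tendsto_mult[OF tendsto_const P(3)]] tendsto_mult[OF tendsto_const P(4)]]])
       (use q[OF P(1)] in auto)
  define a where "a = sqint g + \<mu> * wint V u - l * wint f u"
  define b where "b = (\<integral>x. g x \<bullet> cgrad \<phi> x \<partial>lebesgue) + \<mu> * (\<integral>x. V x * u x * \<phi> x \<partial>lebesgue) - l * (\<integral>x. f x * u x * \<phi> x \<partial>lebesgue)"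
  define d where "d = sqint (cgrad \<phi>) + \<mu> * wint V \<phi> - l * wint f \<phi>"
  have "0 \<le> a + 2 * t * b + t\<^sup>2 * d" for t
    using ge[of t] unfolding E a_def b_def d_def by (simp add: algebra_simps)
  then have "0 \<le> a - 2 * t * (- b) + t\<^sup>2 * d" for t by simp
  moreover have "d \<ge> 0" using q[OF \<phi>] by (simp add: d_def)
  ultimately have "(- b)\<^sup>2 \<le> a * d" by (rule quadratic_nonneg_discriminant)
  moreover have "a * d \<le> 0" using qu \<open>d \<ge> 0\<close> by (simp add: a_def mult_nonpos_nonneg)
  ultimately have "(- b)\<^sup>2 \<le> 0" by linarith
  then have "b = 0" by simp
  then show ?thesis by (simp add: b_def)
qed

end

subsection \<open>The principal eigenvalue\<close>

context kirchhoff_data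
begin

abbreviation "Om \<equiv> interior {x. V x = 0}"

lemma V_test_fun_Om: "test_fun Om \<phi> \<Longrightarrow> V x * (\<phi> x)\<^sup>2 = 0" "test_fun Om \<phi> \<Longrightarrow> V x * a * \<phi> x = 0"
  using test_fun_eq0_outside[of Om \<phi> x] interior_subset[of "{x. V x = 0}"] by (cases "x \<in> Om"; force)+

text \<open>It lets the equation for u be tested with u itself: u is not a test function, but \<xi>
  n is, and the right-hand side converges.\<close>

lemma f_product_tendsto:
  assumes app: "nnapp U u g \<xi>"
  shows "(\<lambda>n. \<integral>x. f x * u x * \<xi> n x \<partial>lebesgue) \<longlonglongrightarrow> wint f u"
proof -
  note A = nnappD[OF app]
  note [measurable] = A(8) f(1)
  have [measurable]: "\<xi> n \<in> borel_measurable lebesgue" for n by (rule test_fun_measurable[OF A(1)])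
  obtain B where B: "\<And>n. sqint (cgrad (\<xi> n)) \<le> B" using L2to_bounded[OF A(4)] by blast
  note S = sixth_power_limit[OF A(1) B A(8) A(5)]
  have i1: "integrable lebesgue (\<lambda>x. f x * u x * \<xi> n x)" for n
    by (rule f_product_integrable[OF A(8) S(1) test_fun_measurable[OF A(1)] test_fun_pow_integrable(2)[OF A(1)]])
  have i2: "integrable lebesgue (\<lambda>x. f x * (u x)\<^sup>2)" by (rule f_weight_integrable[OF A(8) S(1)])
  have "(\<lambda>n. \<integral>x. \<bar>f x * u x * \<xi> n x - f x * (u x)\<^sup>2\<bar> \<partial>lebesgue) \<longlonglongrightarrow> 0"
  proof (rule Vitali_tendsto_zero[where e="\<lambda>n x. \<xi> n x ^ 6" and B="4096 * B ^ 3"])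
    show "AE x in lebesgue. (\<lambda>n. \<bar>f x * u x * \<xi> n x - f x * (u x)\<^sup>2\<bar>) \<longlonglongrightarrow> 0"
      using A(5)
    proof eventually_elim
      case (elim x)
      have "(\<lambda>n. \<bar>f x * u x * \<xi> n x - f x * (u x)\<^sup>2\<bar>) \<longlonglongrightarrow> \<bar>f x * u x * u x - f x * (u x)\<^sup>2\<bar>" by (intro tendsto_intros elim)
      then show ?case by (simp add: power2_eq_square)
    qed
    show "(\<integral>x. \<xi> n x ^ 6 \<partial>lebesgue) \<le> 4096 * B ^ 3" for n by (rule S(3))
    fix \<tau> :: real assume \<tau>: "\<tau> > 0"
    define k where "k x = 2 * \<bar>f x * (u x)\<^sup>2\<bar> + inverse (sqrt \<tau>) * \<bar>f x\<bar> powr (3/2)" for x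
    have "\<bar>f x * u x * \<xi> n x - f x * (u x)\<^sup>2\<bar> \<le> k x + 0 + \<tau> * \<xi> n x ^ 6" for n x
    proof -
      have "2 * (\<bar>u x\<bar> * \<bar>\<xi> n x\<bar>) \<le> (u x)\<^sup>2 + (\<xi> n x)\<^sup>2" using sum_squares_bound[of "\<bar>u x\<bar>" "\<bar>\<xi> n x\<bar>"] by (simp add: mult.assoc)
      moreover have "0 \<le> \<bar>u x\<bar> * \<bar>\<xi> n x\<bar>" by simp
      ultimately have "\<bar>u x\<bar> * \<bar>\<xi> n x\<bar> \<le> (u x)\<^sup>2 + (\<xi> n x)\<^sup>2" by linarith
      then have "\<bar>f x\<bar> * (\<bar>u x\<bar> * \<bar>\<xi> n x\<bar>) \<le> \<bar>f x\<bar> * ((u x)\<^sup>2 + (\<xi> n x)\<^sup>2)" by (intro mult_left_mono) auto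
      moreover have "\<bar>f x * u x * \<xi> n x - f x * (u x)\<^sup>2\<bar> \<le> \<bar>f x\<bar> * (\<bar>u x\<bar> * \<bar>\<xi> n x\<bar>) + \<bar>f x\<bar> * (u x)\<^sup>2"
        using abs_triangle_ineq4[of "f x * u x * \<xi> n x" "f x * (u x)\<^sup>2"] by (simp add: abs_mult mult.assoc)
      moreover have "\<bar>f x\<bar> * (\<xi> n x)\<^sup>2 \<le> inverse (sqrt \<tau>) * \<bar>f x\<bar> powr (3/2) + \<tau> * \<xi> n x ^ 6"
        using \<tau> by (intro weight_square_le) auto
      ultimately show ?thesis unfolding k_def by (simp add: abs_mult distrib_left)
    qed
    moreover have "integrable lebesgue k" unfolding k_def using i2 f(2) by simp
    ultimately show "\<exists>k d. integrable lebesgue k \<and> (\<forall>n. integrable lebesgue (d n)) \<and> (\<forall>n. AE x in lebesgue. d n x \<ge> 0) \<and>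
        (\<lambda>n. integral\<^sup>L lebesgue (d n)) \<longlonglongrightarrow> 0 \<and> (\<forall>n. AE x in lebesgue. \<bar>f x * u x * \<xi> n x - f x * (u x)\<^sup>2\<bar> \<le> k x + d n x + \<tau> * \<xi> n x ^ 6)"
      by (intro exI[of _ k] exI[of _ "\<lambda>n x. 0"]) auto
  qed (use i1 i2 test_fun_pow_integrable(2)[OF A(1)] in \<open>auto simp: zero_le_even_power\<close>)
  then have "(\<lambda>n. (\<integral>x. f x * u x * \<xi> n x \<partial>lebesgue) - wint f u) \<longlonglongrightarrow> 0"
  proof (rule Lim_null_comparison[rotated])
    show "\<forall>\<^sub>F n in sequentially. norm ((\<integral>x. f x * u x * \<xi> n x \<partial>lebesgue) - wint f u) \<le> (\<integral>x. \<bar>f x * u x * \<xi> n x - f x * (u x)\<^sup>2\<bar> \<partial>lebesgue)"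
    proof (rule always_eventually, rule allI)
      fix n
      have "(\<integral>x. f x * u x * \<xi> n x \<partial>lebesgue) - wint f u = (\<integral>x. f x * u x * \<xi> n x - f x * (u x)\<^sup>2 \<partial>lebesgue)" using i1 i2 by simp
      then show "norm ((\<integral>x. f x * u x * \<xi> n x \<partial>lebesgue) - wint f u) \<le> (\<integral>x. \<bar>f x * u x * \<xi> n x - f x * (u x)\<^sup>2\<bar> \<partial>lebesgue)"
        using integral_abs_bound[of lebesgue "\<lambda>x. f x * u x * \<xi> n x - f x * (u x)\<^sup>2"] by simp
    qed
  qed
  then show ?thesis by (simp add: LIM_zero_iff)
qed

text \<open>l is the infimum of the Rayleigh quotient over test functions with positive weighted
  integral; it is positive because that integral is at most Cf times the squared gradient norm. A
  non-negative minimising sequence with weighted integral 1 has a limit by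
  \<open>test_fun_compactness\<close>, and the constraint survives since the f-term is continuous.
  The form with the factor l is then non-negative and at most 0 at u.\<close>

lemma eigenfunction_exists:
  assumes pos: "test_fun Om \<phi>0" "(wint f \<phi>0) > 0"
  obtains l u g \<xi> where "l > 0" "nnapp Om u g \<xi>" "L2to (\<lambda>n x. sqrt (V x) * \<xi> n x) (\<lambda>x. sqrt (V x) * u x)"
    "wint f u = 1" "sqint g \<le> l"
    "\<And>\<phi>. test_fun Om \<phi> \<Longrightarrow> (\<integral>x. g x \<bullet> cgrad \<phi> x \<partial>lebesgue) = l * (\<integral>x. f x * u x * \<phi> x \<partial>lebesgue)"
proof -
  define G where "G \<phi> = sqint (cgrad \<phi>)" for \<phi>
  define F where "F \<phi> = wint f \<phi>" for \<phi> :: "R3 \<Rightarrow> real"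
  define Cf where "Cf = (\<integral>x. \<bar>f x\<bar> powr (3/2) \<partial>lebesgue) + 4096"
  have Cf: "Cf > 0" unfolding Cf_def by (intro add_nonneg_pos Bochner_Integration.integral_nonneg) auto
  have G0: "G \<phi> \<ge> 0" for \<phi> by (simp add: G_def)
  have FC: "F \<phi> \<le> Cf * G \<phi>" if "test_fun Om \<phi>" for \<phi>
    using f_weight_test(2)[OF that] by (simp add: F_def Cf_def G_def)
  define S where "S = {\<phi>. test_fun Om \<phi> \<and> F \<phi> > 0}"
  define R where "R \<phi> = G \<phi> / F \<phi>" for \<phi>
  define l where "l = Inf (R ` S)"
  have ne: "S \<noteq> {}" using pos by (auto simp: S_def F_def)
  have Rb: "1 / Cf \<le> R \<phi>" if "\<phi> \<in> S" for \<phi>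
    using FC[of \<phi>] that Cf by (simp add: S_def R_def field_simps)
  have bdd: "bdd_below (R ` S)" using Rb by (intro bdd_belowI[of _ "1 / Cf"]) auto
  have "1 / Cf \<le> l" unfolding l_def using ne Rb by (intro cInf_greatest) auto
  then have l0: "l > 0" using Cf by (metis divide_pos_pos less_le_trans zero_less_one)
  have lR: "l \<le> R \<phi>" if "\<phi> \<in> S" for \<phi> unfolding l_def using bdd that by (intro cInf_lower) auto
  have q: "0 \<le> G \<phi> - l * F \<phi>" if t: "test_fun Om \<phi>" for \<phi>
  proof (cases "F \<phi> > 0")
    case True
    then show ?thesis using lR[of \<phi>] t by (simp add: S_def R_def field_simps)
  next
    case False
    then have "l * F \<phi> \<le> 0" using l0 by (simp add: mult_nonneg_nonpos)
    then show ?thesis using G0[of \<phi>] by linarith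
  qed
  have "\<exists>\<psi>. test_fun Om \<psi> \<and> (\<forall>x. \<psi> x \<ge> 0) \<and> F \<psi> = 1 \<and> G \<psi> < l + 1 / real (Suc n)" for n
  proof -
    define d where "d = l + 1 / real (Suc n)"
    have d: "d > 0" using l0 by (simp add: d_def add_pos_pos)
    have "\<exists>y\<in>R ` S. y < d" using ne bdd by (subst cInf_less_iff[symmetric]) (auto simp: l_def[symmetric] d_def)
    then obtain \<phi> where \<phi>: "test_fun Om \<phi>" "F \<phi> > 0" "G \<phi> / F \<phi> < d" by (auto simp: S_def R_def)
    then have Gd: "G \<phi> / d < F \<phi>" using d by (simp add: field_simps)
    define e where "e k = 1 / real (Suc k)" for k
    have e: "e k > 0" for k by (simp add: e_def)
    have p2: "\<bar>a\<bar> powr 2 = a\<^sup>2" for a :: real by (cases "a = 0") (auto simp: powr_numeral)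
    \<comment> \<open>Passing to \<open>sabs\<close> does not raise the gradient integral but may
      change the weighted one. As the bound d on the quotient is strict, a small smoothing parameter
      keeps the quotient below it.\<close>
    have "(\<lambda>k. F (\<lambda>x. sabs (e k) (\<phi> x))) \<longlonglongrightarrow> F \<phi>"
      using sabs_weighted_tendsto[OF \<phi>(1) f(1), of 2] f_weight_test(1)[OF \<phi>(1)] by (simp add: F_def e_def p2)
    from order_tendstoD(1)[OF this Gd] obtain k where k: "G \<phi> / d < F (\<lambda>x. sabs (e k) (\<phi> x))"
      by (meson eventually_happens trivial_limit_sequentially)
    define \<psi>0 where "\<psi>0 x = sabs (e k) (\<phi> x)" for x
    have \<psi>0: "test_fun Om \<psi>0" "\<And>x. \<psi>0 x \<ge> 0" "G \<psi>0 \<le> G \<phi>" "G \<phi> / d < F \<psi>0"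
      using test_fun_sabs(1)[OF \<phi>(1) e] sabs_props(1)[OF e] test_fun_sabs_integrals(1)[OF \<phi>(1) e V(2,1)] k
      unfolding \<psi>0_def[abs_def] G_def by auto
    have "0 \<le> G \<phi> / d" using G0 d by simp
    then have F0: "F \<psi>0 > 0" using \<psi>0(4) by linarith
    have "G \<phi> < d * F \<psi>0" using \<psi>0(4) d by (simp add: field_simps)
    then have Gl: "G \<psi>0 < d * F \<psi>0" using \<psi>0(3) by linarith
    define a where "a = 1 / sqrt (F \<psi>0)"
    have a: "a > 0" "a\<^sup>2 = 1 / F \<psi>0" using F0 by (auto simp: a_def power_divide)
    define \<psi> where "\<psi> x = a * \<psi>0 x" for x
    have "test_fun Om \<psi>" unfolding \<psi>_def by (rule test_fun_cmult[OF \<psi>0(1)])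
    moreover have "\<forall>x. \<psi> x \<ge> 0" using a \<psi>0(2) by (simp add: \<psi>_def)
    moreover have "F \<psi> = a\<^sup>2 * F \<psi>0"
    proof -
      have "f x * (\<psi> x)\<^sup>2 = a\<^sup>2 * (f x * (\<psi>0 x)\<^sup>2)" for x by (simp add: \<psi>_def power_mult_distrib)
      then show ?thesis unfolding F_def by (simp only: integral_mult_right_zero)
    qed
    moreover have "G \<psi> = a\<^sup>2 * G \<psi>0"
    proof -
      have "cgrad \<psi> x = a *\<^sub>R cgrad \<psi>0 x" for x unfolding \<psi>_def by (rule cgrad_cmult[OF test_fun_smooth[OF \<psi>0(1)]])
      then show ?thesis by (simp add: G_def power_mult_distrib)
    qed
    moreover have "a\<^sup>2 * F \<psi>0 = 1" "a\<^sup>2 * G \<psi>0 < d"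
      unfolding a(2) using F0 Gl by (auto simp: divide_less_eq)
    ultimately show ?thesis unfolding d_def by (intro exI[of _ \<psi>]) auto
  qed
  then obtain \<psi> where \<psi>: "\<And>n. test_fun Om (\<psi> n)" "\<And>n x. \<psi> n x \<ge> 0" "\<And>n. F (\<psi> n) = 1" "\<And>n. G (\<psi> n) < l + 1 / real (Suc n)"
    by metis
  have Gl: "l \<le> G (\<psi> n)" for n using q[OF \<psi>(1)[of n]] \<psi>(3)[of n] by simp
  have Glim: "(\<lambda>n. G (\<psi> n)) \<longlonglongrightarrow> l"
  proof (rule tendsto_sandwich[OF _ _ tendsto_const])
    show "(\<lambda>n. l + 1 / real (Suc n)) \<longlonglongrightarrow> l"
      using tendsto_add[OF tendsto_const[of l] LIMSEQ_Suc[OF lim_1_over_n]] by simp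
    show "\<forall>\<^sub>F n in sequentially. G (\<psi> n) \<le> l + 1 / real (Suc n)"
      by (rule always_eventually, rule allI, rule less_imp_le, rule \<psi>(4))
  qed (use Gl in auto)
  have G1: "G (\<psi> n) \<le> l + 1" for n
  proof -
    have "1 / real (Suc n) \<le> 1" by simp
    then show ?thesis using \<psi>(4)[of n] by linarith
  qed
  have W0: "wint V (\<psi> n) = 0" for n
    unfolding V_test_fun_Om(1)[OF \<psi>(1)] by simp
  have M: "(\<integral>x. (\<psi> n x)\<^sup>2 \<partial>lebesgue) \<le> measure lebesgue {x. V x < c} + 4096 * (l + 1) ^ 3" for n
  proof -
    have "(\<integral>x. (\<psi> n x)\<^sup>2 \<partial>lebesgue) \<le> measure lebesgue {x. V x < c} + 4096 * (G (\<psi> n)) ^ 3"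
      using L2_bound[OF \<psi>(1)[of n]] W0 by (simp add: G_def)
    also have "\<dots> \<le> measure lebesgue {x. V x < c} + 4096 * (l + 1) ^ 3"
      by (intro add_left_mono mult_left_mono power_mono G1 G0) auto
    finally show ?thesis .
  qed
  have Wlim: "(\<lambda>n. wint V (\<psi> n)) \<longlonglongrightarrow> 0" using W0 by simp
  obtain s u g \<xi> where *: "strict_mono (s :: nat \<Rightarrow> nat)" "nnapp Om u g \<xi>" "AE x in lebesgue. (\<lambda>n. \<psi> (s n) x) \<longlonglongrightarrow> u x"
    "sqint g \<le> l" "L2to (\<lambda>n x. sqrt (V x) * \<xi> n x) (\<lambda>x. sqrt (V x) * u x)"
    "wint V u \<le> 0"
    by (rule test_fun_compactness[OF V(2,1) \<psi>(1,2) Glim[unfolded G_def] Wlim M])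
  have "(\<lambda>n. wint f (\<psi> (s n))) \<longlonglongrightarrow> wint f u"
    by (rule f_term_tendsto[OF \<psi>(1) G1[unfolded G_def] nnappD(8)[OF *(2)] *(3)])
  then have "(\<lambda>n. 1) \<longlonglongrightarrow> wint f u" using \<psi>(3) by (simp add: F_def)
  then have Fu: "wint f u = 1" using LIMSEQ_unique[OF tendsto_const] by metis
  \<comment> \<open>The case \<mu> = 0 of \<open>quadratic_stationary\<close>; its value at u is at
    most l - l times 1.\<close>
  have eq: "(\<integral>x. g x \<bullet> cgrad \<phi> x \<partial>lebesgue) = l * (\<integral>x. f x * u x * \<phi> x \<partial>lebesgue)" if "test_fun Om \<phi>" for \<phi>
    using quadratic_stationary[OF *(2,5) that, of 0 l] q *(4) Fu by (simp add: G_def F_def)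
  show ?thesis by (rule that[OF l0 *(2,5) Fu *(4) eq])
qed

text \<open>By the maximum principle, on each closed ball inside \<open>Om\<close> either u = 0
  almost everywhere or u is nonzero almost everywhere in the interior. The centres of either kind
  form an open set, and the two sets are disjoint because a ball is not a null set; connectedness
  leaves one of them. The first kind would make the weighted integral of u^2 vanish.\<close>

lemma eigenfunction_positive:
  assumes app: "nnapp Om u g \<xi>" and l: "l > 0" and conn: "connected Om"
    and nz: "(wint f u) \<noteq> 0"
    and eq: "\<And>\<phi>. test_fun Om \<phi> \<Longrightarrow> (\<integral>x. g x \<bullet> cgrad \<phi> x \<partial>lebesgue) = l * (\<integral>x. f x * u x * \<phi> x \<partial>lebesgue)"
  shows "AE x in lebesgue. x \<in> Om \<longrightarrow> u x > 0"
proof -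
  note A = nnappD[OF app]
  note [measurable] = A(8) f(1)
  have ii: "integrable lebesgue (\<lambda>x. f x * u x * \<phi> x)" if "test_fun Om \<phi>" for \<phi>
    by (rule f_product_integrable[OF A(8) nnapp_sixth[OF app] test_fun_measurable[OF that] test_fun_pow_integrable(2)[OF that]])
  have dich: "AE y in lebesgue. y \<in> ball x r \<longrightarrow> u y = 0" if r: "r > 0" "cball x r \<subseteq> Om"
    and nz: "\<not> (AE y in lebesgue. y \<in> ball x r \<longrightarrow> u y \<noteq> 0)" for x r
  proof (rule maximum_principle_ball[OF app open_interior zero_less_one _ _ _ _ _ _ r nz, where c="\<lambda>x. l * (f x * u x)" and c0="\<lambda>x. l * \<bar>f x\<bar>"])
    fix \<phi> assume \<phi>: "test_fun Om \<phi>"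
    show "1 * (\<integral>x. g x \<bullet> cgrad \<phi> x \<partial>lebesgue) = (\<integral>x. l * (f x * u x) * \<phi> x \<partial>lebesgue)" using eq[OF \<phi>] by (simp add: mult.assoc)
    show "integrable lebesgue (\<lambda>x. l * (f x * u x) * \<phi> x)" using integrable_mult_right[of l, OF ii[OF \<phi>]] by (simp add: mult.assoc)
    show "integrable lebesgue (\<lambda>x. l * \<bar>f x\<bar> * \<phi> x)" using integrable_mult_right[of l, OF f_local_integrable(2)[OF \<phi>]] by (simp add: mult.assoc)
  next
    show "AE x in lebesgue. \<bar>l * (f x * u x)\<bar> \<le> l * \<bar>f x\<bar> * u x"
      using A(10) by eventually_elim (use l in \<open>auto simp: abs_mult\<close>)
  qed (use l in auto)
  define Z where "Z = {x. \<exists>r>0. cball x r \<subseteq> Om \<and> (AE y in lebesgue. y \<in> ball x r \<longrightarrow> u y = 0)}"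
  define N where "N = {x. \<exists>r>0. cball x r \<subseteq> Om \<and> (AE y in lebesgue. y \<in> ball x r \<longrightarrow> u y \<noteq> 0)}"
  have op: "open {x. \<exists>r>0. cball x r \<subseteq> Om \<and> (AE y in lebesgue. y \<in> ball x r \<longrightarrow> P y)}" for P
    unfolding open_contains_ball
  proof clarify
    fix x r assume r: "r > 0" "cball x r \<subseteq> Om" "AE y in lebesgue. y \<in> ball x r \<longrightarrow> P y"
    show "\<exists>e>0. ball x e \<subseteq> {x. \<exists>r>0. cball x r \<subseteq> Om \<and> (AE y in lebesgue. y \<in> ball x r \<longrightarrow> P y)}"
    proof (rule exI[of _ "r/2"], rule conjI)
      show "r/2 > 0" using r by simp
      show "ball x (r/2) \<subseteq> {x. \<exists>r>0. cball x r \<subseteq> Om \<and> (AE y in lebesgue. y \<in> ball x r \<longrightarrow> P y)}"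
      proof (rule subsetI, rule CollectI)
      fix y assume "y \<in> ball x (r/2)"
      then have d: "dist x y < r / 2" by simp
      have "cball y (r/2) \<subseteq> cball x r" using d by (simp add: cball_subset_cball_iff dist_commute)
      moreover have "AE z in lebesgue. z \<in> ball y (r/2) \<longrightarrow> P z"
        using r(3)
      proof eventually_elim
        case (elim z)
        then show ?case using d dist_triangle_less_add[of x y "r/2" z "r/2"] by (auto simp: dist_commute)
      qed
      ultimately show "\<exists>r>0. cball y r \<subseteq> Om \<and> (AE z in lebesgue. z \<in> ball y r \<longrightarrow> P z)"
        using r by (intro exI[of _ "r/2"]) auto
      qed
    qed
  qed
  have cover: "Om \<subseteq> Z \<union> N"
  proof
    fix x assume "x \<in> Om"
    then obtain r where "r > 0" "cball x r \<subseteq> Om" using open_contains_cball[of Om] by auto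
    then show "x \<in> Z \<union> N" using dich[of r x] unfolding Z_def N_def by blast
  qed
  have disj: "Z \<inter> N \<inter> Om = {}"
  proof (rule ccontr)
    assume "Z \<inter> N \<inter> Om \<noteq> {}"
    then obtain x r1 r2 where x: "r1 > 0" "AE y in lebesgue. y \<in> ball x r1 \<longrightarrow> u y = 0" "r2 > 0" "AE y in lebesgue. y \<in> ball x r2 \<longrightarrow> u y \<noteq> 0"
      unfolding Z_def N_def by blast
    have "AE y in lebesgue. y \<notin> ball x (min r1 r2)"
      using x(2,4) by eventually_elim auto
    then have "ball x (min r1 r2) \<in> null_sets lebesgue" by (subst AE_iff_null_sets) auto
    then have "negligible (ball x (min r1 r2))" by (simp add: negligible_iff_null_sets)
    then show False using open_not_negligible[of "ball x (min r1 r2)"] x by simp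
  qed
  have "Z \<inter> Om = {} \<or> N \<inter> Om = {}"
    using connectedD[OF conn op[of "\<lambda>y. u y = 0", folded Z_def] op[of "\<lambda>y. u y \<noteq> 0", folded N_def] disj cover] by blast
  then show ?thesis
  proof
    assume "Z \<inter> Om = {}"
    then have "Om \<subseteq> N" using cover by blast
    then have "AE y in lebesgue. y \<in> Om \<longrightarrow> u y \<noteq> 0"
      by (intro AE_local) (auto simp: N_def)
    then show ?thesis using A(10) by eventually_elim auto
  next
    assume "N \<inter> Om = {}"
    then have "Om \<subseteq> Z" using cover by blast
    then have "AE y in lebesgue. y \<in> Om \<longrightarrow> u y = 0"
      by (intro AE_local) (auto simp: Z_def)
    then have "AE y in lebesgue. f y * (u y)\<^sup>2 = 0"
      using nnapp_eq0_outside[OF app] by eventually_elim auto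
    then have "wint f u = 0" by (rule integral_eq_zero_AE)
    then show ?thesis using nz by simp
  qed
qed

text \<open>Picone's inequality for u, tested with the approximants of v, gives l Fv <= Gv in the
  limit, while the equation of v, tested with v, gives Gv = l' Fv. Since v is not null, Gv > 0 and
  hence Fv > 0, so it cancels. Used in both directions this determines the number described by
  \<open>lambda1\<close>.\<close>

lemma principal_eigenvalue_le:
  assumes Om: "Om \<noteq> {}" and l: "l > 0" "principal_eigenfun Om f l u" and l': "l' > 0" "principal_eigenfun Om f l' v"
  shows "l \<le> l'"
proof -
  obtain gu where gu: "H10_grad Om u gu" "AE x in lebesgue. x \<in> Om \<longrightarrow> u x > 0"
    "\<And>\<phi>. test_fun Om \<phi> \<Longrightarrow> (\<integral>x. gu x \<bullet> cgrad \<phi> x \<partial>lebesgue) = l * (\<integral>x. f x * u x * \<phi> x \<partial>lebesgue)"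
    using l(2) by (auto simp: principal_eigenfun_def)
  obtain gv where gv: "H10_grad Om v gv" "AE x in lebesgue. x \<in> Om \<longrightarrow> v x > 0"
    "\<And>\<phi>. test_fun Om \<phi> \<Longrightarrow> (\<integral>x. gv x \<bullet> cgrad \<phi> x \<partial>lebesgue) = l' * (\<integral>x. f x * v x * \<phi> x \<partial>lebesgue)"
    using l'(2) by (auto simp: principal_eigenfun_def)
  obtain \<xi> where app: "nnapp Om u gu \<xi>" by (rule H10_positive_nnapp[OF gu(1) open_interior gu(2)])
  obtain \<zeta> where app': "nnapp Om v gv \<zeta>" by (rule H10_positive_nnapp[OF gv(1) open_interior gv(2)])
  note A = nnappD[OF app] and A' = nnappD[OF app']
  define Fv where "Fv = wint f v"
  define Gv where "Gv = sqint gv"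
  have ii: "integrable lebesgue (\<lambda>x. f x * u x * \<phi> x)" if "test_fun Om \<phi>" for \<phi>
    by (rule f_product_integrable[OF A(8) nnapp_sixth[OF app] test_fun_measurable[OF that] test_fun_pow_integrable(2)[OF that]])
  have Pic: "l * wint f (\<zeta> n) \<le> sqint (cgrad (\<zeta> n))" for n
    by (rule Picone_inequality[OF app A'(1) gu(2,3) f(1) ii f_local_integrable(1)])
  obtain B where B: "\<And>n. sqint (cgrad (\<zeta> n)) \<le> B" using L2to_bounded[OF A'(4)] by blast
  have Flim: "(\<lambda>n. wint f (\<zeta> n)) \<longlonglongrightarrow> Fv" unfolding Fv_def
    by (rule f_term_tendsto[OF A'(1) B A'(8,5)])
  have le: "l * Fv \<le> Gv" unfolding Gv_def
    by (rule LIMSEQ_le[OF tendsto_mult[OF tendsto_const Flim] L2to_norm[OF A'(4)]]) (use Pic in auto)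
  have "(\<lambda>n. \<integral>x. gv x \<bullet> cgrad (\<zeta> n) x \<partial>lebesgue) \<longlonglongrightarrow> (\<integral>x. gv x \<bullet> gv x \<partial>lebesgue)"
    by (rule L2to_inner[OF L2to_const[OF A'(7)] A'(4)])
  moreover have "(\<lambda>n. l' * (\<integral>x. f x * v x * \<zeta> n x \<partial>lebesgue)) \<longlonglongrightarrow> l' * Fv"
    unfolding Fv_def by (intro tendsto_mult tendsto_const f_product_tendsto[OF app'])
  ultimately have eq: "Gv = l' * Fv"
    unfolding gv(3)[OF A'(1)] Gv_def power2_norm_eq_inner by (rule LIMSEQ_unique)
  have "Gv \<noteq> 0"
  proof
    assume "Gv = 0"
    then have "AE x in lebesgue. v x = 0" using nnapp_zero_grad[OF app'] by (simp add: Gv_def)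
    then have "AE x in lebesgue. x \<notin> Om" using gv(2) by eventually_elim auto
    then have "Om \<in> null_sets lebesgue" by (subst AE_iff_null_sets) auto
    then show False using open_not_negligible[of Om] Om by (simp add: negligible_iff_null_sets)
  qed
  moreover have "Gv \<ge> 0" by (simp add: Gv_def)
  ultimately have "Fv > 0" using eq l'(1) by (metis less_eq_real_def zero_less_mult_pos)
  moreover have "l * Fv \<le> l' * Fv" using le eq by simp
  ultimately show ?thesis by simp
qed

text \<open>Existence and uniqueness together evaluate the definite description in
  \<open>lambda1\<close> as the Rayleigh infimum, so that the minimiser and its approximants become
  available under that name.\<close>

lemma lambda1_eigenfunction:
  assumes Om: "Om \<noteq> {}" "bounded Om" "connected Om" and fpos: "\<not> (AE x in lebesgue. x \<in> Om \<longrightarrow> f x \<le> 0)"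
  obtains u g \<xi> where "lambda1 Om f > 0" "nnapp Om u g \<xi>" "L2to (\<lambda>n x. sqrt (V x) * \<xi> n x) (\<lambda>x. sqrt (V x) * u x)"
    "AE x in lebesgue. x \<in> Om \<longrightarrow> u x > 0" "wint f u = 1" "sqint g \<le> lambda1 Om f"
proof -
  have [measurable]: "Om \<in> sets lebesgue" by (auto intro: borel_open)
  note [measurable] = f(1)
  have fi: "integrable lebesgue (\<lambda>x. indicator Om x * f x)"
  proof (rule integrable_real_bound[of _ "\<lambda>x. indicator Om x + \<bar>f x\<bar> powr (3/2)"])
    have "Om \<in> lmeasurable" using Om by (simp add: lmeasurable_open)
    then show "integrable lebesgue (\<lambda>x. indicator Om x + \<bar>f x\<bar> powr (3/2))"
      using f(2) by (intro Bochner_Integration.integrable_add integrable_real_indicator) (auto simp: fmeasurable_def)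
    have "\<bar>f x\<bar> \<le> 1 + \<bar>f x\<bar> powr (3/2)" for x
    proof (cases "\<bar>f x\<bar> \<le> 1")
      case False
      then have "\<bar>f x\<bar> powr 1 \<le> \<bar>f x\<bar> powr (3/2)" by (intro powr_mono) auto
      then show ?thesis by simp
    qed (simp add: add_increasing2)
    then show "AE x in lebesgue. \<bar>indicator Om x * f x\<bar> \<le> indicator Om x + \<bar>f x\<bar> powr (3/2)" by (auto simp: indicator_def)
    show "(\<lambda>x. indicator Om x * f x) \<in> borel_measurable lebesgue" by measurable
  qed
  have two: "(2::real) > 0" by simp
  obtain \<phi> where \<phi>: "test_fun Om \<phi>" "\<And>x. \<phi> x \<ge> 0" "(\<integral>x. f x * \<bar>\<phi> x\<bar> powr 2 \<partial>lebesgue) > 0"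
    using positive_weight_test_fun[OF open_interior Om(2) f(1) fi fpos two] by blast
  have p2: "\<bar>a\<bar> powr 2 = a\<^sup>2" for a :: real by (cases "a = 0") (auto simp: powr_numeral)
  obtain l u g \<xi> where *: "l > 0" "nnapp Om u g \<xi>" "L2to (\<lambda>n x. sqrt (V x) * \<xi> n x) (\<lambda>x. sqrt (V x) * u x)"
    "wint f u = 1" "sqint g \<le> l"
    "\<And>\<phi>. test_fun Om \<phi> \<Longrightarrow> (\<integral>x. g x \<bullet> cgrad \<phi> x \<partial>lebesgue) = l * (\<integral>x. f x * u x * \<phi> x \<partial>lebesgue)"
    using eigenfunction_exists[OF \<phi>(1) \<phi>(3)[unfolded p2]] by blast
  have pos: "AE x in lebesgue. x \<in> Om \<longrightarrow> u x > 0"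
    by (rule eigenfunction_positive[OF *(2,1) Om(3) _ *(6)]) (use *(4) in auto)
  have pe: "principal_eigenfun Om f l u"
    unfolding principal_eigenfun_def using nnapp_H10_grad[OF *(2)] pos *(6) by blast
  have "lambda1 Om f = l" unfolding lambda1_def
  proof (rule the_equality)
    show "l > 0 \<and> (\<exists>u. principal_eigenfun Om f l u)" using *(1) pe by blast
    fix l' assume "l' > 0 \<and> (\<exists>u. principal_eigenfun Om f l' u)"
    then obtain v where v: "l' > 0" "principal_eigenfun Om f l' v" by blast
    show "l' = l" using principal_eigenvalue_le[OF Om(1) v *(1) pe] principal_eigenvalue_le[OF Om(1) *(1) pe v] by simp
  qed
  then show ?thesis using that *(1-5) pos by blast
qed

end

subsection \<open>Minimisation of the energy\<close>

lemma DERIV_abs_powr: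
  fixes p s :: real
  assumes p: "p > 1"
  shows "((\<lambda>s. \<bar>s\<bar> powr p) has_real_derivative p * \<bar>s\<bar> powr (p - 2) * s) (at s)"
proof (cases s "0::real" rule: linorder_cases)
  case greater
  have "((\<lambda>s. s powr p) has_real_derivative p * s powr (p - 1)) (at s)"
    using has_real_derivative_powr[OF greater] by simp
  moreover have "p * s powr (p - 1) = p * \<bar>s\<bar> powr (p - 2) * s"
    using greater powr_mult_base[of s "p - 2"] by (simp add: mult.commute)
  moreover have "\<forall>\<^sub>F t in nhds s. \<bar>t\<bar> powr p = t powr p"
    using eventually_nhds_in_open[of "{0<..}" s] greater by (auto elim!: eventually_mono)
  ultimately show ?thesis by (subst DERIV_cong_ev[OF refl _ refl]) auto
next
  case less
  have "((\<lambda>s. (- s) powr p) has_real_derivative p * (- s) powr (p - 1) * (- 1)) (at s)"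
    by (rule DERIV_chain'[OF _ has_real_derivative_powr, of "\<lambda>s. - s"]) (use less in \<open>auto intro!: derivative_eq_intros\<close>)
  moreover have "p * (- s) powr (p - 1) * (- 1) = p * \<bar>s\<bar> powr (p - 2) * s"
    using arg_cong[OF powr_mult_base[of "- s" "p - 2"], of "\<lambda>z. p * (- z)"] less by (simp add: ac_simps)
  moreover have "\<forall>\<^sub>F t in nhds s. \<bar>t\<bar> powr p = (- t) powr p"
    using eventually_nhds_in_open[of "{..<0}" s] less by (auto elim!: eventually_mono)
  ultimately show ?thesis by (subst DERIV_cong_ev[OF refl _ refl]) auto
next
  case equal
  have "((\<lambda>h. \<bar>h\<bar> powr (p - 1)) \<longlongrightarrow> 0) (at 0)"
  proof (rule tendsto_zero_powrI[OF _ tendsto_const])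
    show "((\<lambda>h::real. \<bar>h\<bar>) \<longlongrightarrow> 0) (at 0)" by (rule tendsto_rabs_zero[OF tendsto_ident_at])
  qed (use p in auto)
  then have "((\<lambda>h. \<bar>h\<bar> powr p / h) \<longlongrightarrow> 0) (at 0)"
  proof (rule Lim_null_comparison[rotated])
    have "norm (\<bar>h\<bar> powr p / h) \<le> \<bar>h\<bar> powr (p - 1)" if "h \<noteq> 0" for h :: real
      using that by (simp add: powr_diff)
    then show "\<forall>\<^sub>F h in at 0. norm (\<bar>h\<bar> powr p / h) \<le> \<bar>h\<bar> powr (p - 1)"
      by (simp add: eventually_at_filter)
  qed
  then show ?thesis using equal p by (simp add: DERIV_def)
qed

text \<open>The mean value theorem turns the derivative into a domination of the difference quotients.\<close>
lemma abs_powr_diff_bound: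
  fixes p a b t :: real
  assumes p: "2 < p" "p < 4" and t: "\<bar>t\<bar> \<le> 1"
  shows "\<bar>\<bar>a + t * b\<bar> powr p - \<bar>a\<bar> powr p\<bar> \<le> \<bar>t\<bar> * (p * ((\<bar>a\<bar> + \<bar>b\<bar>)\<^sup>2 + (\<bar>a\<bar> + \<bar>b\<bar>) ^ 6))"
proof -
  define h where "h s = \<bar>a + s * b\<bar> powr p" for s
  define D where "D = p * ((\<bar>a\<bar> + \<bar>b\<bar>)\<^sup>2 + (\<bar>a\<bar> + \<bar>b\<bar>) ^ 6)"
  have der: "(h has_real_derivative p * \<bar>a + s * b\<bar> powr (p - 2) * (a + s * b) * b) (at s)" for s
    unfolding h_def[abs_def] by (rule DERIV_chain'[OF _ DERIV_abs_powr, of "\<lambda>s. a + s * b"]) (use p in \<open>auto intro!: derivative_eq_intros\<close>)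
  have "norm (h t - h 0) \<le> D * norm (t - 0)"
  proof (rule field_differentiable_bound[of "{-1..1::real}" h "\<lambda>s. p * \<bar>a + s * b\<bar> powr (p - 2) * (a + s * b) * b"])
    show "(h has_field_derivative p * \<bar>a + s * b\<bar> powr (p - 2) * (a + s * b) * b) (at s within {-1..1})" for s
      using der by (rule has_field_derivative_at_within)
    fix s :: real assume "s \<in> {-1..1}"
    then have "\<bar>s\<bar> * \<bar>b\<bar> \<le> 1 * \<bar>b\<bar>" by (intro mult_right_mono) auto
    then have m: "\<bar>a + s * b\<bar> \<le> \<bar>a\<bar> + \<bar>b\<bar>" using abs_triangle_ineq[of a "s * b"] by (simp add: abs_mult)
    define m where "m = \<bar>a\<bar> + \<bar>b\<bar>"
    have m0: "m \<ge> 0" "\<bar>b\<bar> \<le> m" by (auto simp: m_def)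
    have "norm (p * \<bar>a + s * b\<bar> powr (p - 2) * (a + s * b) * b) = p * (\<bar>a + s * b\<bar> powr (p - 2) * \<bar>a + s * b\<bar> * \<bar>b\<bar>)"
      using p by (simp add: abs_mult)
    also have "\<dots> \<le> p * (m powr (p - 2) * m * m)"
      using m p m0 by (intro mult_left_mono mult_mono powr_mono2) (auto simp: m_def)
    also have "m powr (p - 2) * m * m = \<bar>m\<bar> powr p"
      using m0 powr_add[of m "p - 2" 2] by (cases "m = 0") (auto simp: powr_numeral power2_eq_square)
    also have "p * \<bar>m\<bar> powr p \<le> D" unfolding D_def m_def[symmetric] using p by (intro mult_left_mono abs_powr_le_2_6) auto
    finally show "norm (p * \<bar>a + s * b\<bar> powr (p - 2) * (a + s * b) * b) \<le> D" .
  qed (use t in auto)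
  then show ?thesis by (simp add: h_def D_def mult.commute)
qed

lemma power6_add_le: "(a + b) ^ 6 \<le> 32 * a ^ 6 + 32 * b ^ 6" if "a \<ge> 0" "b \<ge> 0" for a b :: real
proof -
  have sq: "(x + y)\<^sup>2 \<le> 2 * x\<^sup>2 + 2 * y\<^sup>2" for x y :: real using sum_squares_bound[of x y] by (simp add: power2_sum)
  have cu: "(x + y) ^ 3 \<le> 4 * (x ^ 3 + y ^ 3)" if "x \<ge> 0" "y \<ge> 0" for x y :: real
  proof -
    have "0 \<le> 3 * ((x + y) * (x - y)\<^sup>2)" using that by simp
    also have "\<dots> = 4 * (x ^ 3 + y ^ 3) - (x + y) ^ 3" by (simp add: power2_eq_square power3_eq_cube algebra_simps)
    finally show ?thesis by simp
  qed
  have "(a + b) ^ 6 = ((a + b)\<^sup>2) ^ 3" by simp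
  also have "\<dots> \<le> (2 * a\<^sup>2 + 2 * b\<^sup>2) ^ 3" by (intro power_mono sq) auto
  also have "\<dots> \<le> 4 * ((2 * a\<^sup>2) ^ 3 + (2 * b\<^sup>2) ^ 3)" by (intro cu) auto
  also have "\<dots> = 32 * a ^ 6 + 32 * b ^ 6" by (simp add: power_mult_distrib)
  finally show ?thesis .
qed

section \<open>The derivative of the Q-term and the minimiser\<close>

context kirchhoff_data
begin

text \<open>Differentiation under the integral sign along arbitrary sequences tending to 0, with the
  majorant from \<open>abs_powr_diff_bound\<close>. Dominated convergence gives integrability of the
  limit as well, which is the second claim.\<close>

lemma Q_term_derivative:
  assumes app: "nnapp UNIV u g \<xi>" and \<phi>: "test_fun UNIV \<phi>"
  shows "((\<lambda>t. \<integral>x. Q x * \<bar>u x + t * \<phi> x\<bar> powr p \<partial>lebesgue) has_real_derivative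
      p * (\<integral>x. Q x * \<bar>u x\<bar> powr (p - 2) * u x * \<phi> x \<partial>lebesgue)) (at 0)"
    "integrable lebesgue (\<lambda>x. Q x * \<bar>u x\<bar> powr (p - 2) * u x * \<phi> x)"
proof -
  note A = nnappD[OF app]
  note [measurable] = A(8) Q(1) test_fun_measurable[OF \<phi>]
  note u6 = nnapp_sixth[OF app]
  have u2: "integrable lebesgue (\<lambda>x. (u x)\<^sup>2)" using sqi_integrable[OF A(6)] by simp
  note P = test_fun_pow_integrable[OF \<phi>]
  define w where "w x = C * (p * ((\<bar>u x\<bar> + \<bar>\<phi> x\<bar>)\<^sup>2 + (\<bar>u x\<bar> + \<bar>\<phi> x\<bar>) ^ 6))" for x
  have iw: "integrable lebesgue w"
  proof (rule integrable_real_bound[of _ "\<lambda>x. C * (p * ((2 * (u x)\<^sup>2 + 2 * (\<phi> x)\<^sup>2) + (32 * u x ^ 6 + 32 * \<phi> x ^ 6)))"])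
    show "integrable lebesgue (\<lambda>x. C * (p * ((2 * (u x)\<^sup>2 + 2 * (\<phi> x)\<^sup>2) + (32 * u x ^ 6 + 32 * \<phi> x ^ 6))))"
      using u6 u2 P(1,2) by (intro integrable_mult_right Bochner_Integration.integrable_add) auto
    show "w \<in> borel_measurable lebesgue" unfolding w_def by measurable
    show "AE x in lebesgue. \<bar>w x\<bar> \<le> C * (p * ((2 * (u x)\<^sup>2 + 2 * (\<phi> x)\<^sup>2) + (32 * u x ^ 6 + 32 * \<phi> x ^ 6)))"
    proof (rule AE_I2)
      fix x
      have a1: "(\<bar>u x\<bar> + \<bar>\<phi> x\<bar>)\<^sup>2 \<le> 2 * (u x)\<^sup>2 + 2 * (\<phi> x)\<^sup>2" using norm_add_square_le[of "\<bar>u x\<bar>" "\<bar>\<phi> x\<bar>"] by simp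
      have a2: "(\<bar>u x\<bar> + \<bar>\<phi> x\<bar>) ^ 6 \<le> 32 * u x ^ 6 + 32 * \<phi> x ^ 6" using power6_add_le[of "\<bar>u x\<bar>" "\<bar>\<phi> x\<bar>"] by simp
      have "w x \<ge> 0" unfolding w_def using p Q(3) by (intro mult_nonneg_nonneg add_nonneg_nonneg) auto
      then have "\<bar>w x\<bar> = w x" by simp
      also have "\<dots> \<le> C * (p * ((2 * (u x)\<^sup>2 + 2 * (\<phi> x)\<^sup>2) + (32 * u x ^ 6 + 32 * \<phi> x ^ 6)))"
        unfolding w_def using p Q(3) a1 a2 by (intro mult_left_mono add_mono) auto
      finally show "\<bar>w x\<bar> \<le> C * (p * ((2 * (u x)\<^sup>2 + 2 * (\<phi> x)\<^sup>2) + (32 * u x ^ 6 + 32 * \<phi> x ^ 6)))" .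
    qed
  qed
  define q where "q t x = Q x * \<bar>u x + t * \<phi> x\<bar> powr p" for t x
  have bnd: "AE x in lebesgue. \<bar>q t x - q 0 x\<bar> \<le> \<bar>t\<bar> * w x" if t: "\<bar>t\<bar> \<le> 1" for t
    using Q(2)
  proof eventually_elim
    case (elim x)
    have "\<bar>q t x - q 0 x\<bar> = \<bar>Q x\<bar> * \<bar>\<bar>u x + t * \<phi> x\<bar> powr p - \<bar>u x\<bar> powr p\<bar>"
      by (simp add: q_def abs_mult flip: right_diff_distrib)
    also have "\<dots> \<le> C * (\<bar>t\<bar> * (p * ((\<bar>u x\<bar> + \<bar>\<phi> x\<bar>)\<^sup>2 + (\<bar>u x\<bar> + \<bar>\<phi> x\<bar>) ^ 6)))"
      by (intro mult_mono elim abs_powr_diff_bound p t) (use Q(3) in auto)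
    also have "\<dots> = \<bar>t\<bar> * w x" by (simp add: w_def)
    finally show ?case .
  qed
  have q0: "integrable lebesgue (q 0)"
    using Q_term_integrable[OF A(8) u2 u6] by (simp add: q_def[abs_def])
  have qm [measurable]: "q t \<in> borel_measurable lebesgue" for t unfolding q_def[abs_def] by measurable
  have iq: "integrable lebesgue (q t)" if t: "\<bar>t\<bar> \<le> 1" for t
  proof -
    have "integrable lebesgue (\<lambda>x. q t x - q 0 x)"
      by (rule integrable_real_bound[OF _ _ bnd[OF t]]) (use iw in auto)
    then have "integrable lebesgue (\<lambda>x. (q t x - q 0 x) + q 0 x)" using q0 by (rule Bochner_Integration.integrable_add)
    then show ?thesis by simp
  qed
  define d where "d x = p * (Q x * \<bar>u x\<bar> powr (p - 2) * u x * \<phi> x)" for x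
  have ptw: "(\<lambda>n. (q (h n) x - q 0 x) / h n) \<longlonglongrightarrow> d x" if h: "\<And>n. h n \<noteq> 0" "h \<longlonglongrightarrow> 0" for h x
  proof -
    have "((\<lambda>t. \<bar>u x + t * \<phi> x\<bar> powr p) has_real_derivative p * \<bar>u x + 0 * \<phi> x\<bar> powr (p - 2) * (u x + 0 * \<phi> x) * \<phi> x) (at 0)"
      by (rule DERIV_chain'[OF _ DERIV_abs_powr, of "\<lambda>t. u x + t * \<phi> x"]) (use p in \<open>auto intro!: derivative_eq_intros\<close>)
    from DERIV_cmult[OF this, of "Q x"] have "((\<lambda>t. q t x) has_real_derivative d x) (at 0)"
      unfolding q_def d_def by (simp add: ac_simps)
    then have "((\<lambda>t. (q t x - q 0 x) / t) \<longlongrightarrow> d x) (at 0)" by (simp add: DERIV_def)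
    then show ?thesis using h by (auto simp: tendsto_at_iff_sequentially o_def)
  qed
  have lim: "integrable lebesgue d \<and> (\<lambda>n. ((\<integral>x. q (h n) x \<partial>lebesgue) - (\<integral>x. q 0 x \<partial>lebesgue)) / h n) \<longlonglongrightarrow> (\<integral>x. d x \<partial>lebesgue)"
    if h: "\<And>n. h n \<noteq> 0" "\<And>n. \<bar>h n\<bar> \<le> 1" "h \<longlonglongrightarrow> 0" for h
  proof -
    have s: "(\<lambda>x. (q (h n) x - q 0 x) / h n) \<in> borel_measurable lebesgue" for n by measurable
    have dm: "d \<in> borel_measurable lebesgue" unfolding d_def by measurable
    have b: "AE x in lebesgue. norm ((q (h n) x - q 0 x) / h n) \<le> w x" for n
      using bnd[OF h(2)[of n]] by eventually_elim (use h(1)[of n] in \<open>simp add: field_simps\<close>)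
    have l: "AE x in lebesgue. (\<lambda>n. (q (h n) x - q 0 x) / h n) \<longlonglongrightarrow> d x" using ptw[OF h(1,3)] by auto
    have "(\<integral>x. (q (h n) x - q 0 x) / h n \<partial>lebesgue) = ((\<integral>x. q (h n) x \<partial>lebesgue) - (\<integral>x. q 0 x \<partial>lebesgue)) / h n" for n
      using iq[OF h(2)[of n]] q0 by simp
    then have "(\<lambda>n. ((\<integral>x. q (h n) x \<partial>lebesgue) - (\<integral>x. q 0 x \<partial>lebesgue)) / h n) = (\<lambda>n. \<integral>x. (q (h n) x - q 0 x) / h n \<partial>lebesgue)" by metis
    then show ?thesis
      using integral_dominated_convergence[OF dm s iw l b] integrable_dominated_convergence[OF dm s iw l b] by metis
  qed
  have half: "integrable lebesgue d"
    using lim[of "\<lambda>n. 1 / real (Suc n)"] LIMSEQ_Suc[OF lim_1_over_n] by auto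
  then show "integrable lebesgue (\<lambda>x. Q x * \<bar>u x\<bar> powr (p - 2) * u x * \<phi> x)"
    using p unfolding d_def by simp
  have dI: "(\<integral>x. d x \<partial>lebesgue) = p * (\<integral>x. Q x * \<bar>u x\<bar> powr (p - 2) * u x * \<phi> x \<partial>lebesgue)" unfolding d_def by simp
  have "((\<lambda>t. ((\<integral>x. q t x \<partial>lebesgue) - (\<integral>x. q 0 x \<partial>lebesgue)) / t) \<longlongrightarrow> (\<integral>x. d x \<partial>lebesgue)) (at 0)"
    unfolding tendsto_at_iff_sequentially
  proof (intro allI impI, unfold o_def)
    fix h :: "nat \<Rightarrow> real" assume h: "\<forall>i. h i \<in> UNIV - {0}" "h \<longlonglongrightarrow> 0"
    have "\<forall>\<^sub>F n in sequentially. \<bar>h n\<bar> < 1" using order_tendstoD(2)[OF tendsto_rabs[OF h(2)], of 1] by simp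
    then obtain N where N: "\<And>n. n \<ge> N \<Longrightarrow> \<bar>h n\<bar> < 1" by (auto simp: eventually_sequentially)
    have "(\<lambda>n. ((\<integral>x. q (h (n + N)) x \<partial>lebesgue) - (\<integral>x. q 0 x \<partial>lebesgue)) / h (n + N)) \<longlonglongrightarrow> (\<integral>x. d x \<partial>lebesgue)"
      using lim[of "\<lambda>n. h (n + N)"] h(1) less_imp_le[OF N] LIMSEQ_ignore_initial_segment[OF h(2)] by auto
    then show "(\<lambda>n. ((\<integral>x. q (h n) x \<partial>lebesgue) - (\<integral>x. q 0 x \<partial>lebesgue)) / h n) \<longlonglongrightarrow> (\<integral>x. d x \<partial>lebesgue)"
      by (rule LIMSEQ_offset)
  qed
  then show "((\<lambda>t. \<integral>x. Q x * \<bar>u x + t * \<phi> x\<bar> powr p \<partial>lebesgue) has_real_derivative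
      p * (\<integral>x. Q x * \<bar>u x\<bar> powr (p - 2) * u x * \<phi> x \<partial>lebesgue)) (at 0)"
    unfolding DERIV_def dI[symmetric] by (simp add: q_def)
qed

text \<open>Replacing \<phi> by \<open>sabs\<close> of it does not increase the gradient and
  V-terms, which have non-negative coefficients, and the f- and Q-terms converge whatever the signs
  of f and Q. The strict bound on the energy leaves room for the limit.\<close>

lemma energy_nonneg_test_fun:
  assumes \<phi>: "test_fun U \<phi>" and a: "a > 0" and \<mu>: "\<mu> \<ge> 0" and e: "energy a \<mu> lam p V f Q \<phi> (cgrad \<phi>) < e"
  obtains \<psi> where "test_fun U \<psi>" "\<And>x. \<psi> x \<ge> 0" "energy a \<mu> lam p V f Q \<psi> (cgrad \<psi>) < e"
proof -
  define \<psi> where "\<psi> n x = sabs (1 / real (Suc n)) (\<phi> x)" for n x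
  have pos: "1 / real (Suc n) > 0" for n by simp
  have p2: "\<bar>a\<bar> powr 2 = a\<^sup>2" for a :: real by (cases "a = 0") (auto simp: powr_numeral)
  have F: "(\<lambda>n. wint f (\<psi> n)) \<longlonglongrightarrow> wint f \<phi>"
    using sabs_weighted_tendsto[OF \<phi> f(1), of 2] f_weight_test(1)[OF \<phi>] by (simp add: \<psi>_def p2)
  have q: "(\<lambda>n. \<integral>x. Q x * \<bar>\<psi> n x\<bar> powr p \<partial>lebesgue) \<longlonglongrightarrow> (\<integral>x. Q x * \<bar>\<phi> x\<bar> powr p \<partial>lebesgue)"
    using sabs_weighted_tendsto[OF \<phi> Q(1), of p] p
      Q_term_integrable[OF test_fun_measurable[OF \<phi>] test_fun_pow_integrable(1,2)[OF \<phi>]] by (simp add: \<psi>_def)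
  define D where "D h = a / 4 * (sqint (cgrad h))\<^sup>2
     + 1 / 2 * (sqint (cgrad h) + \<mu> * wint V h)" for h
  define B where "B h = - 1 / p * (\<integral>x. Q x * \<bar>h x\<bar> powr p \<partial>lebesgue) - lam / 2 * wint f h" for h :: "R3 \<Rightarrow> real"
  have E: "energy a \<mu> lam p V f Q h (cgrad h) = D h + B h" for h unfolding energy_def D_def B_def by simp
  have "(\<lambda>n. B (\<psi> n)) \<longlonglongrightarrow> B \<phi>" unfolding B_def by (intro tendsto_intros F q)
  from order_tendstoD(2)[OF this, of "e - D \<phi>"] obtain n where n: "B (\<psi> n) < e - D \<phi>"
    using e unfolding E by (auto simp: eventually_sequentially)
  note S = test_fun_sabs_integrals[OF \<phi> pos V(2,1), of n]
  have "D (\<psi> n) \<le> D \<phi>"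
    unfolding D_def \<psi>_def[abs_def] using a \<mu> by (intro add_mono mult_left_mono power_mono S) auto
  then have "energy a \<mu> lam p V f Q (\<psi> n) (cgrad (\<psi> n)) < e" using n unfolding E by linarith
  moreover have "test_fun U (\<psi> n)" unfolding \<psi>_def[abs_def] by (rule test_fun_sabs(1)[OF \<phi> pos])
  moreover have "\<psi> n x \<ge> 0" for x unfolding \<psi>_def by (rule sabs_props(1)[OF pos])
  ultimately show ?thesis using that by blast
qed

text \<open>The infimum m is taken over test functions, and the limit pair is shown to have energy
  at most m. The gradient and V-integrals along the sequence tend to A and B, which may exceed those
  of the limit; a smaller value only lowers the energy, because a and \<mu> are positive.\<close>

lemma energy_minimiser:
  assumes a: "a > 0" and \<mu>: "\<mu> > 0" and K: "K \<ge> 0"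
    and coer: "\<And>\<phi>. test_fun UNIV \<phi> \<Longrightarrow>
     a / 8 * (sqint (cgrad \<phi>))\<^sup>2 + wint V \<phi> - K * (sqint (cgrad \<phi>))
       \<le> energy a \<mu> lam p V f Q \<phi> (cgrad \<phi>)"
    and neg: "test_fun UNIV \<phi>0" "energy a \<mu> lam p V f Q \<phi>0 (cgrad \<phi>0) < 0"
  obtains m u g \<xi> where "m < 0" "nnapp UNIV u g \<xi>" "L2to (\<lambda>n x. sqrt (V x) * \<xi> n x) (\<lambda>x. sqrt (V x) * u x)"
    "energy a \<mu> lam p V f Q u g \<le> m" "\<And>\<phi>. test_fun UNIV \<phi> \<Longrightarrow> m \<le> energy a \<mu> lam p V f Q \<phi> (cgrad \<phi>)"
proof -
  define G where "G \<phi> = sqint (cgrad \<phi>)" for \<phi>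
  define W where "W \<phi> = wint V \<phi>" for \<phi> :: "R3 \<Rightarrow> real"
  define E where "E \<phi> = energy a \<mu> lam p V f Q \<phi> (cgrad \<phi>)" for \<phi>
  have G0: "G \<phi> \<ge> 0" for \<phi> by (simp add: G_def)
  have W0: "W \<phi> \<ge> 0" for \<phi> using V(1) by (simp add: W_def)
  have coer': "a / 8 * (G \<phi>)\<^sup>2 + W \<phi> - K * G \<phi> \<le> E \<phi>" if "test_fun UNIV \<phi>" for \<phi>
    using coer[OF that] by (simp add: G_def W_def E_def)
  define S where "S = {\<phi>. test_fun UNIV \<phi>}"
  define m where "m = Inf (E ` S)"
  have lower: "- (2 * K\<^sup>2 / a) \<le> E \<phi>" if "test_fun UNIV \<phi>" for \<phi>
  proof -
    \<comment> \<open>Completing the square: the minimum of a G^2 / 8 - K G over all G is -2 K^2 /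
      a, attained at G = 4 K / a.\<close>
    have "0 \<le> a / 8 * (G \<phi> - 4 * K / a)\<^sup>2" using a by simp
    also have "\<dots> = a / 8 * (G \<phi>)\<^sup>2 - K * G \<phi> + 2 * K\<^sup>2 / a"
      using a by (simp add: power2_eq_square field_simps)
    finally show ?thesis using coer'[OF that] W0[of \<phi>] by linarith
  qed
  have bdd: "bdd_below (E ` S)" by (rule bdd_belowI[of _ "- (2 * K\<^sup>2 / a)"]) (use lower in \<open>auto simp: S_def\<close>)
  have mle: "m \<le> E \<phi>" if "test_fun UNIV \<phi>" for \<phi> unfolding m_def using bdd that by (intro cInf_lower) (auto simp: S_def)
  have m0: "m < 0" using mle[OF neg(1)] neg(2) by (simp add: E_def)
  have "\<exists>\<psi>. test_fun UNIV \<psi> \<and> (\<forall>x. \<psi> x \<ge> 0) \<and> E \<psi> < m + 1 / real (Suc n)" for n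
  proof -
    define d where "d = m + 1 / real (Suc n)"
    have "Inf (E ` S) < d" by (simp add: d_def m_def)
    moreover have "E ` S \<noteq> {}" using neg(1) by (auto simp: S_def)
    ultimately have "\<exists>y\<in>E ` S. y < d" using cInf_less_iff[OF _ bdd, of d] by blast
    then obtain \<phi> where \<phi>: "test_fun UNIV \<phi>" "E \<phi> < d" by (auto simp: S_def)
    show ?thesis
      by (rule energy_nonneg_test_fun[OF \<phi>(1) a less_imp_le[OF \<mu>] \<phi>(2)[unfolded E_def]]) (auto simp: d_def E_def)
  qed
  then obtain \<psi> where \<psi>: "\<And>n. test_fun UNIV (\<psi> n)" "\<And>n x. \<psi> n x \<ge> 0" "\<And>n. E (\<psi> n) < m + 1 / real (Suc n)" by metis
  \<comment> \<open>For G > 1 the energy bound gives a G^2 / 8 <= 1 + K G <= (K + 1) G, and division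
    by G yields the second entry of the maximum.\<close>
  define Gm where "Gm = max 1 (8 * (K + 1) / a)"
  define Wm where "Wm = 1 + K * Gm"
  have c1: "a / 8 * (G (\<psi> n))\<^sup>2 + W (\<psi> n) - K * G (\<psi> n) \<le> 1" for n
  proof -
    have "1 / real (Suc n) \<le> 1" by simp
    then show ?thesis using coer'[OF \<psi>(1)[of n]] \<psi>(3)[of n] m0 by linarith
  qed
  have Gb: "G (\<psi> n) \<le> Gm" for n
  proof (cases "G (\<psi> n) \<le> 1")
    case False
    then have g1: "1 \<le> G (\<psi> n)" "G (\<psi> n) > 0" by auto
    have "a / 8 * (G (\<psi> n))\<^sup>2 \<le> 1 + K * G (\<psi> n)" using c1[of n] W0[of "\<psi> n"] by linarith
    then have "(a / 8 * G (\<psi> n)) * G (\<psi> n) \<le> (K + 1) * G (\<psi> n)" using g1 by (simp add: power2_eq_square algebra_simps)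
    then have "a / 8 * G (\<psi> n) \<le> K + 1" using g1(2) by (rule mult_right_le_imp_le)
    then have "G (\<psi> n) \<le> 8 * (K + 1) / a" using a by (simp add: field_simps)
    then show ?thesis by (simp add: Gm_def)
  qed (simp add: Gm_def)
  have Wb: "W (\<psi> n) \<le> Wm" for n
  proof -
    have "K * G (\<psi> n) \<le> K * Gm" using K Gb by (intro mult_left_mono) auto
    moreover have "0 \<le> a / 8 * (G (\<psi> n))\<^sup>2" using a by simp
    ultimately show ?thesis using c1[of n] unfolding Wm_def by linarith
  qed
  \<comment> \<open>Compactness of the rectangle selects one subsequence along which the gradient
    integral and the V-integral both converge, as \<open>test_fun_compactness\<close>
    demands.\<close>
  have "compact ({0..Gm} \<times> {0..Wm})" by (intro compact_Times compact_Icc)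
  then have sc: "seq_compact ({0..Gm} \<times> {0..Wm})" by (simp add: compact_eq_seq_compact_metric)
  have GW: "\<forall>n. (G (\<psi> n), W (\<psi> n)) \<in> {0..Gm} \<times> {0..Wm}" using G0 W0 Gb Wb by auto
  obtain AB r where r: "strict_mono (r :: nat \<Rightarrow> nat)" "((\<lambda>n. (G (\<psi> n), W (\<psi> n))) \<circ> r) \<longlonglongrightarrow> AB"
    using seq_compactE[OF sc GW] by blast
  define A B where "A = fst AB" and "B = snd AB"
  have Glim: "(\<lambda>n. G (\<psi> (r n))) \<longlonglongrightarrow> A" and Wlim: "(\<lambda>n. W (\<psi> (r n))) \<longlonglongrightarrow> B"
    using tendsto_fst[OF r(2)] tendsto_snd[OF r(2)] by (auto simp: A_def B_def o_def)
  have M: "(\<integral>x. (\<psi> n x)\<^sup>2 \<partial>lebesgue) \<le> Wm / c + measure lebesgue {x. V x < c} + 4096 * Gm ^ 3" for n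
  proof -
    have "(\<integral>x. (\<psi> n x)\<^sup>2 \<partial>lebesgue) \<le> W (\<psi> n) / c + measure lebesgue {x. V x < c} + 4096 * (G (\<psi> n)) ^ 3"
      using L2_bound[OF \<psi>(1)[of n]] by (simp add: G_def W_def)
    also have "\<dots> \<le> Wm / c + measure lebesgue {x. V x < c} + 4096 * Gm ^ 3"
      using c(1) by (intro add_mono divide_right_mono mult_left_mono power_mono Gb Wb G0 order_refl) auto
    finally show ?thesis .
  qed
  obtain s u g \<xi> where *: "strict_mono (s :: nat \<Rightarrow> nat)" "nnapp UNIV u g \<xi>" "AE x in lebesgue. (\<lambda>n. \<psi> (r (s n)) x) \<longlonglongrightarrow> u x"
    "sqint g \<le> A" "L2to (\<lambda>n x. sqrt (V x) * \<xi> n x) (\<lambda>x. sqrt (V x) * u x)"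
    "wint V u \<le> B"
    by (rule test_fun_compactness[OF V(2,1) \<psi>(1,2) Glim[unfolded G_def] Wlim[unfolded W_def] M])
  note A = nnappD[OF *(2)]
  have u2: "integrable lebesgue (\<lambda>x. (u x)\<^sup>2)" using sqi_integrable[OF A(6)] by simp
  define \<zeta> where "\<zeta> n = \<psi> (r (s n))" for n
  have \<zeta>: "test_fun UNIV (\<zeta> n)" "sqint (cgrad (\<zeta> n)) \<le> Gm" "wint V (\<zeta> n) \<le> Wm"
    "(\<integral>x. (\<zeta> n x)\<^sup>2 \<partial>lebesgue) \<le> Wm / c + measure lebesgue {x. V x < c} + 4096 * Gm ^ 3" for n
    using \<psi>(1) Gb[of "r (s n)"] Wb[of "r (s n)"] M[of "r (s n)"] by (auto simp: \<zeta>_def G_def W_def)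
  have \<zeta>u: "AE x in lebesgue. (\<lambda>n. \<zeta> n x) \<longlonglongrightarrow> u x" using *(3) by (simp add: \<zeta>_def)
  have F: "(\<lambda>n. wint f (\<zeta> n)) \<longlonglongrightarrow> wint f u"
    by (rule f_term_tendsto[OF \<zeta>(1,2) A(8) \<zeta>u])
  define q where "q = (\<integral>x. Q x * \<bar>u x\<bar> powr p \<partial>lebesgue)"
  obtain e where e: "e \<longlonglongrightarrow> 0" "\<And>n. (\<integral>x. Q x * \<bar>\<zeta> n x\<bar> powr p \<partial>lebesgue) \<le> q + e n"
    unfolding q_def using Q_term_upper[OF \<zeta>(1,2,3,4) A(8) u2 \<zeta>u] by blast
  have G': "(\<lambda>n. G (\<zeta> n)) \<longlonglongrightarrow> A" and W': "(\<lambda>n. W (\<zeta> n)) \<longlonglongrightarrow> B"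
    using LIMSEQ_subseq_LIMSEQ[OF Glim *(1)] LIMSEQ_subseq_LIMSEQ[OF Wlim *(1)] by (auto simp: \<zeta>_def o_def)
  have inv: "(\<lambda>n. m + 1 / real (Suc (r (s n)))) \<longlonglongrightarrow> m + 0"
    using LIMSEQ_subseq_LIMSEQ[OF LIMSEQ_subseq_LIMSEQ[OF LIMSEQ_Suc[OF lim_1_over_n] r(1)] *(1)]
    by (intro tendsto_add tendsto_const) (simp add: o_def)
  \<comment> \<open>The energy inequality passes to the limit with the Q-integral of the sequence
    replaced by its one-sided bound q + e n.\<close>
  have "a / 4 * A\<^sup>2 + 1 / 2 * (A + \<mu> * B) - 1 / p * (q + 0) - lam / 2 * wint f u \<le> m + 0"
  proof (rule LIMSEQ_le[OF _ inv])
    show "(\<lambda>n. a / 4 * (G (\<zeta> n))\<^sup>2 + 1 / 2 * (G (\<zeta> n) + \<mu> * W (\<zeta> n)) - 1 / p * (q + e n) - lam / 2 * wint f (\<zeta> n))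
       \<longlonglongrightarrow> a / 4 * A\<^sup>2 + 1 / 2 * (A + \<mu> * B) - 1 / p * (q + 0) - lam / 2 * wint f u"
      by (intro tendsto_diff tendsto_add tendsto_mult tendsto_power tendsto_const G' W' F e(1))
    have "a / 4 * (G (\<zeta> n))\<^sup>2 + 1 / 2 * (G (\<zeta> n) + \<mu> * W (\<zeta> n)) - 1 / p * (q + e n) - lam / 2 * (wint f (\<zeta> n))
        \<le> m + 1 / real (Suc (r (s n)))" for n
    proof -
      have "1 / p * (\<integral>x. Q x * \<bar>\<zeta> n x\<bar> powr p \<partial>lebesgue) \<le> 1 / p * (q + e n)" using p e(2) by (intro mult_left_mono) auto
      then have "a / 4 * (G (\<zeta> n))\<^sup>2 + 1 / 2 * (G (\<zeta> n) + \<mu> * W (\<zeta> n)) - 1 / p * (q + e n) - lam / 2 * wint f (\<zeta> n) \<le> E (\<zeta> n)"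
        unfolding E_def energy_def G_def W_def by argo
      also have "\<dots> \<le> m + 1 / real (Suc (r (s n)))" unfolding \<zeta>_def by (rule less_imp_le[OF \<psi>(3)])
      finally show ?thesis .
    qed
    then show "\<exists>N. \<forall>n\<ge>N. a / 4 * (G (\<zeta> n))\<^sup>2 + 1 / 2 * (G (\<zeta> n) + \<mu> * W (\<zeta> n)) - 1 / p * (q + e n) - lam / 2 * (wint f (\<zeta> n))
        \<le> m + 1 / real (Suc (r (s n)))" by blast
  qed
  moreover have "energy a \<mu> lam p V f Q u g \<le> a / 4 * A\<^sup>2 + 1 / 2 * (A + \<mu> * B) - 1 / p * (q + 0) - lam / 2 * wint f u"
    unfolding energy_def add_0_right q_def using a \<mu> *(4,6)
    by (intro diff_mono add_mono mult_left_mono power_mono order_refl) auto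
  ultimately have "energy a \<mu> lam p V f Q u g \<le> m" by simp
  then show ?thesis using that[OF m0 *(2,5)] mle by (simp add: E_def)
qed

text \<open>On each line u + t \<phi> the energy is at least m, by approximation, and at t = 0 it is
  at most m; so its derivative there vanishes. All terms except the Q-term are polynomials in t, and
  the derivative at 0 is the weak equation tested with \<phi>.\<close>

lemma minimiser_solution:
  assumes app: "nnapp UNIV u g \<xi>" and LV: "L2to (\<lambda>n x. sqrt (V x) * \<xi> n x) (\<lambda>x. sqrt (V x) * u x)"
    and le: "energy a \<mu> lam p V f Q u g \<le> m" and ge: "\<And>\<phi>. test_fun UNIV \<phi> \<Longrightarrow> m \<le> energy a \<mu> lam p V f Q \<phi> (cgrad \<phi>)"
  shows "kirchhoff_sol a \<mu> lam p V f Q u g"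
  unfolding kirchhoff_sol_def
proof (intro conjI allI impI)
  show "H1_grad u g" by (rule nnapp_H1_grad[OF app])
  fix \<phi> assume \<phi>: "test_fun UNIV \<phi>"
  note P = perturbation_limits[OF app LV \<phi>]
  note X = expand_quadratic[OF app L2to_sqi(2)[OF LV] \<phi>]
  define J where "J t = energy a \<mu> lam p V f Q (\<lambda>x. u x + t * \<phi> x) (\<lambda>x. g x + t *\<^sub>R cgrad \<phi> x)" for t
  have Jge: "m \<le> J t" for t
    unfolding J_def energy_def[of _ _ _ _ _ _ _ "\<lambda>x. u x + t * \<phi> x"]
    by (rule LIMSEQ_le_const[OF tendsto_diff[OF tendsto_diff[OF tendsto_add[OF tendsto_mult[OF tendsto_const tendsto_power[OF P(2)]]
       tendsto_mult[OF tendsto_const tendsto_add[OF P(2) tendsto_mult[OF tendsto_const P(3)]]]] tendsto_mult[OF tendsto_const P(5)]] tendsto_mult[OF tendsto_const P(4)]]])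
      (use ge[OF P(1), unfolded energy_def] in blast)
  have J0: "J 0 \<le> m" using le by (simp add: J_def)
  define G0 b d where "G0 = sqint g" and "b = (\<integral>x. g x \<bullet> cgrad \<phi> x \<partial>lebesgue)"
    and "d = sqint (cgrad \<phi>)"
  define W0 w w2 where "W0 = wint V u" and "w = (\<integral>x. V x * u x * \<phi> x \<partial>lebesgue)"
    and "w2 = wint V \<phi>"
  define F0 h h2 where "F0 = wint f u" and "h = (\<integral>x. f x * u x * \<phi> x \<partial>lebesgue)"
    and "h2 = wint f \<phi>"
  define q where "q = (\<integral>x. Q x * \<bar>u x\<bar> powr (p - 2) * u x * \<phi> x \<partial>lebesgue)"
  have J: "J = (\<lambda>t. a / 4 * (G0 + 2 * t * b + t\<^sup>2 * d)\<^sup>2 + 1 / 2 * ((G0 + 2 * t * b + t\<^sup>2 * d) + \<mu> * (W0 + 2 * t * w + t\<^sup>2 * w2))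
      - 1 / p * (\<integral>x. Q x * \<bar>u x + t * \<phi> x\<bar> powr p \<partial>lebesgue) - lam / 2 * (F0 + 2 * t * h + t\<^sup>2 * h2))"
    unfolding J_def energy_def X(1-3) G0_def b_def d_def W0_def w_def w2_def F0_def h_def h2_def ..
  note dq = Q_term_derivative(1)[OF app \<phi>, folded q_def]
  have "(J has_real_derivative a * G0 * b + b + \<mu> * w - q - lam * h) (at 0)"
    unfolding J by (rule derivative_eq_intros refl dq)+ (use p in \<open>simp add: algebra_simps\<close>)
  then have "a * G0 * b + b + \<mu> * w - q - lam * h = 0"
    by (rule DERIV_local_min[where d=1]) (use Jge J0 in \<open>auto intro: order_trans\<close>)
  then show "(a * sqint g + 1) * (\<integral>x. g x \<bullet> cgrad \<phi> x \<partial>lebesgue)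
        + \<mu> * (\<integral>x. V x * u x * \<phi> x \<partial>lebesgue)
        = (\<integral>x. Q x * \<bar>u x\<bar> powr (p - 2) * u x * \<phi> x \<partial>lebesgue)
        + lam * (\<integral>x. f x * u x * \<phi> x \<partial>lebesgue)"
    unfolding G0_def[symmetric] b_def[symmetric] w_def[symmetric] q_def[symmetric] h_def[symmetric] by (simp add: algebra_simps)
qed

end

text \<open>Balls about the origin exhaust the space. If the zero set has positive measure in one of
  them, it has so in all larger ones, and \<open>maximum_principle_ball\<close> forces u = 0 on
  each.\<close>

lemma solution_dichotomy:
  assumes app: "nnapp UNIV u g \<xi>" and K: "K > 0"
    and eq: "\<And>\<phi>. test_fun UNIV \<phi> \<Longrightarrow> K * (\<integral>x. g x \<bullet> cgrad \<phi> x \<partial>lebesgue) = (\<integral>x. c x * \<phi> x \<partial>lebesgue)"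
    and c: "c \<in> borel_measurable lebesgue" "\<And>\<phi>. test_fun UNIV \<phi> \<Longrightarrow> integrable lebesgue (\<lambda>x. c x * \<phi> x)"
    and c0: "\<And>\<phi>. test_fun UNIV \<phi> \<Longrightarrow> integrable lebesgue (\<lambda>x. c0 x * \<phi> x)" "AE x in lebesgue. \<bar>c x\<bar> \<le> c0 x * u x"
      "\<And>x. c0 x \<ge> 0"
  shows "(AE x in lebesgue. u x = 0) \<or> (AE x in lebesgue. u x > 0)"
proof (cases "\<forall>n. AE x in lebesgue. x \<in> ball 0 (real (Suc n)) \<longrightarrow> u x \<noteq> 0")
  case True
  then have "AE x in lebesgue. \<forall>n. x \<in> ball 0 (real (Suc n)) \<longrightarrow> u x \<noteq> 0" unfolding AE_all_countable by blast
  then have "AE x in lebesgue. u x > 0"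
    using nnappD(10)[OF app]
  proof eventually_elim
    case (elim x)
    obtain n where "norm x < real n" using reals_Archimedean2 by blast
    then have "x \<in> ball 0 (real (Suc n))" by simp
    then show ?case using elim by fastforce
  qed
  then show ?thesis by blast
next
  case False
  then obtain N where N: "\<not> (AE x in lebesgue. x \<in> ball 0 (real (Suc N)) \<longrightarrow> u x \<noteq> 0)" by blast
  have "AE x in lebesgue. x \<in> ball 0 (real (Suc (N + n))) \<longrightarrow> u x = 0" for n
  proof (rule maximum_principle_ball[OF app open_UNIV K eq c c0])
    show "\<not> (AE x in lebesgue. x \<in> ball 0 (real (Suc (N + n))) \<longrightarrow> u x \<noteq> 0)"
    proof
      assume "AE x in lebesgue. x \<in> ball 0 (real (Suc (N + n))) \<longrightarrow> u x \<noteq> 0"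
      then have "AE x in lebesgue. x \<in> ball 0 (real (Suc N)) \<longrightarrow> u x \<noteq> 0" by eventually_elim auto
      then show False using N by blast
    qed
  qed auto
  then have "AE x in lebesgue. \<forall>n. x \<in> ball 0 (real (Suc (N + n))) \<longrightarrow> u x = 0" unfolding AE_all_countable by blast
  then have "AE x in lebesgue. u x = 0"
  proof eventually_elim
    case (elim x)
    obtain n where "norm x < real n" using reals_Archimedean2 by blast
    then have "x \<in> ball 0 (real (Suc (N + n)))" by simp
    then show ?case using elim by blast
  qed
  then show ?thesis by blast
qed

section \<open>Positive solutions from negative energy\<close>

context kirchhoff_data
begin

lemma continuous_local_integrable:
  assumes "continuous_on UNIV h" "test_fun U \<phi>"
  shows "integrable lebesgue (\<lambda>x. h x * \<phi> x)"
proof -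
  obtain K where K: "compact K" "\<And>x. x \<notin> K \<Longrightarrow> \<phi> x = 0" using test_funE[OF assms(2)] by metis
  show ?thesis
    by (rule integrable_lebesgue_continuous_compact[OF _ K(1)]) (use K(2) assms(1) test_fun_continuous[OF assms(2)] in \<open>auto intro!: continuous_intros\<close>)
qed

lemma powr_local_integrable:
  assumes app: "nnapp UNIV u g \<xi>" and \<phi>: "test_fun U \<phi>"
  shows "integrable lebesgue (\<lambda>x. \<bar>u x\<bar> powr (p - 2) * \<phi> x)"
proof -
  note A = nnappD[OF app]
  note [measurable] = A(8) test_fun_measurable[OF \<phi>]
  obtain B where B: "B > 0" "\<And>x. \<bar>\<phi> x\<bar> \<le> B" using test_fun_bounded[OF \<phi>] by blast
  have u2: "integrable lebesgue (\<lambda>x. (u x)\<^sup>2)" using sqi_integrable[OF A(6)] by simp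
  have i1: "integrable lebesgue \<phi>" using continuous_local_integrable[of "\<lambda>x. 1", OF _ \<phi>] by simp
  show ?thesis
  proof (rule integrable_real_bound[of _ "\<lambda>x. \<bar>\<phi> x\<bar> + B * (u x)\<^sup>2"])
    show "integrable lebesgue (\<lambda>x. \<bar>\<phi> x\<bar> + B * (u x)\<^sup>2)" using i1 u2 by simp
    show "(\<lambda>x. \<bar>u x\<bar> powr (p - 2) * \<phi> x) \<in> borel_measurable lebesgue" by measurable
    show "AE x in lebesgue. \<bar>\<bar>u x\<bar> powr (p - 2) * \<phi> x\<bar> \<le> \<bar>\<phi> x\<bar> + B * (u x)\<^sup>2"
    proof (rule AE_I2)
      fix x
      have "\<bar>u x\<bar> powr (p - 2) \<le> 1 + (u x)\<^sup>2"
      proof (cases "\<bar>u x\<bar> \<le> 1")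
        case True
        then have "\<bar>u x\<bar> powr (p - 2) \<le> 1" using p by (intro powr_le1) auto
        then show ?thesis by (simp add: add_increasing2)
      next
        case False
        then have "\<bar>u x\<bar> powr (p - 2) \<le> \<bar>u x\<bar> powr 2" using p by (intro powr_mono) auto
        also have "\<dots> = (u x)\<^sup>2" using False by (simp add: powr_numeral)
        finally show ?thesis by simp
      qed
      then have "\<bar>u x\<bar> powr (p - 2) * \<bar>\<phi> x\<bar> \<le> (1 + (u x)\<^sup>2) * \<bar>\<phi> x\<bar>" by (intro mult_right_mono) auto
      moreover have "(u x)\<^sup>2 * \<bar>\<phi> x\<bar> \<le> (u x)\<^sup>2 * B" using B by (intro mult_left_mono) auto
      ultimately show "\<bar>\<bar>u x\<bar> powr (p - 2) * \<phi> x\<bar> \<le> \<bar>\<phi> x\<bar> + B * (u x)\<^sup>2" by (simp add: abs_mult algebra_simps)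
    qed
  qed
qed

text \<open>For a fixed solution the nonlocal factor a |g|^2 + 1, with the integral inside, is a
  positive constant. The remaining terms form a function h with |h| <= h0 u, where h0 is built from
  |u| powr (p - 2), |f| and V and is locally integrable. So the maximum principle for linear
  equations applies, and its alternative u = 0 is excluded because it would make the energy
  non-negative.\<close>

lemma kirchhoff_sol_positive:
  assumes app: "nnapp UNIV u g \<xi>" and sV: "sqi (\<lambda>x. sqrt (V x) * u x)"
    and a: "a > 0" and lam: "lam \<ge> 0" and \<mu>: "\<mu> > 0" and sol: "kirchhoff_sol a \<mu> lam p V f Q u g"
    and neg: "energy a \<mu> lam p V f Q u g < 0"
  shows "AE x in lebesgue. u x > 0"
proof -
  note A = nnappD[OF app]
  note [measurable] = A(8) f(1) Q(1) continuous_imp_lebesgue[OF V(2)]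
  define h where "h x = Q x * \<bar>u x\<bar> powr (p - 2) * u x + lam * (f x * u x) - \<mu> * (V x * u x)" for x
  define h0 where "h0 x = C * \<bar>u x\<bar> powr (p - 2) + lam * \<bar>f x\<bar> + \<mu> * V x" for x
  have hm: "h \<in> borel_measurable lebesgue" unfolding h_def by measurable
  have h\<phi>: "h x * \<phi> x = Q x * \<bar>u x\<bar> powr (p - 2) * u x * \<phi> x + lam * (f x * u x * \<phi> x) - \<mu> * (V x * u x * \<phi> x)" for x and \<phi> :: "R3 \<Rightarrow> real"
    by (simp add: h_def algebra_simps)
  have h0\<phi>: "h0 x * \<phi> x = C * (\<bar>u x\<bar> powr (p - 2) * \<phi> x) + lam * (\<bar>f x\<bar> * \<phi> x) + \<mu> * (V x * \<phi> x)" for x and \<phi> :: "R3 \<Rightarrow> real"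
    by (simp add: h0_def algebra_simps)
  have ih: "integrable lebesgue (\<lambda>x. h x * \<phi> x)" if \<phi>: "test_fun UNIV \<phi>" for \<phi>
    unfolding h\<phi> using Q_term_derivative(2)[OF app \<phi>] expand_quadratic(4,5)[OF app sV \<phi>] by simp
  have ih0: "integrable lebesgue (\<lambda>x. h0 x * \<phi> x)" if \<phi>: "test_fun UNIV \<phi>" for \<phi>
    unfolding h0\<phi> using powr_local_integrable[OF app \<phi>] f_local_integrable(2)[OF \<phi>] continuous_local_integrable[OF V(2) \<phi>] by simp
  have K: "a * sqint g + 1 > 0" using a by (intro add_nonneg_pos mult_nonneg_nonneg) auto
  have eq: "(a * sqint g + 1) * (\<integral>x. g x \<bullet> cgrad \<phi> x \<partial>lebesgue) = (\<integral>x. h x * \<phi> x \<partial>lebesgue)"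
    if \<phi>: "test_fun UNIV \<phi>" for \<phi>
  proof -
    have "(\<integral>x. h x * \<phi> x \<partial>lebesgue) = (\<integral>x. Q x * \<bar>u x\<bar> powr (p - 2) * u x * \<phi> x \<partial>lebesgue)
        + lam * (\<integral>x. f x * u x * \<phi> x \<partial>lebesgue) - \<mu> * (\<integral>x. V x * u x * \<phi> x \<partial>lebesgue)"
      unfolding h\<phi> using Q_term_derivative(2)[OF app \<phi>] expand_quadratic(4,5)[OF app sV \<phi>] by simp
    moreover have "(a * sqint g + 1) * (\<integral>x. g x \<bullet> cgrad \<phi> x \<partial>lebesgue) + \<mu> * (\<integral>x. V x * u x * \<phi> x \<partial>lebesgue)
        = (\<integral>x. Q x * \<bar>u x\<bar> powr (p - 2) * u x * \<phi> x \<partial>lebesgue) + lam * (\<integral>x. f x * u x * \<phi> x \<partial>lebesgue)"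
      using sol \<phi> unfolding kirchhoff_sol_def by blast
    ultimately show ?thesis by linarith
  qed
  have h00: "h0 x \<ge> 0" for x unfolding h0_def using Q(3) lam \<mu> V(1)[of x] by (intro add_nonneg_nonneg mult_nonneg_nonneg) auto
  have le: "AE x in lebesgue. \<bar>h x\<bar> \<le> h0 x * u x"
    using A(10) Q(2)
  proof eventually_elim
    case (elim x)
    have "\<bar>h x\<bar> \<le> \<bar>Q x * \<bar>u x\<bar> powr (p - 2) * u x\<bar> + \<bar>lam * (f x * u x)\<bar> + \<bar>\<mu> * (V x * u x)\<bar>" unfolding h_def by linarith
    also have "\<dots> = \<bar>Q x\<bar> * (\<bar>u x\<bar> powr (p - 2) * u x) + lam * (\<bar>f x\<bar> * u x) + \<mu> * (V x * u x)"
      using elim lam \<mu> V(1)[of x] by (simp add: abs_mult)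
    also have "\<dots> \<le> C * (\<bar>u x\<bar> powr (p - 2) * u x) + lam * (\<bar>f x\<bar> * u x) + \<mu> * (V x * u x)"
      using elim by (intro add_right_mono mult_right_mono) auto
    also have "\<dots> = h0 x * u x" by (simp add: h0_def algebra_simps)
    finally show ?case .
  qed
  have "(AE x in lebesgue. u x = 0) \<or> (AE x in lebesgue. u x > 0)"
    by (rule solution_dichotomy[OF app K eq hm ih ih0 le h00])
  moreover have "\<not> (AE x in lebesgue. u x = 0)"
  proof
    assume z: "AE x in lebesgue. u x = 0"
    have "AE x in lebesgue. Q x * \<bar>u x\<bar> powr p = 0" using z by eventually_elim (use p in auto)
    then have 1: "(\<integral>x. Q x * \<bar>u x\<bar> powr p \<partial>lebesgue) = 0" by (rule integral_eq_zero_AE)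
    have "AE x in lebesgue. f x * (u x)\<^sup>2 = 0" using z by eventually_elim auto
    then have 2: "wint f u = 0" by (rule integral_eq_zero_AE)
    have "(wint V u) \<ge> 0" using V(1) by simp
    then have "energy a \<mu> lam p V f Q u g \<ge> 0" unfolding energy_def 1 2 using a \<mu> by simp
    then show False using neg by simp
  qed
  ultimately show ?thesis by blast
qed

text \<open>Both parts of the theorem are thereby reduced to exhibiting one test function of
  negative energy. The threshold for \<mu> comes from coercivity and is fixed before that test
  function.\<close>

lemma positive_solution_exists:
  assumes a: "a > 0" and lam: "lam \<ge> 0" 
  obtains \<mu>s where "\<mu>s > 0" "\<And>\<mu> \<phi>. \<mu> > \<mu>s \<Longrightarrow> test_fun UNIV \<phi> \<Longrightarrow> energy a \<mu> lam p V f Q \<phi> (cgrad \<phi>) < 0 \<Longrightarrow>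
     \<exists>u. pos_sol_neg_energy a \<mu> lam p V f Q u"
proof -
  obtain \<mu>s K where K: "\<mu>s > 0" "K \<ge> 0" "\<And>\<mu> \<phi>. \<mu> > \<mu>s \<Longrightarrow> test_fun UNIV \<phi> \<Longrightarrow>
     a / 8 * (sqint (cgrad \<phi>))\<^sup>2 + wint V \<phi> - K * (sqint (cgrad \<phi>))
       \<le> energy a \<mu> lam p V f Q \<phi> (cgrad \<phi>)"
    using energy_coercive[OF a lam] by blast
  have "\<exists>u. pos_sol_neg_energy a \<mu> lam p V f Q u"
    if \<mu>: "\<mu> > \<mu>s" and \<phi>: "test_fun UNIV \<phi>" "energy a \<mu> lam p V f Q \<phi> (cgrad \<phi>) < 0" for \<mu> \<phi>
  proof -
    have \<mu>0: "\<mu> > 0" using \<mu> K(1) by simp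
    obtain m u g \<xi> where *: "m < 0" "nnapp UNIV u g \<xi>" "L2to (\<lambda>n x. sqrt (V x) * \<xi> n x) (\<lambda>x. sqrt (V x) * u x)"
      "energy a \<mu> lam p V f Q u g \<le> m" "\<And>\<phi>. test_fun UNIV \<phi> \<Longrightarrow> m \<le> energy a \<mu> lam p V f Q \<phi> (cgrad \<phi>)"
      using energy_minimiser[OF a \<mu>0 K(2) K(3)[OF \<mu>] \<phi>] by blast
    have sV: "sqi (\<lambda>x. sqrt (V x) * u x)" by (rule L2to_sqi(2)[OF *(3)])
    have sol: "kirchhoff_sol a \<mu> lam p V f Q u g" by (rule minimiser_solution[OF *(2-5)])
    have neg: "energy a \<mu> lam p V f Q u g < 0" using *(1,4) by simp
    show ?thesis unfolding pos_sol_neg_energy_def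
      using sol neg kirchhoff_sol_positive[OF *(2) sV a lam \<mu>0 sol neg] expand_quadratic(6)[OF *(2) sV \<phi>(1)] by blast
  qed
  then show ?thesis using that K(1) by blast
qed


section \<open>Test functions of negative energy\<close>

lemma energy_scale:
  assumes \<phi>: "test_fun U \<phi>" and t: "t > 0"
  shows "energy a \<mu> lam p V f Q (\<lambda>x. t * \<phi> x) (cgrad (\<lambda>x. t * \<phi> x)) =
    a / 4 * t ^ 4 * (sqint (cgrad \<phi>))\<^sup>2
    + t\<^sup>2 / 2 * (sqint (cgrad \<phi>) + \<mu> * wint V \<phi> - lam * wint f \<phi>)
    - t powr (p - 2) * t\<^sup>2 / p * (\<integral>x. Q x * \<bar>\<phi> x\<bar> powr p \<partial>lebesgue)"
proof -
  have 1: "cgrad (\<lambda>x. t * \<phi> x) x = t *\<^sub>R cgrad \<phi> x" for x by (rule cgrad_cmult[OF test_fun_smooth[OF \<phi>]])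
  \<comment> \<open>The power is split so that the factor t^2 of the quadratic part appears in the
    Q-term as well; the two can then be compared through t powr (p - 2) alone.\<close>
  have tp: "t powr p = t powr (p - 2) * t\<^sup>2" using t powr_add[of t "p - 2" 2] by (simp add: powr_numeral)
  have 2: "V x * (t * \<phi> x)\<^sup>2 = t\<^sup>2 * (V x * (\<phi> x)\<^sup>2)" "f x * (t * \<phi> x)\<^sup>2 = t\<^sup>2 * (f x * (\<phi> x)\<^sup>2)" 
    "(norm (t *\<^sub>R cgrad \<phi> x))\<^sup>2 = t\<^sup>2 * (norm (cgrad \<phi> x))\<^sup>2"
    "Q x * \<bar>t * \<phi> x\<bar> powr p = t powr (p - 2) * t\<^sup>2 * (Q x * \<bar>\<phi> x\<bar> powr p)" for x
    using t by (simp_all add: power_mult_distrib abs_mult powr_mult tp)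
  show ?thesis unfolding energy_def 1 2 integral_mult_right_zero
    by (simp add: field_simps power2_eq_square power4_eq_xxxx)
qed

text \<open>A test function supported in \<open>Om\<close> does not feel V, so its energy is the
  same for all \<mu>. At a suitable scale the Q-term exceeds the quadratic part, and a small
  Kirchhoff term cannot undo this. Estimating lam by L makes the scale and a0 independent of
  lam.\<close>

lemma negative_energy_small_kirchhoff:
  assumes Om: "bounded Om" and Qpos: "\<not> (AE x in lebesgue. x \<in> Om \<longrightarrow> Q x \<le> 0)" and L: "L \<ge> 0"
  obtains a0 \<phi> where "a0 > 0" "test_fun UNIV \<phi>" 
    "\<And>a lam \<mu>. 0 < a \<Longrightarrow> a < a0 \<Longrightarrow> 0 < lam \<Longrightarrow> lam \<le> L \<Longrightarrow> energy a \<mu> lam p V f Q \<phi> (cgrad \<phi>) < 0"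
proof -
  have [measurable]: "Om \<in> sets lebesgue" by (auto intro: borel_open)
  note [measurable] = Q(1)
  have Qi: "integrable lebesgue (\<lambda>x. indicator Om x * Q x)"
  proof (rule integrable_real_bound[of _ "\<lambda>x. C * indicator Om x"])
    have "Om \<in> lmeasurable" using Om by (simp add: lmeasurable_open)
    then show "integrable lebesgue (\<lambda>x. C * indicator Om x :: real)"
      by (intro integrable_mult_right integrable_real_indicator) (auto simp: fmeasurable_def)
    show "AE x in lebesgue. \<bar>indicator Om x * Q x\<bar> \<le> C * indicator Om x"
      using Q(2) by eventually_elim (auto simp: indicator_def)
    show "(\<lambda>x. indicator Om x * Q x) \<in> borel_measurable lebesgue" by measurable
  qed
  have p0: "p > 0" using p by simp
  obtain \<phi> where \<phi>: "test_fun Om \<phi>" "\<And>x. \<phi> x \<ge> 0" "(\<integral>x. Q x * \<bar>\<phi> x\<bar> powr p \<partial>lebesgue) > 0"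
    using positive_weight_test_fun[OF open_interior Om Q(1) Qi Qpos p0] by blast
  define G where "G = sqint (cgrad \<phi>)"
  define F where "F = wint f \<phi>"
  define q where "q = (\<integral>x. Q x * \<bar>\<phi> x\<bar> powr p \<partial>lebesgue)"
  have q: "q > 0" using \<phi>(3) by (simp add: q_def)
  have W: "wint V \<phi> = 0" unfolding V_test_fun_Om(1)[OF \<phi>(1)] by simp
  define H where "H = G + L * \<bar>F\<bar>"
  have H: "H \<ge> 0" using L by (auto simp: H_def G_def)
  \<comment> \<open>The value of t powr (p - 2) at which the Q-term equals t^2 (H + 1) / 2, that is,
    t^2 / 2 more than the bound for the quadratic part.\<close>
  define b where "b = p * (H + 1) / (2 * q)"
  have b: "b > 0" using p q H by (simp add: b_def)
  define t where "t = b powr (1 / (p - 2))"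
  have t: "t > 0" using b by (simp add: t_def)
  have tb: "t powr (p - 2) = b" using b p by (simp add: t_def powr_powr)
  have bq: "b / p * q = (H + 1) / 2" using p q by (simp add: b_def field_simps)
  \<comment> \<open>For a < a0 the Kirchhoff term a t^4 G^2 / 4 stays below the surplus t^2 / 2; the
    1 in the denominator covers G = 0.\<close>
  define a0 where "a0 = 2 * t\<^sup>2 / (t ^ 4 * G\<^sup>2 + 1)"
  have den: "t ^ 4 * G\<^sup>2 + 1 > 0" by (simp add: add_nonneg_pos)
  have a0: "a0 > 0" using t den by (simp add: a0_def)
  have "energy a \<mu> lam p V f Q (\<lambda>x. t * \<phi> x) (cgrad (\<lambda>x. t * \<phi> x)) < 0"
    if a: "0 < a" "a < a0" and lam: "0 < lam" "lam \<le> L" for a lam \<mu>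
  proof -
    have "a * (t ^ 4 * G\<^sup>2 + 1) < 2 * t\<^sup>2" using a den by (simp add: a0_def pos_less_divide_eq)
    then have 1: "a / 4 * t ^ 4 * G\<^sup>2 < t\<^sup>2 / 2" using a by (simp add: algebra_simps)
    have "lam * (- F) \<le> lam * \<bar>F\<bar>" using lam by (intro mult_left_mono) auto
    then have "- (lam * F) \<le> lam * \<bar>F\<bar>" by simp
    also have "\<dots> \<le> L * \<bar>F\<bar>" using lam by (intro mult_right_mono) auto
    finally have "G + \<mu> * 0 - lam * F \<le> H" by (simp add: H_def)
    then have 2: "t\<^sup>2 / 2 * (G + \<mu> * 0 - lam * F) \<le> t\<^sup>2 / 2 * H" by (intro mult_left_mono) auto
    have "b * t\<^sup>2 / p * q = t\<^sup>2 * (b / p * q)" by simp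
    also have "\<dots> = t\<^sup>2 / 2 * H + t\<^sup>2 / 2" unfolding bq by (simp add: field_simps)
    finally have 3: "b * t\<^sup>2 / p * q = t\<^sup>2 / 2 * H + t\<^sup>2 / 2" .
    show ?thesis unfolding energy_scale[OF \<phi>(1) t] tb W G_def[symmetric] F_def[symmetric] q_def[symmetric] using 1 2 3 by argo
  qed
  moreover have "test_fun UNIV (\<lambda>x. t * \<phi> x)" by (rule test_fun_mono[OF test_fun_cmult[OF \<phi>(1)]]) auto
  ultimately show ?thesis using that a0 by blast
qed

text \<open>If the energy were nonnegative, its quadratic part would be so by scaling; the Dirichlet eigenfunction would then be a null
  vector of that form, hence solve the linear equation on the whole space although it vanishes outside \<open>Om\<close>.\<close>
lemma negative_energy_above_lambda1:
  assumes Om: "Om \<noteq> {}" "bounded Om" "connected Om" and fpos: "\<not> (AE x in lebesgue. x \<in> Om \<longrightarrow> f x \<le> 0)"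
    and lam: "lam \<ge> lambda1 Om f" and \<mu>: "\<mu> > 0"
  obtains \<phi> where "test_fun UNIV \<phi>" "energy a \<mu> lam p V f Q \<phi> (cgrad \<phi>) < 0"
proof (rule ccontr)
  assume "\<not> thesis"
  then have E: "0 \<le> energy a \<mu> lam p V f Q \<phi> (cgrad \<phi>)" if "test_fun UNIV \<phi>" for \<phi>
    using that \<open>\<And>\<phi>. test_fun UNIV \<phi> \<Longrightarrow> energy a \<mu> lam p V f Q \<phi> (cgrad \<phi>) < 0 \<Longrightarrow> thesis\<close> by (meson not_le)
  obtain u g \<xi> where *: "lambda1 Om f > 0" "nnapp Om u g \<xi>" "L2to (\<lambda>n x. sqrt (V x) * \<xi> n x) (\<lambda>x. sqrt (V x) * u x)"
    "AE x in lebesgue. x \<in> Om \<longrightarrow> u x > 0" "wint f u = 1" "sqint g \<le> lambda1 Om f"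
    by (rule lambda1_eigenfunction[OF Om fpos])
  have q: "0 \<le> sqint (cgrad \<phi>) + \<mu> * wint V \<phi> - lam * wint f \<phi>"
    if \<phi>: "test_fun UNIV \<phi>" for \<phi>
  proof -
    define G where "G = sqint (cgrad \<phi>)"
    define H where "H = G + \<mu> * wint V \<phi> - lam * wint f \<phi>"
    define q where "q = (\<integral>x. Q x * \<bar>\<phi> x\<bar> powr p \<partial>lebesgue)"
    define t where "t n = 1 / real (Suc n)" for n
    have t: "t n > 0" for n by (simp add: t_def)
    have tl: "t \<longlonglongrightarrow> 0" unfolding t_def[abs_def] by (rule LIMSEQ_Suc[OF lim_1_over_n])
    have tp: "(\<lambda>n. t n powr (p - 2)) \<longlonglongrightarrow> 0"
      by (rule tendsto_zero_powrI[OF tl tendsto_const]) (use p less_imp_le[OF t] in auto)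
    \<comment> \<open>After division by t^2 the Kirchhoff term is of order t^2 and the Q-term of
      order t powr (p - 2), so only the quadratic part survives as t tends to 0.\<close>
    have "0 \<le> a / 4 * (t n)\<^sup>2 * G\<^sup>2 + 1 / 2 * H - t n powr (p - 2) / p * q" for n
    proof -
      have "0 \<le> energy a \<mu> lam p V f Q (\<lambda>x. t n * \<phi> x) (cgrad (\<lambda>x. t n * \<phi> x))"
        by (rule E[OF test_fun_cmult[OF \<phi>]])
      also have "\<dots> = a / 4 * t n ^ 4 * G\<^sup>2 + (t n)\<^sup>2 / 2 * H - t n powr (p - 2) * (t n)\<^sup>2 / p * q"
        unfolding energy_scale[OF \<phi> t] G_def H_def q_def ..
      also have "\<dots> = (t n)\<^sup>2 * (a / 4 * (t n)\<^sup>2 * G\<^sup>2 + 1 / 2 * H - t n powr (p - 2) / p * q)"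
        by (simp add: algebra_simps power2_eq_square power4_eq_xxxx)
      finally show ?thesis using t[of n] by (simp add: zero_le_mult_iff)
    qed
    moreover have "(\<lambda>n. a / 4 * (t n)\<^sup>2 * G\<^sup>2 + 1 / 2 * H - t n powr (p - 2) / p * q) \<longlonglongrightarrow> a / 4 * 0\<^sup>2 * G\<^sup>2 + 1 / 2 * H - 0 / p * q"
      by (intro tendsto_intros tl tp) (use p in auto)
    ultimately have "0 \<le> a / 4 * 0\<^sup>2 * G\<^sup>2 + 1 / 2 * H - 0 / p * q" by (intro LIMSEQ_le_const) auto
    then show ?thesis by (simp add: H_def G_def)
  qed
  have app: "nnapp UNIV u g \<xi>" by (rule nnapp_mono[OF *(2)]) auto
  note A = nnappD[OF app]
  note [measurable] = A(8) f(1) continuous_imp_lebesgue[OF V(2)]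
  have u0: "AE x in lebesgue. x \<notin> Om \<longrightarrow> u x = 0" by (rule nnapp_eq0_outside[OF *(2)])
  have "AE x in lebesgue. V x * (u x)\<^sup>2 = 0"
    using u0 by eventually_elim (use interior_subset[of "{x. V x = 0}"] in auto)
  then have W0: "wint V u = 0" by (rule integral_eq_zero_AE)
  have sV: "sqi (\<lambda>x. sqrt (V x) * u x)" by (rule L2to_sqi(2)[OF *(3)])
  \<comment> \<open>The weighted integral of u^2 is 1 and its V-integral is 0, so the form at u is
    at most \<open>lambda1\<close> minus lam, hence at most 0.\<close>
  have st: "(\<integral>x. g x \<bullet> cgrad \<phi> x \<partial>lebesgue) = lam * (\<integral>x. f x * u x * \<phi> x \<partial>lebesgue) - \<mu> * (\<integral>x. V x * u x * \<phi> x \<partial>lebesgue)"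
    if \<phi>: "test_fun UNIV \<phi>" for \<phi>
    by (rule quadratic_stationary[OF app *(3) \<phi> q]) (use *(5,6) lam W0 in auto)
  have lam0: "lam > 0" using lam *(1) by linarith
  have "(AE x in lebesgue. u x = 0) \<or> (AE x in lebesgue. u x > 0)"
  proof (rule solution_dichotomy[OF app zero_less_one, of "\<lambda>x. lam * (f x * u x) - \<mu> * (V x * u x)" "\<lambda>x. lam * \<bar>f x\<bar> + \<mu> * V x"])
    fix \<phi> assume \<phi>: "test_fun UNIV \<phi>"
    note X = expand_quadratic(4,5)[OF app sV \<phi>]
    have e: "(lam * (f x * u x) - \<mu> * (V x * u x)) * \<phi> x = lam * (f x * u x * \<phi> x) - \<mu> * (V x * u x * \<phi> x)"
      "(lam * \<bar>f x\<bar> + \<mu> * V x) * \<phi> x = lam * (\<bar>f x\<bar> * \<phi> x) + \<mu> * (V x * \<phi> x)" for x by (simp_all add: algebra_simps)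
    show "integrable lebesgue (\<lambda>x. (lam * (f x * u x) - \<mu> * (V x * u x)) * \<phi> x)" unfolding e using X by simp
    show "integrable lebesgue (\<lambda>x. (lam * \<bar>f x\<bar> + \<mu> * V x) * \<phi> x)" unfolding e
      using f_local_integrable(2)[OF \<phi>] continuous_local_integrable[OF V(2) \<phi>] by simp
    show "1 * (\<integral>x. g x \<bullet> cgrad \<phi> x \<partial>lebesgue) = (\<integral>x. (lam * (f x * u x) - \<mu> * (V x * u x)) * \<phi> x \<partial>lebesgue)"
      unfolding e st[OF \<phi>] using X by simp
  next
    show "(\<lambda>x. lam * (f x * u x) - \<mu> * (V x * u x)) \<in> borel_measurable lebesgue" by measurable
    show "0 \<le> lam * \<bar>f x\<bar> + \<mu> * V x" for x using lam0 \<mu> V(1)[of x] by simp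
    show "AE x in lebesgue. \<bar>lam * (f x * u x) - \<mu> * (V x * u x)\<bar> \<le> (lam * \<bar>f x\<bar> + \<mu> * V x) * u x"
      using A(10)
    proof eventually_elim
      case (elim x)
      have "\<bar>lam * (f x * u x) - \<mu> * (V x * u x)\<bar> \<le> \<bar>lam * (f x * u x)\<bar> + \<bar>\<mu> * (V x * u x)\<bar>" by (rule abs_triangle_ineq4)
      also have "\<dots> = (lam * \<bar>f x\<bar> + \<mu> * V x) * u x" using elim lam0 \<mu> V(1)[of x] by (simp add: abs_mult algebra_simps)
      finally show ?case .
    qed
  qed
  then show False
  proof
    assume "AE x in lebesgue. u x = 0"
    then have "AE x in lebesgue. f x * (u x)\<^sup>2 = 0" by eventually_elim auto
    then have "wint f u = 0" by (rule integral_eq_zero_AE)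
    then show False using *(5) by simp
  next
    assume "AE x in lebesgue. u x > 0"
    \<comment> \<open>Positivity almost everywhere and vanishing outside \<open>Om\<close> would
      make the complement of a bounded set null, although it contains a nonempty open set.\<close>
    then have "AE x in lebesgue. x \<notin> - Om" using u0 by eventually_elim auto
    then have "- Om \<in> null_sets lebesgue" by (subst AE_iff_null_sets) (auto intro: borel_open)
    then have n: "negligible (- Om)" by (simp add: negligible_iff_null_sets)
    obtain R where R: "Om \<subseteq> ball 0 R" using bounded_subset_ballD[OF Om(2), of 0] by blast
    have "open (- cball (0::R3) R)" by (simp add: open_Compl)
    moreover have "- cball (0::R3) R \<subseteq> - Om" using R by force
    ultimately have "- cball (0::R3) R = {}" using open_not_negligible negligible_subset[OF n] by blast
    then have "bounded (UNIV :: R3 set)" using bounded_cball[of "0::R3" R] by (metis Compl_empty_eq double_complement)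
    then show False by simp
  qed
qed

end

theorem theorem1p6:
  fixes V f Q :: "R3 \<Rightarrow> real" and p :: real
  assumes p: "2 < p" "p < 4"
    and V1: "\<forall>x. V x \<ge> 0" "continuous_on UNIV V"
    and V2: "\<exists>c>0. {x. V x < c} \<noteq> {} \<and> emeasure lebesgue {x. V x < c} < \<infinity>"
    and V3: "interior {x. V x = 0} \<noteq> {}" "connected (interior {x. V x = 0})"
            "bounded (interior {x. V x = 0})" "smooth_boundary (interior {x. V x = 0})"
            "closure (interior {x. V x = 0}) = {x. V x = 0}"
    and D1: "f \<in> borel_measurable lebesgue" "integrable lebesgue (\<lambda>x. \<bar>f x\<bar> powr (3/2))"
            "\<not> (AE x in lebesgue. x \<in> interior {x. V x = 0} \<longrightarrow> f x \<le> 0)"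
    and D2: "Q \<in> borel_measurable lebesgue" "\<exists>C. AE x in lebesgue. \<bar>Q x\<bar> \<le> C"
            "\<not> (AE x in lebesgue. x \<in> interior {x. V x = 0} \<longrightarrow> Q x \<le> 0)"
    and D3: "\<exists>cs>0. \<exists>Rs>0. \<forall>x. norm x > Rs \<longrightarrow>
               norm x powr (p - 2) * Q x \<le> cs * V x powr (4 - p)"
  shows "(\<exists>a0>0. \<forall>a lam. 0 < a \<and> a < a0 \<and> 0 < lam \<and> lam < lambda1 (interior {x. V x = 0}) f \<longrightarrow>
            (\<exists>\<mu>s>0. \<forall>\<mu>>\<mu>s. \<exists>u. pos_sol_neg_energy a \<mu> lam p V f Q u))
       \<and> (\<forall>lam a. lam \<ge> lambda1 (interior {x. V x = 0}) f \<and> a > 0 \<longrightarrow>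
            (\<exists>\<mu>s>0. \<forall>\<mu>>\<mu>s. \<exists>u. pos_sol_neg_energy a \<mu> lam p V f Q u))"
proof -
  obtain c where c: "c > 0" "emeasure lebesgue {x. V x < c} < \<infinity>" using V2 by blast
  obtain C0 where C0: "AE x in lebesgue. \<bar>Q x\<bar> \<le> C0" using D2(2) by blast
  define C where "C = max C0 1"
  have C: "AE x in lebesgue. \<bar>Q x\<bar> \<le> C" "C \<ge> 1" using C0 by (auto simp: C_def elim!: eventually_mono)
  obtain cs Rs where cR: "cs > 0" "Rs > 0" "\<And>x. norm x > Rs \<Longrightarrow> norm x powr (p - 2) * Q x \<le> cs * V x powr (4 - p)"
    using D3 by blast
  interpret kirchhoff_data V f Q p C c cs Rs
    by unfold_locales (use p V1 c D1 D2 C cR in auto)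
  show ?thesis
  proof (intro conjI)
    \<comment> \<open>The maximum with 0 supplies the non-negative bound on lam that the choice of
      a0 asks for; lam itself lies below \<open>lambda1\<close>.\<close>
    have L: "max (lambda1 Om f) 0 \<ge> 0" by simp
    obtain a0 \<phi> where a0: "a0 > 0" "test_fun UNIV \<phi>" 
      "\<And>a lam \<mu>. 0 < a \<Longrightarrow> a < a0 \<Longrightarrow> 0 < lam \<Longrightarrow> lam \<le> max (lambda1 Om f) 0 \<Longrightarrow> energy a \<mu> lam p V f Q \<phi> (cgrad \<phi>) < 0"
      using negative_energy_small_kirchhoff[OF V3(3) D2(3) L] by blast
    have "\<exists>\<mu>s>0. \<forall>\<mu>>\<mu>s. \<exists>u. pos_sol_neg_energy a \<mu> lam p V f Q u"
      if h: "0 < a" "a < a0" "0 < lam" "lam < lambda1 Om f" for a lam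
    proof -
      have lam: "lam \<ge> 0" "lam \<le> max (lambda1 Om f) 0" using h by auto
      show ?thesis using positive_solution_exists[OF h(1) lam(1)] a0(2) a0(3)[OF h(1-3) lam(2)] by metis
    qed
    then show "\<exists>a0>0. \<forall>a lam. 0 < a \<and> a < a0 \<and> 0 < lam \<and> lam < lambda1 Om f \<longrightarrow>
            (\<exists>\<mu>s>0. \<forall>\<mu>>\<mu>s. \<exists>u. pos_sol_neg_energy a \<mu> lam p V f Q u)" using a0(1) by blast
  next
    \<comment> \<open>Positivity of \<open>lambda1\<close> makes every admissible lam positive, as
      coercivity requires lam >= 0.\<close>
    have "lambda1 Om f > 0" by (rule lambda1_eigenfunction[OF V3(1,3,2) D1(3)])
    then have "\<exists>\<mu>s>0. \<forall>\<mu>>\<mu>s. \<exists>u. pos_sol_neg_energy a \<mu> lam p V f Q u"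
      if h: "lambda1 Om f \<le> lam" "a > 0" for a lam
    proof -
      have lam: "lam \<ge> 0" using h(1) \<open>lambda1 Om f > 0\<close> by linarith
      obtain \<mu>s where \<mu>s: "\<mu>s > 0" "\<And>\<mu> \<phi>. \<mu> > \<mu>s \<Longrightarrow> test_fun UNIV \<phi> \<Longrightarrow> energy a \<mu> lam p V f Q \<phi> (cgrad \<phi>) < 0 \<Longrightarrow>
         \<exists>u. pos_sol_neg_energy a \<mu> lam p V f Q u" using positive_solution_exists[OF h(2) lam] by blast
      have "\<exists>u. pos_sol_neg_energy a \<mu> lam p V f Q u" if \<mu>: "\<mu> > \<mu>s" for \<mu>
      proof -
        have \<mu>0: "\<mu> > 0" using \<mu> \<mu>s(1) by simp
        obtain \<phi> where "test_fun UNIV \<phi>" "energy a \<mu> lam p V f Q \<phi> (cgrad \<phi>) < 0"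
          by (rule negative_energy_above_lambda1[OF V3(1,3,2) D1(3) h(1) \<mu>0])
        then show ?thesis by (rule \<mu>s(2)[OF \<mu>])
      qed
      then show ?thesis using \<mu>s(1) by blast
    qed
    then show "\<forall>lam a. lam \<ge> lambda1 Om f \<and> a > 0 \<longrightarrow>
            (\<exists>\<mu>s>0. \<forall>\<mu>>\<mu>s. \<exists>u. pos_sol_neg_energy a \<mu> lam p V f Q u)" by blast
  qed
qed

end
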